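(* Let $l:H\times\Lambda\to\mathbb{R}$ be measurable and bounded from below, let $\lambda>0$, let $v$ be a mild solution to the HJB equation $$\lambda v(x)-\tfrac12\mathrm{Tr}[\sigma\sigma^*D^2v(x)]-\langle Ax,Dv(x)\rangle_H-F_0(x,D^Gv(x))=0,\quad x\in H,$$ and assume that $v\in\mathcal{S}^{A,G}(H)$. Then: (i) $v\le V$ over $H$. (ii) Let $x\in H$ and assume that there exists $u^*(\cdot)\in\mathcal{U}_p$ such that, $\mathbb{P}\times dt$-a.e., $$F_0\big(X(t;x,u^*(\cdot)),D^Gv(X(t;x,u^*(\cdot)))\big)=F_{0,CV}\big(X(t;x,u^*(\cdot)),D^Gv(X(t;x,u^*(\cdot)));u^*(t)\big).$$ Then $v(x)=V(x)=J(x;u^*(\cdot))$.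
   Context: Setting. $H,K,\Xi$ are real separable Hilbert spaces; $(U,|\cdot|_U)$ is a real Banach space and $\Lambda\subseteq U$ is a Borel set. $(\Omega,\mathcal{F},\{\mathcal{F}_t\}_{t\ge0},\mathbb{P})$ is a complete filtered probability space satisfying the usual conditions, $W$ a $\Xi$-valued cylindrical Brownian motion on it. Standing assumptions: (i) $A:\mathcal{D}(A)\subseteq H\to H$ is closed, densely defined and generates a $C_0$-semigroup $\{e^{tA}\}_{t\ge0}$ on $H$. (ii) $\sigma\in\mathcal{L}(\Xi,H)$ (bounded linear operators), $e^{sA}\sigma\sigma^*e^{sA^*}$ is trace class on $H$ for all $s>0$, and there is $\gamma\in(0,1/2)$ with $\int_0^t s^{-2\gamma}\,\mathrm{Tr}[e^{sA}\sigma\sigma^*e^{sA^*}]ds<\infty$ for all $t\ge0$. (iii) $G:\mathcal{D}(G)\subseteq K\to H$ is a closed densely defined (possibly unbounded) linear operator such that for every $s>0$ the operator $e^{sA}G:\mathcal{D}(G)\to H$ extends to a bounded operator $\overline{e^{sA}G}\in\mathcal{L}(K,H)$, and there exist $C_G>0$, $a_G\in\mathbb{R}$, $\beta\in[0,1)$ with $|\overline{e^{sA}G}|_{\mathcal{L}(K,H)}\le C_G(s^{-\beta}\vee1)e^{a_Gs}$ for all $s>0$. (iv) $L:\Lambda\to K$ is measurable and $|L(u)|_K\le C_L(1+|u|_U)$ for some $C_L>0$. A number $p\in(\frac{1}{1-\beta},+\infty)$ is fixed, and $\mathcal{U}_p$ is the set of progressively measurable $u:\Omega\times[0,+\infty)\to\Lambda$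 with $\int_0^t\mathbb{E}[|u(s)|_U^p]ds<\infty$ for all $t\ge0$. For $x\in H$, $u(\cdot)\in\mathcal{U}_p$, $$X(t;x,u(\cdot)):=e^{tA}x+\int_0^te^{(t-s)A}\sigma\,dW(s)+\int_0^t\overline{e^{(t-s)A}G}L(u(s))ds,$$ always taken in its version with continuous trajectories. Control problem. $J(x;u(\cdot)):=\mathbb{E}\left[\int_0^\infty e^{-\lambda s}l(X(s;x,u(\cdot)),u(s))ds\right]$ (possibly $+\infty$), $V(x):=\inf_{u(\cdot)\in\mathcal{U}_p}J(x;u(\cdot))$. For $x\in H$, $q\in K$, $u\in\Lambda$: $F_{0,CV}(x,q;u):=\langle L(u),q\rangle_K+l(x,u)$ and $F_0(x,q):=\inf_{u\in\Lambda}F_{0,CV}(x,q;u)$. $G$-derivative. $f:H\to\mathbb{R}$ is $G$-differentiable at $x\in H$ if there is a (unique) $D^Gf(x)\in K$ with $\lim_{k\in\mathcal{D}(G),|k|_K\to0}\frac{|f(x+Gk)-f(x)-\langle D^Gf(x),k\rangle_K|}{|k|_K}=0$. $C^{1,G}_b(H)$ is the space of $f:H\to\mathbb{R}$ that are $G$-differentiable at every $x\in H$ with $D^Gf:H\to K$ bounded and continuous. $\mathcal{S}^{A,G}(H)$ is the set of $\varphi\in C^{1,G}_b(H)$ such that for all $k\in K$ and all continuous $z:[0,\infty)\to H$, $\lim_{t\to0^+}\frac{1}{t}\left[\varphi\left(z(t)+\int_0^t\overline{e^{sA}G}k\,ds\right)-\varphi(z(t))\right]=\langle D^G\varphi(z(0)),k\rangle_K$.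 Mild solution. For $\varphi\in C_b(H)$ (bounded continuous functions $H\to\mathbb{R}$), $P^{(0)}_t[\varphi](x):=\mathbb{E}\big[\varphi\big(e^{tA}x+\int_0^te^{(t-s)A}\sigma\,dW(s)\big)\big]$. A function $v:H\to\mathbb{R}$ is a mild solution to the HJB equation if $v\in C^{1,G}_b(H)$, $F_0(\cdot,D^Gv(\cdot))$ is bounded (and continuous, i.e. in the domain $C_b(H)$ of $P^{(0)}_s$), and $v(x)=\int_0^\infty e^{-\lambda s}P_s^{(0)}[F_0(\cdot,D^Gv(\cdot))](x)ds$ for all $x\in H$. *)

theory Defs
  imports "HOL-Probability.Probability"
begin

text \<open>A real separable Hilbert space is a type of sort
  \<open>{real_inner, banach, second_countable_topology}\<close>.\<close>

section \<open>Linear operators\<close>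

text \<open>A possibly unbounded operator is a pair of its domain \<open>D\<close> and a function \<open>T\<close>
  whose values outside \<open>D\<close> are irrelevant.\<close>

definition closed_densely_defined ::
    "'a::real_normed_vector set \<Rightarrow> ('a \<Rightarrow> 'b::real_normed_vector) \<Rightarrow> bool" where
  "closed_densely_defined D T \<longleftrightarrow>
     subspace D \<and>
     (\<forall>x\<in>D. \<forall>y\<in>D. T (x + y) = T x + T y) \<and>
     (\<forall>x\<in>D. \<forall>c. T (c *\<^sub>R x) = c *\<^sub>R T x) \<and>
     closure D = UNIV \<and>
     closed {(x, T x) | x. x \<in> D}"

text \<open>Only \<open>S t\<close> with \<open>t \<ge> 0\<close> matters.\<close>

definition C0_semigroup :: "(real \<Rightarrow> 'h::banach \<Rightarrow>\<^sub>L 'h) \<Rightarrow> bool" where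
  "C0_semigroup S \<longleftrightarrow>
     S 0 = id_blinfun \<and>
     (\<forall>s\<ge>0. \<forall>t\<ge>0. S (s + t) = S s o\<^sub>L S t) \<and>
     (\<forall>x. ((\<lambda>t. S t x) \<longlongrightarrow> x) (at_right 0))"

definition generates ::
    "'h::banach set \<Rightarrow> ('h \<Rightarrow> 'h) \<Rightarrow> (real \<Rightarrow> 'h \<Rightarrow>\<^sub>L 'h) \<Rightarrow> bool" where
  "generates D A S \<longleftrightarrow>
     C0_semigroup S \<and>
     D = {x. \<exists>y. ((\<lambda>t. (1 / t) *\<^sub>R (S t x - x)) \<longlongrightarrow> y) (at_right 0)} \<and>
     (\<forall>x\<in>D. ((\<lambda>t. (1 / t) *\<^sub>R (S t x - x)) \<longlongrightarrow> A x) (at_right 0))"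

definition orthonormal_basis :: "'a::real_inner set \<Rightarrow> bool" where
  "orthonormal_basis B \<longleftrightarrow>
     (\<forall>e\<in>B. norm e = 1) \<and> pairwise orthogonal B \<and> closure (span B) = UNIV"

text \<open>The quantities below do not depend on the chosen orthonormal basis.\<close>

definition some_basis :: "'a::real_inner set" where
  "some_basis = (SOME B. orthonormal_basis B)"

definition trace_class :: "('h::real_inner \<Rightarrow> 'h) \<Rightarrow> bool" where
  "trace_class T \<longleftrightarrow>
     (\<exists>a b :: nat \<Rightarrow> 'h. summable (\<lambda>j. norm (a j) * norm (b j)) \<and>
        (\<forall>x. (\<lambda>j. (a j \<bullet> x) *\<^sub>R b j) sums T x))"

definition op_trace :: "('h::real_inner \<Rightarrow> 'h) \<Rightarrow> real" where
  "op_trace T = (\<Sum>\<^sub>\<infinity>e\<in>some_basis. T e \<bullet> e)"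

definition hilbert_schmidt_norm_sq :: "('x::real_inner \<Rightarrow> 'h::real_inner) \<Rightarrow> ennreal" where
  "hilbert_schmidt_norm_sq T = (\<Sum>\<^sub>\<infinity>e\<in>some_basis. ennreal ((norm (T e))\<^sup>2))"

text \<open>\<open>cov S \<sigma> s\<close> is \<open>e\<^sup>s\<^sup>A \<sigma> \<sigma>\<^sup>* e\<^sup>s\<^sup>A\<^sup>*\<close>; in a Hilbert space the semigroup generated by the
  adjoint of \<open>A\<close> consists of the adjoints of the operators \<open>S s\<close>.\<close>

definition cov ::
    "(real \<Rightarrow> 'h::{real_inner, banach} \<Rightarrow>\<^sub>L 'h) \<Rightarrow> ('x::{real_inner, banach} \<Rightarrow>\<^sub>L 'h)
      \<Rightarrow> real \<Rightarrow> 'h \<Rightarrow> 'h" where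
  "cov S \<sigma> s = (\<lambda>h. S s (\<sigma> (adjoint (blinfun_apply \<sigma>) (adjoint (blinfun_apply (S s)) h))))"

text \<open>\<open>SG_ext S D G s\<close> is the bounded extension of \<open>e\<^sup>s\<^sup>A G\<close>, unique when \<open>D\<close> is dense.\<close>

definition SG_extends ::
    "(real \<Rightarrow> 'h::banach \<Rightarrow>\<^sub>L 'h) \<Rightarrow> 'k::banach set \<Rightarrow> ('k \<Rightarrow> 'h) \<Rightarrow> real \<Rightarrow> ('k \<Rightarrow>\<^sub>L 'h) \<Rightarrow> bool" where
  "SG_extends S D G s T \<longleftrightarrow> (\<forall>k\<in>D. T k = S s (G k))"

definition SG_ext ::
    "(real \<Rightarrow> 'h::banach \<Rightarrow>\<^sub>L 'h) \<Rightarrow> 'k::banach set \<Rightarrow> ('k \<Rightarrow> 'h) \<Rightarrow> real \<Rightarrow> ('k \<Rightarrow>\<^sub>L 'h)" where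
  "SG_ext S D G s = (THE T. SG_extends S D G s T)"

section \<open>Probability\<close>

text \<open>The filtration is indexed by \<open>t \<ge> 0\<close>; its values at negative times are irrelevant, as are
  the measures (as opposed to the sigma-algebras) carried by \<open>F t\<close>.\<close>

definition filtered_prob_space_usual :: "'w measure \<Rightarrow> (real \<Rightarrow> 'w measure) \<Rightarrow> bool" where
  "filtered_prob_space_usual M F \<longleftrightarrow>
     prob_space M \<and> complete_measure M \<and>
     (\<forall>t\<ge>0. subalgebra M (F t)) \<and>
     (\<forall>s\<ge>0. \<forall>t\<ge>s. sets (F s) \<subseteq> sets (F t)) \<and>
     null_sets M \<subseteq> sets (F 0) \<and>
     (\<forall>t\<ge>0. sets (F t) = (\<Inter>s\<in>{t<..}. sets (F s)))"

text \<open>\<open>W k t\<close> is the real random variable usually written \<open>\<langle>W(t), k\<rangle>\<close>. By linearity, the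
  condition on the increments also fixes their covariances and includes the degenerate
  case \<open>k = 0\<close>.\<close>

definition cylindrical_brownian_motion ::
    "'w measure \<Rightarrow> (real \<Rightarrow> 'w measure) \<Rightarrow> ('x::real_inner \<Rightarrow> real \<Rightarrow> 'w \<Rightarrow> real) \<Rightarrow> bool" where
  "cylindrical_brownian_motion M F W \<longleftrightarrow>
     (\<forall>k. \<forall>t\<ge>0. W k t \<in> borel_measurable (F t)) \<and>
     (\<forall>a b k k'. \<forall>t\<ge>0. AE \<omega> in M.
        W (a *\<^sub>R k + b *\<^sub>R k') t \<omega> = a * W k t \<omega> + b * W k' t \<omega>) \<and>
     (\<forall>k. AE \<omega> in M. W k 0 \<omega> = 0) \<and>
     (\<forall>k. AE \<omega> in M. continuous_on {0..} (\<lambda>t. W k t \<omega>)) \<and>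
     (\<forall>k s t. k \<noteq> 0 \<longrightarrow> 0 \<le> s \<longrightarrow> s < t \<longrightarrow>
        distributed M lborel (\<lambda>\<omega>. W k t \<omega> - W k s \<omega>)
          (normal_density 0 (sqrt (t - s) * norm k))) \<and>
     (\<forall>k s t. 0 \<le> s \<longrightarrow> s \<le> t \<longrightarrow>
        prob_space.indep_set M
          (sets (vimage_algebra (space M) (\<lambda>\<omega>. W k t \<omega> - W k s \<omega>) borel)) (sets (F s)))"

text \<open>The Wiener integral of a deterministic operator-valued integrand: the list entry
  \<open>(a, b, e, h)\<close> stands for the integrand \<open>1\<^bsub>(a,b]\<^esub>(s) h \<otimes> e\<close>, and a general integrand is
  approximated in \<open>L\<^sup>2\<close> with respect to the Hilbert-Schmidt norm. The integral is determined up
  to almost sure equality.\<close>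

definition step_valid :: "real \<Rightarrow> (real \<times> real \<times> 'x \<times> 'h) list \<Rightarrow> bool" where
  "step_valid t xs \<longleftrightarrow> (\<forall>(a, b, e, h)\<in>set xs. 0 \<le> a \<and> a \<le> b \<and> b \<le> t)"

definition step_integrand ::
    "(real \<times> real \<times> 'x::real_inner \<times> 'h::real_inner) list \<Rightarrow> real \<Rightarrow> 'x \<Rightarrow> 'h" where
  "step_integrand xs s k = (\<Sum>(a, b, e, h)\<leftarrow>xs. (indicator {a<..b} s * (e \<bullet> k)) *\<^sub>R h)"

definition step_integral ::
    "('x \<Rightarrow> real \<Rightarrow> 'w \<Rightarrow> real) \<Rightarrow> (real \<times> real \<times> 'x \<times> 'h::real_inner) list \<Rightarrow> 'w \<Rightarrow> 'h" where
  "step_integral W xs \<omega> = (\<Sum>(a, b, e, h)\<leftarrow>xs. (W e b \<omega> - W e a \<omega>) *\<^sub>R h)"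

definition is_wiener_integral ::
    "'w measure \<Rightarrow> ('x::real_inner \<Rightarrow> real \<Rightarrow> 'w \<Rightarrow> real) \<Rightarrow> real \<Rightarrow>
      (real \<Rightarrow> 'x \<Rightarrow> 'h::{real_inner, banach, second_countable_topology}) \<Rightarrow> ('w \<Rightarrow> 'h) \<Rightarrow> bool" where
  "is_wiener_integral M W t \<Phi> Y \<longleftrightarrow>
     Y \<in> borel_measurable M \<and>
     (\<exists>xs :: nat \<Rightarrow> (real \<times> real \<times> 'x \<times> 'h) list.
        (\<forall>n. step_valid t (xs n)) \<and>
        (\<lambda>n. \<integral>\<^sup>+s\<in>{0<..<t}. hilbert_schmidt_norm_sq (\<lambda>k. \<Phi> s k - step_integrand (xs n) s k) \<partial>lborel)
          \<longlonglongrightarrow> 0 \<and>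
        (\<lambda>n. \<integral>\<^sup>+\<omega>. ennreal ((norm (step_integral W (xs n) \<omega> - Y \<omega>))\<^sup>2) \<partial>M) \<longlonglongrightarrow> 0)"

text \<open>\<open>Z\<close> is a version with continuous trajectories of the stochastic convolution
  \<open>\<integral>\<^sub>0\<^sup>t e\<^sup>(\<^sup>t\<^sup>-\<^sup>s\<^sup>)\<^sup>A \<sigma> dW(s)\<close>; it is unique up to indistinguishability.\<close>

definition stochastic_convolution ::
    "'w measure \<Rightarrow> ('x::{real_inner, banach} \<Rightarrow> real \<Rightarrow> 'w \<Rightarrow> real) \<Rightarrow>
      (real \<Rightarrow> 'h \<Rightarrow>\<^sub>L 'h) \<Rightarrow> ('x \<Rightarrow>\<^sub>L 'h::{real_inner, banach, second_countable_topology}) \<Rightarrow>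
      (real \<Rightarrow> 'w \<Rightarrow> 'h) \<Rightarrow> bool" where
  "stochastic_convolution M W S \<sigma> Z \<longleftrightarrow>
     (\<forall>t\<ge>0. is_wiener_integral M W t (\<lambda>s k. S (t - s) (\<sigma> k)) (Z t)) \<and>
     (\<forall>\<omega>\<in>space M. continuous_on {0..} (\<lambda>t. Z t \<omega>))"

definition progressively_measurable ::
    "(real \<Rightarrow> 'w measure) \<Rightarrow> (real \<Rightarrow> 'w \<Rightarrow> 'u::topological_space) \<Rightarrow> bool" where
  "progressively_measurable F u \<longleftrightarrow>
     (\<forall>T\<ge>0. (\<lambda>(\<omega>, s). u s \<omega>) \<in> borel_measurable (F T \<Otimes>\<^sub>M restrict_space borel {0..T}))"

text \<open>Integral with values in \<open>[-\<infinity>, \<infinity>]\<close>, meaningful when the negative part (or the positive part)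
  has finite integral.\<close>

definition ereal_integral :: "'a measure \<Rightarrow> ('a \<Rightarrow> ereal) \<Rightarrow> ereal" where
  "ereal_integral M f =
     enn2ereal (\<integral>\<^sup>+x. e2ennreal (f x) \<partial>M) - enn2ereal (\<integral>\<^sup>+x. e2ennreal (- f x) \<partial>M)"

section \<open>The control problem\<close>

definition controls ::
    "'w measure \<Rightarrow> (real \<Rightarrow> 'w measure) \<Rightarrow> 'u::real_normed_vector set \<Rightarrow> real \<Rightarrow>
      (real \<Rightarrow> 'w \<Rightarrow> 'u) set" where
  "controls M F \<Lambda> p =
     {u. progressively_measurable F u \<and>
         (\<forall>t\<ge>0. \<forall>\<omega>\<in>space M. u t \<omega> \<in> \<Lambda>) \<and>
         (\<forall>t\<ge>0. (\<integral>\<^sup>+s\<in>{0..t}. (\<integral>\<^sup>+\<omega>. ennreal (norm (u s \<omega>) powr p) \<partial>M) \<partial>lborel) < \<infinity>)}"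

text \<open>The state process; \<open>Z\<close> is the stochastic convolution. The Bochner integral
  exists, and the trajectory is continuous, for almost every \<open>\<omega>\<close>.\<close>

definition state ::
    "(real \<Rightarrow> 'h::{banach, second_countable_topology} \<Rightarrow>\<^sub>L 'h) \<Rightarrow> 'k::banach set \<Rightarrow> ('k \<Rightarrow> 'h) \<Rightarrow>
      ('u \<Rightarrow> 'k) \<Rightarrow> (real \<Rightarrow> 'w \<Rightarrow> 'h) \<Rightarrow> 'h \<Rightarrow> (real \<Rightarrow> 'w \<Rightarrow> 'u) \<Rightarrow> real \<Rightarrow> 'w \<Rightarrow> 'h" where
  "state S D G L Z x u t \<omega> =
     S t x + Z t \<omega> + (LINT s:{0..<t}|lborel. SG_ext S D G (t - s) (L (u s \<omega>)))"

definition cost ::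
    "'w measure \<Rightarrow> real \<Rightarrow> ('h \<Rightarrow> 'u \<Rightarrow> real) \<Rightarrow> (real \<Rightarrow> 'w \<Rightarrow> 'h) \<Rightarrow> (real \<Rightarrow> 'w \<Rightarrow> 'u) \<Rightarrow> ereal" where
  "cost M lam l X u =
     ereal_integral M (\<lambda>\<omega>. ereal_integral (restrict_space lborel {0..})
       (\<lambda>s. ereal (exp (- lam * s) * l (X s \<omega>) (u s \<omega>))))"

definition J ::
    "'w measure \<Rightarrow> (real \<Rightarrow> 'h::{banach, second_countable_topology} \<Rightarrow>\<^sub>L 'h) \<Rightarrow> 'k::banach set \<Rightarrow>
      ('k \<Rightarrow> 'h) \<Rightarrow> ('u \<Rightarrow> 'k) \<Rightarrow> (real \<Rightarrow> 'w \<Rightarrow> 'h) \<Rightarrow> real \<Rightarrow> ('h \<Rightarrow> 'u \<Rightarrow> real) \<Rightarrow>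
      'h \<Rightarrow> (real \<Rightarrow> 'w \<Rightarrow> 'u) \<Rightarrow> ereal" where
  "J M S D G L Z lam l x u = cost M lam l (state S D G L Z x u) u"

definition V ::
    "'w measure \<Rightarrow> (real \<Rightarrow> 'w measure) \<Rightarrow> 'u::real_normed_vector set \<Rightarrow> real \<Rightarrow>
      (real \<Rightarrow> 'h::{banach, second_countable_topology} \<Rightarrow>\<^sub>L 'h) \<Rightarrow> 'k::banach set \<Rightarrow>
      ('k \<Rightarrow> 'h) \<Rightarrow> ('u \<Rightarrow> 'k) \<Rightarrow> (real \<Rightarrow> 'w \<Rightarrow> 'h) \<Rightarrow> real \<Rightarrow> ('h \<Rightarrow> 'u \<Rightarrow> real) \<Rightarrow>
      'h \<Rightarrow> ereal" where
  "V M F \<Lambda> p S D G L Z lam l x = (INF u\<in>controls M F \<Lambda> p. J M S D G L Z lam l x u)"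

definition F0_CV :: "('u \<Rightarrow> 'k::real_inner) \<Rightarrow> ('h \<Rightarrow> 'u \<Rightarrow> real) \<Rightarrow> 'h \<Rightarrow> 'k \<Rightarrow> 'u \<Rightarrow> real" where
  "F0_CV L l x q u = L u \<bullet> q + l x u"

text \<open>Extended-real-valued, so that an unbounded (or empty) infimum is not given a junk value.\<close>

definition F0 :: "'u set \<Rightarrow> ('u \<Rightarrow> 'k::real_inner) \<Rightarrow> ('h \<Rightarrow> 'u \<Rightarrow> real) \<Rightarrow> 'h \<Rightarrow> 'k \<Rightarrow> ereal" where
  "F0 \<Lambda> L l x q = (INF u\<in>\<Lambda>. ereal (F0_CV L l x q u))"

section \<open>\<open>G\<close>-derivatives and mild solutions\<close>

definition has_G_derivative ::
    "'k::real_inner set \<Rightarrow> ('k \<Rightarrow> 'h::real_normed_vector) \<Rightarrow> ('h \<Rightarrow> real) \<Rightarrow> 'h \<Rightarrow> 'k \<Rightarrow> bool" where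
  "has_G_derivative D G f x d \<longleftrightarrow>
     ((\<lambda>k. \<bar>f (x + G k) - f x - d \<bullet> k\<bar> / norm k) \<longlongrightarrow> 0) (at 0 within D)"

definition G_deriv ::
    "'k::real_inner set \<Rightarrow> ('k \<Rightarrow> 'h::real_normed_vector) \<Rightarrow> ('h \<Rightarrow> real) \<Rightarrow> 'h \<Rightarrow> 'k" where
  "G_deriv D G f x = (THE d. has_G_derivative D G f x d)"

definition C1_G_b ::
    "'k::real_inner set \<Rightarrow> ('k \<Rightarrow> 'h::real_normed_vector) \<Rightarrow> ('h \<Rightarrow> real) set" where
  "C1_G_b D G =
     {f. (\<forall>x. \<exists>d. has_G_derivative D G f x d) \<and>
         bounded (range (G_deriv D G f)) \<and> continuous_on UNIV (G_deriv D G f)}"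

definition S_AG ::
    "(real \<Rightarrow> 'h::{banach, second_countable_topology} \<Rightarrow>\<^sub>L 'h) \<Rightarrow> 'k::{real_inner, banach} set \<Rightarrow>
      ('k \<Rightarrow> 'h) \<Rightarrow> ('h \<Rightarrow> real) set" where
  "S_AG S D G =
     {\<phi> \<in> C1_G_b D G. \<forall>k. \<forall>z :: real \<Rightarrow> 'h. continuous_on {0..} z \<longrightarrow>
        ((\<lambda>t. (1 / t) * (\<phi> (z t + (LINT s:{0<..t}|lborel. SG_ext S D G s k)) - \<phi> (z t)))
          \<longlongrightarrow> G_deriv D G \<phi> (z 0) \<bullet> k) (at_right 0)}"

definition P0 ::
    "'w measure \<Rightarrow> (real \<Rightarrow> 'h::real_normed_vector \<Rightarrow>\<^sub>L 'h) \<Rightarrow> (real \<Rightarrow> 'w \<Rightarrow> 'h) \<Rightarrow>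
      real \<Rightarrow> ('h \<Rightarrow> real) \<Rightarrow> 'h \<Rightarrow> real" where
  "P0 M S Z t \<phi> x = (\<integral>\<omega>. \<phi> (S t x + Z t \<omega>) \<partial>M)"

definition mild_solution ::
    "'w measure \<Rightarrow> 'u set \<Rightarrow> (real \<Rightarrow> 'h::{banach, second_countable_topology} \<Rightarrow>\<^sub>L 'h) \<Rightarrow>
      'k::{real_inner, banach} set \<Rightarrow> ('k \<Rightarrow> 'h) \<Rightarrow> ('u \<Rightarrow> 'k) \<Rightarrow> (real \<Rightarrow> 'w \<Rightarrow> 'h) \<Rightarrow>
      real \<Rightarrow> ('h \<Rightarrow> 'u \<Rightarrow> real) \<Rightarrow> ('h \<Rightarrow> real) \<Rightarrow> bool" where
  "mild_solution M \<Lambda> S D G L Z lam l v \<longleftrightarrow>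
     v \<in> C1_G_b D G \<and>
     (\<exists>f. f \<in> bcontfun \<and>
          (\<forall>x. F0 \<Lambda> L l x (G_deriv D G v x) = ereal (f x)) \<and>
          (\<forall>x. v x = (LINT s:{0..}|lborel. exp (- lam * s) * P0 M S Z s f x)))"

end

theory Submission
  imports Defs
begin

text \<open>
  Put \<open>f x = F\<^sub>0(x, D\<^sup>Gv(x))\<close>, let \<open>u\<close> be a control and \<open>X\<close> its state process started at \<open>x\<close>.
  Everything rests on the identity
    \<open>v x = E[\<integral>\<^sub>0\<^sup>T e\<^sup>-\<^sup>\<lambda>\<^sup>s (f(X(s)) - \<langle>D\<^sup>Gv(X(s)), L(u(s))\<rangle>) ds] + e\<^sup>-\<^sup>\<lambda>\<^sup>T E[v(X(T))]\<close>,
  which formally is Ito's formula for \<open>e\<^sup>-\<^sup>\<lambda>\<^sup>t v(X(t))\<close> combined with the HJB equation. As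
  \<open>f(X) \<le> \<langle>D\<^sup>Gv(X), L(u)\<rangle> + l(X, u)\<close>, the integrand is at most the discounted running cost, and it
  is equal to it along an optimal \<open>u\<^sup>*\<close>. The last term is at most \<open>e\<^sup>-\<^sup>\<lambda>\<^sup>T\<close> times a constant, since a mild
  solution is bounded. Letting \<open>T \<rightarrow> \<infinity>\<close> gives \<open>v x \<le> J x u\<close> (\<open>value_le_cost\<close>) and
  \<open>v x = J x u\<^sup>*\<close> (\<open>value_eq_cost\<close>).

  The function \<open>v\<close> is only known to be differentiable along the range of \<open>G\<close>, so Ito's formula does not apply.
  The identity is obtained in three stages instead.

  \<^item> \<^emph>\<open>No control.\<close> The innovation \<open>Z(t+h) - e\<^sup>h\<^sup>A Z(t)\<close> is independent of \<open>F t\<close> and distributed as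
    \<open>Z(h)\<close>. Inserting this Markov property into the mild formula for \<open>v\<close> gives the exact one-step
    identity \<open>uncontrolled_step\<close>. The property itself (\<open>innovation_char\<close>) is read off the
    characteristic functions of step integrals, which are products of independent Gaussian
    factors; that characteristic functions weighted by the events of \<open>F t\<close> determine the joint
    law is \<open>integral_freeze\<close>.

  \<^item> \<^emph>\<open>Constant control.\<close> Over a short time \<open>h\<close> a constant value \<open>k\<close> of \<open>L(u)\<close> displaces the uncontrolled
    continuation by \<open>\<Gamma> h k\<close>, and membership in \<open>S\<^sup>A\<^sup>,\<^sup>G\<close> says that \<open>v\<close> then changes by
    \<open>h \<langle>D\<^sup>Gv, k\<rangle> + o(h)\<close> along each continuous path. A path can be threaded through any sequence
    converging to its starting point, so the limit holds jointly in time and space, hence uniformly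
    along the compact pieces of a trajectory; the one-step drifts therefore add up to
    Riemann sums of a continuous rate, trajectory by trajectory. To take expectations, the sums are stopped, at an
    adapted time, as soon as one difference quotient is too large. The stopped sums are dominated
    and still satisfy the one-step identity, and each trajectory is eventually never stopped. This
    is \<open>dynkin_constant_control\<close>.

  \<^item> \<^emph>\<open>General control.\<close> On each cell of a grid, replace \<open>L(u)\<close> by its mean over the preceding cell. This
    gives an adapted control that is constant on cells, for which the second stage can be chained
    (\<open>dynkin_step_control\<close>). When the grid is refined these controls converge to \<open>L(u)\<close> in \<open>L\<^sup>1\<close>, and by
    Young's inequality, the singularity of \<open>e\<^sup>s\<^sup>A G\<close> at \<open>0\<close> being integrable, so do the states
    (\<open>dynkin_estimate\<close>).
\<close>

section \<open>Strongly continuous semigroups\<close>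

text \<open>The Banach-Steinhaus theorem, from Baire's theorem: one of the closed sets where all \<open>norm (T n x)\<close> are at most \<open>m\<close> has interior.\<close>
lemma uniform_boundedness:
  fixes T :: "nat \<Rightarrow> 'a::banach \<Rightarrow>\<^sub>L 'b::real_normed_vector"
  assumes bdd: "\<And>x. bounded (range (\<lambda>n. T n x))"
  shows "\<exists>C. \<forall>n. norm (T n) \<le> C"
proof -
  define E where "E m = {x. \<forall>n. norm (T n x) \<le> real m}" for m :: nat
  have "closed (E m)" for m
  proof -
    have "E m = (\<Inter>n. {x. norm (T n x) \<le> real m})" by (auto simp: E_def)
    then show ?thesis by (auto intro!: closed_INT closed_Collect_le continuous_intros)
  qed
  moreover have "(\<Union>m. E m) = UNIV"
  proof (safe; simp)
    fix x
    obtain a where "\<And>n. norm (T n x) \<le> a" using bdd[of x] by (auto simp: bounded_iff)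
    then show "\<exists>m. x \<in> E m"
      using real_arch_simple[of a] by (auto simp: E_def intro: order_trans)
  qed
  ultimately have "\<exists>m. interior (E m) \<noteq> {}"
  proof -
    have "Met_TC.mtopology interior_of \<Union>(range E) = {}" if "\<forall>m. interior (E m) = {}"
      by (rule Met_TC.metric_Baire_category_alt)
        (use \<open>\<And>m. closed (E m)\<close> that in \<open>auto simp: complete_UNIV\<close>)
    with \<open>(\<Union>m. E m) = UNIV\<close> show ?thesis by auto
  qed
  then obtain m x0 where "x0 \<in> interior (E m)" by auto
  then obtain e where e: "e > 0" "cball x0 e \<subseteq> E m"
    by (meson interior_subset mem_interior_cball subset_trans)
  have "norm (T n) \<le> 2 * real m / e" for n
  proof (rule norm_blinfun_bound)
    show "0 \<le> 2 * real m / e" using e by simp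
    fix x
    show "norm (T n x) \<le> 2 * real m / e * norm x"
    proof (cases "x = 0")
      case False
      define y where "y = (e / norm x) *\<^sub>R x"
      have "norm y = e" using False e by (simp add: y_def)
      then have "x0 + y \<in> E m" "x0 \<in> E m" using e by (auto simp: dist_norm intro!: subsetD[OF e(2)])
      then have "norm (T n (x0 + y)) \<le> m" "norm (T n x0) \<le> m" by (auto simp: E_def)
      moreover have "T n y = T n (x0 + y) - T n x0" by (simp add: blinfun.add_right)
      ultimately have "norm (T n y) \<le> 2 * real m"
        by (smt (verit) norm_triangle_ineq4)
      then show ?thesis using False e by (simp add: y_def blinfun.scaleR_right field_simps)
    qed simp
  qed
  then show ?thesis by blast
qed

locale strongly_continuous_semigroup =
  fixes S :: "real \<Rightarrow> 'h::banach \<Rightarrow>\<^sub>L 'h"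
  assumes C0: "C0_semigroup S"
begin

lemma S_0 [simp]: "S 0 x = x"
  using C0 by (simp add: C0_semigroup_def)

lemma S_add: "0 \<le> s \<Longrightarrow> 0 \<le> t \<Longrightarrow> S (s + t) x = S s (S t x)"
  using C0 by (simp add: C0_semigroup_def)

lemma S_add_op: "0 \<le> s \<Longrightarrow> 0 \<le> t \<Longrightarrow> S (s + t) = S s o\<^sub>L S t"
  using C0 by (simp add: C0_semigroup_def)

lemma S_tendsto_0: "((\<lambda>t. S t x) \<longlongrightarrow> x) (at_right 0)"
  using C0 by (simp add: C0_semigroup_def)

text \<open>Otherwise \<open>norm (S (t n))\<close> would be unbounded for some \<open>t n\<close> tending to \<open>0\<close>, although \<open>S (t n) x\<close> converges for each \<open>x\<close>; this contradicts uniform boundedness.\<close>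
lemma norm_S_bounded_near_0: "\<exists>\<eta>>0. \<exists>C. \<forall>t\<in>{0..\<eta>}. norm (S t) \<le> C"
proof (rule ccontr)
  assume "\<not> ?thesis"
  then have "\<exists>t\<in>{0..\<eta>}. norm (S t) > C" if "\<eta> > 0" for \<eta> C
    using that by (meson not_le)
  then have "\<forall>n::nat. \<exists>t\<in>{0..1 / Suc n}. norm (S t) > max (real n) (norm (S 0))"
    by (meson of_nat_0_less_iff zero_less_Suc zero_less_divide_1_iff)
  then obtain t where t: "\<And>n. t n \<in> {0..1 / Suc n}" "\<And>n. norm (S (t n)) > max (real n) (norm (S 0))"
    by metis
  have pos: "t n > 0" for n using t[of n] by (cases "t n = 0") auto
  have "t \<longlonglongrightarrow> 0"
    by (rule tendsto_sandwich[of "\<lambda>_. 0" _ _ "\<lambda>n. 1 / Suc n"])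
      (use t LIMSEQ_Suc[OF lim_1_over_n] in auto)
  then have "filterlim t (at_right 0) sequentially"
    using pos by (auto simp: filterlim_at less_imp_neq[THEN not_sym])
  then have "(\<lambda>n. S (t n) x) \<longlonglongrightarrow> x" for x
    using filterlim_compose[OF S_tendsto_0] by blast
  then have "bounded (range (\<lambda>n. S (t n) x))" for x
    using convergent_imp_bounded by blast
  then obtain C where C: "\<And>n. norm (S (t n)) \<le> C" using uniform_boundedness[of "\<lambda>n. S (t n)"] by auto
  obtain n :: nat where "real n > C" using reals_Archimedean2 by blast
  with C[of n] t(2)[of n] show False by auto
qed

lemma norm_S_bounded: "\<exists>C\<ge>1. \<forall>t\<in>{0..T}. norm (S t) \<le> C"
proof -
  obtain \<eta> C0 where \<eta>: "\<eta> > 0" and "\<And>t. t \<in> {0..\<eta>} \<Longrightarrow> norm (S t) \<le> C0"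
    using norm_S_bounded_near_0 by blast
  then have C: "1 \<le> max 1 C0" "\<And>t. t \<in> {0..\<eta>} \<Longrightarrow> norm (S t) \<le> max 1 C0" by fastforce+
  define C where "C = max 1 C0"
  have *: "t \<in> {0..real n * \<eta>} \<Longrightarrow> norm (S t) \<le> C ^ n" for n t
  proof (induction n arbitrary: t)
    case 0
    have "S 0 = id_blinfun" by (intro blinfun_eqI) simp
    with 0 show ?case using norm_blinfun_id_le by auto
  next
    case (Suc n)
    show ?case
    proof (cases "t \<le> \<eta>")
      case True
      have "C \<le> C ^ Suc n" using C(1) unfolding C_def[symmetric] by (intro self_le_power) auto
      with True Suc.prems C(2)[of t] show ?thesis unfolding C_def[symmetric] by (auto intro: order_trans)
    next
      case False
      then have *: "t - \<eta> \<in> {0..real n * \<eta>}" using Suc.prems \<eta> by (auto simp: algebra_simps)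
      have "S t = S \<eta> o\<^sub>L S (t - \<eta>)" using S_add_op[of \<eta> "t - \<eta>"] \<eta> False by simp
      then have "norm (S t) \<le> norm (S \<eta>) * norm (S (t - \<eta>))"
        by (metis norm_blinfun_compose)
      also have "\<dots> \<le> C * C ^ n"
        using Suc.IH[OF *] C(2)[of \<eta>] \<eta> C(1) unfolding C_def[symmetric]
        by (intro mult_mono) auto
      finally show ?thesis by simp
    qed
  qed
  obtain n :: nat where "real n \<ge> T / \<eta>" using real_arch_simple by blast
  then have "T \<le> real n * \<eta>" using \<eta> by (simp add: field_simps)
  with *[of _ n] have "\<forall>t\<in>{0..T}. norm (S t) \<le> C ^ n" by auto
  moreover have "1 \<le> C ^ n" using C(1) by (simp add: C_def)
  ultimately show ?thesis by blast
qed

text \<open>Factoring out \<open>S (min s t)\<close> reduces continuity at an arbitrary time to continuity at \<open>0\<close>.\<close>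
lemma S_norm_diff_le:
  assumes "0 \<le> s" "0 \<le> t" and C: "\<And>r. r \<in> {0..max s t} \<Longrightarrow> norm (S r) \<le> C"
  shows "norm (S s x - S t x) \<le> C * norm (S \<bar>s - t\<bar> x - x)"
proof -
  have *: "norm (S s x - S t x) \<le> C * norm (S \<bar>s - t\<bar> x - x)"
    if "0 \<le> s" "s \<le> t" "\<And>r. r \<in> {0..t} \<Longrightarrow> norm (S r) \<le> C" for s t
  proof -
    have "S t x - S s x = S s (S (t - s) x - x)"
      using S_add[of s "t - s" x] that by (simp add: blinfun.diff_right)
    then have "norm (S t x - S s x) \<le> norm (S s) * norm (S (t - s) x - x)"
      by (metis norm_blinfun)
    also have "\<dots> \<le> C * norm (S (t - s) x - x)" using that by (intro mult_right_mono) auto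
    finally show ?thesis using that by (simp add: norm_minus_commute abs_minus_commute)
  qed
  show ?thesis
  proof (cases "s \<le> t")
    case True then show ?thesis using *[of s t] assms by auto
  next
    case False then show ?thesis using *[of t s] assms
      by (auto simp: norm_minus_commute abs_minus_commute)
  qed
qed

lemma S_continuous_on: "continuous_on ({0..} \<times> UNIV) (\<lambda>(t, x). S t x)"
proof -
  have "((\<lambda>(t, x). S t x) \<longlongrightarrow> S s y) (at (s, y) within {0..} \<times> UNIV)" if s: "0 \<le> s" for s y
  proof -
    obtain C where C: "C \<ge> 1" "\<And>t. t \<in> {0..s + 1} \<Longrightarrow> norm (S t) \<le> C"
      using norm_S_bounded[of "s + 1"] by blast
    let ?F = "at (s, y) within {0..} \<times> (UNIV::'h set)"
    have f: "(fst \<longlongrightarrow> s) ?F" "(snd \<longlongrightarrow> y) ?F"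
      by (auto intro!: tendsto_eq_intros)
    have ev: "eventually (\<lambda>p. fst p \<in> {0..s + 1}) ?F"
    proof -
      have "eventually (\<lambda>p. fst p < s + 1) ?F" using f(1) by (rule order_tendstoD) simp
      moreover have "eventually (\<lambda>p. fst p \<ge> 0) ?F"
        by (auto simp: eventually_at_filter intro!: always_eventually)
      ultimately show ?thesis by eventually_elim auto
    qed
    have "((\<lambda>t. S \<bar>t\<bar> y) \<longlongrightarrow> y) (at 0)"
    proof (rule filterlim_split_at)
      have abs: "filterlim abs (at_right 0) (at_right (0::real))" "filterlim abs (at_right 0) (at_left (0::real))"
        by (auto simp: filterlim_at eventually_at_filter intro!: tendsto_eq_intros)
      show "((\<lambda>t. S \<bar>t\<bar> y) \<longlongrightarrow> y) (at_left 0)" "((\<lambda>t. S \<bar>t\<bar> y) \<longlongrightarrow> y) (at_right 0)"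
        using filterlim_compose[OF S_tendsto_0 abs(1)] filterlim_compose[OF S_tendsto_0 abs(2)] by auto
    qed
    then have "isCont (\<lambda>t. S \<bar>t\<bar> y) 0" by (simp add: isCont_def)
    moreover have "((\<lambda>p. fst p - s) \<longlongrightarrow> 0) ?F" using f(1) by (auto intro: tendsto_eq_intros)
    ultimately have 1: "((\<lambda>p. S \<bar>fst p - s\<bar> y) \<longlongrightarrow> y) ?F"
      using isCont_tendsto_compose by fastforce
    have 2: "((\<lambda>p. C * norm (snd p - y) + C * norm (S \<bar>fst p - s\<bar> y - y)) \<longlongrightarrow> C * norm (y - y) + C * norm (y - y)) ?F"
      by (intro tendsto_intros f 1)
    have "eventually (\<lambda>p. norm ((\<lambda>(t, x). S t x) p - S s y) \<le> C * norm (snd p - y) + C * norm (S \<bar>fst p - s\<bar> y - y)) ?F"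
      using ev
    proof eventually_elim
      case (elim p)
      obtain t x where p: "p = (t, x)" by force
      have "S t x - S s y = S t (x - y) + (S t y - S s y)" by (simp add: blinfun.diff_right)
      then have "norm (S t x - S s y) \<le> norm (S t (x - y)) + norm (S t y - S s y)"
        by (metis norm_triangle_ineq)
      also have "\<dots> \<le> C * norm (x - y) + C * norm (S \<bar>t - s\<bar> y - y)"
      proof (intro add_mono S_norm_diff_le)
        show "norm (S t (x - y)) \<le> C * norm (x - y)"
          using C elim p by (intro order_trans[OF norm_blinfun] mult_right_mono) auto
      qed (use C s elim p in auto)
      finally show ?case using p by simp
    qed
    then have "((\<lambda>p. (\<lambda>(t, x). S t x) p - S s y) \<longlongrightarrow> 0) ?F"
      by (rule Lim_null_comparison) (use 2 in simp)
    then show ?thesis by (simp add: LIM_zero_iff)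
  qed
  then show ?thesis by (auto simp: continuous_on_def)
qed

lemma continuous_on_S [continuous_intros]:
  assumes "continuous_on A f" "continuous_on A g" "\<And>x. x \<in> A \<Longrightarrow> 0 \<le> f x"
  shows "continuous_on A (\<lambda>x. S (f x) (g x))"
proof -
  have "continuous_on A ((\<lambda>(t, x). S t x) \<circ> (\<lambda>x. (f x, g x)))"
    using assms by (intro continuous_on_compose continuous_on_subset[OF S_continuous_on] continuous_intros) auto
  then show ?thesis by (simp add: comp_def)
qed

lemma tendsto_S:
  assumes "(f \<longlongrightarrow> a) X" "(g \<longlongrightarrow> b) X" "eventually (\<lambda>x. 0 \<le> f x) X" "0 \<le> a"
  shows "((\<lambda>x. S (f x) (g x)) \<longlongrightarrow> S a b) X"
  using continuous_on_tendsto_compose[OF S_continuous_on, of "\<lambda>x. (f x, g x)" "(a, b)" X] assms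
  by (auto simp: tendsto_Pair)

end

section \<open>The unbounded input operator\<close>

lemma SG_extends_unique:
  assumes "closed_densely_defined D G" "SG_extends S D G s T" "SG_extends S D G s T'"
  shows "T = T'"
proof (rule blinfun_eqI)
  fix k
  have "closure D = UNIV" using assms(1) by (simp add: closed_densely_defined_def)
  moreover have "closed {k. T k = T' k}"
    by (intro closed_Collect_eq continuous_intros)
  moreover have "D \<subseteq> {k. T k = T' k}" using assms(2,3) by (auto simp: SG_extends_def)
  ultimately have "UNIV \<subseteq> {k. T k = T' k}" using closure_minimal[of D "{k. T k = T' k}"] by simp
  then show "T k = T' k" by auto
qed

lemma SG_ext_extends:
  assumes "closed_densely_defined D G" "\<exists>T. SG_extends S D G s T"
  shows "SG_extends S D G s (SG_ext S D G s)"
  unfolding SG_ext_def by (rule theI') (use assms SG_extends_unique[OF assms(1)] in blast)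

definition singular_bound :: "real \<Rightarrow> real \<Rightarrow> real \<Rightarrow> real \<Rightarrow> real" where
  "singular_bound C \<beta> a s = C * max (s powr (- \<beta>)) 1 * exp (a * s)"

lemma singular_bound_nonneg: "C \<ge> 0 \<Longrightarrow> 0 \<le> singular_bound C \<beta> a s"
  by (simp add: singular_bound_def)

lemma singular_bound_measurable [measurable]: "singular_bound C \<beta> a \<in> borel_measurable borel"
  unfolding singular_bound_def[abs_def] by measurable

lemma singular_bound_integrable:
  assumes "0 \<le> \<beta>" "\<beta> < 1" "0 \<le> C"
  shows "set_integrable lborel {0<..t} (singular_bound C \<beta> a)"
proof (cases "t > 0")
  case True
  have 1: "set_integrable lborel {0<..t} (\<lambda>s. s powr (- \<beta>))"
  proof -
    have "(\<lambda>s. s powr (- \<beta>)) integrable_on {0..t}"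
      using integrable_on_powr_from_0[of "- \<beta>" t] assms True by simp
    then have "(\<lambda>s. s powr (- \<beta>)) absolutely_integrable_on {0..t}"
      by (intro nonnegative_absolutely_integrable_1) auto
    then have "set_integrable lebesgue {0<..t} (\<lambda>s. s powr (- \<beta>))"
      by (rule set_integrable_subset) auto
    then show ?thesis
      unfolding set_integrable_def by (subst (asm) integrable_completion) auto
  qed
  have 2: "set_integrable lborel {0<..t} (\<lambda>s. C * exp (\<bar>a\<bar> * t) * (s powr (- \<beta>) + 1))"
  proof -
    have "set_integrable lborel {0<..t} (\<lambda>s. 1::real)"
      using True by (auto simp: set_integrable_def intro!: integrable_real_indicator)
    with 1 show ?thesis by (intro set_integrable_mult_right set_integral_add(1))
  qed
  show ?thesis
  proof (rule set_integrable_bound[OF 2])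
    show "set_borel_measurable lborel {0<..t} (singular_bound C \<beta> a)"
      unfolding set_borel_measurable_def by measurable
    show "AE s in lborel. s \<in> {0<..t} \<longrightarrow> norm (singular_bound C \<beta> a s)
       \<le> norm (C * exp (\<bar>a\<bar> * t) * (s powr (- \<beta>) + 1))"
    proof (intro always_eventually allI impI)
      fix s assume s: "s \<in> {0<..t}"
      have "a * s \<le> \<bar>a\<bar> * t" using s by (intro mult_mono) auto
      then have "exp (a * s) \<le> exp (\<bar>a\<bar> * t)" by simp
      moreover have "max (s powr (- \<beta>)) 1 \<le> s powr (- \<beta>) + 1" by simp
      ultimately have "C * (max (s powr (- \<beta>)) 1 * exp (a * s)) \<le> C * ((s powr (- \<beta>) + 1) * exp (\<bar>a\<bar> * t))"
        using assms by (intro mult_left_mono mult_mono) (auto simp: add_nonneg_nonneg)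
      then show "norm (singular_bound C \<beta> a s) \<le> norm (C * exp (\<bar>a\<bar> * t) * (s powr (- \<beta>) + 1))"
        using assms by (simp add: singular_bound_def abs_mult mult_ac)
    qed
  qed
next
  case False
  then have "{0<..t} = {}" by auto
  then show ?thesis by simp
qed

locale unbounded_input = strongly_continuous_semigroup S
  for S :: "real \<Rightarrow> 'h::{banach, second_countable_topology} \<Rightarrow>\<^sub>L 'h" +
  fixes D :: "'k::{banach, second_countable_topology} set" and G :: "'k \<Rightarrow> 'h" and C_G \<beta> a_G :: real
  assumes G: "closed_densely_defined D G"
    and SG_ex: "\<And>s. s > 0 \<Longrightarrow> \<exists>T. SG_extends S D G s T"
    and C_G: "C_G > 0" and \<beta>: "0 \<le> \<beta>" "\<beta> < 1"
    and SG_bound: "\<And>s. s > 0 \<Longrightarrow> norm (SG_ext S D G s) \<le> C_G * max (s powr (- \<beta>)) 1 * exp (a_G * s)"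
begin

abbreviation E where "E \<equiv> SG_ext S D G"
abbreviation \<rho> where "\<rho> \<equiv> singular_bound C_G \<beta> a_G"

lemma norm_E: "s > 0 \<Longrightarrow> norm (E s) \<le> \<rho> s"
  using SG_bound by (simp add: singular_bound_def)

lemma norm_E_apply: "s > 0 \<Longrightarrow> norm (E s k) \<le> \<rho> s * norm k"
  by (meson norm_E order_trans norm_blinfun mult_right_mono norm_ge_zero)

lemma \<rho>_nonneg: "0 \<le> \<rho> s"
  using C_G by (simp add: singular_bound_nonneg)

lemma \<rho>_integrable: "set_integrable lborel {0<..t} \<rho>"
  using singular_bound_integrable \<beta> C_G by simp

lemma E_add_op:
  assumes "0 \<le> s" "0 < t"
  shows "E (s + t) = S s o\<^sub>L E t"
proof (rule SG_extends_unique[OF G])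
  show "SG_extends S D G (s + t) (E (s + t))" using SG_ext_extends[OF G SG_ex] assms by simp
  have "SG_extends S D G t (E t)" using SG_ext_extends[OF G SG_ex] assms by simp
  then show "SG_extends S D G (s + t) (S s o\<^sub>L E t)"
    using assms by (auto simp: SG_extends_def S_add)
qed

lemma E_add: "0 \<le> s \<Longrightarrow> 0 < t \<Longrightarrow> E (s + t) k = S s (E t k)"
  by (simp add: E_add_op)

text \<open>For \<open>t > \<epsilon>\<close> the operator \<open>E t\<close> is \<open>S (t - \<epsilon>) o E \<epsilon>\<close> with \<open>E \<epsilon>\<close> bounded, so continuity is inherited from the semigroup although \<open>norm (E t)\<close> may blow up at \<open>0\<close>.\<close>
lemma E_continuous_on: "continuous_on ({0<..} \<times> UNIV) (\<lambda>(t, k). E t k)"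
proof -
  have "continuous_on ({\<epsilon><..} \<times> UNIV) (\<lambda>(t, k). E t k)" if \<epsilon>: "\<epsilon> > 0" for \<epsilon>
  proof -
    have "continuous_on ({\<epsilon><..} \<times> UNIV) (\<lambda>p. S (fst p - \<epsilon>) (E \<epsilon> (snd p)))"
      by (intro continuous_intros) auto
    moreover have "S (fst p - \<epsilon>) (E \<epsilon> (snd p)) = (\<lambda>(t, k). E t k) p" if "p \<in> {\<epsilon><..} \<times> UNIV" for p
      using that \<epsilon> E_add[of "fst p - \<epsilon>" \<epsilon> "snd p"] by (auto simp: split_beta)
    ultimately show ?thesis by (metis (no_types, lifting) continuous_on_cong)
  qed
  then have "continuous_on (\<Union>\<epsilon>\<in>{0<..}. {\<epsilon><..} \<times> UNIV) (\<lambda>(t, k). E t k)"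
    by (intro continuous_on_open_UN) (auto intro!: open_Times)
  moreover have "(\<Union>\<epsilon>\<in>{0<..}. {\<epsilon><..} \<times> UNIV) = {0::real<..} \<times> (UNIV :: 'k set)"
    using dense by fastforce
  ultimately show ?thesis by metis
qed

text \<open>The value for \<open>t \<le> 0\<close> is chosen so that the function is measurable everywhere.\<close>
definition E0 :: "real \<Rightarrow> 'k \<Rightarrow> 'h" where
  "E0 t k = (if 0 < t then E t k else 0)"

lemma E0_measurable [measurable]: "(\<lambda>(t, k). E0 t k) \<in> borel_measurable (borel \<Otimes>\<^sub>M borel)"
proof -
  have "(\<lambda>p. if p \<in> {0<..} \<times> UNIV then (\<lambda>(t, k). E t k) p else 0) \<in> borel_measurable borel"
    by (intro borel_measurable_continuous_on_if E_continuous_on continuous_intros borel_open open_Times) auto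
  also have "(\<lambda>p. if p \<in> {0<..} \<times> UNIV then (\<lambda>(t, k). E t k) p else 0) = (\<lambda>(t, k). E0 t k)"
    by (auto simp: E0_def fun_eq_iff)
  finally show ?thesis by (simp add: borel_prod)
qed

lemma norm_E0: "norm (E0 t k) \<le> \<rho> t * norm k"
  using norm_E_apply \<rho>_nonneg by (simp add: E0_def)

lemma E0_add: "0 \<le> s \<Longrightarrow> 0 < t \<Longrightarrow> E0 (s + t) k = S s (E0 t k)"
  by (simp add: E0_def E_add)

text \<open>Response of the deterministic system, started at the origin, to a constant control.\<close>
definition \<Gamma> :: "real \<Rightarrow> 'k \<Rightarrow> 'h" where
  "\<Gamma> t k = (LINT s:{0<..t}|lborel. E s k)"

lemma E_set_integrable: "set_integrable lborel {0<..t} (\<lambda>s. E s k)"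
proof (rule set_integrable_bound)
  show "set_integrable lborel {0<..t} (\<lambda>s. \<rho> s * norm k)"
    using \<rho>_integrable by (rule set_integrable_mult_left)
  have "(\<lambda>s. indicator {0<..t} s *\<^sub>R E0 s k) \<in> borel_measurable lborel" by measurable
  also have "(\<lambda>s. indicator {0<..t} s *\<^sub>R E0 s k) = (\<lambda>s. indicator {0<..t} s *\<^sub>R E s k)"
    by (auto simp: E0_def indicator_def)
  finally show "set_borel_measurable lborel {0<..t} (\<lambda>s. E s k)"
    by (simp add: set_borel_measurable_def)
  show "AE s in lborel. s \<in> {0<..t} \<longrightarrow> norm (E s k) \<le> norm (\<rho> s * norm k)"
    using norm_E_apply \<rho>_nonneg by (auto simp: abs_mult)
qed

lemma \<Gamma>_0 [simp]: "\<Gamma> 0 k = 0"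
  by (simp add: \<Gamma>_def set_lebesgue_integral_def)

lemma \<Gamma>_diff: "\<Gamma> t (k - k') = \<Gamma> t k - \<Gamma> t k'"
  by (simp add: \<Gamma>_def blinfun.diff_right set_integral_diff(2)[OF E_set_integrable E_set_integrable])

lemma norm_\<Gamma>: "norm (\<Gamma> t k) \<le> (LINT s:{0<..t}|lborel. \<rho> s) * norm k"
proof -
  have "norm (\<Gamma> t k) \<le> (LINT s:{0<..t}|lborel. norm (E s k))"
    unfolding \<Gamma>_def by (rule set_integral_norm_bound[OF E_set_integrable])
  also have "\<dots> \<le> (LINT s:{0<..t}|lborel. \<rho> s * norm k)"
    by (intro set_integral_mono set_integrable_norm E_set_integrable set_integrable_mult_left \<rho>_integrable norm_E_apply) auto
  also have "\<dots> = (LINT s:{0<..t}|lborel. \<rho> s) * norm k" by simp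
  finally show ?thesis .
qed

lemma \<rho>_integral_mono:
  assumes "s \<le> t" shows "(LINT s:{0<..s}|lborel. \<rho> s) \<le> (LINT s:{0<..t}|lborel. \<rho> s)"
  unfolding set_lebesgue_integral_def
  using \<rho>_integrable[of s] \<rho>_integrable[of t] \<rho>_nonneg assms
  by (intro integral_mono) (auto simp: set_integrable_def indicator_def)

text \<open>The flow property of the controlled dynamics: after a further time \<open>h\<close> the response to the control is the transported old response plus a fresh one.\<close>
lemma S_\<Gamma>:
  assumes "0 \<le> h" "0 \<le> t"
  shows "S h (\<Gamma> t k) = \<Gamma> (t + h) k - \<Gamma> h k"
proof -
  have "S h (\<Gamma> t k) = (LINT s:{0<..t}|lborel. S h (E s k))"
    unfolding \<Gamma>_def set_lebesgue_integral_def
    using E_set_integrable[of t k] unfolding set_integrable_def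
    by (subst integral_bounded_linear[of "blinfun_apply (S h)", symmetric])
       (auto simp: blinfun.scaleR_right blinfun.bounded_linear_right)
  also have "\<dots> = (LINT s:{0<..t}|lborel. E (h + s) k)"
    using assms by (intro set_lebesgue_integral_cong) (auto simp: E_add)
  also have "\<dots> = (LINT s|lborel. indicator {h<..t+h} (h + 1 * s) *\<^sub>R E (h + 1 * s) k)"
    unfolding set_lebesgue_integral_def
    by (intro Bochner_Integration.integral_cong refl) (auto simp: indicator_def)
  also have "\<dots> = (LINT s:{h<..t+h}|lborel. E s k)"
    unfolding set_lebesgue_integral_def by (subst lborel_integral_real_affine[of 1 _ h]) auto
  finally have *: "S h (\<Gamma> t k) = (LINT s:{h<..t+h}|lborel. E s k)" .
  have "\<Gamma> (t + h) k = (LINT s:{0<..h} \<union> {h<..t+h}|lborel. E s k)"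
    unfolding \<Gamma>_def using assms by (subst ivl_disj_un) auto
  also have "\<dots> = \<Gamma> h k + (LINT s:{h<..t+h}|lborel. E s k)"
    unfolding \<Gamma>_def using assms
    by (intro set_integral_Un set_integrable_subset[OF E_set_integrable[of "t+h"]]) auto
  finally show ?thesis using * by simp
qed

lemma \<rho>_integral_tendsto_0: "((\<lambda>t. LINT s:{0<..t}|lborel. \<rho> s) \<longlongrightarrow> 0) (at_right 0)"
proof -
  have "(\<lambda>n. LINT s:{0<..u n}|lborel. \<rho> s) \<longlonglongrightarrow> 0" if u: "u \<longlonglongrightarrow> 0" "\<And>n. u n > 0" for u
  proof -
    obtain b where b: "\<And>n. u n \<le> b"
      using convergent_imp_Bseq[of u] u(1) by (auto simp: convergent_def Bseq_def abs_le_iff)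
    have "(\<lambda>n. LINT s|lborel. indicator {0<..u n} s *\<^sub>R \<rho> s) \<longlonglongrightarrow> (LINT (s::real)|lborel. 0)"
    proof (rule integral_dominated_convergence)
      show "integrable lborel (\<lambda>s. indicator {0<..b} s *\<^sub>R \<rho> s)"
        using \<rho>_integrable[of b] by (simp add: set_integrable_def)
      show "AE s in lborel. (\<lambda>n. indicator {0<..u n} s *\<^sub>R \<rho> s) \<longlonglongrightarrow> 0"
      proof (rule AE_I2)
        fix s :: real
        show "(\<lambda>n. indicator {0<..u n} s *\<^sub>R \<rho> s) \<longlonglongrightarrow> 0"
        proof (cases "s > 0")
          case True
          have "eventually (\<lambda>n. u n < s) sequentially" using u(1) True by (rule order_tendstoD(2))
          then have "eventually (\<lambda>n. indicator {0<..u n} s *\<^sub>R \<rho> s = 0) sequentially"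
            by eventually_elim auto
          then show ?thesis by (rule tendsto_eventually)
        qed simp
      qed
      show "AE s in lborel. norm (indicator {0<..u n} s *\<^sub>R \<rho> s) \<le> indicator {0<..b} s *\<^sub>R \<rho> s" for n
        using b[of n] \<rho>_nonneg by (auto simp: indicator_def intro!: AE_I2 split: if_splits)
    qed auto
    then show ?thesis by (simp add: set_lebesgue_integral_def)
  qed
  then show ?thesis
    by (auto simp: tendsto_at_iff_sequentially comp_def)
qed

lemma \<Gamma>_tendsto_0: "((\<lambda>t. \<Gamma> t k) \<longlongrightarrow> 0) (at_right 0)"
proof (rule Lim_null_comparison)
  show "eventually (\<lambda>t. norm (\<Gamma> t k) \<le> (LINT s:{0<..t}|lborel. \<rho> s) * norm k) (at_right 0)"
    using norm_\<Gamma> by simp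
  show "((\<lambda>t. (LINT s:{0<..t}|lborel. \<rho> s) * norm k) \<longlongrightarrow> 0) (at_right 0)"
    by (rule tendsto_mult_left_zero[OF \<rho>_integral_tendsto_0])
qed

lemma \<Gamma>_continuous_on: "continuous_on ({0..} \<times> UNIV) (\<lambda>(t, k). \<Gamma> t k)"
proof -
  have "((\<lambda>(t, k). \<Gamma> t k) \<longlongrightarrow> \<Gamma> s l) (at (s, l) within {0..} \<times> UNIV)" if s: "0 \<le> s" for s l
  proof -
    obtain C where C: "C \<ge> 1" "\<And>t. t \<in> {0..s + 1} \<Longrightarrow> norm (S t) \<le> C"
      using norm_S_bounded[of "s + 1"] by blast
    define R where "R = (LINT s:{0<..s+1}|lborel. \<rho> s)"
    let ?F = "at (s, l) within {0..} \<times> (UNIV::'k set)"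
    have f: "(fst \<longlongrightarrow> s) ?F" "(snd \<longlongrightarrow> l) ?F"
      by (auto intro!: tendsto_eq_intros)
    have ev: "eventually (\<lambda>p. fst p \<in> {0..s + 1}) ?F"
    proof -
      have "eventually (\<lambda>p. fst p < s + 1) ?F" using f(1) by (rule order_tendstoD) simp
      moreover have "eventually (\<lambda>p. fst p \<ge> 0) ?F"
        by (auto simp: eventually_at_filter intro!: always_eventually)
      ultimately show ?thesis by eventually_elim auto
    qed
    have "((\<lambda>t. \<Gamma> \<bar>t\<bar> l) \<longlongrightarrow> 0) (at 0)"
    proof (rule filterlim_split_at)
      have abs: "filterlim abs (at_right 0) (at_right (0::real))" "filterlim abs (at_right 0) (at_left (0::real))"
        by (auto simp: filterlim_at eventually_at_filter intro!: tendsto_eq_intros)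
      show "((\<lambda>t. \<Gamma> \<bar>t\<bar> l) \<longlongrightarrow> 0) (at_left 0)" "((\<lambda>t. \<Gamma> \<bar>t\<bar> l) \<longlongrightarrow> 0) (at_right 0)"
        using filterlim_compose[OF \<Gamma>_tendsto_0 abs(1)] filterlim_compose[OF \<Gamma>_tendsto_0 abs(2)] by auto
    qed
    then have "isCont (\<lambda>t. \<Gamma> \<bar>t\<bar> l) 0" by (simp add: isCont_def)
    moreover have "((\<lambda>p. fst p - s) \<longlongrightarrow> 0) ?F" using f(1) by (auto intro: tendsto_eq_intros)
    ultimately have 1: "((\<lambda>p. \<Gamma> \<bar>fst p - s\<bar> l) \<longlongrightarrow> 0) ?F"
      using isCont_tendsto_compose by fastforce
    have 2: "((\<lambda>p. R * norm (snd p - l) + C * norm (\<Gamma> \<bar>fst p - s\<bar> l)) \<longlongrightarrow> R * norm (l - l) + C * norm (0::'h)) ?F"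
      by (intro tendsto_intros f 1)
    have step: "norm (\<Gamma> b l - \<Gamma> a l) \<le> C * norm (\<Gamma> (b - a) l)" if "0 \<le> a" "a \<le> b" "b \<le> s + 1" for a b
    proof -
      have "\<Gamma> b l - \<Gamma> a l = S a (\<Gamma> (b - a) l)" using S_\<Gamma>[of a "b - a" l] that by simp
      then show ?thesis
        using C that by (auto intro!: order_trans[OF norm_blinfun] mult_right_mono)
    qed
    have "eventually (\<lambda>p. norm ((\<lambda>(t, k). \<Gamma> t k) p - \<Gamma> s l) \<le> R * norm (snd p - l) + C * norm (\<Gamma> \<bar>fst p - s\<bar> l)) ?F"
      using ev
    proof eventually_elim
      case (elim p)
      obtain t x where p: "p = (t, x)" by force
      have "\<Gamma> t x - \<Gamma> s l = \<Gamma> t (x - l) + (\<Gamma> t l - \<Gamma> s l)" by (simp add: \<Gamma>_diff)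
      then have "norm (\<Gamma> t x - \<Gamma> s l) \<le> norm (\<Gamma> t (x - l)) + norm (\<Gamma> t l - \<Gamma> s l)"
        by (metis norm_triangle_ineq)
      also have "\<dots> \<le> R * norm (x - l) + C * norm (\<Gamma> \<bar>t - s\<bar> l)"
      proof (intro add_mono)
        have "(LINT s:{0<..t}|lborel. \<rho> s) \<le> R" unfolding R_def using elim p by (intro \<rho>_integral_mono) auto
        then show "norm (\<Gamma> t (x - l)) \<le> R * norm (x - l)"
          by (intro order_trans[OF norm_\<Gamma>] mult_right_mono) auto
        show "norm (\<Gamma> t l - \<Gamma> s l) \<le> C * norm (\<Gamma> \<bar>t - s\<bar> l)"
          using step[of s t] step[of t s] s elim p by (cases "s \<le> t") (auto simp: norm_minus_commute)
      qed
      finally show ?case using p by simp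
    qed
    then have "((\<lambda>p. (\<lambda>(t, k). \<Gamma> t k) p - \<Gamma> s l) \<longlongrightarrow> 0) ?F"
      by (rule Lim_null_comparison) (use 2 in simp)
    then show ?thesis by (simp add: LIM_zero_iff)
  qed
  then show ?thesis by (auto simp: continuous_on_def)
qed

lemma continuous_on_\<Gamma> [continuous_intros]:
  assumes "continuous_on A f" "continuous_on A g" "\<And>x. x \<in> A \<Longrightarrow> 0 \<le> f x"
  shows "continuous_on A (\<lambda>x. \<Gamma> (f x) (g x))"
proof -
  have "continuous_on A ((\<lambda>(t, x). \<Gamma> t x) \<circ> (\<lambda>x. (f x, g x)))"
    using assms by (intro continuous_on_compose continuous_on_subset[OF \<Gamma>_continuous_on] continuous_intros) auto
  then show ?thesis by (simp add: comp_def)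
qed

end

section \<open>From limits along paths to uniform limits\<close>

text \<open>A continuous curve that starts at \<open>x\<close> and meets prescribed values at times decreasing to \<open>0\<close>: the bump at \<open>t n\<close> has half-width \<open>t n / 4\<close>, and the halving of the times makes the supports disjoint.\<close>
lemma bump_interpolation:
  fixes z :: "nat \<Rightarrow> 'a::banach" and t :: "nat \<Rightarrow> real"
  assumes t: "\<And>n. 0 < t n" "\<And>n. t (Suc n) \<le> t n / 2"
    and z: "\<And>n. norm (z n - x) \<le> (1/2) ^ n"
  obtains f where "continuous_on UNIV f" "f 0 = x" "\<And>n. f (t n) = z n"
proof -
  define b where "b n s = max 0 (1 - 4 * \<bar>s - t n\<bar> / t n)" for n s
  define g where "g n s = b n s *\<^sub>R (z n - x)" for n s
  have b01: "0 \<le> b n s" "b n s \<le> 1" for n s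
    using t(1)[of n] by (auto simp: b_def)
  have summ: "summable (\<lambda>n. (1/2::real) ^ n)" by (simp add: summable_geometric)
  have g_le: "norm (g n s) \<le> (1/2) ^ n" for n s
    using mult_mono[OF b01(2)[of n s] z[of n]] b01[of n s] by (simp add: g_def)
  have "uniform_limit UNIV (\<lambda>n s. \<Sum>i<n. g i s) (\<lambda>s. \<Sum>i. g i s) sequentially"
    by (rule Weierstrass_m_test[OF g_le summ])
  then have "continuous_on UNIV (\<lambda>s. \<Sum>i. g i s)"
    by (rule uniform_limit_theorem[rotated])
       (use t(1) in \<open>auto simp: g_def b_def less_imp_neq[THEN not_sym] intro!: always_eventually continuous_intros\<close>)
  moreover have "(\<Sum>i. g i 0) = 0"
    using t(1) by (simp add: g_def b_def)
  moreover have "(\<Sum>i. g i (t n)) = z n - x" for n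
  proof -
    have dec: "t j \<le> t i / 2" if "i < j" for i j
      using that
    proof (induction rule: strict_inc_induct)
      case (base i) then show ?case using t(2) by simp
    next
      case (step i)
      then have "t j \<le> t (Suc i)" using t(1)[of "Suc i"] by linarith
      with t(2)[of i] show ?case by linarith
    qed
    have "g i (t n) = 0" if "i \<noteq> n" for i
    proof -
      have "4 * \<bar>t n - t i\<bar> / t i \<ge> 1"
        using dec[of i n] dec[of n i] that t(1)[of i] t(1)[of n] by (cases "i < n") (auto simp: field_simps)
      then show ?thesis by (simp add: g_def b_def)
    qed
    then have "(\<Sum>i. g i (t n)) = (\<Sum>i\<in>{n}. g i (t n))" by (intro suminf_finite) auto
    then show ?thesis by (simp add: g_def b_def)
  qed
  ultimately show ?thesis
    by (intro that[of "\<lambda>s. x + (\<Sum>i. g i s)"]) (auto intro!: continuous_intros)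
qed

text \<open>If the joint limit failed, there would be bad points \<open>(t n, y n)\<close> with \<open>t n\<close> at least halving and \<open>y n\<close> tending to \<open>x\<close>; a continuous path through all of them contradicts the limit along that path. This turns the defining condition of \<open>S_AG\<close> into a statement that compactness can exploit.\<close>
lemma joint_limit_of_path_limits:
  fixes q :: "real \<Rightarrow> 'a::banach \<Rightarrow> real"
  assumes paths: "\<And>z. continuous_on {0..} z \<Longrightarrow> z 0 = x \<Longrightarrow> ((\<lambda>t. q t (z t)) \<longlongrightarrow> c) (at_right 0)"
  shows "((\<lambda>(t, y). q t y) \<longlongrightarrow> c) (at_right 0 \<times>\<^sub>F nhds x)"
proof (rule ccontr)
  assume "\<not> ?thesis"
  then obtain e where e: "e > 0" and ne: "\<not> eventually (\<lambda>p. dist ((\<lambda>(t, y). q t y) p) c < e) (at_right 0 \<times>\<^sub>F nhds x)"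
    by (auto simp: tendsto_iff)
  have bad: "\<exists>t y. 0 < t \<and> t < d \<and> dist y x < r \<and> \<not> dist (q t y) c < e" if "d > 0" "r > 0" for d r
  proof (rule ccontr)
    assume "\<not> ?thesis"
    then have *: "\<And>t y. 0 < t \<Longrightarrow> t < d \<Longrightarrow> dist y x < r \<Longrightarrow> dist (q t y) c < e" by blast
    have "eventually (\<lambda>t. 0 < t \<and> t < d) (at_right 0)"
      using that by (auto simp: eventually_at_right_field)
    moreover have "eventually (\<lambda>y. dist y x < r) (nhds x)"
      using that by (auto simp: eventually_nhds_metric)
    ultimately have "eventually (\<lambda>p. dist ((\<lambda>(t, y). q t y) p) c < e) (at_right 0 \<times>\<^sub>F nhds x)"
      unfolding eventually_prod_filter using *
      by (intro exI[of _ "\<lambda>t. 0 < t \<and> t < d"] exI[of _ "\<lambda>y. dist y x < r"]) simp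
    with ne show False by simp
  qed
  define P where "P n p \<longleftrightarrow> 0 < fst p \<and> dist (snd p) x < (1/2)^n \<and> \<not> dist (q (fst p) (snd p)) c < e"
    for n :: nat and p :: "real \<times> 'a"
  have "\<exists>p. \<forall>n. P n (p n) \<and> fst (p (Suc n)) \<le> fst (p n) / 2"
  proof (rule dependent_nat_choice)
    show "\<exists>p. P 0 p" using bad[of 1 1] by (auto simp: P_def)
    fix p n assume "P n p"
    then have "fst p / 2 > 0" by (simp add: P_def)
    from bad[OF this, of "(1/2) ^ Suc n"] obtain t y where
      "0 < t" "t < fst p / 2" "dist y x < (1/2) ^ Suc n" "\<not> dist (q t y) c < e" by auto
    then have "P (Suc n) (t, y) \<and> fst (t, y) \<le> fst p / 2" by (simp add: P_def)
    then show "\<exists>p'. P (Suc n) p' \<and> fst p' \<le> fst p / 2" by blast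
  qed
  then obtain p where p: "\<And>n. P n (p n)" "\<And>n. fst (p (Suc n)) \<le> fst (p n) / 2" by blast
  have pos: "0 < fst (p n)" for n using p(1)[of n] by (simp add: P_def)
  obtain z where z: "continuous_on UNIV z" "z 0 = x" "\<And>n. z (fst (p n)) = snd (p n)"
    by (rule bump_interpolation[of "\<lambda>n. fst (p n)" "\<lambda>n. snd (p n)" x])
      (use p pos in \<open>auto simp: P_def dist_norm less_imp_le\<close>)
  have lim: "((\<lambda>t. q t (z t)) \<longlongrightarrow> c) (at_right 0)"
    using z by (intro paths) (auto intro: continuous_on_subset)
  have le: "fst (p n) \<le> fst (p 0) * (1/2) ^ n" for n
    by (induction n) (use p(2) in \<open>auto intro: order_trans\<close>)
  have "(\<lambda>n. fst (p n)) \<longlonglongrightarrow> 0"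
  proof (rule tendsto_sandwich[of "\<lambda>_. 0"])
    show "(\<lambda>n. fst (p 0) * (1/2) ^ n) \<longlonglongrightarrow> 0"
      by (intro tendsto_mult_right_zero LIMSEQ_power_zero) auto
  qed (use le pos in \<open>auto intro!: always_eventually less_imp_le\<close>)
  then have "filterlim (\<lambda>n. fst (p n)) (at_right 0) sequentially"
    using pos by (auto simp: filterlim_at less_imp_neq[THEN not_sym])
  from filterlim_compose[OF lim this] have "(\<lambda>n. q (fst (p n)) (snd (p n))) \<longlonglongrightarrow> c"
    using z(3) by simp
  then have "eventually (\<lambda>n. dist (q (fst (p n)) (snd (p n))) c < e) sequentially"
    using e by (auto simp: tendsto_iff)
  with p(1) show False by (auto simp: P_def eventually_sequentially)
qed

text \<open>Extract from the parameters of hypothetical counterexamples a convergent subsequence; the joint limit at the limiting point excludes them.\<close>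
lemma uniform_of_joint_limit:
  fixes q :: "real \<Rightarrow> 'a::topological_space \<Rightarrow> real" and Y :: "real \<Rightarrow> real \<Rightarrow> 'a"
  assumes lim: "\<And>x. ((\<lambda>(t, y). q t y) \<longlongrightarrow> c x) (at_right 0 \<times>\<^sub>F nhds x)"
    and Y: "continuous_on ({0..d} \<times> {0..1}) (\<lambda>(r, h). Y r h)"
    and c: "continuous_on UNIV c"
    and e: "e > 0"
  shows "\<exists>\<eta>>0. \<forall>h r. 0 < h \<longrightarrow> h < \<eta> \<longrightarrow> h \<le> 1 \<longrightarrow> r \<in> {0..d} \<longrightarrow> \<bar>q h (Y r h) - c (Y r 0)\<bar> < e"
proof (rule ccontr)
  define P where "P n h r \<longleftrightarrow> 0 < h \<and> h < 1 / real (Suc n) \<and> h \<le> 1 \<and> r \<in> {0..d} \<and> \<not> \<bar>q h (Y r h) - c (Y r 0)\<bar> < e" for n h r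
  assume "\<not> ?thesis"
  then have "\<exists>h r. 0 < h \<and> h < \<eta> \<and> h \<le> 1 \<and> r \<in> {0..d} \<and> \<not> \<bar>q h (Y r h) - c (Y r 0)\<bar> < e" if "\<eta> > 0" for \<eta>
    using that by blast
  then have "\<forall>n::nat. \<exists>h r. 0 < h \<and> h < 1 / Suc n \<and> h \<le> 1 \<and> r \<in> {0..d} \<and> \<not> \<bar>q h (Y r h) - c (Y r 0)\<bar> < e"
    by simp
  then have "\<forall>n. \<exists>h r. P n h r" by (simp add: P_def)
  then obtain h r where "\<And>n. P n (h n) (r n)" by metis
  then have hr: "\<And>n. 0 < h n" "\<And>n. h n < 1 / Suc n" "\<And>n. h n \<le> 1" "\<And>n. r n \<in> {0..d}"
    "\<And>n. \<not> \<bar>q (h n) (Y (r n) (h n)) - c (Y (r n) 0)\<bar> < e"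
    by (simp_all add: P_def)
  obtain r0 and s :: "nat \<Rightarrow> nat" where s: "r0 \<in> {0..d}" "strict_mono s" "(r \<circ> s) \<longlonglongrightarrow> r0"
    using compact_Icc[of 0 d, unfolded compact_def, rule_format, of r] hr(4) by blast
  have "h \<longlonglongrightarrow> 0"
    by (rule tendsto_sandwich[of "\<lambda>_. 0" _ _ "\<lambda>n. 1 / Suc n"])
      (use hr LIMSEQ_Suc[OF lim_1_over_n] in \<open>auto intro!: always_eventually less_imp_le\<close>)
  then have h0: "(\<lambda>n. h (s n)) \<longlonglongrightarrow> 0" using LIMSEQ_subseq_LIMSEQ[OF _ s(2)] by (auto simp: comp_def)
  then have h: "filterlim (\<lambda>n. h (s n)) (at_right 0) sequentially"
    using hr(1) by (auto simp: filterlim_at less_imp_neq[THEN not_sym])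
  have r0: "(\<lambda>n. r (s n)) \<longlonglongrightarrow> r0" using s(3) by (simp add: comp_def)
  have Yl: "(\<lambda>n. Y (r (s n)) (h (s n))) \<longlonglongrightarrow> Y r0 0"
    using continuous_on_tendsto_compose[OF Y tendsto_Pair[OF r0 h0]] hr(1,3,4) s(1)
    by (auto simp: less_imp_le)
  have Y0: "(\<lambda>n. Y (r (s n)) 0) \<longlonglongrightarrow> Y r0 0"
    using continuous_on_tendsto_compose[OF Y tendsto_Pair[OF r0 tendsto_const[of 0]]] hr(4) s(1) by auto
  have "filterlim (\<lambda>n. (h (s n), Y (r (s n)) (h (s n)))) (at_right 0 \<times>\<^sub>F nhds (Y r0 0)) sequentially"
    using h Yl by (rule filterlim_Pair)
  from filterlim_compose[OF lim this]
  have 1: "(\<lambda>n. q (h (s n)) (Y (r (s n)) (h (s n)))) \<longlonglongrightarrow> c (Y r0 0)" by simp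
  have 2: "(\<lambda>n. c (Y (r (s n)) 0)) \<longlonglongrightarrow> c (Y r0 0)"
    using continuous_on_tendsto_compose[OF c Y0] by simp
  have "(\<lambda>n. q (h (s n)) (Y (r (s n)) (h (s n))) - c (Y (r (s n)) 0)) \<longlonglongrightarrow> 0"
    using tendsto_diff[OF 1 2] by simp
  then have "eventually (\<lambda>n. \<bar>q (h (s n)) (Y (r (s n)) (h (s n))) - c (Y (r (s n)) 0)\<bar> < e) sequentially"
    using e by (auto simp: tendsto_iff dist_real_def)
  with hr(5) show False by (auto simp: eventually_sequentially)
qed

text \<open>The increments \<open>Q r h\<close> need not be additive in \<open>h\<close>: being \<open>h * q r\<close> up to a uniform \<open>o(h)\<close> suffices for their sum over a grid to converge to the integral.\<close>
lemma Riemann_sum_uniform: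
  fixes Q :: "real \<Rightarrow> real \<Rightarrow> real" and q :: "real \<Rightarrow> real"
  assumes d: "d > 0" and q: "continuous_on {0..d} q"
    and unif: "\<And>e. e > 0 \<Longrightarrow> \<exists>\<eta>>0. \<forall>h r. 0 < h \<longrightarrow> h < \<eta> \<longrightarrow> r \<in> {0..d} \<longrightarrow> r + h \<le> d \<longrightarrow> \<bar>Q r h - h * q r\<bar> \<le> h * e"
  shows "(\<lambda>m. \<Sum>i<m. Q (real i * (d / real m)) (d / real m)) \<longlonglongrightarrow> (LINT r:{0..d}|lborel. q r)"
proof (rule LIMSEQ_I)
  fix \<epsilon> :: real assume \<epsilon>: "\<epsilon> > 0"
  define e where "e = \<epsilon> / (4 * d)"
  have e: "e > 0" using \<epsilon> d by (simp add: e_def)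
  obtain \<eta>1 where \<eta>1: "\<eta>1 > 0" "\<And>h r. 0 < h \<Longrightarrow> h < \<eta>1 \<Longrightarrow> r \<in> {0..d} \<Longrightarrow> r + h \<le> d \<Longrightarrow> \<bar>Q r h - h * q r\<bar> \<le> h * e"
    using unif[OF e] by blast
  have "uniformly_continuous_on {0..d} q" using q compact_uniformly_continuous by blast
  then obtain \<eta>2 where \<eta>2: "\<eta>2 > 0" "\<And>r s. r \<in> {0..d} \<Longrightarrow> s \<in> {0..d} \<Longrightarrow> \<bar>r - s\<bar> < \<eta>2 \<Longrightarrow> \<bar>q r - q s\<bar> < e"
    using e unfolding uniformly_continuous_on_def dist_real_def by meson
  obtain m0 :: nat where m0: "real m0 > d / min \<eta>1 \<eta>2" using reals_Archimedean2 by blast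
  have "\<bar>(\<Sum>i<m. Q (real i * (d / real m)) (d / real m)) - (LINT r:{0..d}|lborel. q r)\<bar> < \<epsilon>" if "m \<ge> Suc m0" for m
  proof -
    define h where "h = d / real m"
    have m: "real m > 0" using that by simp
    have "d / min \<eta>1 \<eta>2 < real m" using m0 that by linarith
    then have "d < real m * min \<eta>1 \<eta>2" using \<eta>1(1) \<eta>2(1) by (simp add: pos_divide_less_eq)
    then have "h < min \<eta>1 \<eta>2" using m by (simp add: h_def pos_divide_less_eq mult.commute del: min_less_iff_conj)
    then have h: "0 < h" "h < \<eta>1" "h < \<eta>2" "real m * h = d" using d m by (auto simp: h_def)
    have qi: "set_integrable lborel {a..b} q" if "0 \<le> a" "b \<le> d" for a b
      using that by (intro borel_integrable_atLeastAtMost' continuous_on_subset[OF q]) auto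
    have part: "\<bar>(\<Sum>i<k. Q (real i * h) h) - (LINT r:{0..real k * h}|lborel. q r)\<bar> \<le> real k * (2 * e * h)" if "k \<le> m" for k
      using that
    proof (induction k)
      case 0
      have "(LINT r:{0::real}|lborel. q r) = 0"
        unfolding set_lebesgue_integral_def
          by (rule integral_eq_zero_AE) (use AE_lborel_singleton[of 0] in \<open>auto elim!: eventually_mono\<close>)
      then show ?case by simp
    next
      case (Suc k)
      have k: "real (Suc k) * h \<le> d" using mult_right_mono[of "real (Suc k)" "real m" h] Suc.prems h by simp
      then have k': "real k * h + h \<le> d" by (simp add: algebra_simps)
      have kh: "real k * h \<in> {0..d}" using k' h by auto
      have "(LINT r:{0..real (Suc k) * h}|lborel. q r) = (LINT r:{0..real k * h} \<union> {real k * h<..real k * h + h}|lborel. q r)"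
        using h by (subst ivl_disj_un) (auto simp: algebra_simps)
      also have "\<dots> = (LINT r:{0..real k * h}|lborel. q r) + (LINT r:{real k * h<..real k * h + h}|lborel. q r)"
      proof (intro set_integral_Un set_integrable_subset[OF qi[of 0 d]])
        have nn: "0 \<le> x" if "real k * h < x" for x
        proof -
          have "0 \<le> real k * h" using kh by simp
          with that show ?thesis by linarith
        qed
        show "{real k * h<..real k * h + h} \<subseteq> {0..d}"
        proof
          fix x assume "x \<in> {real k * h<..real k * h + h}"
          then have "real k * h < x" "x \<le> real k * h + h" by simp_all
          with nn[of x] k' show "x \<in> {0..d}" unfolding atLeastAtMost_iff by linarith
        qed
        show "{0..real k * h} \<subseteq> {0..d}" using kh by (intro atLeastatMost_subset_iff[THEN iffD2]) simp
      qed (use kh h in auto)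
      finally have split: "(LINT r:{0..real (Suc k) * h}|lborel. q r) = \<dots>" .
      have "{real k * h<..real k * h + h} \<subseteq> {0..d}"
      proof
        fix x assume "x \<in> {real k * h<..real k * h + h}"
        then have "real k * h < x" "x \<le> real k * h + h" by simp_all
        with k' kh show "x \<in> {0..d}" unfolding atLeastAtMost_iff by linarith
      qed
      then have int: "set_integrable lborel {real k * h<..real k * h + h} q"
        by (intro set_integrable_subset[OF qi[of 0 d]]) auto
      have intc: "set_integrable lborel {real k * h<..real k * h + h} (\<lambda>_. c::real)" for c
        using h by (auto simp: set_integrable_def intro!: integrable_real_indicator integrable_mult_left)
      have c: "(LINT r:{real k * h<..real k * h + h}|lborel. c) = h * c" for c :: real
        using h by (simp add: set_lebesgue_integral_def)
      have "\<bar>(LINT r:{real k * h<..real k * h + h}|lborel. q r) - h * q (real k * h)\<bar>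
          = \<bar>LINT r:{real k * h<..real k * h + h}|lborel. q r - q (real k * h)\<bar>"
        by (subst set_integral_diff(2)[OF int intc]) (simp add: c)
      also have "\<dots> \<le> (LINT r:{real k * h<..real k * h + h}|lborel. \<bar>q r - q (real k * h)\<bar>)"
        using set_integral_norm_bound[OF set_integral_diff(1)[OF int intc]] by simp
      also have "\<dots> \<le> (LINT r:{real k * h<..real k * h + h}|lborel. e)"
      proof (rule set_integral_mono)
        show "set_integrable lborel {real k * h<..real k * h + h} (\<lambda>r. \<bar>q r - q (real k * h)\<bar>)"
          by (intro set_integrable_abs set_integral_diff(1) int intc)
        fix r assume "r \<in> {real k * h<..real k * h + h}"
        then have r: "real k * h < r" "r \<le> real k * h + h" by simp_all
        have "r \<in> {0..d}" using r k' kh unfolding atLeastAtMost_iff by linarith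
        moreover have "\<bar>r - real k * h\<bar> < \<eta>2" using r h(3) by linarith
        ultimately show "\<bar>q r - q (real k * h)\<bar> \<le> e"
          using kh by (intro less_imp_le \<eta>2)
      qed (rule intc)
      also have "\<dots> = h * e" by (rule c)
      finally have 1: "\<bar>(LINT r:{real k * h<..real k * h + h}|lborel. q r) - h * q (real k * h)\<bar> \<le> h * e" .
      have 2: "\<bar>Q (real k * h) h - h * q (real k * h)\<bar> \<le> h * e"
        using h kh k' by (intro \<eta>1) auto
      have 3: "\<bar>(\<Sum>i<k. Q (real i * h) h) - (LINT r:{0..real k * h}|lborel. q r)\<bar> \<le> real k * (2 * e * h)"
        using Suc by simp
      have "real (Suc k) * (2 * e * h) = real k * (2 * e * h) + 2 * (h * e)" by (simp add: algebra_simps)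
      with 1 2 3 split show ?case by simp
    qed
    have "real m * (2 * e * h) = \<epsilon> / 2" using h(4) d m by (simp add: e_def h_def field_simps)
    with part[of m] \<epsilon> show ?thesis unfolding h_def[symmetric] h(4) by simp
  qed
  then show "\<exists>m0. \<forall>m\<ge>m0. norm ((\<Sum>i<m. Q (real i * (d / real m)) (d / real m)) - (LINT r:{0..d}|lborel. q r)) < \<epsilon>"
    by auto
qed

section \<open>Orthonormal bases, cylinder sets and joint measurability\<close>

text \<open>Gram-Schmidt on a countable dense sequence. It ensures that \<open>some_basis\<close> in the definition of the Hilbert-Schmidt norm really is a basis.\<close>
lemma exists_orthonormal_basis:
  "\<exists>B :: 'a::{real_inner, second_countable_topology} set. orthonormal_basis B"
proof -
  obtain D :: "'a set" where D: "countable D" "\<And>X. open X \<Longrightarrow> X \<noteq> {} \<Longrightarrow> \<exists>d\<in>D. d \<in> X"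
    using countable_dense_exists by blast
  define d where "d = from_nat_into D"
  have "D \<noteq> {}" using D(2)[of UNIV] by auto
  then have range_d: "range d = D" using D(1) by (simp add: d_def range_from_nat_into)
  define r where "r B x = x - (\<Sum>b\<in>B. (x \<bullet> b) *\<^sub>R b)" for B and x :: 'a
  define B where "B = rec_nat {} (\<lambda>n B. if r B (d n) = 0 then B else insert ((1 / norm (r B (d n))) *\<^sub>R r B (d n)) B)"
  have B0: "B 0 = {}" and BS: "\<And>n. B (Suc n) = (if r (B n) (d n) = 0 then B n else insert ((1 / norm (r (B n) (d n))) *\<^sub>R r (B n) (d n)) (B n))"
    by (simp_all add: B_def)
  have inv: "finite (B n) \<and> (\<forall>e\<in>B n. norm e = 1) \<and> pairwise orthogonal (B n)" for n
  proof (induction n)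
    case (Suc n)
    have orth: "r (B n) x \<bullet> b = 0" if "b \<in> B n" for x b
    proof -
      have "(\<Sum>b'\<in>B n. (x \<bullet> b') *\<^sub>R b') \<bullet> b = (\<Sum>b'\<in>B n. (x \<bullet> b') * (b' \<bullet> b))"
        by (simp add: inner_sum_left)
      also have "\<dots> = (\<Sum>b'\<in>B n. if b' = b then x \<bullet> b else 0)"
      proof (rule sum.cong)
        fix b' assume "b' \<in> B n"
        then show "(x \<bullet> b') * (b' \<bullet> b) = (if b' = b then x \<bullet> b else 0)"
          using Suc that by (auto simp: pairwise_def orthogonal_def dot_square_norm)
      qed simp
      finally show ?thesis using Suc that by (simp add: r_def inner_diff_left)
    qed
    show ?case
      using Suc orth unfolding BS
      by (auto simp: pairwise_insert orthogonal_def inner_commute)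
  qed (simp add: B0)
  have mono: "B m \<subseteq> B n" if "m \<le> n" for m n
    by (rule lift_Suc_mono_le[OF _ that]) (auto simp: BS)
  have dspan: "d n \<in> span (\<Union>n. B n)" for n
  proof -
    have "r (B n) (d n) \<in> span (B (Suc n))"
    proof (cases "r (B n) (d n) = 0")
      case False
      then have "norm (r (B n) (d n)) *\<^sub>R ((1 / norm (r (B n) (d n))) *\<^sub>R r (B n) (d n)) \<in> span (B (Suc n))"
        by (intro span_scale span_base) (simp add: BS)
      with False show ?thesis by simp
    qed (simp add: span_zero)
    moreover have "(\<Sum>b\<in>B n. (d n \<bullet> b) *\<^sub>R b) \<in> span (B (Suc n))"
      using mono[of n "Suc n"] by (intro span_sum span_scale span_base) auto
    ultimately have "r (B n) (d n) + (\<Sum>b\<in>B n. (d n \<bullet> b) *\<^sub>R b) \<in> span (B (Suc n))"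
      by (rule span_add)
    then have "d n \<in> span (B (Suc n))" by (simp add: r_def)
    then show ?thesis by (meson span_mono UN_upper UNIV_I subsetD)
  qed
  have "closure (span (\<Union>n. B n)) = UNIV"
  proof -
    have "closure D = UNIV"
    proof (rule ccontr)
      assume "closure D \<noteq> UNIV"
      then have "- closure D \<noteq> {}" by auto
      then obtain x where "x \<in> D" "x \<in> - closure D" using D(2)[of "- closure D"] by auto
      then show False using closure_subset by auto
    qed
    moreover have "D \<subseteq> span (\<Union>n. B n)" using dspan range_d by auto
    ultimately show ?thesis using closure_mono by (metis top.extremum_uniqueI)
  qed
  moreover have "norm e = 1" if "e \<in> (\<Union>n. B n)" for e
    using that inv by auto
  moreover have "pairwise orthogonal (\<Union>n. B n)"
    unfolding pairwise_def
  proof (intro ballI impI)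
    fix x y assume "x \<in> (\<Union>n. B n)" "y \<in> (\<Union>n. B n)" "x \<noteq> y"
    then obtain m n where "x \<in> B m" "y \<in> B n" by auto
    then have "x \<in> B (max m n)" "y \<in> B (max m n)" using mono[of m "max m n"] mono[of n "max m n"] by auto
    then show "orthogonal x y" using inv[of "max m n"] \<open>x \<noteq> y\<close> by (auto simp: pairwise_def)
  qed
  ultimately have "orthonormal_basis (\<Union>n. B n)" by (simp add: orthonormal_basis_def)
  then show ?thesis by blast
qed

text \<open>The operator norm is bounded by the Hilbert-Schmidt norm. The approximation in the definition of the Wiener integral is exploited through this bound, at each time in a single direction.\<close>
lemma norm_sq_le_hilbert_schmidt:
  fixes T :: "'a::{real_inner, second_countable_topology} \<Rightarrow> 'b::real_inner"
  assumes T: "bounded_linear T"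
  shows "ennreal ((norm (T k))\<^sup>2) \<le> hilbert_schmidt_norm_sq T * ennreal ((norm k)\<^sup>2)"
proof (cases "hilbert_schmidt_norm_sq T = \<infinity>")
  case True
  interpret T: bounded_linear T by fact
  show ?thesis using True by (cases "k = 0") (auto simp: T.zero ennreal_top_mult)
next
  case False
  interpret T: bounded_linear T by fact
  define B where "B = (some_basis :: 'a set)"
  define c where "c = enn2real (hilbert_schmidt_norm_sq T)"
  have c: "hilbert_schmidt_norm_sq T = ennreal c" "c \<ge> 0" using False by (auto simp: c_def less_top)
  have B: "orthonormal_basis B"
    unfolding B_def some_basis_def using exists_orthonormal_basis by (rule someI_ex)
  have fin: "(\<Sum>e\<in>F. (norm (T e))\<^sup>2) \<le> c" if "finite F" "F \<subseteq> B" for F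
  proof -
    have "(\<Sum>e\<in>F. ennreal ((norm (T e))\<^sup>2)) \<le> hilbert_schmidt_norm_sq T"
      unfolding hilbert_schmidt_norm_sq_def B_def[symmetric]
      using that by (subst nonneg_infsum_complete) (auto intro!: SUP_upper)
    then show ?thesis using c by (simp add: sum_nonneg)
  qed
  have span: "(norm (T k))\<^sup>2 \<le> c * (norm k)\<^sup>2" if k: "k \<in> span B" for k
  proof -
    obtain F a where F: "finite F" "F \<subseteq> B" "k = (\<Sum>e\<in>F. a e *\<^sub>R e)"
      using k unfolding span_explicit by blast
    have "(norm k)\<^sup>2 = (\<Sum>e\<in>F. (norm (a e *\<^sub>R e))\<^sup>2)"
      unfolding F(3) using B F
      by (intro norm_sum_Pythagorean) (auto simp: orthonormal_basis_def pairwise_def orthogonal_def subset_iff)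
    also have "\<dots> = (\<Sum>e\<in>F. (a e)\<^sup>2)"
      using B F by (intro sum.cong) (auto simp: orthonormal_basis_def power_mult_distrib)
    finally have nk: "(norm k)\<^sup>2 = (\<Sum>e\<in>F. (a e)\<^sup>2)" .
    have "norm (T k) \<le> (\<Sum>e\<in>F. \<bar>a e\<bar> * norm (T e))"
      unfolding F(3) T.sum T.scaleR by (rule order_trans[OF norm_sum]) simp
    then have "(norm (T k))\<^sup>2 \<le> (\<Sum>e\<in>F. \<bar>a e\<bar> * norm (T e))\<^sup>2" by (intro power_mono) auto
    also have "\<dots> \<le> (\<Sum>e\<in>F. \<bar>a e\<bar>\<^sup>2) * (\<Sum>e\<in>F. (norm (T e))\<^sup>2)" by (rule Cauchy_Schwarz_ineq_sum)
    also have "\<dots> \<le> (norm k)\<^sup>2 * c" unfolding nk using fin[OF F(1,2)] by (intro mult_mono) (auto intro: sum_nonneg)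
    finally show ?thesis by (simp add: mult.commute)
  qed
  have "closed {k. (norm (T k))\<^sup>2 \<le> c * (norm k)\<^sup>2}"
    by (intro closed_Collect_le continuous_intros T.continuous_on)
  then have "closure (span B) \<subseteq> {k. (norm (T k))\<^sup>2 \<le> c * (norm k)\<^sup>2}"
    using span by (intro closure_minimal) auto
  then have "(norm (T k))\<^sup>2 \<le> c * (norm k)\<^sup>2" using B by (auto simp: orthonormal_basis_def)
  then show ?thesis using c by (simp add: ennreal_mult[symmetric])
qed

definition cylinder :: "('a::real_inner \<times> real set) list \<Rightarrow> 'a set" where
  "cylinder l = {x. \<forall>(e, B)\<in>set l. x \<bullet> e \<in> B}"

definition cylinders :: "'a::real_inner set set" where
  "cylinders = {cylinder l | l. \<forall>(e, B)\<in>set l. B \<in> sets borel}"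

lemma Int_stable_cylinders: "Int_stable cylinders"
proof (rule Int_stableI)
  fix a b :: "'a set" assume "a \<in> cylinders" "b \<in> cylinders"
  then obtain l m where l: "a = cylinder l" "\<forall>(e, B)\<in>set l. B \<in> sets borel"
    and m: "b = cylinder m" "\<forall>(e, B)\<in>set m. B \<in> sets borel" by (auto simp: cylinders_def)
  have "a \<inter> b = cylinder (l @ m)" by (auto simp: l m cylinder_def)
  then show "a \<inter> b \<in> cylinders" using l m by (auto simp: cylinders_def intro!: exI[of _ "l @ m"])
qed

lemma cylinder_borel: "l \<in> lists (UNIV \<times> sets borel) \<Longrightarrow> cylinder l \<in> sets borel"
proof (induction l)
  case Nil then show ?case by (simp add: cylinder_def)
next
  case (Cons p l)
  obtain e B where p: "p = (e, B)" by force
  have "cylinder (p # l) = {x. x \<bullet> e \<in> B} \<inter> cylinder l" by (auto simp: cylinder_def p)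
  moreover have "{x. x \<bullet> e \<in> B} \<in> sets borel"
  proof -
    have "(\<lambda>x. x \<bullet> e) \<in> borel_measurable borel"
      by (intro borel_measurable_continuous_onI continuous_intros)
    from measurable_sets[OF this, of B] show ?thesis using Cons p by (auto simp: vimage_def)
  qed
  ultimately show ?case using Cons by auto
qed

text \<open>By separability a closed ball is a countable intersection of half-spaces, so measures on the Hilbert space are determined by finitely many inner products at a time.\<close>
lemma sets_borel_cylinders:
  "sets (borel :: 'a::{real_inner, second_countable_topology} measure) = sigma_sets UNIV cylinders"
proof (rule antisym)
  obtain D :: "'a set" where D: "countable D" "\<And>X. open X \<Longrightarrow> X \<noteq> {} \<Longrightarrow> \<exists>d\<in>D. d \<in> X"
    using countable_dense_exists by blast
  have denseD: "closure D = UNIV"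
  proof (rule ccontr)
    assume "closure D \<noteq> UNIV"
    then have "- closure D \<noteq> {}" by auto
    then obtain x where "x \<in> D" "x \<in> - closure D" using D(2)[of "- closure D"] by auto
    then show False using closure_subset by auto
  qed
  interpret sa: sigma_algebra UNIV "sigma_sets UNIV (cylinders :: 'a set set)"
    by (rule sigma_algebra_sigma_sets) auto
  have half: "{x. x \<bullet> d \<le> a} \<in> sigma_sets UNIV cylinders" for d :: 'a and a
  proof (rule sigma_sets.Basic)
    have "{x. x \<bullet> d \<le> a} = cylinder [(d, {..a})]" by (auto simp: cylinder_def)
    then show "{x. x \<bullet> d \<le> a} \<in> cylinders" by (auto simp: cylinders_def intro!: exI[of _ "[(d, {..a})]"])
  qed
  have cball: "cball c q \<in> sigma_sets UNIV cylinders" if q: "q > 0" for c :: 'a and q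
  proof -
    have "cball c q = (\<Inter>d\<in>D. {x. x \<bullet> d \<le> q * norm d + c \<bullet> d})"
    proof safe
      fix x d assume "x \<in> cball c q"
      then have "(x - c) \<bullet> d \<le> q * norm d"
        by (intro order_trans[OF norm_cauchy_schwarz] mult_right_mono) (auto simp: dist_norm norm_minus_commute)
      then show "x \<bullet> d \<le> q * norm d + c \<bullet> d" by (simp add: inner_diff_left)
    next
      fix x assume "x \<in> (\<Inter>d\<in>D. {x. x \<bullet> d \<le> q * norm d + c \<bullet> d})"
      then have "D \<subseteq> {d. x \<bullet> d \<le> q * norm d + c \<bullet> d}" by auto
      moreover have "closed {d. x \<bullet> d \<le> q * norm d + c \<bullet> d}"
        by (intro closed_Collect_le continuous_intros)
      ultimately have "closure D \<subseteq> {d. x \<bullet> d \<le> q * norm d + c \<bullet> d}" by (rule closure_minimal)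
      then have "x \<bullet> (x - c) \<le> q * norm (x - c) + c \<bullet> (x - c)" using denseD by auto
      then have "(x - c) \<bullet> (x - c) \<le> q * norm (x - c)" by (subst inner_diff_left) simp
      then have "norm (x - c) * norm (x - c) \<le> q * norm (x - c)"
        by (simp add: power2_norm_eq_inner[symmetric] power2_eq_square)
      then have "norm (x - c) \<le> q" using q by (cases "x = c") auto
      then show "x \<in> cball c q" by (simp add: dist_norm norm_minus_commute)
    qed
    moreover have "D \<noteq> {}" using D(2)[of UNIV] by auto
    then have "(\<Inter>d\<in>D. {x. x \<bullet> d \<le> q * norm d + c \<bullet> d}) \<in> sigma_sets UNIV cylinders"
      by (intro sa.countable_INT'[OF D(1)] image_subsetI half)
    ultimately show ?thesis by simp
  qed
  have "U \<in> sigma_sets UNIV cylinders" if U: "open U" for U :: "'a set"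
  proof -
    define I where "I = {(c, q). c \<in> D \<and> q \<in> \<rat> \<and> q > 0 \<and> cball c q \<subseteq> U}"
    have "countable I"
      by (rule countable_subset[of _ "D \<times> \<rat>"]) (auto simp: I_def D countable_rat)
    moreover have "U = (\<Union>(c, q)\<in>I. cball c q)"
    proof safe
      fix x assume "x \<in> U"
      then obtain e where e: "e > 0" "cball x e \<subseteq> U" using U open_contains_cball by blast
      obtain q where q: "q \<in> \<rat>" "0 < q" "q < e / 2" using Rats_dense_in_real[of 0 "e/2"] e by auto
      obtain c where c: "c \<in> D" "c \<in> ball x q" using D(2)[of "ball x q"] q by auto
      have "cball c q \<subseteq> cball x e"
      proof
        fix y assume "y \<in> cball c q"
        then show "y \<in> cball x e" using c q dist_triangle[of x y c] by auto
      qed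
      then have "(c, q) \<in> I" using c q e by (auto simp: I_def)
      then show "x \<in> (\<Union>(c, q)\<in>I. cball c q)" using c by (auto simp: dist_commute less_imp_le intro!: bexI[of _ "(c, q)"])
    qed (auto simp: I_def)
    moreover have "cball c q \<in> sigma_sets UNIV cylinders" if "(c, q) \<in> I" for c q
      using that cball by (auto simp: I_def)
    then have "(\<Union>p\<in>I. (\<lambda>(c, q). cball c q) p) \<in> sigma_sets UNIV cylinders"
      by (intro sa.countable_UN'[OF \<open>countable I\<close>] image_subsetI) auto
    ultimately show ?thesis by simp
  qed
  then show "sets borel \<subseteq> sigma_sets UNIV (cylinders :: 'a set set)"
    using sa.sigma_sets_subset[of "{S. open S}"] by (auto simp: borel_def sets_measure_of)
  show "sigma_sets UNIV (cylinders :: 'a set set) \<subseteq> sets borel"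
  proof -
    have "(cylinders :: 'a set set) \<subseteq> sets borel"
      using cylinder_borel by (fastforce simp: cylinders_def)
    then show ?thesis using sets.sigma_sets_subset[of cylinders "borel :: 'a measure"] by simp
  qed
qed

lemma jointly_measurable_of_continuous_paths:
  fixes X :: "real \<Rightarrow> 'w \<Rightarrow> 'a::metric_space"
  assumes meas: "\<And>t. t \<ge> 0 \<Longrightarrow> X t \<in> borel_measurable M"
    and cont: "\<And>\<omega>. \<omega> \<in> space M \<Longrightarrow> continuous_on {0..} (\<lambda>t. X t \<omega>)"
  shows "(\<lambda>(\<omega>, t). X (max 0 t) \<omega>) \<in> borel_measurable (M \<Otimes>\<^sub>M borel)"
proof (rule borel_measurable_LIMSEQ_metric)
  define a :: "nat \<Rightarrow> real \<Rightarrow> real" where "a n t = real_of_int \<lfloor>real (Suc n) * t\<rfloor> / real (Suc n)" for n t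
  show "(\<lambda>(\<omega>, t). X (max 0 (a n t)) \<omega>) \<in> borel_measurable (M \<Otimes>\<^sub>M borel)" for n
  proof -
    have "(\<lambda>p. X (max 0 (real_of_int \<lfloor>real (Suc n) * snd p\<rfloor> / real (Suc n))) (fst p)) \<in> borel_measurable (M \<Otimes>\<^sub>M borel)"
    proof (rule measurable_compose_countable[where f="\<lambda>i p. X (max 0 (real_of_int i / real (Suc n))) (fst p)"])
      show "(\<lambda>p. X (max 0 (real_of_int i / real (Suc n))) (fst p)) \<in> borel_measurable (M \<Otimes>\<^sub>M borel)" for i
        using measurable_compose[OF measurable_fst meas[of "max 0 (real_of_int i / real (Suc n))"], of borel] by simp
    qed measurable
    then show ?thesis by (simp add: a_def split_beta')
  qed
  fix p assume "p \<in> space (M \<Otimes>\<^sub>M (borel :: real measure))"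
  then obtain \<omega> t where p: "p = (\<omega>, t)" "\<omega> \<in> space M" by (auto simp: space_pair_measure)
  have "(\<lambda>n. a n t) \<longlonglongrightarrow> t"
  proof (rule tendsto_sandwich)
    show "eventually (\<lambda>n. t - 1 / real (Suc n) \<le> a n t) sequentially"
    proof (intro always_eventually allI)
      fix n
      have "(real (Suc n) * t - 1) / real (Suc n) \<le> a n t"
        unfolding a_def by (intro divide_right_mono) linarith+
      then show "t - 1 / real (Suc n) \<le> a n t" by (simp add: diff_divide_distrib del: of_nat_Suc)
    qed
    show "eventually (\<lambda>n. a n t \<le> t) sequentially"
      by (intro always_eventually allI) (simp add: a_def pos_divide_le_eq mult.commute)
    show "(\<lambda>n. t - 1 / real (Suc n)) \<longlonglongrightarrow> t"
      using tendsto_diff[OF tendsto_const LIMSEQ_Suc[OF lim_1_over_n]] by simp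
  qed simp
  then have "(\<lambda>n. max 0 (a n t)) \<longlonglongrightarrow> max 0 t" by (intro tendsto_intros)
  then show "(\<lambda>n. (\<lambda>(\<omega>, t). X (max 0 (a n t)) \<omega>) p) \<longlonglongrightarrow> (\<lambda>(\<omega>, t). X (max 0 t) \<omega>) p"
    using continuous_on_tendsto_compose[OF cont[OF p(2)], of "\<lambda>n. max 0 (a n t)" "max 0 t"] p by simp
qed

section \<open>Delayed averages\<close>

text \<open>The mean of \<open>g\<close> over the grid cell preceding the one that contains \<open>s\<close>. The delay makes the value on a cell depend only on \<open>g\<close> before that cell, hence adapted when \<open>g\<close> is.\<close>
definition delayed_average :: "real \<Rightarrow> (real \<Rightarrow> 'a::{banach, second_countable_topology}) \<Rightarrow> real \<Rightarrow> 'a" where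
  "delayed_average \<delta> g s = (1 / \<delta>) *\<^sub>R (LINT r:{r. \<lfloor>r / \<delta>\<rfloor> + 1 = \<lfloor>s / \<delta>\<rfloor>}|lborel. g r)"

lemma floor_cell:
  fixes \<delta> s :: real assumes \<delta>: "\<delta> > 0"
  shows "{r. \<lfloor>r / \<delta>\<rfloor> + 1 = \<lfloor>s / \<delta>\<rfloor>} = {real_of_int (\<lfloor>s / \<delta>\<rfloor> - 1) * \<delta>..<real_of_int \<lfloor>s / \<delta>\<rfloor> * \<delta>}"
proof -
  have "(\<lfloor>r / \<delta>\<rfloor> + 1 = \<lfloor>s / \<delta>\<rfloor>) \<longleftrightarrow> r \<in> {real_of_int (\<lfloor>s / \<delta>\<rfloor> - 1) * \<delta>..<real_of_int \<lfloor>s / \<delta>\<rfloor> * \<delta>}" for r :: real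
  proof -
    have "(\<lfloor>r / \<delta>\<rfloor> + 1 = \<lfloor>s / \<delta>\<rfloor>) \<longleftrightarrow> \<lfloor>r / \<delta>\<rfloor> = \<lfloor>s / \<delta>\<rfloor> - 1" by auto
    also have "\<dots> \<longleftrightarrow> real_of_int (\<lfloor>s / \<delta>\<rfloor> - 1) \<le> r / \<delta> \<and> r / \<delta> < real_of_int (\<lfloor>s / \<delta>\<rfloor> - 1) + 1"
      by (rule floor_eq_iff)
    finally show ?thesis using \<delta> by (simp add: pos_le_divide_eq pos_divide_less_eq)
  qed
  then show ?thesis unfolding set_eq_iff mem_Collect_eq by blast
qed

lemma delayed_average_measurable [measurable]: "delayed_average \<delta> g \<in> borel_measurable borel"
proof -
  have "(\<lambda>s. (\<lambda>i s. (1 / \<delta>) *\<^sub>R (LINT r:{r. \<lfloor>r / \<delta>\<rfloor> + 1 = i}|lborel. g r)) \<lfloor>s / \<delta>\<rfloor> s) \<in> borel_measurable borel"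
    by (rule measurable_compose_countable) measurable
  then show ?thesis by (simp add: delayed_average_def[abs_def])
qed

lemma cell_integrable:
  fixes g :: "real \<Rightarrow> 'a::{banach, second_countable_topology}"
  assumes "integrable lborel g"
  shows "set_integrable lborel {r. \<lfloor>r / \<delta>\<rfloor> + 1 = i} g"
  using assms unfolding set_integrable_def by (intro integrable_mult_indicator) auto

lemma delayed_average_add:
  assumes "integrable lborel f" "integrable lborel g"
  shows "delayed_average \<delta> (\<lambda>x. f x + g x) s = delayed_average \<delta> f s + delayed_average \<delta> g s"
  using assms by (simp add: delayed_average_def set_integral_add(2)[OF cell_integrable cell_integrable] scaleR_add_right)

lemma delayed_average_diff:
  assumes "integrable lborel f" "integrable lborel g"
  shows "delayed_average \<delta> (\<lambda>x. f x - g x) s = delayed_average \<delta> f s - delayed_average \<delta> g s"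
  using assms by (simp add: delayed_average_def set_integral_diff(2)[OF cell_integrable cell_integrable] scaleR_diff_right)

lemma delayed_average_scaleR:
  fixes f :: "real \<Rightarrow> real"
  assumes "integrable lborel f"
  shows "delayed_average \<delta> (\<lambda>x. f x *\<^sub>R c) s = delayed_average \<delta> f s *\<^sub>R c"
proof -
  have "(LINT r:{r. \<lfloor>r / \<delta>\<rfloor> + 1 = \<lfloor>s / \<delta>\<rfloor>}|lborel. f r *\<^sub>R c) = (LINT r:{r. \<lfloor>r / \<delta>\<rfloor> + 1 = \<lfloor>s / \<delta>\<rfloor>}|lborel. f r) *\<^sub>R c"
    using cell_integrable[OF assms, of \<delta> "\<lfloor>s / \<delta>\<rfloor>"] unfolding set_lebesgue_integral_def set_integrable_def
    by (subst integral_scaleR_left[symmetric]) (auto simp: mult_ac)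
  then show ?thesis by (simp add: delayed_average_def)
qed

text \<open>Averaging is a contraction of \<open>L\<^sup>1\<close>: every \<open>r\<close> contributes to exactly one cell of length \<open>\<delta>\<close>, with weight \<open>1 / \<delta>\<close>.\<close>
lemma nn_integral_delayed_average_le:
  assumes \<delta>: "\<delta> > 0" and g: "integrable lborel g"
  shows "(\<integral>\<^sup>+s. norm (delayed_average \<delta> g s) \<partial>lborel) \<le> (\<integral>\<^sup>+s. norm (g s) \<partial>lborel)"
proof -
  have [measurable]: "g \<in> borel_measurable borel" using g by auto
  have "ennreal (norm (delayed_average \<delta> g s)) \<le> (\<integral>\<^sup>+r. ennreal (1 / \<delta>) * (indicator {r. \<lfloor>r / \<delta>\<rfloor> + 1 = \<lfloor>s / \<delta>\<rfloor>} r * norm (g r)) \<partial>lborel)" for s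
  proof -
    have "ennreal (norm (delayed_average \<delta> g s)) = ennreal (1 / \<delta>) * ennreal (norm (LINT r:{r. \<lfloor>r / \<delta>\<rfloor> + 1 = \<lfloor>s / \<delta>\<rfloor>}|lborel. g r))"
      using \<delta> by (simp add: delayed_average_def ennreal_mult[symmetric])
    also have "\<dots> \<le> ennreal (1 / \<delta>) * (\<integral>\<^sup>+r. norm (indicator {r. \<lfloor>r / \<delta>\<rfloor> + 1 = \<lfloor>s / \<delta>\<rfloor>} r *\<^sub>R g r) \<partial>lborel)"
      using cell_integrable[OF g] unfolding set_lebesgue_integral_def set_integrable_def
      by (intro mult_left_mono integral_norm_bound_ennreal) auto
    also have "\<dots> = (\<integral>\<^sup>+r. ennreal (1 / \<delta>) * (indicator {r. \<lfloor>r / \<delta>\<rfloor> + 1 = \<lfloor>s / \<delta>\<rfloor>} r * norm (g r)) \<partial>lborel)"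
      by (subst nn_integral_cmult[symmetric]) (auto intro!: nn_integral_cong simp: indicator_def)
    finally show ?thesis .
  qed
  then have "(\<integral>\<^sup>+s. norm (delayed_average \<delta> g s) \<partial>lborel)
      \<le> (\<integral>\<^sup>+s. (\<integral>\<^sup>+r. ennreal (1 / \<delta>) * (indicator {r. \<lfloor>r / \<delta>\<rfloor> + 1 = \<lfloor>s / \<delta>\<rfloor>} r * norm (g r)) \<partial>lborel) \<partial>lborel)"
    by (intro nn_integral_mono) auto
  also have "\<dots> = (\<integral>\<^sup>+s. (\<integral>\<^sup>+r. ennreal (1 / \<delta>) * ((if \<lfloor>r / \<delta>\<rfloor> + 1 = \<lfloor>s / \<delta>\<rfloor> then 1 else 0) * norm (g r)) \<partial>lborel) \<partial>lborel)"
    by (intro nn_integral_cong) (auto simp: indicator_def)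
  also have "\<dots> = (\<integral>\<^sup>+r. (\<integral>\<^sup>+s. ennreal (1 / \<delta>) * ((if \<lfloor>r / \<delta>\<rfloor> + 1 = \<lfloor>s / \<delta>\<rfloor> then 1 else 0) * norm (g r)) \<partial>lborel) \<partial>lborel)"
    by (rule lborel_pair.Fubini') measurable
  also have "\<dots> = (\<integral>\<^sup>+r. norm (g r) \<partial>lborel)"
  proof (rule nn_integral_cong)
    fix r :: real
    define i where "i = \<lfloor>r / \<delta>\<rfloor> + 1"
    have set: "{s. i = \<lfloor>s / \<delta>\<rfloor>} = {i * \<delta>..<(i + 1) * \<delta>}"
    proof -
      have "i = \<lfloor>s / \<delta>\<rfloor> \<longleftrightarrow> s \<in> {i * \<delta>..<(i + 1) * \<delta>}" for s
        using floor_eq_iff[of "s / \<delta>" i] \<delta> by (auto simp: pos_le_divide_eq pos_divide_less_eq)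
      then show ?thesis unfolding set_eq_iff mem_Collect_eq by blast
    qed
    have "(\<integral>\<^sup>+s. ennreal (1 / \<delta>) * ((if i = \<lfloor>s / \<delta>\<rfloor> then 1 else 0) * norm (g r)) \<partial>lborel)
       = (\<integral>\<^sup>+s. ennreal (1 / \<delta>) * norm (g r) * indicator {i * \<delta>..<(i + 1) * \<delta>} s \<partial>lborel)"
      unfolding set[symmetric] by (intro nn_integral_cong) (auto simp: indicator_def)
    also have "\<dots> = ennreal (1 / \<delta>) * norm (g r) * ennreal \<delta>"
      using \<delta> by (subst nn_integral_cmult_indicator) (auto simp: algebra_simps)
    also have "\<dots> = norm (g r)"
      using \<delta> by (simp add: ennreal_mult[symmetric])
    finally show "(\<integral>\<^sup>+s. ennreal (1 / \<delta>) * ((if \<lfloor>r / \<delta>\<rfloor> + 1 = \<lfloor>s / \<delta>\<rfloor> then 1 else 0) * norm (g r)) \<partial>lborel) = norm (g r)"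
      by (simp add: i_def)
  qed
  finally show ?thesis .
qed

lemma delayed_average_integrable:
  assumes "\<delta> > 0" "integrable lborel g"
  shows "integrable lborel (delayed_average \<delta> g)"
  using nn_integral_delayed_average_le[OF assms] assms(2)
  unfolding integrable_iff_bounded by (auto intro: le_less_trans)

lemma integral_norm_delayed_average_le:
  assumes "\<delta> > 0" "integrable lborel g"
  shows "(LINT s|lborel. norm (delayed_average \<delta> g s)) \<le> (LINT s|lborel. norm (g s))"
  using nn_integral_delayed_average_le[OF assms] assms(2) delayed_average_integrable[OF assms]
  by (simp add: nn_integral_eq_integral)

context
  fixes \<delta> :: "nat \<Rightarrow> real"
  assumes \<delta>: "\<And>n. \<delta> n > 0" "\<delta> \<longlonglongrightarrow> 0"
begin

definition avg_conv :: "(real \<Rightarrow> 'a::{banach, second_countable_topology}) \<Rightarrow> bool" where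
  "avg_conv g \<longleftrightarrow> integrable lborel g \<and> (\<lambda>n. LINT s|lborel. norm (delayed_average (\<delta> n) g s - g s)) \<longlonglongrightarrow> 0"

lemma avg_conv_add:
  assumes "avg_conv f" "avg_conv g" shows "avg_conv (\<lambda>x. f x + g x)"
proof -
  have i: "integrable lborel f" "integrable lborel g" using assms by (auto simp: avg_conv_def)
  have "(\<lambda>n. LINT s|lborel. norm (delayed_average (\<delta> n) (\<lambda>x. f x + g x) s - (f s + g s))) \<longlonglongrightarrow> 0"
  proof (rule tendsto_sandwich[of "\<lambda>_. 0"])
    show "(\<lambda>n. (LINT s|lborel. norm (delayed_average (\<delta> n) f s - f s)) + (LINT s|lborel. norm (delayed_average (\<delta> n) g s - g s))) \<longlonglongrightarrow> 0"
      using assms tendsto_add unfolding avg_conv_def by fastforce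
    show "eventually (\<lambda>n. (LINT s|lborel. norm (delayed_average (\<delta> n) (\<lambda>x. f x + g x) s - (f s + g s)))
      \<le> (LINT s|lborel. norm (delayed_average (\<delta> n) f s - f s)) + (LINT s|lborel. norm (delayed_average (\<delta> n) g s - g s))) sequentially"
    proof (intro always_eventually allI)
      fix n
      have di: "integrable lborel (delayed_average (\<delta> n) f)" "integrable lborel (delayed_average (\<delta> n) g)"
        using delayed_average_integrable \<delta> i by auto
      have "(LINT s|lborel. norm (delayed_average (\<delta> n) (\<lambda>x. f x + g x) s - (f s + g s)))
        \<le> (LINT s|lborel. norm (delayed_average (\<delta> n) f s - f s) + norm (delayed_average (\<delta> n) g s - g s))"
        unfolding delayed_average_add[OF i] add_diff_add
        using i di by (intro integral_mono norm_triangle_ineq) auto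
      also have "\<dots> = (LINT s|lborel. norm (delayed_average (\<delta> n) f s - f s)) + (LINT s|lborel. norm (delayed_average (\<delta> n) g s - g s))"
        using i di by (intro Bochner_Integration.integral_add) auto
      finally show "(LINT s|lborel. norm (delayed_average (\<delta> n) (\<lambda>x. f x + g x) s - (f s + g s))) \<le> \<dots>" .
    qed
  qed (auto intro!: always_eventually)
  with i show ?thesis by (auto simp: avg_conv_def)
qed

lemma avg_conv_scaleR:
  fixes f :: "real \<Rightarrow> real"
  assumes "avg_conv f" shows "avg_conv (\<lambda>x. f x *\<^sub>R c)"
proof -
  have i: "integrable lborel f" using assms by (auto simp: avg_conv_def)
  have "(\<lambda>n. LINT s|lborel. norm (delayed_average (\<delta> n) (\<lambda>x. f x *\<^sub>R c) s - f s *\<^sub>R c))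
      = (\<lambda>n. (LINT s|lborel. norm (delayed_average (\<delta> n) f s - f s)) * norm c)"
    by (simp add: delayed_average_scaleR[OF i] scaleR_diff_left[symmetric])
  then show ?thesis
    using assms i unfolding avg_conv_def by (auto intro: tendsto_mult_left_zero)
qed

lemma avg_conv_zero: "avg_conv (\<lambda>_. 0)"
  by (simp add: avg_conv_def delayed_average_def set_lebesgue_integral_def)

lemma avg_conv_sum: "finite I \<Longrightarrow> (\<And>i. i \<in> I \<Longrightarrow> avg_conv (f i)) \<Longrightarrow> avg_conv (\<lambda>x. \<Sum>i\<in>I. f i x)"
  by (induction I rule: finite_induct) (auto intro: avg_conv_add avg_conv_zero)

text \<open>Since averaging is a contraction, the set of functions whose averages converge is closed in \<open>L\<^sup>1\<close>; so intervals suffice to reach all integrable functions.\<close>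
lemma avg_conv_L1_limit:
  assumes s: "\<And>j. avg_conv (s j)" and g: "integrable lborel g"
    and lim: "(\<lambda>j. LINT x|lborel. norm (s j x - g x)) \<longlonglongrightarrow> 0"
  shows "avg_conv g"
proof -
  have "(\<lambda>n. LINT x|lborel. norm (delayed_average (\<delta> n) g x - g x)) \<longlonglongrightarrow> 0"
  proof (rule LIMSEQ_I)
    fix e :: real assume e: "e > 0"
    have "eventually (\<lambda>j. (LINT x|lborel. norm (s j x - g x)) < e / 3) sequentially"
      using order_tendstoD(2)[OF lim, of "e/3"] e by simp
    then obtain j where j: "(LINT x|lborel. norm (s j x - g x)) < e / 3"
      by (auto simp: eventually_sequentially)
    have si: "integrable lborel (s j)" using s by (auto simp: avg_conv_def)
    have "(\<lambda>n. LINT x|lborel. norm (delayed_average (\<delta> n) (s j) x - s j x)) \<longlonglongrightarrow> 0" using s by (auto simp: avg_conv_def)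
    then have "eventually (\<lambda>n. (LINT x|lborel. norm (delayed_average (\<delta> n) (s j) x - s j x)) < e / 3) sequentially"
      using e by (auto dest: order_tendstoD(2)[of _ _ _ "e/3"])
    then obtain N where N: "\<And>n. n \<ge> N \<Longrightarrow> (LINT x|lborel. norm (delayed_average (\<delta> n) (s j) x - s j x)) < e / 3"
      by (auto simp: eventually_sequentially)
    have "(LINT x|lborel. norm (delayed_average (\<delta> n) g x - g x)) < e" if n: "n \<ge> N" for n
    proof -
      let ?A = "delayed_average (\<delta> n)"
      have gs: "integrable lborel (\<lambda>x. g x - s j x)" using g si by auto
      have di: "integrable lborel (?A g)" "integrable lborel (?A (s j))" "integrable lborel (?A (\<lambda>x. g x - s j x))"
        using delayed_average_integrable \<delta> g si gs by blast+
      have "(LINT x|lborel. norm (?A g x - g x))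
         \<le> (LINT x|lborel. norm (?A (\<lambda>x. g x - s j x) x) + norm (?A (s j) x - s j x) + norm (s j x - g x))"
      proof (rule integral_mono)
        fix x
        have eq: "?A g x - g x = ?A (\<lambda>x. g x - s j x) x + (?A (s j) x - s j x) + (s j x - g x)"
          unfolding delayed_average_diff[OF g si] by simp
        show "norm (?A g x - g x) \<le> norm (?A (\<lambda>x. g x - s j x) x) + norm (?A (s j) x - s j x) + norm (s j x - g x)"
          unfolding eq by (rule order_trans[OF norm_triangle_ineq add_right_mono[OF norm_triangle_ineq]])
      qed (use g si di in auto)
      also have "\<dots> = (LINT x|lborel. norm (?A (\<lambda>x. g x - s j x) x)) + (LINT x|lborel. norm (?A (s j) x - s j x)) + (LINT x|lborel. norm (s j x - g x))"
        using g si di by (simp add: Bochner_Integration.integral_add)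
      also have "(LINT x|lborel. norm (?A (\<lambda>x. g x - s j x) x)) \<le> (LINT x|lborel. norm (g x - s j x))"
        by (rule integral_norm_delayed_average_le[OF \<delta>(1) gs])
      also have "\<dots> = (LINT x|lborel. norm (s j x - g x))" by (simp add: norm_minus_commute)
      finally show ?thesis using j N[OF n] by linarith
    qed
    then show "\<exists>N. \<forall>n\<ge>N. norm ((LINT x|lborel. norm (delayed_average (\<delta> n) g x - g x)) - 0) < e"
      by (intro exI[of _ N]) (auto simp: integral_nonneg_AE)
  qed
  with g show ?thesis by (simp add: avg_conv_def)
qed

text \<open>The average of the indicator of an interval differs from it only within two cells of an endpoint.\<close>
lemma avg_conv_interval: "avg_conv (indicator {a..b::real} :: real \<Rightarrow> real)"
proof (cases "a \<le> b")
  case True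
  have i: "integrable lborel (indicator {a..b} :: real \<Rightarrow> real)"
    using True by (intro integrable_real_indicator) auto
  let ?g = "indicator {a..b} :: real \<Rightarrow> real"
  have pt: "\<bar>delayed_average \<delta> ?g s - ?g s\<bar> \<le> indicator {a - 2 * \<delta>..a + 2 * \<delta>} s + indicator {b - 2 * \<delta>..b + 2 * \<delta>} s"
    if \<delta>: "\<delta> > 0" for s \<delta> :: real
  proof -
    define c where "c = real_of_int \<lfloor>s / \<delta>\<rfloor> * \<delta>"
    have c: "c \<le> s" "s < c + \<delta>"
    proof -
      have "real_of_int \<lfloor>s / \<delta>\<rfloor> \<le> s / \<delta>" "s / \<delta> < real_of_int \<lfloor>s / \<delta>\<rfloor> + 1" by linarith+
      then have "real_of_int \<lfloor>s / \<delta>\<rfloor> * \<delta> \<le> s" "s < (real_of_int \<lfloor>s / \<delta>\<rfloor> + 1) * \<delta>"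
        by (simp_all only: pos_le_divide_eq[OF \<delta>] pos_divide_less_eq[OF \<delta>])
      then show "c \<le> s" "s < c + \<delta>" by (simp_all add: c_def algebra_simps)
    qed
    have avg: "delayed_average \<delta> ?g s = (1 / \<delta>) * (LINT r:{c - \<delta>..<c}|lborel. ?g r)"
      unfolding delayed_average_def floor_cell[OF \<delta>] c_def by (simp add: algebra_simps)
    have const: "(LINT r:{c - \<delta>..<c}|lborel. k) = \<delta> * k" for k :: real
      using \<delta> by (simp add: set_lebesgue_integral_def)
    have "0 \<le> (LINT r:{c - \<delta>..<c}|lborel. ?g r)"
      by (auto simp: set_lebesgue_integral_def intro!: integral_nonneg_AE)
    moreover have "(LINT r:{c - \<delta>..<c}|lborel. ?g r) \<le> (LINT r:{c - \<delta>..<c}|lborel. 1)"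
    proof (rule set_integral_mono)
      show "set_integrable lborel {c - \<delta>..<c} ?g"
        using i unfolding set_integrable_def by (intro integrable_mult_indicator) auto
      show "set_integrable lborel {c - \<delta>..<c} (\<lambda>_. 1::real)"
        using \<delta> by (auto simp: set_integrable_def intro!: integrable_real_indicator)
    qed (auto simp: indicator_def)
    ultimately have b01: "0 \<le> delayed_average \<delta> ?g s" "delayed_average \<delta> ?g s \<le> 1"
      using \<delta> by (auto simp: avg const field_simps)
    consider "s \<in> {a - 2 * \<delta>..a + 2 * \<delta>} \<union> {b - 2 * \<delta>..b + 2 * \<delta>}" | "s < a - 2 * \<delta>" | "s > b + 2 * \<delta>"
      | "a + 2 * \<delta> < s" "s < b - 2 * \<delta>"
      by fastforce
    then show ?thesis
    proof cases
      case 1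
      have "\<bar>delayed_average \<delta> ?g s - ?g s\<bar> \<le> 1" using b01 by (auto simp: indicator_def)
      also have "\<dots> \<le> indicator {a - 2 * \<delta>..a + 2 * \<delta>} s + indicator {b - 2 * \<delta>..b + 2 * \<delta>} s"
        using 1 by (auto simp: indicator_def)
      finally show ?thesis .
    next
      case 2
      have "(LINT r:{c - \<delta>..<c}|lborel. ?g r) = (LINT r:{c - \<delta>..<c}|lborel. 0)"
        using 2 c \<delta> by (intro set_lebesgue_integral_cong) (auto simp: indicator_def)
      then show ?thesis using 2 c \<delta> by (auto simp: avg const indicator_def)
    next
      case 3
      have "(LINT r:{c - \<delta>..<c}|lborel. ?g r) = (LINT r:{c - \<delta>..<c}|lborel. 0)"
        using 3 c \<delta> by (intro set_lebesgue_integral_cong) (auto simp: indicator_def)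
      then show ?thesis using 3 c \<delta> by (auto simp: avg const indicator_def)
    next
      case 4
      have "(LINT r:{c - \<delta>..<c}|lborel. ?g r) = (LINT r:{c - \<delta>..<c}|lborel. 1)"
        using 4 c \<delta> by (intro set_lebesgue_integral_cong) (auto simp: indicator_def)
      then show ?thesis using 4 c \<delta> by (auto simp: avg const indicator_def)
    qed
  qed
  have "(LINT s|lborel. norm (delayed_average (\<delta> n) ?g s - ?g s)) \<le> 8 * \<delta> n" for n
  proof -
    have "(LINT s|lborel. norm (delayed_average (\<delta> n) ?g s - ?g s))
       \<le> (LINT s|lborel. indicator {a - 2 * \<delta> n..a + 2 * \<delta> n} s + indicator {b - 2 * \<delta> n..b + 2 * \<delta> n} s)"
      using delayed_average_integrable[OF \<delta>(1) i] i \<delta>(1)[of n] pt[OF \<delta>(1)]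
      by (intro integral_mono) (auto intro!: integrable_real_indicator)
    also have "\<dots> = 8 * \<delta> n"
      using \<delta>(1)[of n] by (subst Bochner_Integration.integral_add) (auto intro!: integrable_real_indicator)
    finally show ?thesis .
  qed
  then have "(\<lambda>n. LINT s|lborel. norm (delayed_average (\<delta> n) ?g s - ?g s)) \<longlonglongrightarrow> 0"
    by (intro tendsto_sandwich[OF _ _ tendsto_const tendsto_mult_right_zero[OF \<delta>(2), of 8]])
       (auto intro!: always_eventually)
  with i show ?thesis by (simp add: avg_conv_def)
next
  case False
  then have "(indicator {a..b} :: real \<Rightarrow> real) = (\<lambda>_. 0)" by auto
  then show ?thesis by (simp add: avg_conv_zero)
qed

lemma avg_conv_bounded_set:
  assumes "A \<in> sets borel"
  shows "avg_conv (indicator (A \<inter> {a..b::real}) :: real \<Rightarrow> real)"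
proof -
  have fin: "emeasure lborel (B \<inter> {a..b}) < \<infinity>" if "B \<in> sets borel" for B
  proof -
    have "emeasure lborel (B \<inter> {a..b}) \<le> emeasure lborel {a..b}" by (rule emeasure_mono) auto
    also have "\<dots> < \<infinity>" by (simp add: emeasure_lborel_Icc_eq)
    finally show ?thesis .
  qed
  have int: "integrable lborel (indicator (B \<inter> {a..b}) :: real \<Rightarrow> real)" if "B \<in> sets borel" for B
    using fin[OF that] that by (intro integrable_real_indicator) auto
  have "sets borel = sigma_sets UNIV (range (\<lambda>a::real. {..a}))"
    by (subst borel_eq_atMost) (simp add: sets_measure_of)
  note borel = this
  have Asig: "A \<in> sigma_sets UNIV (range (\<lambda>a::real. {..a}))" using assms borel by simp
  have "Int_stable (range (\<lambda>a::real. {..a}))"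
  proof (rule Int_stableI)
    fix A B :: "real set" assume "A \<in> range atMost" "B \<in> range atMost"
    then obtain x y where "A = {..x}" "B = {..y}" by auto
    then have "A \<inter> B = {..min x y}" by auto
    then show "A \<inter> B \<in> range atMost" by auto
  qed
  moreover have "range (\<lambda>a::real. {..a}) \<subseteq> Pow UNIV" by simp
  ultimately show ?thesis
    using Asig
  proof (induction rule: sigma_sets_induct_disjoint)
    fix A :: "real set" assume "A \<in> range atMost"
    then obtain x where "A = {..x}" by auto
    then have "A \<inter> {a..b} = {a..min x b}" by auto
    then show "avg_conv (indicator (A \<inter> {a..b}) :: real \<Rightarrow> real)" by (simp add: avg_conv_interval)
  next
    show "avg_conv (indicator ({} \<inter> {a..b}) :: real \<Rightarrow> real)"
      using avg_conv_interval[of 1 0] by simp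
  next
    fix A :: "real set" assume A: "avg_conv (indicator (A \<inter> {a..b}) :: real \<Rightarrow> real)"
    have eq: "(indicator ((UNIV - A) \<inter> {a..b}) :: real \<Rightarrow> real) = (\<lambda>x. indicator {a..b} x + indicator (A \<inter> {a..b}) x *\<^sub>R (-1))"
      by (auto simp: indicator_def)
    show "avg_conv (indicator ((UNIV - A) \<inter> {a..b}) :: real \<Rightarrow> real)"
      unfolding eq by (rule avg_conv_add[OF avg_conv_interval avg_conv_scaleR[OF A]])
  next
    fix A :: "nat \<Rightarrow> real set"
    assume disj: "disjoint_family A" and sets: "range A \<subseteq> sigma_sets UNIV (range atMost)"
      and A: "\<And>i. avg_conv (indicator (A i \<inter> {a..b}) :: real \<Rightarrow> real)"
    have [measurable]: "A i \<in> sets borel" for i using sets borel by auto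
    have eq: "(\<Sum>i<j. indicator (A i \<inter> {a..b}) x) = (indicator ((\<Union>i<j. A i) \<inter> {a..b}) x :: real)" for j x
    proof -
      have *: "(\<Union>i<j. A i) \<inter> {a..b} = (\<Union>i<j. A i \<inter> {a..b})" by auto
      show ?thesis
        unfolding * by (rule indicator_UN_disjoint[symmetric]) (use disj in \<open>auto simp: disjoint_family_on_def\<close>)
    qed
    show "avg_conv (indicator (\<Union>(range A) \<inter> {a..b}) :: real \<Rightarrow> real)"
    proof (rule avg_conv_L1_limit)
      show "avg_conv (\<lambda>x. \<Sum>i<j. indicator (A i \<inter> {a..b}) x :: real)" for j
        by (rule avg_conv_sum) (use A in auto)
      show "integrable lborel (indicator (\<Union>(range A) \<inter> {a..b}) :: real \<Rightarrow> real)"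
        by (rule int) measurable
      have "(\<lambda>j. LINT x|lborel. norm ((\<Sum>i<j. indicator (A i \<inter> {a..b}) x) - indicator (\<Union>(range A) \<inter> {a..b}) x :: real)) \<longlonglongrightarrow> (LINT (x::real)|lborel. 0)"
      proof (rule integral_dominated_convergence)
        show "integrable lborel (indicator {a..b} :: real \<Rightarrow> real)" using int[of UNIV] by simp
        show "AE x in lborel. (\<lambda>j. norm ((\<Sum>i<j. indicator (A i \<inter> {a..b}) x) - indicator (\<Union>(range A) \<inter> {a..b}) x :: real)) \<longlonglongrightarrow> 0"
        proof (rule AE_I2, rule tendsto_eventually)
          fix x
          have "eventually (\<lambda>j. x \<in> (\<Union>i<j. A i) \<longleftrightarrow> x \<in> \<Union>(range A)) sequentially"
          proof (cases "x \<in> \<Union>(range A)")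
            case True
            then obtain k where "x \<in> A k" by auto
            then have "x \<in> (\<Union>i<j. A i)" if "j \<ge> Suc k" for j using that by (auto intro!: bexI[of _ k])
            with True show ?thesis unfolding eventually_sequentially by blast
          qed auto
          then show "eventually (\<lambda>j. norm ((\<Sum>i<j. indicator (A i \<inter> {a..b}) x) - indicator (\<Union>(range A) \<inter> {a..b}) x :: real) = 0) sequentially"
            unfolding eq by eventually_elim (auto simp: indicator_def)
        qed
        show "AE x in lborel. norm (norm ((\<Sum>i<j. indicator (A i \<inter> {a..b}) x) - indicator (\<Union>(range A) \<inter> {a..b}) x :: real)) \<le> indicator {a..b} x" for j
          unfolding eq by (intro AE_I2) (auto simp: indicator_def)
      qed measurable
      then show "(\<lambda>j. LINT x|lborel. norm ((\<Sum>i<j. indicator (A i \<inter> {a..b}) x) - indicator (\<Union>(range A) \<inter> {a..b}) x :: real)) \<longlonglongrightarrow> 0"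
        by simp
    qed
  qed
qed

lemma avg_conv_integrable:
  assumes "integrable lborel g" shows "avg_conv g"
  using assms
proof (induction rule: integrable_induct)
  case (base A c)
  have A[measurable]: "A \<in> sets borel" using base by simp
  have iA: "integrable lborel (indicator A :: real \<Rightarrow> real)" using base by (intro integrable_real_indicator) auto
  have "avg_conv (indicator A :: real \<Rightarrow> real)"
  proof (rule avg_conv_L1_limit)
    show "avg_conv (indicator (A \<inter> {- real j..real j}) :: real \<Rightarrow> real)" for j
      by (rule avg_conv_bounded_set[OF A])
    have "(\<lambda>j. LINT x|lborel. norm (indicator (A \<inter> {- real j..real j}) x - indicator A x :: real)) \<longlonglongrightarrow> (LINT (x::real)|lborel. 0)"
    proof (rule integral_dominated_convergence[OF _ _ iA])
      show "AE x in lborel. (\<lambda>j. norm (indicator (A \<inter> {- real j..real j}) x - indicator A x :: real)) \<longlonglongrightarrow> 0"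
      proof (rule AE_I2, rule tendsto_eventually)
        fix x :: real
        obtain N :: nat where "\<bar>x\<bar> \<le> real N" using real_arch_simple by blast
        then have "x \<in> {- real j..real j}" if "j \<ge> N" for j using that by (auto simp: abs_le_iff)
        then show "eventually (\<lambda>j. norm (indicator (A \<inter> {- real j..real j}) x - indicator A x :: real) = 0) sequentially"
          unfolding eventually_sequentially by (intro exI[of _ N]) (auto simp: indicator_def)
      qed
    qed (auto simp: indicator_def)
    then show "(\<lambda>j. LINT x|lborel. norm (indicator (A \<inter> {- real j..real j}) x - indicator A x :: real)) \<longlonglongrightarrow> 0" by simp
  qed (rule iA)
  then show ?case by (rule avg_conv_scaleR)
next
  case (add f g) then show ?case by (intro avg_conv_add)
next
  case (lim f s)
  have "(\<lambda>j. LINT x|lborel. norm (s j x - f x)) \<longlonglongrightarrow> (LINT (x::real)|lborel. 0)"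
  proof (rule integral_dominated_convergence)
    show "integrable lborel (\<lambda>x. 3 * norm (f x))" using lim by auto
    show "AE x in lborel. (\<lambda>j. norm (s j x - f x)) \<longlonglongrightarrow> 0"
      using lim by (intro AE_I2 tendsto_norm_zero LIM_zero) auto
    show "AE x in lborel. norm (norm (s j x - f x)) \<le> 3 * norm (f x)" for j
    proof (rule AE_I2)
      fix x have "norm (s j x - f x) \<le> norm (s j x) + norm (f x)" by (rule norm_triangle_ineq4)
      also have "norm (s j x) \<le> 2 * norm (f x)" using lim by simp
      finally show "norm (norm (s j x - f x)) \<le> 3 * norm (f x)" by simp
    qed
  qed (use lim in auto)
  then have "(\<lambda>j. LINT x|lborel. norm (s j x - f x)) \<longlonglongrightarrow> 0" by simp
  then show ?case by (rule avg_conv_L1_limit[rotated 2]) (use lim in simp_all)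
qed

end

lemma delayed_average_tendsto:
  assumes "\<And>n. \<delta> n > 0" "\<delta> \<longlonglongrightarrow> 0" "integrable lborel g"
  shows "(\<lambda>n. LINT s|lborel. norm (delayed_average (\<delta> n) g s - g s)) \<longlonglongrightarrow> 0"
  using avg_conv_integrable[OF assms] by (simp add: avg_conv_def[OF assms(1,2)])

section \<open>Laws and independence from characteristic functions\<close>

lemma cis_measurable [measurable]: "cis \<in> borel_measurable borel"
proof -
  have "(\<lambda>x. exp (\<i> * complex_of_real x)) \<in> borel_measurable borel"
    by (intro borel_measurable_continuous_onI continuous_intros)
  then show ?thesis by (simp add: cis_conv_exp[abs_def])
qed

lemma cnj_measurable [measurable]: "cnj \<in> borel_measurable borel"
  by (intro borel_measurable_continuous_onI continuous_intros)

lemma char_distr_cis: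
  assumes [measurable]: "R \<in> borel_measurable M"
  shows "char (distr M borel R) t = (LINT \<omega>|M. cis (t * R \<omega>))"
  unfolding char_def by (subst integral_distr) (auto simp: cis_conv_exp mult_ac)

lemma (in prob_space) integrable_bounded:
  fixes f :: "'a \<Rightarrow> 'b::{banach, second_countable_topology}"
  assumes "f \<in> borel_measurable M" "\<And>\<omega>. norm (f \<omega>) \<le> c"
  shows "integrable M f"
  using assms by (intro integrable_const_bound[of _ c]) auto

text \<open>Levy's uniqueness theorem for the probability measures with density proportional to \<open>G\<close>; adding a constant makes the weight positive, and the contribution of that constant is known from the unweighted law.\<close>
lemma weighted_law_unique_real:
  fixes R1 :: "'a \<Rightarrow> real" and R2 :: "'b \<Rightarrow> real" and G1 G2
  assumes M: "prob_space M1" "prob_space M2"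
    and R[measurable]: "R1 \<in> borel_measurable M1" "R2 \<in> borel_measurable M2"
    and G[measurable]: "G1 \<in> borel_measurable M1" "G2 \<in> borel_measurable M2"
    and c: "\<And>\<omega>. \<bar>G1 \<omega>\<bar> \<le> c" "\<And>\<omega>. \<bar>G2 \<omega>\<bar> \<le> c"
    and law: "\<And>\<tau>. (LINT \<omega>|M1. cis (\<tau> * R1 \<omega>)) = (LINT \<omega>|M2. cis (\<tau> * R2 \<omega>))"
    and wlaw: "\<And>\<tau>. (LINT \<omega>|M1. complex_of_real (G1 \<omega>) * cis (\<tau> * R1 \<omega>)) = (LINT \<omega>|M2. complex_of_real (G2 \<omega>) * cis (\<tau> * R2 \<omega>))"
    and B[measurable]: "B \<in> sets borel"
  shows "(LINT \<omega>|M1. G1 \<omega> * indicator B (R1 \<omega>)) = (LINT \<omega>|M2. G2 \<omega> * indicator B (R2 \<omega>))"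
proof -
  interpret M1: prob_space M1 by fact
  interpret M2: prob_space M2 by fact
  have c0: "c \<ge> 0" using c(1) abs_ge_zero order_trans by blast
  \<comment> \<open>total mass after the shift of the weights by \<open>c + 1\<close>, which makes them at least \<open>1\<close>\<close>
  define Z where "Z = (LINT \<omega>|M1. G1 \<omega>) + (c + 1)"
  have iG: "integrable M1 G1" "integrable M2 G2"
    using c by (auto intro!: M1.integrable_bounded[of _ c] M2.integrable_bounded[of _ c])
  have "complex_of_real (LINT \<omega>|M1. G1 \<omega>) = complex_of_real (LINT \<omega>|M2. G2 \<omega>)"
    using wlaw[of 0] by simp
  then have Z2: "Z = (LINT \<omega>|M2. G2 \<omega>) + (c + 1)" by (simp add: Z_def)
  have "- c \<le> (LINT \<omega>|M1. G1 \<omega>)"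
  proof -
    have "(LINT \<omega>|M1. - c) \<le> (LINT \<omega>|M1. G1 \<omega>)"
      by (rule integral_mono) (use iG c(1) in \<open>auto simp: abs_le_iff minus_le_iff\<close>)
    then show ?thesis by (simp add: M1.prob_space)
  qed
  then have Zpos: "Z > 0" by (simp add: Z_def)
  define w1 where "w1 \<omega> = (G1 \<omega> + (c + 1)) / Z" for \<omega>
  define w2 where "w2 \<omega> = (G2 \<omega> + (c + 1)) / Z" for \<omega>
  have w[measurable]: "w1 \<in> borel_measurable M1" "w2 \<in> borel_measurable M2"
    unfolding w1_def w2_def by measurable
  have wpos: "w1 \<omega> \<ge> 0" "w2 \<omega>' \<ge> 0" for \<omega> \<omega>'
    using c(1)[of \<omega>] c(2)[of \<omega>'] Zpos by (auto simp: w1_def w2_def abs_le_iff intro!: divide_nonneg_nonneg)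
  have wint: "(\<integral>\<^sup>+\<omega>. ennreal (w1 \<omega>) \<partial>M1) = 1" "(\<integral>\<^sup>+\<omega>. ennreal (w2 \<omega>) \<partial>M2) = 1"
  proof -
    have "integrable M1 w1" "integrable M2 w2" using iG by (auto simp: w1_def[abs_def] w2_def[abs_def])
    moreover have "(LINT \<omega>|M1. w1 \<omega>) = 1" "(LINT \<omega>|M2. w2 \<omega>) = 1"
      using iG Zpos by (simp_all add: w1_def w2_def M1.prob_space M2.prob_space Z_def[symmetric] Z2[symmetric])
    ultimately show "(\<integral>\<^sup>+\<omega>. ennreal (w1 \<omega>) \<partial>M1) = 1" "(\<integral>\<^sup>+\<omega>. ennreal (w2 \<omega>) \<partial>M2) = 1"
      using wpos by (simp_all add: nn_integral_eq_integral)
  qed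
  define N1 where "N1 = density M1 (\<lambda>\<omega>. ennreal (w1 \<omega>))"
  define N2 where "N2 = density M2 (\<lambda>\<omega>. ennreal (w2 \<omega>))"
  interpret N1: prob_space N1 by (rule prob_spaceI) (simp add: N1_def emeasure_density wint cong: nn_integral_cong_simp)
  interpret N2: prob_space N2 by (rule prob_spaceI) (simp add: N2_def emeasure_density wint cong: nn_integral_cong_simp)
  have RN[measurable]: "R1 \<in> borel_measurable N1" "R2 \<in> borel_measurable N2" by (simp_all add: N1_def N2_def)
  have dens: "(LINT \<omega>|N1. g (R1 \<omega>)) = (LINT \<omega>|M1. w1 \<omega> *\<^sub>R g (R1 \<omega>))"
     "(LINT \<omega>|N2. g (R2 \<omega>)) = (LINT \<omega>|M2. w2 \<omega> *\<^sub>R g (R2 \<omega>))"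
    if [measurable]: "g \<in> borel_measurable borel" for g :: "real \<Rightarrow> 'c::{banach, second_countable_topology}"
    unfolding N1_def N2_def using wpos by (subst integral_density; auto)+
  have icis: "integrable M1 (\<lambda>\<omega>. cis (\<tau> * R1 \<omega>))" "integrable M2 (\<lambda>\<omega>. cis (\<tau> * R2 \<omega>))" for \<tau>
    by (auto intro!: M1.integrable_bounded[of _ 1] M2.integrable_bounded[of _ 1])
  have iGcis: "integrable M1 (\<lambda>\<omega>. complex_of_real (G1 \<omega>) * cis (\<tau> * R1 \<omega>))" "integrable M2 (\<lambda>\<omega>. complex_of_real (G2 \<omega>) * cis (\<tau> * R2 \<omega>))" for \<tau>
    using c by (auto intro!: M1.integrable_bounded[of _ c] M2.integrable_bounded[of _ c] simp: norm_mult)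
  have "distr N1 borel R1 = distr N2 borel R2"
  proof (rule Levy_uniqueness)
    show "real_distribution (distr N1 borel R1)" by (rule N1.real_distribution_distr) simp
    show "real_distribution (distr N2 borel R2)" by (rule N2.real_distribution_distr) simp
    have "char (distr N1 borel R1) \<tau> = char (distr N2 borel R2) \<tau>" for \<tau>
    proof -
      have e1: "w1 \<omega> *\<^sub>R cis (\<tau> * R1 \<omega>) = (complex_of_real (G1 \<omega>) * cis (\<tau> * R1 \<omega>) + complex_of_real (c + 1) * cis (\<tau> * R1 \<omega>)) / complex_of_real Z" for \<omega>
        by (simp add: w1_def scaleR_conv_of_real field_simps)
      have e2: "w2 \<omega> *\<^sub>R cis (\<tau> * R2 \<omega>) = (complex_of_real (G2 \<omega>) * cis (\<tau> * R2 \<omega>) + complex_of_real (c + 1) * cis (\<tau> * R2 \<omega>)) / complex_of_real Z" for \<omega>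
        by (simp add: w2_def scaleR_conv_of_real field_simps)
      have "char (distr N1 borel R1) \<tau> = (LINT \<omega>|M1. w1 \<omega> *\<^sub>R cis (\<tau> * R1 \<omega>))"
        unfolding char_distr_cis[OF RN(1)] by (rule dens(1)[of "\<lambda>x. cis (\<tau> * x)"]) measurable
      also have "\<dots> = (LINT \<omega>|M2. w2 \<omega> *\<^sub>R cis (\<tau> * R2 \<omega>))"
        unfolding e1 e2 integral_divide_zero
        by (simp only: Bochner_Integration.integral_add[OF iGcis(1) integrable_mult_right[OF icis(1)]]
             Bochner_Integration.integral_add[OF iGcis(2) integrable_mult_right[OF icis(2)]] integral_mult_right_zero law wlaw)
      also have "\<dots> = char (distr N2 borel R2) \<tau>"
        unfolding char_distr_cis[OF RN(2)] by (rule dens(2)[of "\<lambda>x. cis (\<tau> * x)", symmetric]) measurable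
      finally show ?thesis .
    qed
    then show "char (distr N1 borel R1) = char (distr N2 borel R2)" by auto
  qed
  then have "(LINT x|distr N1 borel R1. indicator B x :: real) = (LINT x|distr N2 borel R2. indicator B x)" by simp
  then have "(LINT \<omega>|N1. indicator B (R1 \<omega>) :: real) = (LINT \<omega>|N2. indicator B (R2 \<omega>))"
    by (subst (asm) (1 2) integral_distr) auto
  then have A: "(LINT \<omega>|M1. w1 \<omega> * indicator B (R1 \<omega>)) = (LINT \<omega>|M2. w2 \<omega> * indicator B (R2 \<omega>))"
    using dens(1)[of "indicator B :: real \<Rightarrow> real"] dens(2)[of "indicator B :: real \<Rightarrow> real"] by simp
  have "distr M1 borel R1 = distr M2 borel R2"
  proof (rule Levy_uniqueness)
    show "real_distribution (distr M1 borel R1)" by (rule M1.real_distribution_distr) simp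
    show "real_distribution (distr M2 borel R2)" by (rule M2.real_distribution_distr) simp
    show "char (distr M1 borel R1) = char (distr M2 borel R2)"
      by (rule ext) (simp add: char_distr_cis law)
  qed
  then have "(LINT x|distr M1 borel R1. indicator B x :: real) = (LINT x|distr M2 borel R2. indicator B x)" by simp
  then have C: "(LINT \<omega>|M1. indicator B (R1 \<omega>) :: real) = (LINT \<omega>|M2. indicator B (R2 \<omega>))"
    by (subst (asm) (1 2) integral_distr) auto
  have ib: "integrable M1 (\<lambda>\<omega>. indicator B (R1 \<omega>) :: real)" "integrable M2 (\<lambda>\<omega>. indicator B (R2 \<omega>) :: real)"
    by (auto intro!: M1.integrable_bounded[of _ 1] M2.integrable_bounded[of _ 1] simp: indicator_def)
  have iGb: "integrable M1 (\<lambda>\<omega>. G1 \<omega> * indicator B (R1 \<omega>) :: real)" "integrable M2 (\<lambda>\<omega>. G2 \<omega> * indicator B (R2 \<omega>) :: real)"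
    using c c0 by (auto intro!: M1.integrable_bounded[of _ c] M2.integrable_bounded[of _ c] simp: indicator_def)
  have Zw: "Z * w1 \<omega> = G1 \<omega> + (c + 1)" "Z * w2 \<omega>' = G2 \<omega>' + (c + 1)" for \<omega> \<omega>'
    using Zpos by (simp_all add: w1_def w2_def)
  have "(LINT \<omega>|M1. G1 \<omega> * indicator B (R1 \<omega>)) = (LINT \<omega>|M1. Z * (w1 \<omega> * indicator B (R1 \<omega>)) - (c + 1) * indicator B (R1 \<omega>))"
    by (intro Bochner_Integration.integral_cong refl, simp only: mult.assoc[symmetric] Zw) (simp add: algebra_simps)
  also have "\<dots> = Z * (LINT \<omega>|M1. w1 \<omega> * indicator B (R1 \<omega>)) - (c + 1) * (LINT \<omega>|M1. indicator B (R1 \<omega>))"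
    using ib iGb by (subst Bochner_Integration.integral_diff) (auto simp: w1_def add_divide_distrib distrib_right)
  also have "\<dots> = Z * (LINT \<omega>|M2. w2 \<omega> * indicator B (R2 \<omega>)) - (c + 1) * (LINT \<omega>|M2. indicator B (R2 \<omega>))"
    unfolding A C ..
  also have "\<dots> = (LINT \<omega>|M2. Z * (w2 \<omega> * indicator B (R2 \<omega>)) - (c + 1) * indicator B (R2 \<omega>))"
    using ib iGb by (subst Bochner_Integration.integral_diff) (auto simp: w2_def add_divide_distrib distrib_right)
  also have "\<dots> = (LINT \<omega>|M2. G2 \<omega> * indicator B (R2 \<omega>))"
    by (intro Bochner_Integration.integral_cong refl, simp only: mult.assoc[symmetric] Zw) (simp add: algebra_simps)
  finally show ?thesis .
qed

lemma weighted_law_unique: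
  fixes R1 :: "'a \<Rightarrow> real" and R2 :: "'b \<Rightarrow> real" and G1 G2
  assumes M: "prob_space M1" "prob_space M2"
    and R[measurable]: "R1 \<in> borel_measurable M1" "R2 \<in> borel_measurable M2"
    and G[measurable]: "G1 \<in> borel_measurable M1" "G2 \<in> borel_measurable M2"
    and c: "\<And>\<omega>. cmod (G1 \<omega>) \<le> c" "\<And>\<omega>. cmod (G2 \<omega>) \<le> c"
    and law: "\<And>\<tau>. (LINT \<omega>|M1. cis (\<tau> * R1 \<omega>)) = (LINT \<omega>|M2. cis (\<tau> * R2 \<omega>))"
    and wlaw: "\<And>\<tau>. (LINT \<omega>|M1. G1 \<omega> * cis (\<tau> * R1 \<omega>)) = (LINT \<omega>|M2. G2 \<omega> * cis (\<tau> * R2 \<omega>))"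
    and B[measurable]: "B \<in> sets borel"
  shows "(LINT \<omega>|M1. G1 \<omega> * of_real (indicator B (R1 \<omega>))) = (LINT \<omega>|M2. G2 \<omega> * of_real (indicator B (R2 \<omega>)))"
proof -
  interpret M1: prob_space M1 by fact
  interpret M2: prob_space M2 by fact
  have i1: "integrable M1 (\<lambda>\<omega>. G1 \<omega> * cis (\<tau> * R1 \<omega>))" "integrable M1 (\<lambda>\<omega>. cnj (G1 \<omega>) * cis (\<tau> * R1 \<omega>))" for \<tau>
    using c by (auto intro!: M1.integrable_bounded[of _ c] simp: norm_mult)
  have i2: "integrable M2 (\<lambda>\<omega>. G2 \<omega> * cis (\<tau> * R2 \<omega>))" "integrable M2 (\<lambda>\<omega>. cnj (G2 \<omega>) * cis (\<tau> * R2 \<omega>))" for \<tau>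
    using c by (auto intro!: M2.integrable_bounded[of _ c] simp: norm_mult)
  have conj: "(LINT \<omega>|M1. cnj (G1 \<omega>) * cis (\<tau> * R1 \<omega>)) = (LINT \<omega>|M2. cnj (G2 \<omega>) * cis (\<tau> * R2 \<omega>))" for \<tau>
  proof -
    have e: "(LINT \<omega>|M'. cnj (G \<omega>) * cis (\<tau> * R \<omega>)) = cnj (LINT \<omega>|M'. G \<omega> * cis ((- \<tau>) * R \<omega>))"
      for M' :: "'c measure" and G R
      by (subst Bochner_Integration.integral_cnj[symmetric]) (simp add: cis_cnj del: Bochner_Integration.integral_cnj)
    show ?thesis unfolding e by (simp only: wlaw)
  qed
  have re: "complex_of_real (Re z) * w = (z * w + cnj z * w) / 2" and im: "complex_of_real (Im z) * w = (z * w - cnj z * w) / (2 * \<i>)" for z w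
  proof -
    have "complex_of_real (Re z) = (z + cnj z) / 2" by (simp add: complex_add_cnj)
    then show "complex_of_real (Re z) * w = (z * w + cnj z * w) / 2" by (simp only: times_divide_eq_left distrib_right)
    have "z - cnj z = complex_of_real (Im z) * (2 * \<i>)" by (simp add: complex_eq_iff)
    moreover have "2 * \<i> \<noteq> 0" by simp
    ultimately have "complex_of_real (Im z) = (z - cnj z) / (2 * \<i>)"
      by (simp only: nonzero_mult_div_cancel_right not_False_eq_True)
    then show "complex_of_real (Im z) * w = (z * w - cnj z * w) / (2 * \<i>)" by (simp only: times_divide_eq_left left_diff_distrib)
  qed
  have Re: "(LINT \<omega>|M1. Re (G1 \<omega>) * indicator B (R1 \<omega>)) = (LINT \<omega>|M2. Re (G2 \<omega>) * indicator B (R2 \<omega>))"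
  proof (rule weighted_law_unique_real[OF M R _ _ _ _ law _ B])
    show "\<bar>Re (G1 \<omega>)\<bar> \<le> c" "\<bar>Re (G2 \<omega>')\<bar> \<le> c" for \<omega> \<omega>'
      using c abs_Re_le_cmod order_trans by blast+
    show "(LINT \<omega>|M1. complex_of_real (Re (G1 \<omega>)) * cis (\<tau> * R1 \<omega>)) = (LINT \<omega>|M2. complex_of_real (Re (G2 \<omega>)) * cis (\<tau> * R2 \<omega>))" for \<tau>
      unfolding re integral_divide_zero
      by (simp only: Bochner_Integration.integral_add[OF i1] Bochner_Integration.integral_add[OF i2] wlaw conj)
  qed measurable
  have Im: "(LINT \<omega>|M1. Im (G1 \<omega>) * indicator B (R1 \<omega>)) = (LINT \<omega>|M2. Im (G2 \<omega>) * indicator B (R2 \<omega>))"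
  proof (rule weighted_law_unique_real[OF M R _ _ _ _ law _ B])
    show "\<bar>Im (G1 \<omega>)\<bar> \<le> c" "\<bar>Im (G2 \<omega>')\<bar> \<le> c" for \<omega> \<omega>'
      using c abs_Im_le_cmod order_trans by blast+
    show "(LINT \<omega>|M1. complex_of_real (Im (G1 \<omega>)) * cis (\<tau> * R1 \<omega>)) = (LINT \<omega>|M2. complex_of_real (Im (G2 \<omega>)) * cis (\<tau> * R2 \<omega>))" for \<tau>
      unfolding im integral_divide_zero
      by (simp only: Bochner_Integration.integral_diff[OF i1] Bochner_Integration.integral_diff[OF i2] wlaw conj)
  qed measurable
  have "cmod (G1 \<omega> * of_real (indicator B (R1 \<omega>))) \<le> c" "cmod (G2 \<omega>' * of_real (indicator B (R2 \<omega>'))) \<le> c" for \<omega> \<omega>'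
    using c(1)[of \<omega>] c(2)[of \<omega>'] order_trans[OF norm_ge_zero c(1)[of \<omega>]] by (auto simp: norm_mult indicator_def)
  then have int: "integrable M1 (\<lambda>\<omega>. G1 \<omega> * of_real (indicator B (R1 \<omega>)))" "integrable M2 (\<lambda>\<omega>. G2 \<omega> * of_real (indicator B (R2 \<omega>)))"
    by (auto intro!: M1.integrable_bounded[of _ c] M2.integrable_bounded[of _ c])
  show ?thesis
    using Re Im integral_Re[OF int(1)] integral_Re[OF int(2)] integral_Im[OF int(1)] integral_Im[OF int(2)]
    by (intro complex_eqI) simp_all
qed

text \<open>Induction on the list: the indicator of the first condition is absorbed into the weight, which is where complex weights come from, since the remaining phases have to be carried along.\<close>
lemma weighted_cylinder_unique:
  fixes X1 :: "'a \<Rightarrow> 'h::{real_inner, second_countable_topology}" and X2 :: "'b \<Rightarrow> 'h"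
  assumes M: "prob_space M1" "prob_space M2"
    and X[measurable]: "X1 \<in> borel_measurable M1" "X2 \<in> borel_measurable M2"
    and law: "\<And>y. (LINT \<omega>|M1. cis (X1 \<omega> \<bullet> y)) = (LINT \<omega>|M2. cis (X2 \<omega> \<bullet> y))"
    and "G1 \<in> borel_measurable M1" "G2 \<in> borel_measurable M2"
    and "\<And>\<omega>. cmod (G1 \<omega>) \<le> c" "\<And>\<omega>. cmod (G2 \<omega>) \<le> c"
    and "\<And>y. (LINT \<omega>|M1. G1 \<omega> * cis (X1 \<omega> \<bullet> y)) = (LINT \<omega>|M2. G2 \<omega> * cis (X2 \<omega> \<bullet> y))"
    and "\<forall>(e, B)\<in>set l. B \<in> sets borel"
  shows "(LINT \<omega>|M1. G1 \<omega> * of_real (indicator (cylinder l) (X1 \<omega>))) = (LINT \<omega>|M2. G2 \<omega> * of_real (indicator (cylinder l) (X2 \<omega>)))"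
  using assms(6-11)
proof (induction l arbitrary: G1 G2)
  case Nil
  then show ?case using Nil(5)[of 0] by (simp add: cylinder_def)
next
  case (Cons p l)
  obtain e B where p: "p = (e, B)" by force
  note [measurable] = Cons.prems(1,2)
  have B[measurable]: "B \<in> sets borel" using Cons.prems(6) p by auto
  define G1' where "G1' \<omega> = G1 \<omega> * complex_of_real (indicator B (X1 \<omega> \<bullet> e))" for \<omega>
  define G2' where "G2' \<omega> = G2 \<omega> * complex_of_real (indicator B (X2 \<omega> \<bullet> e))" for \<omega>
  have le: "cmod (z * complex_of_real (indicator B' x)) \<le> c" if "cmod z \<le> c" for z x and B' :: "real set"
    using that order_trans[OF norm_ge_zero that] by (auto simp: norm_mult indicator_def)
  have "(LINT \<omega>|M1. G1' \<omega> * of_real (indicator (cylinder l) (X1 \<omega>))) = (LINT \<omega>|M2. G2' \<omega> * of_real (indicator (cylinder l) (X2 \<omega>)))"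
  proof (rule Cons.IH)
    show "G1' \<in> borel_measurable M1" "G2' \<in> borel_measurable M2" unfolding G1'_def[abs_def] G2'_def[abs_def] by measurable
    show "cmod (G1' \<omega>) \<le> c" "cmod (G2' \<omega>') \<le> c" for \<omega> \<omega>'
      unfolding G1'_def G2'_def using Cons.prems(3,4) by (auto intro!: le)
    show "\<forall>(e, B)\<in>set l. B \<in> sets borel" using Cons.prems(6) by auto
    fix y
    have cis_le: "cmod (G1 \<omega> * cis (X1 \<omega> \<bullet> y)) \<le> c" "cmod (G2 \<omega>' * cis (X2 \<omega>' \<bullet> y)) \<le> c" for \<omega> \<omega>'
      using Cons.prems(3,4) by (auto simp: norm_mult)
    have "(LINT \<omega>|M1. (G1 \<omega> * cis (X1 \<omega> \<bullet> y)) * of_real (indicator B (X1 \<omega> \<bullet> e)))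
        = (LINT \<omega>|M2. (G2 \<omega> * cis (X2 \<omega> \<bullet> y)) * of_real (indicator B (X2 \<omega> \<bullet> e)))"
    proof (rule weighted_law_unique[OF M _ _ _ _ cis_le _ _ B])
      show "(LINT \<omega>|M1. cis (\<tau> * (X1 \<omega> \<bullet> e))) = (LINT \<omega>|M2. cis (\<tau> * (X2 \<omega> \<bullet> e)))" for \<tau>
        using law[of "\<tau> *\<^sub>R e"] by simp
      show "(LINT \<omega>|M1. G1 \<omega> * cis (X1 \<omega> \<bullet> y) * cis (\<tau> * (X1 \<omega> \<bullet> e))) = (LINT \<omega>|M2. G2 \<omega> * cis (X2 \<omega> \<bullet> y) * cis (\<tau> * (X2 \<omega> \<bullet> e)))" for \<tau>
        using Cons.prems(5)[of "y + \<tau> *\<^sub>R e"] by (simp add: mult.assoc cis_mult inner_add_right)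
    qed measurable
    then show "(LINT \<omega>|M1. G1' \<omega> * cis (X1 \<omega> \<bullet> y)) = (LINT \<omega>|M2. G2' \<omega> * cis (X2 \<omega> \<bullet> y))"
      by (simp add: G1'_def G2'_def mult_ac)
  qed
  moreover have "complex_of_real (indicator (cylinder (p # l)) x) = complex_of_real (indicator B (x \<bullet> e)) * complex_of_real (indicator (cylinder l) x)" for x
    by (auto simp: cylinder_def p indicator_def)
  ultimately show ?case by (simp add: G1'_def G2'_def mult_ac)
qed

text \<open>If the characteristic function of \<open>N\<close> tested against the events of \<open>F\<close> factorizes, then \<open>N\<close> is independent of \<open>F\<close> and has the law of \<open>Y\<close>; in the integral of a function of an \<open>F\<close>-measurable variable and of \<open>N\<close> the former may be frozen.\<close>
lemma (in prob_space) integral_freeze: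
  fixes N Y :: "'a \<Rightarrow> 'h::{real_inner, second_countable_topology}" and \<Phi> :: "'a \<Rightarrow> 'h \<Rightarrow> real"
  assumes F: "subalgebra M F"
    and N[measurable]: "N \<in> borel_measurable M" and Y[measurable]: "Y \<in> borel_measurable M"
    and char: "\<And>A y. A \<in> sets F \<Longrightarrow> (LINT \<omega>|M. of_real (indicator A \<omega>) * cis (N \<omega> \<bullet> y)) = of_real (prob A) * (LINT \<omega>|M. cis (Y \<omega> \<bullet> y))"
    and \<Phi>: "(\<lambda>(\<omega>, z). \<Phi> \<omega> z) \<in> borel_measurable (F \<Otimes>\<^sub>M borel)"
  shows "(LINT \<omega>|M. \<Phi> \<omega> (N \<omega>)) = (LINT p|(M \<Otimes>\<^sub>M M). \<Phi> (fst p) (Y (snd p)))"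
proof -
  have FM: "sets F \<subseteq> sets M" "space F = space M" using F by (auto simp: subalgebra_def)
  have id: "(\<lambda>\<omega>. \<omega>) \<in> measurable M F" using FM by (intro measurableI) auto
  have law: "(LINT \<omega>|M. cis (N \<omega> \<bullet> y)) = (LINT \<omega>|M. cis (Y \<omega> \<bullet> y))" for y
  proof -
    have "space M \<in> sets F" using FM by (metis sets.top)
    from char[OF this, of y] have "(LINT \<omega>|M. of_real (indicator (space M) \<omega>) * cis (N \<omega> \<bullet> y)) = (LINT \<omega>|M. cis (Y \<omega> \<bullet> y))"
      by (simp add: prob_space)
    also have "(LINT \<omega>|M. of_real (indicator (space M) \<omega>) * cis (N \<omega> \<bullet> y)) = (LINT \<omega>|M. cis (N \<omega> \<bullet> y))"
      by (intro Bochner_Integration.integral_cong) auto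
    finally show ?thesis .
  qed
  have cyl: "prob (A \<inter> (N -` C \<inter> space M)) = prob A * prob (Y -` C \<inter> space M)" if A: "A \<in> sets F" and C: "C \<in> cylinders" for A C
  proof -
    obtain l where l: "C = cylinder l" "\<forall>(e, B)\<in>set l. B \<in> sets borel" using C by (auto simp: cylinders_def)
    have "l \<in> lists (UNIV \<times> sets borel)"
      unfolding in_lists_conv_set using l(2) by (auto simp: mem_Times_iff split_beta)
    then have [measurable]: "A \<in> sets M" "C \<in> sets borel"
      using A FM l(1) cylinder_borel[of l] by auto
    have pos: "0 \<le> prob A" "prob A \<le> 1" by auto
    have "(LINT \<omega>|M. complex_of_real (indicator A \<omega>) * of_real (indicator (cylinder l) (N \<omega>)))
       = (LINT \<omega>|M. complex_of_real (prob A) * of_real (indicator (cylinder l) (Y \<omega>)))"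
    proof (rule weighted_cylinder_unique[OF prob_space_axioms prob_space_axioms N Y law, of _ _ 1])
      show "(LINT \<omega>|M. complex_of_real (indicator A \<omega>) * cis (N \<omega> \<bullet> y)) = (LINT \<omega>|M. complex_of_real (prob A) * cis (Y \<omega> \<bullet> y))" for y
        using char[OF A, of y] by simp
    qed (use l pos in \<open>auto simp: indicator_def\<close>)
    also have "(LINT \<omega>|M. complex_of_real (indicator A \<omega>) * of_real (indicator (cylinder l) (N \<omega>)))
       = complex_of_real (LINT \<omega>|M. indicator (A \<inter> (N -` C \<inter> space M)) \<omega>)"
      unfolding integral_complex_of_real[symmetric] l(1)[symmetric]
      by (intro Bochner_Integration.integral_cong refl) (auto simp: indicator_def)
    also have "\<dots> = complex_of_real (prob (A \<inter> (N -` C \<inter> space M)))"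
      by simp
    also have "(LINT \<omega>|M. complex_of_real (prob A) * of_real (indicator (cylinder l) (Y \<omega>)))
       = complex_of_real (prob A * (LINT \<omega>|M. indicator (Y -` C \<inter> space M) \<omega>))"
      unfolding l(1)[symmetric] integral_mult_right_zero of_real_mult integral_complex_of_real[symmetric]
      by (intro arg_cong2[where f="(*)"] Bochner_Integration.integral_cong refl) (auto simp: indicator_def)
    also have "\<dots> = complex_of_real (prob A * prob (Y -` C \<inter> space M))"
      by simp
    finally show ?thesis by (simp only: of_real_eq_iff)
  qed
  have all: "prob (A \<inter> (N -` C \<inter> space M)) = prob A * prob (Y -` C \<inter> space M)" if A: "A \<in> sets F" and C: "C \<in> sets borel" for A C
  proof -
    have AM[measurable]: "A \<in> sets M" using A FM by auto
    have C': "C \<in> sigma_sets UNIV cylinders" using C sets_borel_cylinders by auto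
    have "cylinders \<subseteq> Pow (UNIV :: 'h set)" by simp
    from Int_stable_cylinders this C' show ?thesis
    proof (induction rule: sigma_sets_induct_disjoint)
      case (basic C) then show ?case using cyl[OF A] by simp
    next
      case empty then show ?case by simp
    next
      case (compl C)
      have [measurable]: "C \<in> sets borel" using compl sets_borel_cylinders by auto
      have e1: "A \<inter> (N -` (UNIV - C) \<inter> space M) = A - (A \<inter> (N -` C \<inter> space M))"
        using sets.sets_into_space[OF AM] by auto
      have e2: "Y -` (UNIV - C) \<inter> space M = space M - (Y -` C \<inter> space M)" by auto
      have "prob (A - (A \<inter> (N -` C \<inter> space M))) = prob A - prob (A \<inter> (N -` C \<inter> space M))"
        by (intro finite_measure_Diff) auto
      moreover have "prob (space M - (Y -` C \<inter> space M)) = 1 - prob (Y -` C \<inter> space M)"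
        by (intro prob_compl) auto
      moreover have "prob (A \<inter> (N -` C \<inter> space M)) = prob A * prob (Y -` C \<inter> space M)" using compl by simp
      ultimately show ?case unfolding e1 e2 by (simp only: right_diff_distrib mult_1_right)
    next
      case (union C)
      have [measurable]: "C i \<in> sets borel" for i using union(2) sets_borel_cylinders by auto
      have "(\<lambda>i. prob (A \<inter> (N -` C i \<inter> space M))) sums prob (\<Union>i. A \<inter> (N -` C i \<inter> space M))"
        using union(1) by (intro finite_measure_UNION) (auto simp: disjoint_family_on_def)
      moreover have "(\<lambda>i. prob (Y -` C i \<inter> space M)) sums prob (\<Union>i. Y -` C i \<inter> space M)"
        using union(1) by (intro finite_measure_UNION) (auto simp: disjoint_family_on_def)
      then have "(\<lambda>i. prob A * prob (Y -` C i \<inter> space M)) sums (prob A * prob (\<Union>i. Y -` C i \<inter> space M))"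
        by (rule sums_mult)
      ultimately have "prob (\<Union>i. A \<inter> (N -` C i \<inter> space M)) = prob A * prob (\<Union>i. Y -` C i \<inter> space M)"
        unfolding union by (rule sums_unique2)
      moreover have "A \<inter> (N -` (\<Union>i. C i) \<inter> space M) = (\<Union>i. A \<inter> (N -` C i \<inter> space M))" by auto
      moreover have "Y -` (\<Union>i. C i) \<inter> space M = (\<Union>i. Y -` C i \<inter> space M)" by auto
      ultimately show ?case by simp
    qed
  qed
  have [measurable]: "(\<lambda>\<omega>. (\<omega>, N \<omega>)) \<in> measurable M (F \<Otimes>\<^sub>M borel)" using id by measurable
  have eq: "distr M F (\<lambda>\<omega>. \<omega>) \<Otimes>\<^sub>M distr M borel Y = distr M (F \<Otimes>\<^sub>M borel) (\<lambda>\<omega>. (\<omega>, N \<omega>))"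
  proof (rule pair_measure_eqI)
    show "sigma_finite_measure (distr M F (\<lambda>\<omega>. \<omega>))" "sigma_finite_measure (distr M borel Y)"
      using prob_space_distr[OF id] prob_space_distr[OF Y] prob_space_imp_sigma_finite by auto
    show "sets (distr M F (\<lambda>\<omega>. \<omega>) \<Otimes>\<^sub>M distr M borel Y) = sets (distr M (F \<Otimes>\<^sub>M borel) (\<lambda>\<omega>. (\<omega>, N \<omega>)))"
      by (simp cong: sets_pair_measure_cong)
    fix A C assume A: "A \<in> sets (distr M F (\<lambda>\<omega>. \<omega>))" and C: "C \<in> sets (distr M borel Y)"
    then have A': "A \<in> sets F" and C': "C \<in> sets borel" by auto
    have "(\<lambda>\<omega>. (\<omega>, N \<omega>)) -` (A \<times> C) \<inter> space M = A \<inter> (N -` C \<inter> space M)" by auto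
    moreover have "A \<inter> space M = A" using sets.sets_into_space[OF A'] FM by auto
    ultimately show "emeasure (distr M F (\<lambda>\<omega>. \<omega>)) A * emeasure (distr M borel Y) C = emeasure (distr M (F \<Otimes>\<^sub>M borel) (\<lambda>\<omega>. (\<omega>, N \<omega>))) (A \<times> C)"
      using all[OF A' C'] A' C' id
      by (simp add: emeasure_distr emeasure_eq_measure ennreal_mult[symmetric])
  qed
  have "(LINT \<omega>|M. \<Phi> \<omega> (N \<omega>)) = (LINT p|distr M (F \<Otimes>\<^sub>M borel) (\<lambda>\<omega>. (\<omega>, N \<omega>)). (\<lambda>(\<omega>, z). \<Phi> \<omega> z) p)"
    using \<Phi> by (subst integral_distr) auto
  also have "\<dots> = (LINT p|distr (M \<Otimes>\<^sub>M M) (F \<Otimes>\<^sub>M borel) (\<lambda>(x, y). (x, Y y)). (\<lambda>(\<omega>, z). \<Phi> \<omega> z) p)"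
  proof -
    have "sigma_finite_measure (distr M borel Y)" using prob_space_distr[OF Y] prob_space_imp_sigma_finite by auto
    from pair_measure_distr[OF id Y this] show ?thesis unfolding eq[symmetric] by simp
  qed
  also have "\<dots> = (LINT p|(M \<Otimes>\<^sub>M M). \<Phi> (fst p) (Y (snd p)))"
  proof -
    have "(\<lambda>(x, y). (x, Y y)) \<in> measurable (M \<Otimes>\<^sub>M M) (F \<Otimes>\<^sub>M borel)"
      using measurable_compose[OF measurable_fst id] by measurable
    then show ?thesis using \<Phi> by (subst integral_distr) (auto simp: split_beta)
  qed
  finally show ?thesis .
qed

section \<open>Phases converging to zero\<close>

text \<open>A mode of convergence to \<open>0\<close> in probability that acts directly on characteristic functions. It covers both differences that are small in \<open>L\<^sup>2\<close> and Gaussian variables known only through their characteristic function.\<close>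
definition null_phase :: "'w measure \<Rightarrow> (nat \<Rightarrow> 'w \<Rightarrow> real) \<Rightarrow> bool" where
  "null_phase M A \<longleftrightarrow> (\<forall>n. A n \<in> borel_measurable M) \<and> (\<lambda>n. LINT \<omega>|M. cmod (cis (A n \<omega>) - 1)) \<longlonglongrightarrow> 0"

lemma cmod_cis_minus_1_sq: "(cmod (cis x - 1))\<^sup>2 = 2 - 2 * Re (cis x)"
proof -
  have "(cmod (cis x - 1))\<^sup>2 = (cos x - 1)\<^sup>2 + (sin x)\<^sup>2" by (simp add: cmod_power2)
  also have "\<dots> = (sin x)\<^sup>2 + (cos x)\<^sup>2 + 1 - 2 * cos x" by (simp add: power2_eq_square algebra_simps)
  also have "\<dots> = 2 - 2 * Re (cis x)" by simp
  finally show ?thesis .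
qed

lemma cmod_cis_minus_1_sq_le: "(cmod (cis x - 1))\<^sup>2 \<le> x\<^sup>2"
proof -
  have "cos x = 1 - 2 * (sin (x / 2))\<^sup>2" using cos_double_sin[of "x / 2"] by simp
  moreover have "(sin (x / 2))\<^sup>2 \<le> (x / 2)\<^sup>2"
    using power_mono[OF abs_sin_x_le_abs_x[of "x / 2"], of 2] by (simp add: power_divide)
  ultimately show ?thesis unfolding cmod_cis_minus_1_sq by (simp add: power_divide)
qed

lemma cmod_cis_le_2: "cmod (cis x - 1) \<le> 2"
  using norm_triangle_ineq4[of "cis x" 1] by simp

lemma tendsto_0_squeeze:
  fixes f g :: "nat \<Rightarrow> real"
  assumes "\<And>n. 0 \<le> f n" "\<And>n. f n \<le> g n" "g \<longlonglongrightarrow> 0"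
  shows "f \<longlonglongrightarrow> 0"
  by (rule tendsto_sandwich[OF _ _ tendsto_const assms(3)]) (use assms in auto)

context prob_space
begin

lemma integral_le_sqrt:
  assumes [measurable]: "f \<in> borel_measurable M" and b: "\<And>\<omega>. \<bar>f \<omega>\<bar> \<le> (c::real)"
  shows "(LINT \<omega>|M. f \<omega>) \<le> sqrt (LINT \<omega>|M. (f \<omega>)\<^sup>2)"
proof -
  have i: "integrable M f" using b by (intro integrable_bounded[of _ c]) auto
  have "integrable M (\<lambda>\<omega>. (f \<omega>)\<^sup>2)"
    using b by (intro integrable_bounded[of _ "c\<^sup>2"]) (auto simp: abs_le_square_iff[symmetric] intro!: power_mono[of "\<bar>f x\<bar>" c 2 for x, simplified])
  then have "0 \<le> (LINT \<omega>|M. (f \<omega>)\<^sup>2) - (LINT \<omega>|M. f \<omega>)\<^sup>2"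
    using variance_positive[of f] variance_eq[OF i] by simp
  then show ?thesis by (simp add: real_le_rsqrt)
qed

lemma null_phaseI:
  assumes [measurable]: "\<And>n. A n \<in> borel_measurable M"
    and lim: "(\<lambda>n. LINT \<omega>|M. (cmod (cis (A n \<omega>) - 1))\<^sup>2) \<longlonglongrightarrow> 0"
  shows "null_phase M A"
proof -
  have lim': "(\<lambda>n. sqrt (LINT \<omega>|M. (cmod (cis (A n \<omega>) - 1))\<^sup>2)) \<longlonglongrightarrow> 0"
    using tendsto_real_sqrt[OF lim] by simp
  have le: "(LINT \<omega>|M. cmod (cis (A n \<omega>) - 1)) \<le> sqrt (LINT \<omega>|M. (cmod (cis (A n \<omega>) - 1))\<^sup>2)" for n
    by (rule integral_le_sqrt[of _ 2]) (auto intro: cmod_cis_le_2)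
  have "(\<lambda>n. LINT \<omega>|M. cmod (cis (A n \<omega>) - 1)) \<longlonglongrightarrow> 0"
    by (rule tendsto_0_squeeze[OF _ le lim']) simp
  then show ?thesis by (simp add: null_phase_def)
qed

lemma null_phase_L2:
  assumes A[measurable]: "\<And>n. A n \<in> borel_measurable M"
    and le: "\<And>n \<omega>. (A n \<omega>)\<^sup>2 \<le> c * q n \<omega>" and c: "c \<ge> 0" and q: "\<And>n \<omega>. q n \<omega> \<ge> 0" and [measurable]: "\<And>n. q n \<in> borel_measurable M"
    and lim: "(\<lambda>n. \<integral>\<^sup>+\<omega>. ennreal (q n \<omega>) \<partial>M) \<longlonglongrightarrow> 0"
  shows "null_phase M A"
proof (rule null_phaseI[OF A])
  have "(\<lambda>n. ennreal c * (\<integral>\<^sup>+\<omega>. ennreal (q n \<omega>) \<partial>M)) \<longlonglongrightarrow> ennreal c * 0"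
    using lim by (intro tendsto_mult_ennreal tendsto_const) auto
  then have lim': "(\<lambda>n. ennreal c * (\<integral>\<^sup>+\<omega>. ennreal (q n \<omega>) \<partial>M)) \<longlonglongrightarrow> 0" by simp
  have le': "ennreal (LINT \<omega>|M. (cmod (cis (A n \<omega>) - 1))\<^sup>2) \<le> ennreal c * (\<integral>\<^sup>+\<omega>. ennreal (q n \<omega>) \<partial>M)" for n
  proof -
    have "(cmod (cis x - 1))\<^sup>2 \<le> 4" for x
      using power_mono[OF cmod_cis_le_2[of x], of 2] by simp
    then have "integrable M (\<lambda>\<omega>. (cmod (cis (A n \<omega>) - 1))\<^sup>2)"
      by (intro integrable_bounded[of _ 4]) auto
    then have "ennreal (LINT \<omega>|M. (cmod (cis (A n \<omega>) - 1))\<^sup>2) = (\<integral>\<^sup>+\<omega>. ennreal ((cmod (cis (A n \<omega>) - 1))\<^sup>2) \<partial>M)"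
      by (subst nn_integral_eq_integral) auto
    also have "\<dots> \<le> (\<integral>\<^sup>+\<omega>. ennreal c * ennreal (q n \<omega>) \<partial>M)"
    proof (rule nn_integral_mono)
      fix \<omega>
      have "(cmod (cis (A n \<omega>) - 1))\<^sup>2 \<le> c * q n \<omega>"
        using cmod_cis_minus_1_sq_le le order_trans by blast
      then show "ennreal ((cmod (cis (A n \<omega>) - 1))\<^sup>2) \<le> ennreal c * ennreal (q n \<omega>)"
        using c q by (simp add: ennreal_mult[symmetric] ennreal_leI)
    qed
    also have "\<dots> = ennreal c * (\<integral>\<^sup>+\<omega>. ennreal (q n \<omega>) \<partial>M)" by (rule nn_integral_cmult) auto
    finally show ?thesis .
  qed
  have "(\<lambda>n. ennreal (LINT \<omega>|M. (cmod (cis (A n \<omega>) - 1))\<^sup>2)) \<longlonglongrightarrow> 0"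
    by (rule tendsto_sandwich[OF _ _ tendsto_const lim']) (auto intro!: always_eventually le')
  then show "(\<lambda>n. LINT \<omega>|M. (cmod (cis (A n \<omega>) - 1))\<^sup>2) \<longlonglongrightarrow> 0"
    by (simp add: ennreal_0[symmetric] del: ennreal_0)
qed

lemma null_phase_gauss:
  assumes A[measurable]: "\<And>n. A n \<in> borel_measurable M"
    and char: "\<And>n. (LINT \<omega>|M. cis (A n \<omega>)) = complex_of_real (exp (- q n / 2))"
    and q: "q \<longlonglongrightarrow> 0"
  shows "null_phase M A"
proof (rule null_phaseI[OF A])
  have "(LINT \<omega>|M. (cmod (cis (A n \<omega>) - 1))\<^sup>2) = 2 - 2 * exp (- q n / 2)" for n
  proof -
    have i: "integrable M (\<lambda>\<omega>. cis (A n \<omega>))" by (intro integrable_bounded[of _ 1]) auto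
    then have iR: "integrable M (\<lambda>\<omega>. Re (cis (A n \<omega>)))" by (rule integrable_Re)
    have "(LINT \<omega>|M. (cmod (cis (A n \<omega>) - 1))\<^sup>2) = (LINT \<omega>|M. 2 - 2 * Re (cis (A n \<omega>)))"
      by (simp only: cmod_cis_minus_1_sq)
    also have "\<dots> = 2 - 2 * (LINT \<omega>|M. Re (cis (A n \<omega>)))"
      using iR by (subst Bochner_Integration.integral_diff) (auto simp: prob_space simp del: cis.sel)
    also have "(LINT \<omega>|M. Re (cis (A n \<omega>))) = Re (LINT \<omega>|M. cis (A n \<omega>))" by (rule integral_Re[OF i])
    finally show ?thesis by (simp add: char)
  qed
  moreover have "(\<lambda>n. 2 - 2 * exp (- q n / 2)) \<longlonglongrightarrow> 2 - 2 * exp (- 0 / 2)"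
    by (intro tendsto_intros q) auto
  ultimately show "(\<lambda>n. LINT \<omega>|M. (cmod (cis (A n \<omega>) - 1))\<^sup>2) \<longlonglongrightarrow> 0" by simp
qed

lemma null_phase_add:
  assumes A: "null_phase M A" and B: "null_phase M B"
  shows "null_phase M (\<lambda>n \<omega>. A n \<omega> + B n \<omega>)"
proof -
  have [measurable]: "A n \<in> borel_measurable M" "B n \<in> borel_measurable M" for n
    using A B by (auto simp: null_phase_def)
  have i: "integrable M (\<lambda>\<omega>. cmod (cis (X \<omega>) - 1))" if [measurable]: "X \<in> borel_measurable M" for X
    by (intro integrable_bounded[of _ 2]) (auto intro: cmod_cis_le_2)
  have "(LINT \<omega>|M. cmod (cis (A n \<omega> + B n \<omega>) - 1)) \<le> (LINT \<omega>|M. cmod (cis (A n \<omega>) - 1)) + (LINT \<omega>|M. cmod (cis (B n \<omega>) - 1))" for n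
  proof -
    have "cmod (cis (a + b) - 1) \<le> cmod (cis a - 1) + cmod (cis b - 1)" for a b
    proof -
      have "cis (a + b) - 1 = cis b * (cis a - 1) + (cis b - 1)" by (simp add: cis_mult[symmetric] algebra_simps)
      then have "cmod (cis (a + b) - 1) \<le> cmod (cis b * (cis a - 1)) + cmod (cis b - 1)" by (metis norm_triangle_ineq)
      then show ?thesis by (simp add: norm_mult)
    qed
    then have "(LINT \<omega>|M. cmod (cis (A n \<omega> + B n \<omega>) - 1)) \<le> (LINT \<omega>|M. cmod (cis (A n \<omega>) - 1) + cmod (cis (B n \<omega>) - 1))"
      by (intro integral_mono) (auto intro!: i Bochner_Integration.integrable_add)
    then show ?thesis by (subst (asm) Bochner_Integration.integral_add) (auto intro!: i)
  qed
  then have le: "(LINT \<omega>|M. cmod (cis (A n \<omega> + B n \<omega>) - 1)) \<le> (LINT \<omega>|M. cmod (cis (A n \<omega>) - 1)) + (LINT \<omega>|M. cmod (cis (B n \<omega>) - 1))" for n .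
  have "(\<lambda>n. (LINT \<omega>|M. cmod (cis (A n \<omega>) - 1)) + (LINT \<omega>|M. cmod (cis (B n \<omega>) - 1))) \<longlonglongrightarrow> 0 + 0"
    using A B unfolding null_phase_def by (intro tendsto_add) auto
  then have "(\<lambda>n. (LINT \<omega>|M. cmod (cis (A n \<omega>) - 1)) + (LINT \<omega>|M. cmod (cis (B n \<omega>) - 1))) \<longlonglongrightarrow> 0" by simp
  from tendsto_0_squeeze[OF _ le this] have "(\<lambda>n. LINT \<omega>|M. cmod (cis (A n \<omega> + B n \<omega>) - 1)) \<longlonglongrightarrow> 0" by simp
  then show ?thesis by (simp add: null_phase_def)
qed

lemma null_phase_cong:
  assumes "null_phase M A" "\<And>n \<omega>. A n \<omega> = B n \<omega>" shows "null_phase M B"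
proof -
  have "A = B" using assms(2) by (intro ext)
  with assms(1) show ?thesis by simp
qed

lemma null_phase_minus:
  assumes A: "null_phase M A"
  shows "null_phase M (\<lambda>n \<omega>. - A n \<omega>)"
proof -
  have "cmod (cis (- a) - 1) = cmod (cis a - 1)" for a
  proof -
    have "cis (- a) - 1 = cnj (cis a - 1)" by (simp add: cis_cnj)
    then show ?thesis by (metis complex_mod_cnj)
  qed
  then show ?thesis using A by (simp add: null_phase_def)
qed

text \<open>If \<open>X - B n\<close> is negligible, then characteristic functions of \<open>B n\<close>, with any bounded weight, converge to those of \<open>X\<close>.\<close>
lemma null_phase_transfer:
  assumes d: "null_phase M (\<lambda>n \<omega>. X \<omega> - B n \<omega>)"
    and [measurable]: "X \<in> borel_measurable M" "\<And>n. B n \<in> borel_measurable M" "\<theta> \<in> borel_measurable M"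
    and \<theta>: "\<And>\<omega>. cmod (\<theta> \<omega>) \<le> c"
  shows "(\<lambda>n. LINT \<omega>|M. \<theta> \<omega> * cis (B n \<omega>)) \<longlonglongrightarrow> (LINT \<omega>|M. \<theta> \<omega> * cis (X \<omega>))"
proof -
  have i: "integrable M (\<lambda>\<omega>. cmod (cis (X \<omega> - B n \<omega>) - 1))" for n
    by (intro integrable_bounded[of _ 2]) (auto intro: cmod_cis_le_2)
  have j: "integrable M (\<lambda>\<omega>. \<theta> \<omega> * cis (Y \<omega>))" if [measurable]: "Y \<in> borel_measurable M" for Y
    using \<theta> by (intro integrable_bounded[of _ c]) (auto simp: norm_mult)
  have "cmod ((LINT \<omega>|M. \<theta> \<omega> * cis (B n \<omega>)) - (LINT \<omega>|M. \<theta> \<omega> * cis (X \<omega>))) \<le> c * (LINT \<omega>|M. cmod (cis (X \<omega> - B n \<omega>) - 1))" for n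
  proof -
    have "(LINT \<omega>|M. \<theta> \<omega> * cis (B n \<omega>)) - (LINT \<omega>|M. \<theta> \<omega> * cis (X \<omega>)) = (LINT \<omega>|M. \<theta> \<omega> * cis (B n \<omega>) - \<theta> \<omega> * cis (X \<omega>))"
      by (rule Bochner_Integration.integral_diff[symmetric]) (auto intro!: j)
    also have "cmod \<dots> \<le> (LINT \<omega>|M. cmod (\<theta> \<omega> * cis (B n \<omega>) - \<theta> \<omega> * cis (X \<omega>)))"
      by (rule integral_norm_bound)
    also have "\<dots> \<le> (LINT \<omega>|M. c * cmod (cis (X \<omega> - B n \<omega>) - 1))"
    proof (rule integral_mono)
      fix \<omega>
      have "\<theta> \<omega> * cis (B n \<omega>) - \<theta> \<omega> * cis (X \<omega>) = - (\<theta> \<omega> * (cis (B n \<omega>) * (cis (X \<omega> - B n \<omega>) - 1)))"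
        by (simp add: right_diff_distrib cis_mult)
      then have "cmod (\<theta> \<omega> * cis (B n \<omega>) - \<theta> \<omega> * cis (X \<omega>)) = cmod (\<theta> \<omega>) * cmod (cis (X \<omega> - B n \<omega>) - 1)"
        by (simp add: norm_mult)
      also have "\<dots> \<le> c * cmod (cis (X \<omega> - B n \<omega>) - 1)" using \<theta> by (intro mult_right_mono) auto
      finally show "cmod (\<theta> \<omega> * cis (B n \<omega>) - \<theta> \<omega> * cis (X \<omega>)) \<le> c * cmod (cis (X \<omega> - B n \<omega>) - 1)" .
    next
      show "integrable M (\<lambda>\<omega>. cmod (\<theta> \<omega> * cis (B n \<omega>) - \<theta> \<omega> * cis (X \<omega>)))"
        by (intro integrable_norm Bochner_Integration.integrable_diff j) auto
      show "integrable M (\<lambda>\<omega>. c * cmod (cis (X \<omega> - B n \<omega>) - 1))"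
        by (intro integrable_mult_right i)
    qed
    also have "\<dots> = c * (LINT \<omega>|M. cmod (cis (X \<omega> - B n \<omega>) - 1))" by simp
    finally show ?thesis .
  qed
  then have le: "eventually (\<lambda>n. norm ((LINT \<omega>|M. \<theta> \<omega> * cis (B n \<omega>)) - (LINT \<omega>|M. \<theta> \<omega> * cis (X \<omega>)))
      \<le> c * (LINT \<omega>|M. cmod (cis (X \<omega> - B n \<omega>) - 1))) sequentially"
    by (intro always_eventually allI)
  have "(\<lambda>n. c * (LINT \<omega>|M. cmod (cis (X \<omega> - B n \<omega>) - 1))) \<longlonglongrightarrow> 0"
    using d unfolding null_phase_def by (auto intro: tendsto_mult_right_zero)
  from Lim_null_comparison[OF le this] show ?thesis by (rule LIM_zero_cancel)
qed

end

section \<open>Brownian increments\<close>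

locale cylindrical_BM =
  fixes M :: "'w measure" and F :: "real \<Rightarrow> 'w measure"
    and W :: "'x::{real_inner, banach, second_countable_topology} \<Rightarrow> real \<Rightarrow> 'w \<Rightarrow> real"
  assumes filt: "filtered_prob_space_usual M F"
    and BM: "cylindrical_brownian_motion M F W"
begin

sublocale prob_space M using filt by (simp add: filtered_prob_space_usual_def)

lemma F_sub: "t \<ge> 0 \<Longrightarrow> subalgebra M (F t)"
  using filt by (simp add: filtered_prob_space_usual_def)

lemma F_mono: "0 \<le> s \<Longrightarrow> s \<le> t \<Longrightarrow> sets (F s) \<subseteq> sets (F t)"
  using filt unfolding filtered_prob_space_usual_def by blast

lemma space_F: "t \<ge> 0 \<Longrightarrow> space (F t) = space M"
  using F_sub by (auto simp: subalgebra_def)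

lemma F_subalg: "0 \<le> s \<Longrightarrow> s \<le> t \<Longrightarrow> subalgebra (F t) (F s)"
  using F_mono space_F by (auto simp: subalgebra_def)

lemma meas_F_mono: "f \<in> measurable (F s) N \<Longrightarrow> 0 \<le> s \<Longrightarrow> s \<le> t \<Longrightarrow> f \<in> measurable (F t) N"
  using measurable_from_subalg[OF F_subalg] by blast

lemma meas_F_M: "f \<in> measurable (F s) N \<Longrightarrow> 0 \<le> s \<Longrightarrow> f \<in> measurable M N"
  using measurable_from_subalg[OF F_sub] by blast

lemma W_meas: "t \<ge> 0 \<Longrightarrow> W k t \<in> borel_measurable (F t)"
  using BM by (simp add: cylindrical_brownian_motion_def)

lemma W_meas': "0 \<le> s \<Longrightarrow> s \<le> t \<Longrightarrow> W k s \<in> borel_measurable (F t)"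
  using W_meas meas_F_mono by blast

lemma W_meas_M: "t \<ge> 0 \<Longrightarrow> W k t \<in> borel_measurable M"
  using W_meas meas_F_M by blast

lemma W_linear: "t \<ge> 0 \<Longrightarrow> AE \<omega> in M. W (a *\<^sub>R k + b *\<^sub>R k') t \<omega> = a * W k t \<omega> + b * W k' t \<omega>"
  using BM by (simp add: cylindrical_brownian_motion_def)

lemma W_zero: "t \<ge> 0 \<Longrightarrow> AE \<omega> in M. W 0 t \<omega> = 0"
  using W_linear[of t 0 0 0 0] by simp

lemma W_scale: "t \<ge> 0 \<Longrightarrow> AE \<omega> in M. W (a *\<^sub>R k) t \<omega> = a * W k t \<omega>"
  using W_linear[of t a k 0 0] by simp

lemma W_add: "t \<ge> 0 \<Longrightarrow> AE \<omega> in M. W (k + k') t \<omega> = W k t \<omega> + W k' t \<omega>"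
  using W_linear[of t 1 k 1 k'] by simp

lemma char_increment:
  assumes "0 \<le> s" "s < t" "k \<noteq> 0"
  shows "(LINT \<omega>|M. cis (W k t \<omega> - W k s \<omega>)) = complex_of_real (exp (- ((t - s) * (norm k)\<^sup>2) / 2))"
proof -
  define v where "v = sqrt (t - s) * norm k"
  have v: "v > 0" using assms by (simp add: v_def)
  have d: "distributed M lborel (\<lambda>\<omega>. W k t \<omega> - W k s \<omega>) (normal_density 0 v)"
    using BM assms by (simp add: cylindrical_brownian_motion_def v_def)
  have [measurable]: "W k t \<in> borel_measurable M" "W k s \<in> borel_measurable M"
    using W_meas_M assms by auto
  define Y where "Y \<omega> = (W k t \<omega> - W k s \<omega>) / v" for \<omega>
  have [measurable]: "Y \<in> borel_measurable M" unfolding Y_def[abs_def] by measurable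
  have "distributed M lborel Y std_normal_density"
    using normal_standard_normal_convert[OF v, of _ 0] d by (simp add: Y_def[abs_def])
  then have "distr M lborel Y = std_normal_distribution"
    by (simp add: distributed_def)
  then have "distr M borel Y = std_normal_distribution"
    by (metis distr_cong sets_lborel)
  then have "(LINT \<omega>|M. cis (v * Y \<omega>)) = char std_normal_distribution v"
    using char_distr_cis[of Y M v] by simp
  also have "\<dots> = complex_of_real (exp (- (v\<^sup>2) / 2))" by (simp add: char_std_normal_distribution)
  finally show ?thesis using v assms by (simp add: Y_def v_def power_mult_distrib)
qed

lemma weighted_char_increment:
  assumes st: "0 \<le> s" "s \<le> t" and \<theta>: "\<theta> \<in> borel_measurable (F s)" and b: "\<And>\<omega>. cmod (\<theta> \<omega>) \<le> c"
  shows "(LINT \<omega>|M. \<theta> \<omega> * cis (W k t \<omega> - W k s \<omega>)) = (LINT \<omega>|M. \<theta> \<omega>) * complex_of_real (exp (- ((t - s) * (norm k)\<^sup>2) / 2))"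
proof -
  have [measurable]: "W k t \<in> borel_measurable M" "W k s \<in> borel_measurable M" "\<theta> \<in> borel_measurable M"
    using W_meas_M assms meas_F_M by auto
  consider "s = t" | "k = 0" | "s < t" "k \<noteq> 0" using st by fastforce
  then show ?thesis
  proof cases
    case 2
    have "(LINT \<omega>|M. \<theta> \<omega> * cis (W k t \<omega> - W k s \<omega>)) = (LINT \<omega>|M. \<theta> \<omega>)"
    proof (rule integral_cong_AE)
      show "AE \<omega> in M. \<theta> \<omega> * cis (W k t \<omega> - W k s \<omega>) = \<theta> \<omega>"
        using W_zero[of t] W_zero[of s] st unfolding 2 by (auto elim: AE_mp)
    qed measurable
    then show ?thesis using 2 by simp
  next
    case 3
    let ?I = "\<lambda>\<omega>. W k t \<omega> - W k s \<omega>"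
    have ind: "indep_set (sets (vimage_algebra (space M) ?I borel)) (sets (F s))"
      using BM st by (simp add: cylindrical_brownian_motion_def)
    let ?C = "\<lambda>\<omega>. cis (?I \<omega>)"
    have "{?C -` A \<inter> space M |A. A \<in> sets borel} \<subseteq> sets (vimage_algebra (space M) ?I borel)"
    proof safe
      fix A :: "complex set" assume "A \<in> sets borel"
      then have "cis -` A \<in> sets borel" using measurable_sets[OF cis_measurable, of A] by simp
      then have "?I -` (cis -` A) \<inter> space M \<in> sets (vimage_algebra (space M) ?I borel)"
        by (rule in_vimage_algebra)
      then show "?C -` A \<inter> space M \<in> sets (vimage_algebra (space M) ?I borel)"
        by (simp add: vimage_def)
    qed
    then have 1: "sigma_sets (space M) {?C -` A \<inter> space M |A. A \<in> sets borel} \<subseteq> sets (vimage_algebra (space M) ?I borel)"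
      using sets.sigma_sets_subset[of _ "vimage_algebra (space M) ?I borel"] by simp
    have "{\<theta> -` A \<inter> space M |A. A \<in> sets borel} \<subseteq> sets (F s)"
      using measurable_sets[OF \<theta>] space_F[OF st(1)] by auto
    then have 2: "sigma_sets (space M) {\<theta> -` A \<inter> space M |A. A \<in> sets borel} \<subseteq> sets (F s)"
      using sets.sigma_sets_subset[of _ "F s"] space_F[OF st(1)] by simp
    have "indep_set (sigma_sets (space M) {?C -` A \<inter> space M |A. A \<in> sets borel}) (sigma_sets (space M) {\<theta> -` A \<inter> space M |A. A \<in> sets borel})"
      using ind 1 2 unfolding indep_sets2_eq by blast
    then have iv: "indep_var borel ?C borel \<theta>"
      unfolding indep_var_eq by simp
    have "(LINT \<omega>|M. cis (?I \<omega>) * \<theta> \<omega>) = (LINT \<omega>|M. cis (?I \<omega>)) * (LINT \<omega>|M. \<theta> \<omega>)"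
    proof (rule indep_var_lebesgue_integral[OF iv])
      show "integrable M ?C" by (rule integrable_bounded[of _ 1]) auto
      show "integrable M \<theta>" by (rule integrable_bounded[of _ c]) (auto intro: b)
    qed
    then show ?thesis using char_increment[OF st(1) 3] by (simp add: mult.commute)
  qed simp
qed

text \<open>The integral of the step function \<open>kernel zs\<close> over \<open>(0, r]\<close>; it is stopped at \<open>r\<close> so that an induction on \<open>r\<close> is possible.\<close>
definition increments :: "real \<Rightarrow> (real \<times> real \<times> 'x) list \<Rightarrow> 'w \<Rightarrow> real" where
  "increments r zs \<omega> = (\<Sum>(a, b, e)\<leftarrow>zs. W e (min b r) \<omega> - W e (min a r) \<omega>)"

definition kernel :: "(real \<times> real \<times> 'x) list \<Rightarrow> real \<Rightarrow> 'x" where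
  "kernel zs s = (\<Sum>(a, b, e)\<leftarrow>zs. indicator {a<..b} s *\<^sub>R e)"

lemma increments_meas:
  assumes "\<forall>(a, b, e)\<in>set zs. 0 \<le> a \<and> a \<le> b" "0 \<le> r"
  shows "increments r zs \<in> borel_measurable (F r)"
  using assms(1)
proof (induction zs)
  case Nil then show ?case by (simp add: increments_def[abs_def])
next
  case (Cons p zs)
  obtain a b e where p: "p = (a, b, e)" by (cases p) auto
  have "increments r (p # zs) = (\<lambda>\<omega>. (W e (min b r) \<omega> - W e (min a r) \<omega>) + increments r zs \<omega>)"
    by (auto simp: increments_def p)
  moreover have "W e (min b r) \<in> borel_measurable (F r)" "W e (min a r) \<in> borel_measurable (F r)"
    using Cons.prems p assms(2) by (auto intro!: W_meas')
  moreover have "increments r zs \<in> borel_measurable (F r)" using Cons by simp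
  ultimately show ?case by (simp only:) (intro borel_measurable_add borel_measurable_diff)
qed

lemma kernel_Cons: "kernel ((a, b, e) # zs) s = indicator {a<..b} s *\<^sub>R e + kernel zs s"
  by (simp add: kernel_def)

lemma kernel_measurable [measurable]: "kernel zs \<in> borel_measurable borel"
proof (induction zs)
  case Nil then show ?case by (simp add: kernel_def[abs_def])
next
  case (Cons p zs)
  obtain a b e where p: "p = (a, b, e)" by (cases p) auto
  note [measurable] = Cons
  have "(\<lambda>s. indicator {a<..b} s *\<^sub>R e + kernel zs s) \<in> borel_measurable borel" by measurable
  then show ?case unfolding p kernel_Cons[abs_def] .
qed

lemma kernel_bound: "norm (kernel zs s) \<le> (\<Sum>(a, b, e)\<leftarrow>zs. norm e)"
proof (induction zs)
  case Nil then show ?case by (simp add: kernel_def)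
next
  case (Cons p zs)
  obtain a b e where p: "p = (a, b, e)" by (cases p) auto
  have "norm (kernel (p # zs) s) \<le> norm (indicator {a<..b} s *\<^sub>R e) + norm (kernel zs s)"
    unfolding p kernel_Cons by (rule norm_triangle_ineq)
  also have "norm (indicator {a<..b} s *\<^sub>R e) \<le> norm e" by (simp add: indicator_def)
  finally show ?case using Cons by (simp add: p)
qed

lemma kernel_sq_integrable: "set_integrable lborel {a<..b} (\<lambda>s. (norm (kernel zs s))\<^sup>2)"
proof (cases "a \<le> b")
  case True
  define C where "C = (\<Sum>(a, b, e)\<leftarrow>zs. norm e)"
  show ?thesis
  proof (rule set_integrable_bound)
    show "set_integrable lborel {a<..b} (\<lambda>_. C\<^sup>2)"
      using True by (auto simp: set_integrable_def intro!: integrable_real_indicator integrable_mult_left)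
    show "set_borel_measurable lborel {a<..b} (\<lambda>s. (norm (kernel zs s))\<^sup>2)"
      unfolding set_borel_measurable_def by measurable
    show "AE s in lborel. s \<in> {a<..b} \<longrightarrow> norm ((norm (kernel zs s))\<^sup>2) \<le> norm (C\<^sup>2)"
      using kernel_bound[of zs] by (auto simp: C_def intro!: power_mono AE_I2)
  qed
next
  case False then have "{a<..b} = {}" by auto
  then show ?thesis by simp
qed

lemma AE_sum_list_increment:
  assumes "0 \<le> r" "0 \<le> s"
  shows "AE \<omega> in M. (\<Sum>e\<leftarrow>es. W e r \<omega> - W e s \<omega>) = W (sum_list es) r \<omega> - W (sum_list es) s \<omega>"
proof (induction es)
  case Nil
  show ?case using W_zero[OF assms(1)] W_zero[OF assms(2)] by (auto elim: AE_mp)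
next
  case (Cons e es)
  show ?case using Cons W_add[OF assms(1), of e "sum_list es"] W_add[OF assms(2), of e "sum_list es"]
    by eventually_elim simp
qed

text \<open>Between consecutive breakpoints the kernel is constant, so the increments collapse to one increment \<open>W g\<close>, which is independent of the past and Gaussian. The induction, on the number of breakpoints in \<open>(t, r)\<close>, peels off the last such interval and absorbs the earlier phase into the weight.\<close>
lemma weighted_char_increments:
  assumes zs: "\<forall>(a, b, e)\<in>set zs. t \<le> a \<and> a \<le> b" and t: "0 \<le> t" and r: "t \<le> r"
    and \<theta>: "\<theta> \<in> borel_measurable (F t)" and c: "\<And>\<omega>. cmod (\<theta> \<omega>) \<le> c"
  shows "(LINT \<omega>|M. \<theta> \<omega> * cis (increments r zs \<omega>)) = (LINT \<omega>|M. \<theta> \<omega>) * complex_of_real (exp (- (LINT s:{t<..r}|lborel. (norm (kernel zs s))\<^sup>2) / 2))"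
  using r
proof (induction "card (((\<lambda>(a, b, e). a) ` set zs \<union> (\<lambda>(a, b, e). b) ` set zs) \<inter> {t<..<r})" arbitrary: r rule: less_induct)
  case (less r)
  define P where "P = (\<lambda>(a, b, e). a) ` set zs \<union> (\<lambda>(a, b, e). b) ` set zs"
  have finP: "finite P" by (simp add: P_def)
  have zsD: "t \<le> a" "a \<le> b" "a \<in> P" "b \<in> P" if "(a, b, e) \<in> set zs" for a b e
    using bspec[OF zs that] that unfolding P_def by (auto intro: UnI1 UnI2 image_eqI[of _ _ "(a, b, e)"])
  have zero: "increments t zs \<omega> = 0" for \<omega>
  proof -
    have "map (\<lambda>(a, b, e). W e (min b t) \<omega> - W e (min a t) \<omega>) zs = map (\<lambda>_. 0) zs"
    proof (intro map_cong refl)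
      fix p assume p: "p \<in> set zs"
      obtain a b e where pe: "p = (a, b, e)" by (cases p) auto
      have "min b t = t" "min a t = t" using zsD[of a b e] p pe by auto
      then show "(case p of (a, b, e) \<Rightarrow> W e (min b t) \<omega> - W e (min a t) \<omega>) = 0" by (simp add: pe)
    qed
    then have "increments t zs \<omega> = sum_list (map (\<lambda>_. 0) zs)" by (simp only: increments_def)
    then show ?thesis by simp
  qed
  show ?case
  proof (cases "r = t")
    case True
    then show ?thesis by (simp add: zero set_lebesgue_integral_def)
  next
    case False
    then have tr: "t < r" using less.prems by simp
    \<comment> \<open>the last breakpoint before \<open>r\<close>\<close>
    define r0 where "r0 = (if P \<inter> {t<..<r} = {} then t else Max (P \<inter> {t<..<r}))"
    have mem: "r0 \<in> P \<inter> {t<..<r}" if "P \<inter> {t<..<r} \<noteq> {}"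
      using that finP Max_in[of "P \<inter> {t<..<r}"] by (simp add: r0_def)
    have r0: "t \<le> r0" "r0 < r"
    proof (atomize (full), cases "P \<inter> {t<..<r} = {}")
      case True
      then have "r0 = t" by (simp add: r0_def)
      with tr show "t \<le> r0 \<and> r0 < r" by simp
    next
      case False
      from mem[OF this] show "t \<le> r0 \<and> r0 < r" by auto
    qed
    have gap: "x \<le> r0 \<or> r \<le> x" if "x \<in> P" "t \<le> x" for x
    proof (rule ccontr)
      assume "\<not> ?thesis"
      then have x: "x \<in> P \<inter> {t<..<r}" "r0 < x" using that r0 by auto
      then have eq: "r0 = Max (P \<inter> {t<..<r})" by (auto simp: r0_def)
      have "x \<le> Max (P \<inter> {t<..<r})" using finP x(1) by (intro Max_ge) auto
      with x(2) eq show False by linarith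
    qed
    have IH: "(LINT \<omega>|M. \<theta> \<omega> * cis (increments r0 zs \<omega>)) = (LINT \<omega>|M. \<theta> \<omega>) * complex_of_real (exp (- (LINT s:{t<..r0}|lborel. (norm (kernel zs s))\<^sup>2) / 2))"
    proof (cases "P \<inter> {t<..<r} = {}")
      case True
      then have "r0 = t" by (simp add: r0_def)
      then show ?thesis by (simp add: zero set_lebesgue_integral_def)
    next
      case False
      have "P \<inter> {t<..<r0} \<subset> P \<inter> {t<..<r}" using mem[OF False] r0 by auto
      then have "card (P \<inter> {t<..<r0}) < card (P \<inter> {t<..<r})" using finP by (intro psubset_card_mono) auto
      then show ?thesis unfolding P_def using r0(1) by (rule less.hyps)
    qed
    define es where "es = map (\<lambda>(a, b, e). if a \<le> r0 \<and> r \<le> b then e else 0) zs"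
    define g where "g = sum_list es"
    have kern: "kernel zs s = g" if "s \<in> {r0<..<r}" for s
    proof -
      have "map (\<lambda>(a, b, e). indicator {a<..b} s *\<^sub>R e) zs = es"
        unfolding es_def
      proof (intro map_cong refl)
        fix p assume p: "p \<in> set zs"
        obtain a b e where pe: "p = (a, b, e)" by (cases p) auto
        note ab = zsD[OF p[unfolded pe]]
        have "t \<le> b" using ab by linarith
        then have "a \<le> r0 \<or> r \<le> a" "b \<le> r0 \<or> r \<le> b" using gap ab by blast+
        then show "(case p of (a, b, e) \<Rightarrow> indicator {a<..b} s *\<^sub>R e) = (case p of (a, b, e) \<Rightarrow> if a \<le> r0 \<and> r \<le> b then e else 0)"
          using that by (auto simp: pe indicator_def)
      qed
      then show ?thesis by (simp add: kernel_def g_def)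
    qed
    have incr: "AE \<omega> in M. increments r zs \<omega> = increments r0 zs \<omega> + (W g r \<omega> - W g r0 \<omega>)"
    proof -
      have z0: "AE \<omega> in M. W 0 r \<omega> = 0 \<and> W 0 r0 \<omega> = 0"
        using W_zero[of r] W_zero[of r0] r0 t by auto
      have "AE \<omega> in M. (\<Sum>e\<leftarrow>es. W e r \<omega> - W e r0 \<omega>) = W g r \<omega> - W g r0 \<omega>"
        unfolding g_def using r0 t by (intro AE_sum_list_increment) auto
      with z0 show ?thesis
      proof eventually_elim
        case (elim \<omega>)
        have "increments r zs \<omega> - increments r0 zs \<omega> = (\<Sum>(a, b, e)\<leftarrow>zs. (W e (min b r) \<omega> - W e (min a r) \<omega>) - (W e (min b r0) \<omega> - W e (min a r0) \<omega>))"
          unfolding increments_def by (induction zs) auto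
        also have "map (\<lambda>(a, b, e). (W e (min b r) \<omega> - W e (min a r) \<omega>) - (W e (min b r0) \<omega> - W e (min a r0) \<omega>)) zs
            = map (\<lambda>e. W e r \<omega> - W e r0 \<omega>) es"
          unfolding es_def map_map
        proof (intro map_cong refl)
          fix p assume p: "p \<in> set zs"
          obtain a b e where pe: "p = (a, b, e)" by (cases p) auto
          note zp = zsD[OF p[unfolded pe]]
          have "t \<le> b" using zp by linarith
          then have ab: "a \<le> r0 \<or> r \<le> a" "b \<le> r0 \<or> r \<le> b" "a \<le> b" using gap zp by blast+
          consider "a \<le> r0" "r \<le> b" | "b \<le> r0" "a \<le> r0" | "r \<le> a" "r \<le> b" using ab by linarith
          then show "(case p of (a, b, e) \<Rightarrow> (W e (min b r) \<omega> - W e (min a r) \<omega>) - (W e (min b r0) \<omega> - W e (min a r0) \<omega>))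
              = ((\<lambda>e. W e r \<omega> - W e r0 \<omega>) \<circ> (\<lambda>(a, b, e). if a \<le> r0 \<and> r \<le> b then e else 0)) p"
            by cases (use elim r0 in \<open>auto simp: pe min_def\<close>)
        qed
        finally show ?case using elim by simp
      qed
    qed
    have zs0: "\<forall>(a, b, e)\<in>set zs. 0 \<le> a \<and> a \<le> b" using zs t by auto
    have im: "increments r0 zs \<in> borel_measurable (F r0)" using zs0 r0 t by (intro increments_meas) auto
    have \<theta>0: "\<theta> \<in> borel_measurable (F r0)" by (rule meas_F_mono[OF \<theta> t r0(1)])
    have [measurable]: "\<theta> \<in> borel_measurable M" "increments r0 zs \<in> borel_measurable M" "increments r zs \<in> borel_measurable M"
      "W g r \<in> borel_measurable M" "W g r0 \<in> borel_measurable M"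
    proof -
      have nn: "0 \<le> r0" "0 \<le> r" using t r0 by auto
      show "\<theta> \<in> borel_measurable M" by (rule meas_F_M[OF \<theta> t])
      show "increments r0 zs \<in> borel_measurable M" by (rule meas_F_M[OF im nn(1)])
      show "increments r zs \<in> borel_measurable M" by (rule meas_F_M[OF increments_meas[OF zs0 nn(2)] nn(2)])
      show "W g r \<in> borel_measurable M" "W g r0 \<in> borel_measurable M" using nn by (auto intro: W_meas_M)
    qed
    have "(LINT \<omega>|M. \<theta> \<omega> * cis (increments r zs \<omega>)) = (LINT \<omega>|M. (\<theta> \<omega> * cis (increments r0 zs \<omega>)) * cis (W g r \<omega> - W g r0 \<omega>))"
      using incr by (intro integral_cong_AE) (auto simp: cis_mult mult.assoc elim!: eventually_mono)
    also have "\<dots> = (LINT \<omega>|M. \<theta> \<omega> * cis (increments r0 zs \<omega>)) * complex_of_real (exp (- ((r - r0) * (norm g)\<^sup>2) / 2))"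
    proof (rule weighted_char_increment)
      show "(\<lambda>\<omega>. \<theta> \<omega> * cis (increments r0 zs \<omega>)) \<in> borel_measurable (F r0)"
        using \<theta>0 im by measurable
      show "cmod (\<theta> \<omega> * cis (increments r0 zs \<omega>)) \<le> c" for \<omega> using c by (simp add: norm_mult)
    qed (use r0 t in auto)
    also have "\<dots> = (LINT \<omega>|M. \<theta> \<omega>) * complex_of_real (exp (- (LINT s:{t<..r}|lborel. (norm (kernel zs s))\<^sup>2) / 2))"
    proof -
      have "(LINT s:{t<..r}|lborel. (norm (kernel zs s))\<^sup>2) = (LINT s:{t<..r0} \<union> {r0<..r}|lborel. (norm (kernel zs s))\<^sup>2)"
        using r0 by (subst ivl_disj_un) auto
      also have "\<dots> = (LINT s:{t<..r0}|lborel. (norm (kernel zs s))\<^sup>2) + (LINT s:{r0<..r}|lborel. (norm (kernel zs s))\<^sup>2)"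
        by (intro set_integral_Un kernel_sq_integrable) auto
      also have "(LINT s:{r0<..r}|lborel. (norm (kernel zs s))\<^sup>2) = (LINT s:{r0<..r}|lborel. (norm g)\<^sup>2)"
        unfolding set_lebesgue_integral_def
      proof (rule integral_cong_AE)
        show "AE s in lborel. indicator {r0<..r} s *\<^sub>R (norm (kernel zs s))\<^sup>2 = indicator {r0<..r} s *\<^sub>R (norm g)\<^sup>2"
          using AE_lborel_singleton[of r] by eventually_elim (auto simp: indicator_def kern)
      qed measurable
      also have "\<dots> = (r - r0) * (norm g)\<^sup>2" using r0 by (simp add: set_lebesgue_integral_def)
      finally have e: "(LINT s:{t<..r}|lborel. (norm (kernel zs s))\<^sup>2) = (LINT s:{t<..r0}|lborel. (norm (kernel zs s))\<^sup>2) + (r - r0) * (norm g)\<^sup>2" .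
      show ?thesis unfolding IH e
        by (simp add: mult.assoc of_real_mult[symmetric] exp_add[symmetric] add_divide_distrib diff_divide_distrib del: of_real_mult of_real_exp)
    qed
    finally show ?thesis .
  qed
qed

end

section \<open>Characteristic functions of step integrals\<close>

type_synonym ('x, 'h) step = "(real \<times> real \<times> 'x \<times> 'h) list"

definition map_values :: "('h \<Rightarrow> 'g) \<Rightarrow> ('x, 'h) step \<Rightarrow> ('x, 'g) step" where
  "map_values f xs = map (\<lambda>(a, b, e, h). (a, b, e, f h)) xs"

definition map_times :: "(real \<Rightarrow> real) \<Rightarrow> ('x, 'h) step \<Rightarrow> ('x, 'h) step" where
  "map_times f xs = map (\<lambda>(a, b, e, h). (f a, f b, e, h)) xs"

text \<open>The scalar step integrand obtained by pairing the values with \<open>y\<close>.\<close>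
definition project :: "'h::real_inner \<Rightarrow> ('x::real_inner, 'h) step \<Rightarrow> (real \<times> real \<times> 'x) list" where
  "project y xs = map (\<lambda>(a, b, e, h). (a, b, (h \<bullet> y) *\<^sub>R e)) xs"

lemma square_add_le: "(a + b)\<^sup>2 \<le> 2 * (a\<^sup>2 + b\<^sup>2)" for a b :: real
proof -
  have "0 \<le> (a - b)\<^sup>2" by simp
  then show ?thesis by (simp add: power2_eq_square algebra_simps)
qed

lemma step_integral_append: "step_integral W (xs @ ys) \<omega> = step_integral W xs \<omega> + step_integral W ys \<omega>"
  by (simp add: step_integral_def)

lemma step_integrand_append: "step_integrand (xs @ ys) s k = step_integrand xs s k + step_integrand ys s k"
  by (simp add: step_integrand_def)

lemma step_integral_map_values:
  assumes "linear f" shows "step_integral W (map_values f xs) \<omega> = f (step_integral W xs \<omega>)"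
proof -
  interpret linear f by fact
  show ?thesis by (induction xs) (auto simp: step_integral_def map_values_def zero add scale split_beta)
qed

lemma step_integrand_map_values:
  assumes "linear f" shows "step_integrand (map_values f xs) s k = f (step_integrand xs s k)"
proof -
  interpret linear f by fact
  show ?thesis by (induction xs) (auto simp: step_integrand_def map_values_def zero add scale split_beta)
qed

lemma step_integral_split:
  "step_integral W xs \<omega> = step_integral W (map_times (min t) xs) \<omega> + step_integral W (map_times (max t) xs) \<omega>"
proof (induction xs)
  case Nil then show ?case by (simp add: step_integral_def map_times_def)
next
  case (Cons p xs)
  obtain a b e h where p: "p = (a, b, e, h)" by (cases p) auto
  have "W e b \<omega> - W e a \<omega> = (W e (min t b) \<omega> - W e (min t a) \<omega>) + (W e (max t b) \<omega> - W e (max t a) \<omega>)"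
    by (cases "t \<le> b"; cases "t \<le> a") (simp_all add: min_def max_def)
  then have "(W e b \<omega> - W e a \<omega>) *\<^sub>R h = (W e (min t b) \<omega> - W e (min t a) \<omega>) *\<^sub>R h + (W e (max t b) \<omega> - W e (max t a) \<omega>) *\<^sub>R h"
    by (simp only: scaleR_add_left)
  then show ?case using Cons by (simp add: step_integral_def map_times_def p)
qed

lemma step_integrand_map_times:
  assumes "\<And>a b. a \<le> b \<Longrightarrow> s \<in> {f a<..f b} \<longleftrightarrow> s' \<in> {a<..b}" "\<forall>(a, b, e, h)\<in>set xs. a \<le> b"
  shows "step_integrand (map_times f xs) s k = step_integrand xs s' k"
  using assms(2)
proof (induction xs)
  case Nil then show ?case by (simp add: step_integrand_def map_times_def)
next
  case (Cons p xs)
  obtain a b e h where p: "p = (a, b, e, h)" by (cases p) auto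
  have "s \<in> {f a<..f b} \<longleftrightarrow> s' \<in> {a<..b}" using Cons.prems p by (intro assms(1)) simp
  then have "indicator {f a<..f b} s = (indicator {a<..b} s' :: real)" by (simp only: indicator_def)
  then show ?case using Cons by (simp add: step_integrand_def map_times_def p)
qed

lemma step_integrand_bounded_linear: "bounded_linear (\<lambda>k. step_integrand xs s k)"
proof (induction xs)
  case Nil then show ?case by (simp add: step_integrand_def)
next
  case (Cons p xs)
  obtain a b e h where p: "p = (a, b, e, h)" by (cases p) auto
  have "bounded_linear (\<lambda>k. (indicator {a<..b} s * (e \<bullet> k)) *\<^sub>R h + step_integrand xs s k)"
    by (intro bounded_linear_add Cons bounded_linear_scaleR_const bounded_linear_const_mult bounded_linear_inner_right)
  then show ?case by (simp add: step_integrand_def p)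
qed

context cylindrical_BM
begin

lemma kernel_project_inner: "kernel (project y xs) s \<bullet> k = step_integrand xs s k \<bullet> y"
proof (induction xs)
  case Nil then show ?case by (simp add: kernel_def project_def step_integrand_def)
next
  case (Cons p xs)
  obtain a b e h where p: "p = (a, b, e, h)" by (cases p) auto
  have "kernel (project y (p # xs)) s = indicator {a<..b} s *\<^sub>R ((h \<bullet> y) *\<^sub>R e) + kernel (project y xs) s"
    by (simp add: project_def p kernel_Cons)
  then show ?case using Cons by (simp add: p step_integrand_def inner_add_left mult_ac)
qed

lemma step_integral_meas:
  fixes xs :: "('x, 'h::{real_inner, second_countable_topology}) step"
  assumes "step_valid t xs" "0 \<le> t"
  shows "step_integral W xs \<in> borel_measurable (F t)"
  using assms(1)
proof (induction xs)
  case Nil then show ?case by (simp add: step_integral_def[abs_def])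
next
  case (Cons p xs)
  obtain a b e h where p: "p = (a, b, e, h)" by (cases p) auto
  have "W e a \<in> borel_measurable (F t)" "W e b \<in> borel_measurable (F t)"
    using Cons.prems p assms(2) by (auto intro!: W_meas' simp: step_valid_def)
  moreover have "step_integral W xs \<in> borel_measurable (F t)" using Cons by (auto simp: step_valid_def)
  moreover have "step_integral W (p # xs) = (\<lambda>\<omega>. (W e b \<omega> - W e a \<omega>) *\<^sub>R h + step_integral W xs \<omega>)"
    by (auto simp: step_integral_def p)
  ultimately show ?case
    by (simp only:) (intro borel_measurable_add borel_measurable_scaleR borel_measurable_diff borel_measurable_const)
qed

lemma step_integral_project:
  assumes "step_valid t xs"
  shows "AE \<omega> in M. step_integral W xs \<omega> \<bullet> y = increments t (project y xs) \<omega>"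
  using assms
proof (induction xs)
  case Nil then show ?case by (simp add: step_integral_def project_def increments_def)
next
  case (Cons p xs)
  obtain a b e h where p: "p = (a, b, e, h)" by (cases p) auto
  have ab: "0 \<le> a" "a \<le> b" "b \<le> t" using Cons.prems p by (auto simp: step_valid_def)
  then have "0 \<le> b" by simp
  have IH: "AE \<omega> in M. step_integral W xs \<omega> \<bullet> y = increments t (project y xs) \<omega>"
    using Cons by (auto simp: step_valid_def)
  from W_scale[OF ab(1), of "h \<bullet> y" e] W_scale[OF \<open>0 \<le> b\<close>, of "h \<bullet> y" e] IH show ?case
  proof eventually_elim
    case (elim \<omega>)
    have "step_integral W (p # xs) \<omega> \<bullet> y = (W e b \<omega> - W e a \<omega>) * (h \<bullet> y) + step_integral W xs \<omega> \<bullet> y"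
      by (simp add: step_integral_def p inner_add_left)
    moreover have "increments t (project y (p # xs)) \<omega> = (W ((h \<bullet> y) *\<^sub>R e) b \<omega> - W ((h \<bullet> y) *\<^sub>R e) a \<omega>) + increments t (project y xs) \<omega>"
      using ab by (simp add: increments_def project_def p min_absorb1)
    ultimately show ?case using elim by (simp add: algebra_simps)
  qed
qed

text \<open>The variance of the component along \<open>y\<close> of the step integral over \<open>(t, r]\<close>.\<close>
definition kernel_energy :: "real \<Rightarrow> real \<Rightarrow> 'h::real_inner \<Rightarrow> ('x, 'h) step \<Rightarrow> real" where
  "kernel_energy t r y xs = (LINT s:{t<..r}|lborel. (norm (kernel (project y xs) s))\<^sup>2)"

text \<open>A step integral over times after \<open>t\<close> is, seen from \<open>F t\<close>, Gaussian with the variance given by Ito's isometry.\<close>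
lemma char_step_integral:
  fixes xs :: "('x, 'h::{real_inner, second_countable_topology}) step"
  assumes xs: "step_valid r xs" "\<forall>(a, b, e, h)\<in>set xs. t \<le> a" and t: "0 \<le> t" "t \<le> r"
    and \<theta>: "\<theta> \<in> borel_measurable (F t)" and c: "\<And>\<omega>. cmod (\<theta> \<omega>) \<le> c"
  shows "(LINT \<omega>|M. \<theta> \<omega> * cis (step_integral W xs \<omega> \<bullet> y)) = (LINT \<omega>|M. \<theta> \<omega>) * complex_of_real (exp (- kernel_energy t r y xs / 2))"
proof -
  have pv: "\<forall>(a, b, e)\<in>set (project y xs). t \<le> a \<and> a \<le> b"
    using xs by (auto simp: project_def step_valid_def)
  have pv0: "\<forall>(a, b, e)\<in>set (project y xs). 0 \<le> a \<and> a \<le> b"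
    using xs by (auto simp: project_def step_valid_def)
  have r: "0 \<le> r" using t by simp
  have [measurable]: "\<theta> \<in> borel_measurable M" "step_integral W xs \<in> borel_measurable M" "increments r (project y xs) \<in> borel_measurable M"
    using meas_F_M[OF \<theta> t(1)] meas_F_M[OF step_integral_meas[OF xs(1) r] r] meas_F_M[OF increments_meas[OF pv0 r] r] by auto
  have "(LINT \<omega>|M. \<theta> \<omega> * cis (step_integral W xs \<omega> \<bullet> y)) = (LINT \<omega>|M. \<theta> \<omega> * cis (increments r (project y xs) \<omega>))"
    using step_integral_project[OF xs(1), of y] by (intro integral_cong_AE) auto
  also have "\<dots> = (LINT \<omega>|M. \<theta> \<omega>) * complex_of_real (exp (- kernel_energy t r y xs / 2))"
    unfolding kernel_energy_def by (rule weighted_char_increments[OF pv t \<theta> c])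
  finally show ?thesis .
qed

text \<open>The direction of the kernel is a norming functional for it.\<close>
lemma kernel_sq_le:
  fixes ds :: "('x, 'h::real_inner) step" and y :: 'h
  assumes f: "\<And>k. step_integrand ds s k = T k + R (T' k)" and R: "\<And>h. norm (R h) \<le> c * norm h" and c: "c \<ge> 0"
  defines "u \<equiv> (1 / norm (kernel (project y ds) s)) *\<^sub>R kernel (project y ds) s"
  shows "(norm (kernel (project y ds) s))\<^sup>2 \<le> 2 * (norm y)\<^sup>2 * ((norm (T u))\<^sup>2 + c\<^sup>2 * (norm (T' u))\<^sup>2)"
proof -
  define K where "K = kernel (project y ds) s"
  have "norm K = K \<bullet> u"
    by (cases "K = 0") (simp_all add: u_def K_def[symmetric] power2_norm_eq_inner[symmetric] power2_eq_square)
  also have "\<dots> = step_integrand ds s u \<bullet> y" unfolding K_def by (rule kernel_project_inner)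
  also have "\<dots> \<le> norm (step_integrand ds s u) * norm y" by (rule norm_cauchy_schwarz)
  also have "\<dots> \<le> (norm (T u) + c * norm (T' u)) * norm y"
    unfolding f by (intro mult_right_mono order_trans[OF norm_triangle_ineq add_left_mono[OF R]]) auto
  finally have "(norm K)\<^sup>2 \<le> ((norm (T u) + c * norm (T' u)) * norm y)\<^sup>2" by (intro power_mono) auto
  also have "\<dots> = (norm y)\<^sup>2 * (norm (T u) + c * norm (T' u))\<^sup>2" by (simp add: power_mult_distrib mult.commute)
  also have "\<dots> \<le> (norm y)\<^sup>2 * (2 * ((norm (T u))\<^sup>2 + (c * norm (T' u))\<^sup>2))"
  proof (intro mult_left_mono)
    show "(norm (T u) + c * norm (T' u))\<^sup>2 \<le> 2 * ((norm (T u))\<^sup>2 + (c * norm (T' u))\<^sup>2)"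
      by (rule square_add_le)
  qed simp
  also have "\<dots> = 2 * (norm y)\<^sup>2 * ((norm (T u))\<^sup>2 + c\<^sup>2 * (norm (T' u))\<^sup>2)" by (simp add: power_mult_distrib)
  finally show ?thesis by (simp add: K_def)
qed

end

lemma norm_direction_le_hilbert_schmidt:
  fixes K :: "'x::{real_inner, second_countable_topology}"
  assumes "bounded_linear T"
  shows "ennreal ((norm (T ((1 / norm K) *\<^sub>R K)))\<^sup>2) \<le> hilbert_schmidt_norm_sq T"
proof (cases "K = 0")
  case True
  interpret bounded_linear T by fact
  show ?thesis using True by (simp add: zero)
next
  case False
  then show ?thesis using norm_sq_le_hilbert_schmidt[OF assms, of "(1 / norm K) *\<^sub>R K"] by simp
qed

locale wiener_setting = cylindrical_BM M F W + strongly_continuous_semigroup S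
  for M :: "'w measure" and F :: "real \<Rightarrow> 'w measure"
    and W :: "'x::{real_inner, banach, second_countable_topology} \<Rightarrow> real \<Rightarrow> 'w \<Rightarrow> real"
    and S :: "real \<Rightarrow> 'h::{real_inner, banach, second_countable_topology} \<Rightarrow>\<^sub>L 'h" +
  fixes \<sigma> :: "'x \<Rightarrow>\<^sub>L 'h" and Z :: "real \<Rightarrow> 'w \<Rightarrow> 'h"
  assumes Z: "stochastic_convolution M W S \<sigma> Z"
begin

lemma S_measurable: "(\<lambda>(t, x). S (max 0 t) x) \<in> borel_measurable (borel \<Otimes>\<^sub>M borel)"
proof -
  have "continuous_on UNIV (\<lambda>p. S (max 0 (fst p)) (snd p))"
    by (intro continuous_intros) auto
  then have "(\<lambda>p. S (max 0 (fst p)) (snd p)) \<in> borel_measurable borel" by (rule borel_measurable_continuous_onI)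
  then show ?thesis by (simp add: borel_prod split_beta')
qed

lemma S_meas [measurable (raw)]:
  assumes "f \<in> borel_measurable N" "g \<in> borel_measurable N"
  shows "(\<lambda>x. S (max 0 (f x)) (g x)) \<in> borel_measurable N"
  using measurable_compose[OF measurable_Pair[OF assms] S_measurable] by simp

lemma S_meas_const:
  assumes "g \<in> borel_measurable N" shows "(\<lambda>x. S t (g x)) \<in> borel_measurable N"
  using assms by (rule borel_measurable_continuous_on[rotated]) (intro continuous_intros)

lemma step_integrand_measurable [measurable]:
  fixes xs :: "('x, 'h) step"
  assumes [measurable]: "u \<in> borel_measurable (borel :: real measure)"
  shows "(\<lambda>s. step_integrand xs s (u s) :: 'h) \<in> borel_measurable borel"
proof (induction xs)
  case Nil then show ?case by (simp add: step_integrand_def[abs_def])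
next
  case (Cons p xs)
  obtain a b e h where p: "p = (a, b, e, h)" by (cases p) auto
  note [measurable] = Cons
  have "(\<lambda>s. (indicator {a<..b} s * (e \<bullet> u s)) *\<^sub>R h + step_integrand xs s (u s)) \<in> borel_measurable borel" by measurable
  then show ?case by (simp add: step_integrand_def p)
qed

text \<open>The step functions \<open>ds n\<close> are differences of two approximations of the same integrand, one of them possibly shifted in time by \<open>d\<close> and one transported by \<open>R\<close>. At each time their kernel is controlled by the approximation errors in one direction, hence by Hilbert-Schmidt norms.\<close>
lemma kernel_energy_tendsto_0:
  assumes valid: "\<And>n. step_valid \<tau> (ds n)" and \<tau>: "0 \<le> \<tau>"
    and ds: "\<And>n s k. s \<in> {0<..<\<tau>} \<Longrightarrow> step_integrand (ds n) s k
        = - (S (\<tau>' - s) (\<sigma> k) - step_integrand (xs n) (s + d) k) + R (S (\<tau>'' - s) (\<sigma> k) - step_integrand (ys n) s k)"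
    and \<tau>': "\<tau> \<le> \<tau>'" "\<tau> \<le> \<tau>''" and R: "\<And>h. norm (R h) \<le> c * norm h" "c \<ge> 0"
    and xs: "(\<lambda>n. \<integral>\<^sup>+s\<in>{d<..<\<tau> + d}. hilbert_schmidt_norm_sq (\<lambda>k. S (\<tau>' + d - s) (\<sigma> k) - step_integrand (xs n) s k) \<partial>lborel) \<longlonglongrightarrow> 0"
    and ys: "(\<lambda>n. \<integral>\<^sup>+s\<in>{0<..<\<tau>}. hilbert_schmidt_norm_sq (\<lambda>k. S (\<tau>'' - s) (\<sigma> k) - step_integrand (ys n) s k) \<partial>lborel) \<longlonglongrightarrow> 0"
  shows "(\<lambda>n. kernel_energy 0 \<tau> y (ds n)) \<longlonglongrightarrow> 0"
proof -
  define X where "X n = (\<integral>\<^sup>+s\<in>{d<..<\<tau> + d}. hilbert_schmidt_norm_sq (\<lambda>k. S (\<tau>' + d - s) (\<sigma> k) - step_integrand (xs n) s k) \<partial>lborel)" for n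
  define Y where "Y n = (\<integral>\<^sup>+s\<in>{0<..<\<tau>}. hilbert_schmidt_norm_sq (\<lambda>k. S (\<tau>'' - s) (\<sigma> k) - step_integrand (ys n) s k) \<partial>lborel)" for n
  have le: "ennreal (kernel_energy 0 \<tau> y (ds n)) \<le> ennreal (2 * (norm y)\<^sup>2) * (X n + ennreal (c\<^sup>2) * Y n)" for n
  proof -
    define K where "K = kernel (project y (ds n))"
    define u where "u s = (1 / norm (K s)) *\<^sub>R K s" for s
    have [measurable]: "K \<in> borel_measurable borel" by (simp add: K_def)
    have u[measurable]: "u \<in> borel_measurable borel" unfolding u_def[abs_def] by measurable
    define T where "T s k = S (\<tau>' - s) (\<sigma> k) - step_integrand (xs n) (s + d) k" for s k
    define T' where "T' s k = S (\<tau>'' - s) (\<sigma> k) - step_integrand (ys n) s k" for s k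
    have bl: "bounded_linear (T s)" "bounded_linear (T' s)" for s
      unfolding T_def T'_def
      by (intro bounded_linear_sub step_integrand_bounded_linear bounded_linear_compose[OF blinfun.bounded_linear_right blinfun.bounded_linear_right])+
    have \<sigma>u[measurable]: "(\<lambda>s. \<sigma> (u s)) \<in> borel_measurable borel"
      using u by (rule borel_measurable_continuous_on[rotated]) (intro continuous_intros)
    define p where "p s = norm (S (max 0 (\<tau>' - s)) (\<sigma> (u s)) - step_integrand (xs n) (s + d) (u s))" for s
    define q where "q s = norm (S (max 0 (\<tau>'' - s)) (\<sigma> (u s)) - step_integrand (ys n) s (u s))" for s
    have [measurable]: "(\<lambda>s. step_integrand (xs n) (s + d) (u s)) \<in> borel_measurable borel"
    proof -
      have "(\<lambda>s. step_integrand (xs n) s (u (s - d))) \<in> borel_measurable borel" by measurable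
      then have "(\<lambda>s. step_integrand (xs n) (s + d) (u (s + d - d))) \<in> borel_measurable borel"
        by (rule measurable_compose[rotated]) measurable
      then show ?thesis by simp
    qed
    have pm[measurable]: "p \<in> borel_measurable borel" unfolding p_def[abs_def] by measurable
    have qm[measurable]: "q \<in> borel_measurable borel" unfolding q_def[abs_def] by measurable
    have p: "p s = norm (T s (u s))" and q: "q s = norm (T' s (u s))" if "s \<in> {0<..<\<tau>}" for s
      using that \<tau>' by (simp_all add: p_def q_def T_def T'_def)
    have "ennreal (kernel_energy 0 \<tau> y (ds n)) = (\<integral>\<^sup>+s. ennreal (indicator {0<..\<tau>} s * (norm (K s))\<^sup>2) \<partial>lborel)"
      using kernel_sq_integrable[of 0 \<tau> "project y (ds n)"] unfolding kernel_energy_def set_lebesgue_integral_def set_integrable_def K_def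
      by (subst nn_integral_eq_integral) auto
    also have "\<dots> \<le> (\<integral>\<^sup>+s. ennreal (2 * (norm y)\<^sup>2) * (ennreal (indicator {0<..<\<tau>} s * (p s)\<^sup>2) + ennreal (c\<^sup>2) * ennreal (indicator {0<..<\<tau>} s * (q s)\<^sup>2)) \<partial>lborel)"
    proof (rule nn_integral_mono_AE)
      show "AE s in lborel. ennreal (indicator {0<..\<tau>} s * (norm (K s))\<^sup>2) \<le> ennreal (2 * (norm y)\<^sup>2) * (ennreal (indicator {0<..<\<tau>} s * (p s)\<^sup>2) + ennreal (c\<^sup>2) * ennreal (indicator {0<..<\<tau>} s * (q s)\<^sup>2))"
        using AE_lborel_singleton[of \<tau>]
      proof eventually_elim
        case (elim s)
        show ?case
        proof (cases "s \<in> {0<..<\<tau>}")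
          case True
          have "(norm (kernel (project y (ds n)) s))\<^sup>2 \<le> 2 * (norm y)\<^sup>2 * ((norm (- T s ((1 / norm (kernel (project y (ds n)) s)) *\<^sub>R kernel (project y (ds n)) s)))\<^sup>2
             + c\<^sup>2 * (norm (T' s ((1 / norm (kernel (project y (ds n)) s)) *\<^sub>R kernel (project y (ds n)) s)))\<^sup>2)"
            by (rule kernel_sq_le[where R=R and T="\<lambda>k. - T s k"]) (use ds[OF True] R in \<open>auto simp: T_def T'_def\<close>)
          then have "(norm (K s))\<^sup>2 \<le> 2 * (norm y)\<^sup>2 * ((p s)\<^sup>2 + c\<^sup>2 * (q s)\<^sup>2)"
            using True by (simp add: p q u_def K_def)
          then show ?thesis using True
            by (simp add: ennreal_mult[symmetric] ennreal_plus[symmetric] ennreal_leI del: ennreal_plus)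
        next
          case False
          with elim have "s \<notin> {0<..\<tau>}" by auto
          then show ?thesis by simp
        qed
      qed
    qed
    also have "\<dots> = ennreal (2 * (norm y)\<^sup>2) * ((\<integral>\<^sup>+s. ennreal (indicator {0<..<\<tau>} s * (p s)\<^sup>2) \<partial>lborel) + ennreal (c\<^sup>2) * (\<integral>\<^sup>+s. ennreal (indicator {0<..<\<tau>} s * (q s)\<^sup>2) \<partial>lborel))"
      by (simp add: nn_integral_cmult nn_integral_add)
    also have "\<dots> \<le> ennreal (2 * (norm y)\<^sup>2) * (X n + ennreal (c\<^sup>2) * Y n)"
    proof (intro mult_left_mono add_mono)
      show "(\<integral>\<^sup>+s. ennreal (indicator {0<..<\<tau>} s * (p s)\<^sup>2) \<partial>lborel) \<le> X n"
      proof -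
        have "(\<integral>\<^sup>+s. ennreal (indicator {0<..<\<tau>} s * (p s)\<^sup>2) \<partial>lborel)
            = (\<integral>\<^sup>+s. ennreal (indicator {0<..<\<tau>} (- d + 1 * s) * (p (- d + 1 * s))\<^sup>2) \<partial>lborel)"
          by (subst nn_integral_real_affine[where c=1 and t="- d"]) auto
        also have "\<dots> \<le> X n"
          unfolding X_def
        proof (rule nn_integral_mono)
          fix s
          have T: "(\<lambda>k. S (\<tau>' + d - s) (\<sigma> k) - step_integrand (xs n) s k) = T (s - d)"
            by (rule ext) (simp add: T_def algebra_simps)
          show "ennreal (indicator {0<..<\<tau>} (- d + 1 * s) * (p (- d + 1 * s))\<^sup>2)
              \<le> hilbert_schmidt_norm_sq (\<lambda>k. S (\<tau>' + d - s) (\<sigma> k) - step_integrand (xs n) s k) * indicator {d<..<\<tau> + d} s"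
            unfolding T using norm_direction_le_hilbert_schmidt[OF bl(1)[of "s - d"], of "K (s - d)"] p[of "s - d"]
            by (cases "s - d \<in> {0<..<\<tau>}") (auto simp: u_def)
        qed
        finally show ?thesis .
      qed
      show "(\<integral>\<^sup>+s. ennreal (indicator {0<..<\<tau>} s * (q s)\<^sup>2) \<partial>lborel) \<le> Y n"
        unfolding Y_def T'_def[symmetric]
      proof (rule nn_integral_mono)
        fix s
        show "ennreal (indicator {0<..<\<tau>} s * (q s)\<^sup>2) \<le> hilbert_schmidt_norm_sq (T' s) * indicator {0<..<\<tau>} s"
          using norm_direction_le_hilbert_schmidt[OF bl(2)[of s], of "K s"] q[of s] by (cases "s \<in> {0<..<\<tau>}") (auto simp: u_def)
      qed
    qed auto
    finally show ?thesis .
  qed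
  have "(\<lambda>n. ennreal (2 * (norm y)\<^sup>2) * (X n + ennreal (c\<^sup>2) * Y n)) \<longlonglongrightarrow> ennreal (2 * (norm y)\<^sup>2) * (0 + ennreal (c\<^sup>2) * 0)"
    using xs ys unfolding X_def[symmetric] Y_def[symmetric]
    by (intro tendsto_mult_ennreal tendsto_add tendsto_const) auto
  then have lim: "(\<lambda>n. ennreal (2 * (norm y)\<^sup>2) * (X n + ennreal (c\<^sup>2) * Y n)) \<longlonglongrightarrow> 0" by simp
  have "(\<lambda>n. ennreal (kernel_energy 0 \<tau> y (ds n))) \<longlonglongrightarrow> 0"
    by (rule tendsto_sandwich[OF _ _ tendsto_const lim]) (use le in auto)
  moreover have "0 \<le> kernel_energy 0 \<tau> y (ds n)" for n
    by (simp add: kernel_energy_def set_lebesgue_integral_def)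
  ultimately show ?thesis by (simp add: ennreal_0[symmetric] del: ennreal_0)
qed

end

section \<open>Innovations of the stochastic convolution\<close>

text \<open>The null sets belong to the filtration from time \<open>0\<close> on.\<close>
lemma (in cylindrical_BM) measurable_of_AE_eq:
  fixes f g :: "'w \<Rightarrow> 'b::topological_space"
  assumes t: "0 \<le> t" and f: "f \<in> borel_measurable M" and g: "g \<in> borel_measurable (F t)" and eq: "AE \<omega> in M. f \<omega> = g \<omega>"
  shows "f \<in> borel_measurable (F t)"
proof (rule measurableI)
  fix B :: "'b set" assume B: "B \<in> sets borel"
  obtain N where N: "N \<in> null_sets M" "{\<omega> \<in> space M. f \<omega> \<noteq> g \<omega>} \<subseteq> N" using eq by (auto elim: AE_E3 simp: eventually_ae_filter)
  have null: "null_sets M \<subseteq> sets (F t)"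
    using filt F_mono[of 0 t] t unfolding filtered_prob_space_usual_def by blast
  have "f -` B \<inter> space M \<in> sets M" using f B by (rule measurable_sets)
  then have "f -` B \<inter> space M \<inter> N \<in> null_sets M" using N(1) by (intro null_set_Int1) auto
  then have 1: "f -` B \<inter> space M \<inter> N \<in> sets (F t)" using null by blast
  have 2: "g -` B \<inter> space (F t) \<in> sets (F t)" using g B by (rule measurable_sets)
  have 3: "N \<in> sets (F t)" using N(1) null by blast
  have "f -` B \<inter> space (F t) = ((g -` B \<inter> space (F t)) - N) \<union> (f -` B \<inter> space M \<inter> N)"
    using N(2) space_F[OF t] by auto
  then show "f -` B \<inter> space (F t) \<in> sets (F t)" using 1 2 3 by auto
qed simp

context wiener_setting
begin

lemma Z_meas: "0 \<le> t \<Longrightarrow> Z t \<in> borel_measurable M"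
  using Z by (simp add: stochastic_convolution_def is_wiener_integral_def)

lemma Z_continuous: "\<omega> \<in> space M \<Longrightarrow> continuous_on {0..} (\<lambda>t. Z t \<omega>)"
  using Z by (simp add: stochastic_convolution_def)

lemma Z_approx:
  assumes "0 \<le> t"
  obtains xs where "\<And>n. step_valid t (xs n)"
    "(\<lambda>n. \<integral>\<^sup>+s\<in>{0<..<t}. hilbert_schmidt_norm_sq (\<lambda>k. S (t - s) (\<sigma> k) - step_integrand (xs n) s k) \<partial>lborel) \<longlonglongrightarrow> 0"
    "(\<lambda>n. \<integral>\<^sup>+\<omega>. ennreal ((norm (step_integral W (xs n) \<omega> - Z t \<omega>))\<^sup>2) \<partial>M) \<longlonglongrightarrow> 0"
proof -
  have "is_wiener_integral M W t (\<lambda>s k. S (t - s) (\<sigma> k)) (Z t)"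
    using Z assms by (simp add: stochastic_convolution_def)
  then show ?thesis unfolding is_wiener_integral_def using that by blast
qed

text \<open>An almost sure limit of step integrals up to time \<open>t\<close>.\<close>
lemma Z_adapted:
  assumes t: "0 \<le> t" shows "Z t \<in> borel_measurable (F t)"
proof -
  obtain xs where xs: "\<And>n. step_valid t (xs n)"
    "(\<lambda>n. \<integral>\<^sup>+s\<in>{0<..<t}. hilbert_schmidt_norm_sq (\<lambda>k. S (t - s) (\<sigma> k) - step_integrand (xs n) s k) \<partial>lborel) \<longlonglongrightarrow> 0"
    "(\<lambda>n. \<integral>\<^sup>+\<omega>. ennreal ((norm (step_integral W (xs n) \<omega> - Z t \<omega>))\<^sup>2) \<partial>M) \<longlonglongrightarrow> 0"
    by (rule Z_approx[OF t], rule that, blast, assumption, assumption)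
  define I where "I n = step_integral W (xs n)" for n
  have IF: "I n \<in> borel_measurable (F t)" for n unfolding I_def by (rule step_integral_meas[OF xs(1) t])
  have [measurable]: "I n \<in> borel_measurable M" "Z t \<in> borel_measurable M" for n
    using meas_F_M[OF IF t] Z_meas[OF t] by auto
  define f where "f n \<omega> = (norm (I n \<omega> - Z t \<omega>))\<^sup>2" for n \<omega>
  have [measurable]: "f n \<in> borel_measurable M" for n unfolding f_def[abs_def] by measurable
  have fnn: "0 \<le> f n \<omega>" for n \<omega> by (simp add: f_def)
  have lim: "(\<lambda>n. \<integral>\<^sup>+\<omega>. ennreal (f n \<omega>) \<partial>M) \<longlonglongrightarrow> 0" using xs(3) by (simp add: f_def I_def)
  then have "eventually (\<lambda>n. (\<integral>\<^sup>+\<omega>. ennreal (f n \<omega>) \<partial>M) < 1) sequentially"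
    by (rule order_tendstoD) simp
  then obtain n0 where n0: "\<And>n. n \<ge> n0 \<Longrightarrow> (\<integral>\<^sup>+\<omega>. ennreal (f n \<omega>) \<partial>M) < 1"
    by (auto simp: eventually_sequentially)
  have int: "integrable M (f (n + n0))" for n
  proof (rule integrableI_nonneg)
    have "(\<integral>\<^sup>+\<omega>. ennreal (f (n + n0) \<omega>) \<partial>M) < 1" by (rule n0) simp
    also have "(1::ennreal) < \<infinity>" by simp
    finally show "(\<integral>\<^sup>+\<omega>. ennreal (f (n + n0) \<omega>) \<partial>M) < \<infinity>" .
  qed (auto simp: f_def)
  have "(\<lambda>n. ennreal (LINT \<omega>|M. norm (f (n + n0) \<omega>))) \<longlonglongrightarrow> 0"
  proof -
    have "ennreal (LINT \<omega>|M. norm (f (n + n0) \<omega>)) = (\<integral>\<^sup>+\<omega>. ennreal (f (n + n0) \<omega>) \<partial>M)" for n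
      using int[of n] fnn by (subst nn_integral_eq_integral) auto
    then show ?thesis using LIMSEQ_ignore_initial_segment[OF lim, of n0] by simp
  qed
  then have "(\<lambda>n. LINT \<omega>|M. norm (f (n + n0) \<omega>)) \<longlonglongrightarrow> 0"
    by (simp add: ennreal_0[symmetric] del: ennreal_0)
  from tendsto_L1_AE_subseq[OF int this] obtain r where r: "AE \<omega> in M. (\<lambda>n. f (r n + n0) \<omega>) \<longlonglongrightarrow> 0"
    by blast
  define Z' where "Z' \<omega> = lim (\<lambda>n. I (r n + n0) \<omega>)" for \<omega>
  have "Z' \<in> borel_measurable (F t)" unfolding Z'_def[abs_def] by (rule borel_measurable_lim_metric) (rule IF)
  moreover have "AE \<omega> in M. Z t \<omega> = Z' \<omega>"
    using r
  proof eventually_elim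
    case (elim \<omega>)
    have "(\<lambda>n. sqrt (f (r n + n0) \<omega>)) \<longlonglongrightarrow> 0" using tendsto_real_sqrt[OF elim] by simp
    then have "(\<lambda>n. norm (I (r n + n0) \<omega> - Z t \<omega>)) \<longlonglongrightarrow> 0" by (simp add: f_def)
    then have "(\<lambda>n. I (r n + n0) \<omega>) \<longlonglongrightarrow> Z t \<omega>" by (simp add: tendsto_norm_zero_iff LIM_zero_iff)
    then show ?case unfolding Z'_def by (rule limI[symmetric])
  qed
  ultimately show ?thesis by (intro measurable_of_AE_eq[OF t Z_meas[OF t]])
qed

lemma Z_0: "AE \<omega> in M. Z 0 \<omega> = 0"
proof -
  obtain xs where xs: "\<And>n. step_valid 0 (xs n)"
    "(\<lambda>n. \<integral>\<^sup>+s\<in>{0<..<0}. hilbert_schmidt_norm_sq (\<lambda>k. S (0 - s) (\<sigma> k) - step_integrand (xs n) s k) \<partial>lborel) \<longlonglongrightarrow> 0"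
    "(\<lambda>n. \<integral>\<^sup>+\<omega>. ennreal ((norm (step_integral W (xs n) \<omega> - Z 0 \<omega>))\<^sup>2) \<partial>M) \<longlonglongrightarrow> 0"
    by (rule Z_approx[OF order_refl], rule that, blast, assumption, assumption)
  have "step_integral W ys \<omega> = 0" if "step_valid 0 ys" for ys :: "('x, 'h) step" and \<omega>
    using that
  proof (induction ys)
    case (Cons p ys)
    obtain a b e h where p: "p = (a, b, e, h)" by (cases p) auto
    have "a = 0" "b = 0" "step_valid 0 ys" using Cons.prems p by (auto simp: step_valid_def)
    then show ?case using Cons.IH by (simp add: step_integral_def p)
  qed (simp add: step_integral_def)
  then have "(\<lambda>n::nat. \<integral>\<^sup>+\<omega>. ennreal ((norm (Z 0 \<omega>))\<^sup>2) \<partial>M) \<longlonglongrightarrow> 0" using xs(1,3) by simp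
  then have "(\<integral>\<^sup>+\<omega>. ennreal ((norm (Z 0 \<omega>))\<^sup>2) \<partial>M) = 0" by (simp add: LIMSEQ_const_iff)
  then show ?thesis using Z_meas[of 0] by (subst (asm) nn_integral_0_iff_AE) auto
qed

definition innovation :: "real \<Rightarrow> real \<Rightarrow> 'w \<Rightarrow> 'h" where
  "innovation t h \<omega> = Z (t + h) \<omega> - S h (Z t \<omega>)"

lemma innovation_adapted:
  assumes "0 \<le> t" "0 \<le> h" shows "innovation t h \<in> borel_measurable (F (t + h))"
  unfolding innovation_def[abs_def]
proof (intro borel_measurable_diff S_meas_const)
  show "Z (t + h) \<in> borel_measurable (F (t + h))" using assms by (intro Z_adapted) auto
  show "Z t \<in> borel_measurable (F (t + h))"
    by (rule meas_F_mono[OF Z_adapted[OF assms(1)] assms(1)]) (use assms in simp)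
qed

lemma innovation_meas:
  assumes "0 \<le> t" "0 \<le> h" shows "innovation t h \<in> borel_measurable M"
  using meas_F_M[OF innovation_adapted[OF assms]] assms by simp

lemma null_phase_approx:
  fixes R :: "'h \<Rightarrow> 'h"
  assumes lim: "(\<lambda>n. \<integral>\<^sup>+\<omega>. ennreal ((norm (step_integral W (xs n) \<omega> - Z t \<omega>))\<^sup>2) \<partial>M) \<longlonglongrightarrow> 0"
    and xs: "\<And>n. step_valid t (xs n)" and t: "0 \<le> t"
    and R: "\<And>h. norm (R h) \<le> c * norm h" "c \<ge> 0" "continuous_on UNIV R"
  shows "null_phase M (\<lambda>n \<omega>. R (step_integral W (xs n) \<omega> - Z t \<omega>) \<bullet> y)"
proof (rule null_phase_L2[where c="c\<^sup>2 * (norm y)\<^sup>2" and q="\<lambda>n \<omega>. (norm (step_integral W (xs n) \<omega> - Z t \<omega>))\<^sup>2"])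
  have m[measurable]: "step_integral W (xs n) \<in> borel_measurable M" for n by (rule meas_F_M[OF step_integral_meas[OF xs t] t])
  have [measurable]: "Z t \<in> borel_measurable M" by (rule Z_meas[OF t])
  have [measurable]: "R \<in> borel_measurable borel" using R(3) by (rule borel_measurable_continuous_onI)
  show "(\<lambda>\<omega>. R (step_integral W (xs n) \<omega> - Z t \<omega>) \<bullet> y) \<in> borel_measurable M" for n by measurable
  show "(\<lambda>\<omega>. (norm (step_integral W (xs n) \<omega> - Z t \<omega>))\<^sup>2) \<in> borel_measurable M" for n by measurable
  show "(R (step_integral W (xs n) \<omega> - Z t \<omega>) \<bullet> y)\<^sup>2 \<le> c\<^sup>2 * (norm y)\<^sup>2 * (norm (step_integral W (xs n) \<omega> - Z t \<omega>))\<^sup>2" for n \<omega>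
  proof -
    let ?D = "step_integral W (xs n) \<omega> - Z t \<omega>"
    have "\<bar>R ?D \<bullet> y\<bar> \<le> norm (R ?D) * norm y" by (rule Cauchy_Schwarz_ineq2)
    also have "\<dots> \<le> (c * norm ?D) * norm y" by (intro mult_right_mono R) auto
    finally have "\<bar>R ?D \<bullet> y\<bar>\<^sup>2 \<le> (c * norm ?D * norm y)\<^sup>2" by (intro power_mono) auto
    then show ?thesis by (simp add: power_mult_distrib mult_ac)
  qed
qed (use lim R in auto)

text \<open>The approximating step functions of \<open>Z (t + h)\<close> are split at \<open>t\<close>. The part before \<open>t\<close>, less the transported approximation of \<open>Z t\<close>, has vanishing energy, so that the innovation is the limit of the part after \<open>t\<close>. Shifted back by \<open>t\<close>, that part has the same energies and approximates \<open>Z h\<close>.\<close>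
lemma innovation_char:
  assumes t: "0 \<le> t" and h: "0 \<le> h" and A: "A \<in> sets (F t)"
  shows "(LINT \<omega>|M. of_real (indicator A \<omega>) * cis (innovation t h \<omega> \<bullet> y)) = of_real (prob A) * (LINT \<omega>|M. cis (Z h \<omega> \<bullet> y))"
proof -
  have th: "0 \<le> t + h" using t h by simp
  obtain xs where xs: "\<And>n. step_valid (t + h) (xs n)"
    "(\<lambda>n. \<integral>\<^sup>+s\<in>{0<..<t + h}. hilbert_schmidt_norm_sq (\<lambda>k. S (t + h - s) (\<sigma> k) - step_integrand (xs n) s k) \<partial>lborel) \<longlonglongrightarrow> 0"
    "(\<lambda>n. \<integral>\<^sup>+\<omega>. ennreal ((norm (step_integral W (xs n) \<omega> - Z (t + h) \<omega>))\<^sup>2) \<partial>M) \<longlonglongrightarrow> 0"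
    by (rule Z_approx[OF th], rule that, blast, assumption, assumption)
  obtain ys where ys: "\<And>n. step_valid t (ys n)"
    "(\<lambda>n. \<integral>\<^sup>+s\<in>{0<..<t}. hilbert_schmidt_norm_sq (\<lambda>k. S (t - s) (\<sigma> k) - step_integrand (ys n) s k) \<partial>lborel) \<longlonglongrightarrow> 0"
    "(\<lambda>n. \<integral>\<^sup>+\<omega>. ennreal ((norm (step_integral W (ys n) \<omega> - Z t \<omega>))\<^sup>2) \<partial>M) \<longlonglongrightarrow> 0"
    by (rule Z_approx[OF t], rule that, blast, assumption, assumption)
  obtain zs where zs: "\<And>n. step_valid h (zs n)"
    "(\<lambda>n. \<integral>\<^sup>+s\<in>{0<..<h}. hilbert_schmidt_norm_sq (\<lambda>k. S (h - s) (\<sigma> k) - step_integrand (zs n) s k) \<partial>lborel) \<longlonglongrightarrow> 0"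
    "(\<lambda>n. \<integral>\<^sup>+\<omega>. ennreal ((norm (step_integral W (zs n) \<omega> - Z h \<omega>))\<^sup>2) \<partial>M) \<longlonglongrightarrow> 0"
    by (rule Z_approx[OF h], rule that, blast, assumption, assumption)
  have ord: "\<forall>(a, b, e, h)\<in>set (xs n). a \<le> b" for n using xs(1)[of n] by (auto simp: step_valid_def)
  have sub: "(\<lambda>n. \<integral>\<^sup>+s\<in>{a<..<b}. hilbert_schmidt_norm_sq (\<lambda>k. S (t + h - s) (\<sigma> k) - step_integrand (xs n) s k) \<partial>lborel) \<longlonglongrightarrow> 0"
    if "0 \<le> a" "b \<le> t + h" for a b
  proof (rule tendsto_sandwich[OF _ _ tendsto_const xs(2)])
    show "eventually (\<lambda>n. (\<integral>\<^sup>+s\<in>{a<..<b}. hilbert_schmidt_norm_sq (\<lambda>k. S (t + h - s) (\<sigma> k) - step_integrand (xs n) s k) \<partial>lborel)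
      \<le> (\<integral>\<^sup>+s\<in>{0<..<t + h}. hilbert_schmidt_norm_sq (\<lambda>k. S (t + h - s) (\<sigma> k) - step_integrand (xs n) s k) \<partial>lborel)) sequentially"
      using that by (intro always_eventually allI nn_integral_mono mult_left_mono) (auto simp: indicator_def)
  qed simp
  \<comment> \<open>cutting the time points of \<open>xs n\<close> at \<open>t\<close> from above and from below splits the integral; \<open>past\<close> and \<open>error\<close> tend to \<open>0\<close>\<close>
  define past where "past n = map_times (min t) (xs n) @ map_values (\<lambda>x. - S h x) (ys n)" for n
  define future where "future n = map_times (max t) (xs n)" for n
  define shifted where "shifted n = map_times (\<lambda>a. max t a - t) (xs n)" for n
  define error where "error n = shifted n @ map_values (\<lambda>x. - x) (zs n)" for n
  have lin: "linear (\<lambda>x. - S h x)" "linear (\<lambda>x::'h. - x)"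
    by (auto intro!: linearI simp: blinfun.add_right blinfun.scaleR_right)
  have valid: "step_valid t (past n)" "step_valid (t + h) (future n)" "step_valid h (shifted n)" "step_valid h (error n)"
    and fut: "\<forall>(a, b, e, h)\<in>set (future n). t \<le> a" for n
    using xs(1)[of n] ys(1)[of n] zs(1)[of n] t h
    by (auto simp: step_valid_def past_def future_def shifted_def error_def map_times_def map_values_def min_def max_def)
  have m[measurable]: "step_integral W (xs n) \<in> borel_measurable M" "step_integral W (ys n) \<in> borel_measurable M"
    "step_integral W (zs n) \<in> borel_measurable M" "step_integral W (past n) \<in> borel_measurable M" "step_integral W (future n) \<in> borel_measurable M"
    "step_integral W (shifted n) \<in> borel_measurable M" "step_integral W (error n) \<in> borel_measurable M" for n
    using meas_F_M[OF step_integral_meas[OF xs(1) th] th] meas_F_M[OF step_integral_meas[OF ys(1) t] t]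
      meas_F_M[OF step_integral_meas[OF zs(1) h] h] meas_F_M[OF step_integral_meas[OF valid(1) t] t]
      meas_F_M[OF step_integral_meas[OF valid(2) th] th] meas_F_M[OF step_integral_meas[OF valid(3) h] h]
      meas_F_M[OF step_integral_meas[OF valid(4) h] h] by auto
  have [measurable]: "innovation t h \<in> borel_measurable M" "Z h \<in> borel_measurable M"
    using innovation_meas[OF t h] Z_meas[OF h] by auto
  have energy_past: "(\<lambda>n. kernel_energy 0 t y (past n)) \<longlonglongrightarrow> 0"
  proof (rule kernel_energy_tendsto_0[where \<tau>'="t + h" and \<tau>''=t and d=0 and R="\<lambda>x. S h x" and c="norm (S h)" and xs=xs and ys=ys])
    fix n s k assume s: "s \<in> {0<..<t}"
    have "step_integrand (map_times (min t) (xs n)) s k = step_integrand (xs n) s k"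
      by (rule step_integrand_map_times[OF _ ord]) (use s in auto)
    moreover have "S h (S (t - s) (\<sigma> k)) = S (t + h - s) (\<sigma> k)"
      using S_add[of h "t - s" "\<sigma> k"] h s by (simp add: algebra_simps)
    ultimately show "step_integrand (past n) s k = - (S (t + h - s) (\<sigma> k) - step_integrand (xs n) (s + 0) k) + S h (S (t - s) (\<sigma> k) - step_integrand (ys n) s k)"
      by (simp add: past_def step_integrand_append step_integrand_map_values[OF lin(1)] blinfun.diff_right)
  next
    show "(\<lambda>n. \<integral>\<^sup>+s\<in>{0<..<t + 0}. hilbert_schmidt_norm_sq (\<lambda>k. S (t + h + 0 - s) (\<sigma> k) - step_integrand (xs n) s k) \<partial>lborel) \<longlonglongrightarrow> 0"
      using sub[of 0 t] h by simp
    show "(\<lambda>n. \<integral>\<^sup>+s\<in>{0<..<t}. hilbert_schmidt_norm_sq (\<lambda>k. S (t - s) (\<sigma> k) - step_integrand (ys n) s k) \<partial>lborel) \<longlonglongrightarrow> 0"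
      by (rule ys(2))
  qed (use valid t h in \<open>auto intro: norm_blinfun\<close>)
  have energy_error: "(\<lambda>n. kernel_energy 0 h y (error n)) \<longlonglongrightarrow> 0"
  proof (rule kernel_energy_tendsto_0[where \<tau>'=h and \<tau>''=h and d=t and R="\<lambda>x. x" and c=1 and xs=xs and ys=zs])
    fix n s k assume s: "s \<in> {0<..<h}"
    have "step_integrand (shifted n) s k = step_integrand (xs n) (s + t) k"
      unfolding shifted_def by (rule step_integrand_map_times[OF _ ord]) (use s in auto)
    then show "step_integrand (error n) s k = - (S (h - s) (\<sigma> k) - step_integrand (xs n) (s + t) k) + (S (h - s) (\<sigma> k) - step_integrand (zs n) s k)"
      by (simp add: error_def step_integrand_append step_integrand_map_values[OF lin(2)])
  next
    show "(\<lambda>n. \<integral>\<^sup>+s\<in>{t<..<h + t}. hilbert_schmidt_norm_sq (\<lambda>k. S (h + t - s) (\<sigma> k) - step_integrand (xs n) s k) \<partial>lborel) \<longlonglongrightarrow> 0"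
      using sub[of t "t + h"] t by (simp add: add.commute)
    show "(\<lambda>n. \<integral>\<^sup>+s\<in>{0<..<h}. hilbert_schmidt_norm_sq (\<lambda>k. S (h - s) (\<sigma> k) - step_integrand (zs n) s k) \<partial>lborel) \<longlonglongrightarrow> 0"
      by (rule zs(2))
  qed (use valid t h in auto)
  have char1: "(LINT \<omega>|M. cis (step_integral W ds \<omega> \<bullet> y)) = complex_of_real (exp (- kernel_energy 0 r y ds / 2))"
    if "step_valid r ds" "0 \<le> r" for r and ds :: "('x, 'h) step"
  proof -
    have "\<forall>(a, b, e, h)\<in>set ds. 0 \<le> a" using that by (auto simp: step_valid_def)
    from char_step_integral[OF that(1) this order_refl that(2), of "\<lambda>_. 1" 1] show ?thesis by (simp add: prob_space)
  qed
  have null_past: "null_phase M (\<lambda>n \<omega>. step_integral W (past n) \<omega> \<bullet> y)"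
    by (rule null_phase_gauss[OF _ char1[OF valid(1) t] energy_past]) measurable
  have null_error: "null_phase M (\<lambda>n \<omega>. step_integral W (error n) \<omega> \<bullet> y)"
    by (rule null_phase_gauss[OF _ char1[OF valid(4) h] energy_error]) measurable
  have null_x: "null_phase M (\<lambda>n \<omega>. (\<lambda>x. - x) (step_integral W (xs n) \<omega> - Z (t + h) \<omega>) \<bullet> y)"
    by (rule null_phase_approx[OF xs(3,1) th, where c=1]) (auto intro: continuous_intros)
  have null_y: "null_phase M (\<lambda>n \<omega>. (\<lambda>x. S h x) (step_integral W (ys n) \<omega> - Z t \<omega>) \<bullet> y)"
    by (rule null_phase_approx[OF ys(3,1) t, where c="norm (S h)"]) (auto intro: continuous_intros norm_blinfun)
  have null_z: "null_phase M (\<lambda>n \<omega>. (\<lambda>x. - x) (step_integral W (zs n) \<omega> - Z h \<omega>) \<bullet> y)"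
    by (rule null_phase_approx[OF zs(3,1) h, where c=1]) (auto intro: continuous_intros)
  have d1: "null_phase M (\<lambda>n \<omega>. innovation t h \<omega> \<bullet> y - step_integral W (future n) \<omega> \<bullet> y)"
  proof (rule null_phase_cong[OF null_phase_add[OF null_x null_phase_add[OF null_y null_past]]])
    fix n \<omega>
    have "step_integral W (xs n) \<omega> = step_integral W (map_times (min t) (xs n)) \<omega> + step_integral W (future n) \<omega>"
      unfolding future_def by (rule step_integral_split)
    moreover have "step_integral W (past n) \<omega> = step_integral W (map_times (min t) (xs n)) \<omega> - S h (step_integral W (ys n) \<omega>)"
      by (simp add: past_def step_integral_append step_integral_map_values[OF lin(1)])
    ultimately show "(- (step_integral W (xs n) \<omega> - Z (t + h) \<omega>)) \<bullet> y + (S h (step_integral W (ys n) \<omega> - Z t \<omega>) \<bullet> y + step_integral W (past n) \<omega> \<bullet> y)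
       = innovation t h \<omega> \<bullet> y - step_integral W (future n) \<omega> \<bullet> y"
      by (simp add: innovation_def blinfun.diff_right inner_diff_left inner_add_left)
  qed
  have d2: "null_phase M (\<lambda>n \<omega>. Z h \<omega> \<bullet> y - step_integral W (shifted n) \<omega> \<bullet> y)"
  proof (rule null_phase_cong[OF null_phase_add[OF null_z null_phase_minus[OF null_error]]])
    fix n \<omega>
    show "(- (step_integral W (zs n) \<omega> - Z h \<omega>)) \<bullet> y + - (step_integral W (error n) \<omega> \<bullet> y) = Z h \<omega> \<bullet> y - step_integral W (shifted n) \<omega> \<bullet> y"
      by (simp add: error_def step_integral_append step_integral_map_values[OF lin(2)] inner_diff_left inner_add_left)
  qed
  have energy_eq: "kernel_energy t (t + h) y (future n) = kernel_energy 0 h y (shifted n)" for n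
  proof -
    have k: "kernel (project y (future n)) (t + s) = kernel (project y (shifted n)) s" for s
    proof -
      have "kernel (project y (map_times (max t) zs)) (t + s) = kernel (project y (map_times (\<lambda>a. max t a - t) zs)) s" for zs :: "('x, 'h) step"
      proof (induction zs)
        case Nil then show ?case by (simp add: map_times_def project_def kernel_def)
      next
        case (Cons p zs)
        obtain a b e h where p: "p = (a, b, e, h)" by (cases p) auto
        have "t + s \<in> {max t a<..max t b} \<longleftrightarrow> s \<in> {max t a - t<..max t b - t}" by auto
        then have "indicator {max t a<..max t b} (t + s) = (indicator {max t a - t<..max t b - t} s :: real)" by (simp only: indicator_def)
        then show ?case using Cons by (simp add: map_times_def project_def p kernel_Cons)
      qed
      then show ?thesis by (simp add: future_def shifted_def)
    qed
    have "kernel_energy t (t + h) y (future n) = (LINT s|lborel. indicator {t<..t + h} (t + 1 * s) *\<^sub>R (norm (kernel (project y (future n)) (t + 1 * s)))\<^sup>2)"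
      unfolding kernel_energy_def set_lebesgue_integral_def by (subst lborel_integral_real_affine[where c=1 and t=t]) auto
    also have "\<dots> = kernel_energy 0 h y (shifted n)"
      unfolding kernel_energy_def set_lebesgue_integral_def
      by (intro Bochner_Integration.integral_cong refl) (auto simp: k indicator_def)
    finally show ?thesis .
  qed
  have [measurable]: "A \<in> sets M" using A F_sub[OF t] by (auto simp: subalgebra_def)
  have ind: "(LINT \<omega>|M. complex_of_real (indicator A \<omega>)) = of_real (prob A)" by simp
  have eq: "(LINT \<omega>|M. of_real (indicator A \<omega>) * cis (step_integral W (future n) \<omega> \<bullet> y)) = of_real (prob A) * (LINT \<omega>|M. 1 * cis (step_integral W (shifted n) \<omega> \<bullet> y))" for n
  proof -
    have "(LINT \<omega>|M. of_real (indicator A \<omega>) * cis (step_integral W (future n) \<omega> \<bullet> y)) = (LINT \<omega>|M. complex_of_real (indicator A \<omega>)) * complex_of_real (exp (- kernel_energy t (t + h) y (future n) / 2))"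
    proof (rule char_step_integral[OF valid(2) fut t, where c=1])
      show "(\<lambda>\<omega>. complex_of_real (indicator A \<omega>)) \<in> borel_measurable (F t)" using A by measurable
    qed (use h in \<open>auto simp: indicator_def\<close>)
    then show ?thesis unfolding ind energy_eq char1[OF valid(3) h, symmetric] by simp
  qed
  have L1: "(\<lambda>n. LINT \<omega>|M. of_real (indicator A \<omega>) * cis (step_integral W (future n) \<omega> \<bullet> y)) \<longlonglongrightarrow> (LINT \<omega>|M. of_real (indicator A \<omega>) * cis (innovation t h \<omega> \<bullet> y))"
    by (rule null_phase_transfer[OF d1, where c=1]) (auto simp: indicator_def)
  have L2: "(\<lambda>n. LINT \<omega>|M. 1 * cis (step_integral W (shifted n) \<omega> \<bullet> y)) \<longlonglongrightarrow> (LINT \<omega>|M. 1 * cis (Z h \<omega> \<bullet> y))"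
    by (rule null_phase_transfer[OF d2, where c=1]) auto
  have "(\<lambda>n. LINT \<omega>|M. of_real (indicator A \<omega>) * cis (step_integral W (future n) \<omega> \<bullet> y)) \<longlonglongrightarrow> of_real (prob A) * (LINT \<omega>|M. 1 * cis (Z h \<omega> \<bullet> y))"
    unfolding eq by (intro tendsto_mult tendsto_const L2)
  from LIMSEQ_unique[OF L1 this] show ?thesis by simp
qed

text \<open>The Markov property in the form in which it is applied.\<close>
lemma innovation_freeze:
  fixes \<Phi> :: "'w \<Rightarrow> 'h \<Rightarrow> real"
  assumes "0 \<le> t" "0 \<le> h" "(\<lambda>(\<omega>, z). \<Phi> \<omega> z) \<in> borel_measurable (F t \<Otimes>\<^sub>M borel)"
  shows "(LINT \<omega>|M. \<Phi> \<omega> (innovation t h \<omega>)) = (LINT p|(M \<Otimes>\<^sub>M M). \<Phi> (fst p) (Z h (snd p)))"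
  by (rule integral_freeze[OF F_sub[OF assms(1)] innovation_meas[OF assms(1,2)] Z_meas[OF assms(2)] innovation_char[OF assms(1,2)] assms(3)])

end

section \<open>The mild formula along the uncontrolled process\<close>

lemma exp_decay_integral:
  assumes "lam > (0::real)"
  shows "integrable lborel (\<lambda>s. indicator {0..} s * exp (- lam * s))"
    and "(LINT s|lborel. indicator {0..} s * exp (- lam * s)) = 1 / lam"
proof -
  have eq: "exponential_density lam s = lam * (indicator {0..} s * exp (- lam * s))" for s
    by (simp add: exponential_density_def indicator_def mult.commute)
  have "(\<integral>\<^sup>+s. ennreal (exponential_density lam s) \<partial>lborel) = 1"
    using prob_space.emeasure_space_1[OF prob_space_exponential_density[OF assms]]
    by (simp add: emeasure_density)
  then have n: "(\<integral>\<^sup>+s. ennreal (lam * (indicator {0..} s * exp (- lam * s))) \<partial>lborel) = ennreal 1"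
    by (simp add: eq)
  have "integrable lborel (\<lambda>s. lam * (indicator {0..} s * exp (- lam * s))) \<and> (LINT s|lborel. lam * (indicator {0..} s * exp (- lam * s))) = 1"
    using n assms by (subst (asm) nn_integral_eq_integrable) (auto intro!: AE_I2)
  then have i: "integrable lborel (\<lambda>s. lam * (indicator {0..} s * exp (- lam * s)))"
    and e: "(LINT s|lborel. lam * (indicator {0..} s * exp (- lam * s))) = 1" by auto
  have "integrable lborel (\<lambda>s. (1 / lam) * (lam * (indicator {0..} s * exp (- lam * s))))"
    by (rule integrable_mult_right[OF i])
  then show "integrable lborel (\<lambda>s. indicator {0..} s * exp (- lam * s))" using assms by simp
  have "lam * (LINT s|lborel. indicator {0..} s * exp (- lam * s)) = 1" using e by simp
  then show "(LINT s|lborel. indicator {0..} s * exp (- lam * s)) = 1 / lam" using assms by (simp add: field_simps)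
qed

lemma (in prob_space) integrable_pair_lborel_bound:
  fixes g :: "'a \<times> real \<Rightarrow> 'b::{banach, second_countable_topology}"
  assumes g[measurable]: "g \<in> borel_measurable (M \<Otimes>\<^sub>M lborel)" and c: "integrable lborel c"
    and le: "\<And>\<omega> s. \<omega> \<in> space M \<Longrightarrow> norm (g (\<omega>, s)) \<le> c s"
  shows "integrable (M \<Otimes>\<^sub>M lborel) g"
proof (rule integrableI_bounded)
  have cm[measurable]: "c \<in> borel_measurable lborel" using c by auto
  have "(\<integral>\<^sup>+p. ennreal (norm (g p)) \<partial>(M \<Otimes>\<^sub>M lborel)) = (\<integral>\<^sup>+\<omega>. (\<integral>\<^sup>+s. ennreal (norm (g (\<omega>, s))) \<partial>lborel) \<partial>M)"
    by (rule lborel.nn_integral_fst[symmetric]) measurable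
  also have "\<dots> \<le> (\<integral>\<^sup>+\<omega>. (\<integral>\<^sup>+s. ennreal (norm (c s)) \<partial>lborel) \<partial>M)"
    using le by (intro nn_integral_mono ennreal_leI) (auto intro: order_trans[OF le abs_ge_self])
  also have "\<dots> = (\<integral>\<^sup>+s. ennreal (norm (c s)) \<partial>lborel)" by (simp add: emeasure_space_1)
  also have "\<dots> < \<infinity>" using c by (simp add: integrable_iff_bounded)
  finally show "(\<integral>\<^sup>+p. ennreal (norm (g p)) \<partial>(M \<Otimes>\<^sub>M lborel)) < \<infinity>" .
qed (rule g)

context wiener_setting
begin

sublocale time: pair_sigma_finite M "lborel :: real measure" ..
sublocale square: pair_prob_space M M ..

lemma Z_joint [measurable (raw)]:
  assumes "a \<in> measurable N M" "g \<in> borel_measurable N"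
  shows "(\<lambda>x. Z (max 0 (g x)) (a x)) \<in> borel_measurable N"
proof -
  have "(\<lambda>(\<omega>, t). Z (max 0 t) \<omega>) \<in> borel_measurable (M \<Otimes>\<^sub>M borel)"
    by (rule jointly_measurable_of_continuous_paths[OF Z_meas Z_continuous])
  from measurable_compose[OF measurable_Pair[OF assms] this] show ?thesis by simp
qed

lemma innovation_continuous:
  assumes "\<omega> \<in> space M" "0 \<le> t"
  shows "continuous_on ({0..} \<times> {0..}) (\<lambda>(r, h). innovation (t + r) h \<omega>)"
proof -
  have "continuous_on ({0..} \<times> {0..}) (\<lambda>p. Z (t + fst p + snd p) \<omega> - S (snd p) (Z (t + fst p) \<omega>))"
    using assms by (intro continuous_intros continuous_on_compose2[OF Z_continuous]) auto
  then show ?thesis by (simp add: innovation_def split_beta')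
qed

lemma innovation_continuous':
  assumes "\<omega> \<in> space M" "0 \<le> t"
  shows "continuous_on {0..} (\<lambda>h. innovation t h \<omega>)"
proof -
  have "continuous_on {0..} (\<lambda>h. Z (t + h) \<omega> - S h (Z t \<omega>))"
    using assms by (intro continuous_intros continuous_on_compose2[OF Z_continuous]) auto
  then show ?thesis by (simp add: innovation_def)
qed

lemma innovation_add:
  assumes "0 \<le> h" "0 \<le> s"
  shows "S s (innovation t h \<omega>) + innovation (t + h) s \<omega> = innovation t (h + s) \<omega>"
  using S_add[of s h "Z t \<omega>"] assms by (simp add: innovation_def blinfun.diff_right add_ac)

end

locale discounted_OU = wiener_setting M F W S \<sigma> Z
  for M :: "'w measure" and F :: "real \<Rightarrow> 'w measure"
    and W :: "'x::{real_inner, banach, second_countable_topology} \<Rightarrow> real \<Rightarrow> 'w \<Rightarrow> real"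
    and S :: "real \<Rightarrow> 'h::{real_inner, banach, second_countable_topology} \<Rightarrow>\<^sub>L 'h"
    and \<sigma> Z +
  fixes f v :: "'h \<Rightarrow> real" and lam C_f :: real
  assumes f_cont: "continuous_on UNIV f" and f_bound: "\<And>x. \<bar>f x\<bar> \<le> C_f"
    and lam: "lam > 0"
    and v: "\<And>x. v x = (LINT s:{0..}|lborel. exp (- lam * s) * P0 M S Z s f x)"
begin

lemma f_measurable [measurable]: "f \<in> borel_measurable borel"
  using f_cont by (rule borel_measurable_continuous_onI)

lemma C_f_nonneg: "0 \<le> C_f"
  using f_bound[of 0] by linarith

text \<open>The transition semigroup, extended to negative times to be measurable on the whole line.\<close>
definition Pf :: "real \<Rightarrow> 'h \<Rightarrow> real" where
  "Pf s y = (LINT \<omega>|M. f (S (max 0 s) y + Z (max 0 s) \<omega>))"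

lemma Pf_integrable: "integrable M (\<lambda>\<omega>. f (S (max 0 s) y + Z (max 0 s) \<omega>))"
  using f_bound by (intro integrable_bounded[of _ C_f]) auto

lemma Pf_bound: "\<bar>Pf s y\<bar> \<le> C_f"
proof -
  have "\<bar>Pf s y\<bar> \<le> (LINT \<omega>|M. \<bar>f (S (max 0 s) y + Z (max 0 s) \<omega>)\<bar>)"
    unfolding Pf_def by (rule integral_abs_bound)
  also have "\<dots> \<le> (LINT \<omega>|M. C_f)"
    by (rule integral_mono) (use Pf_integrable f_bound in auto)
  finally show ?thesis by (simp add: prob_space)
qed

lemma Pf_measurable: "(\<lambda>p. Pf (snd p) (fst p)) \<in> borel_measurable (borel \<Otimes>\<^sub>M borel)"
proof -
  have "(\<lambda>(p, \<omega>). f (S (max 0 (snd p)) (fst p) + Z (max 0 (snd p)) \<omega>)) \<in> borel_measurable ((borel \<Otimes>\<^sub>M borel) \<Otimes>\<^sub>M M)"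
    by measurable
  from borel_measurable_lebesgue_integral[OF this] show ?thesis by (simp add: Pf_def)
qed

lemma Pf_meas [measurable (raw)]:
  assumes "g \<in> borel_measurable N" "a \<in> borel_measurable N"
  shows "(\<lambda>x. Pf (g x) (a x)) \<in> borel_measurable N"
  using measurable_compose[OF measurable_Pair[OF assms(2,1)] Pf_measurable] by simp

abbreviation disc :: "real \<Rightarrow> real" where "disc s \<equiv> indicator {0..} s * exp (- lam * s)"

lemma v_eq: "v x = (LINT s|lborel. disc s * Pf s x)"
  unfolding v set_lebesgue_integral_def
  by (intro Bochner_Integration.integral_cong refl) (auto simp: indicator_def Pf_def P0_def)

lemma disc_Pf_integrable: "integrable lborel (\<lambda>s. disc s * Pf s x)"
proof (rule Bochner_Integration.integrable_bound)
  show "integrable lborel (\<lambda>s. C_f * disc s)" by (intro integrable_mult_right exp_decay_integral lam)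
  show "AE s in lborel. norm (disc s * Pf s x) \<le> norm (C_f * disc s)"
  proof (rule AE_I2)
    fix s have "\<bar>disc s\<bar> * \<bar>Pf s x\<bar> \<le> \<bar>disc s\<bar> * C_f" using Pf_bound by (intro mult_left_mono) auto
    then show "norm (disc s * Pf s x) \<le> norm (C_f * disc s)" using C_f_nonneg by (simp add: abs_mult mult.commute)
  qed
qed measurable

lemma v_bound: "\<bar>v x\<bar> \<le> C_f / lam"
proof -
  have "\<bar>v x\<bar> \<le> (LINT s|lborel. \<bar>disc s * Pf s x\<bar>)" unfolding v_eq by (rule integral_abs_bound)
  also have "\<dots> \<le> (LINT s|lborel. C_f * disc s)"
  proof (rule integral_mono)
    show "integrable lborel (\<lambda>s. \<bar>disc s * Pf s x\<bar>)" using disc_Pf_integrable by (rule integrable_abs)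
    show "integrable lborel (\<lambda>s. C_f * disc s)" by (intro integrable_mult_right exp_decay_integral lam)
    fix s have "\<bar>disc s\<bar> * \<bar>Pf s x\<bar> \<le> \<bar>disc s\<bar> * C_f" using Pf_bound by (intro mult_left_mono) auto
    then show "\<bar>disc s * Pf s x\<bar> \<le> C_f * disc s" by (simp add: abs_mult mult.commute)
  qed
  also have "\<dots> = C_f / lam" using exp_decay_integral(2)[OF lam] by simp
  finally show ?thesis .
qed

lemma Pf_continuous: "x \<longlonglongrightarrow> y \<Longrightarrow> (\<lambda>n. Pf s (x n)) \<longlonglongrightarrow> Pf s y"
  unfolding Pf_def
proof (rule integral_dominated_convergence[where w="\<lambda>_. C_f"])
  assume x: "x \<longlonglongrightarrow> y"
  show "AE \<omega> in M. (\<lambda>n. f (S (max 0 s) (x n) + Z (max 0 s) \<omega>)) \<longlonglongrightarrow> f (S (max 0 s) y + Z (max 0 s) \<omega>)"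
  proof (rule AE_I2)
    fix \<omega>
    have "(\<lambda>n. S (max 0 s) (x n) + Z (max 0 s) \<omega>) \<longlonglongrightarrow> S (max 0 s) y + Z (max 0 s) \<omega>"
      by (intro tendsto_intros x)
    then show "(\<lambda>n. f (S (max 0 s) (x n) + Z (max 0 s) \<omega>)) \<longlonglongrightarrow> f (S (max 0 s) y + Z (max 0 s) \<omega>)"
      using continuous_on_tendsto_compose[OF f_cont] by simp
  qed
qed (use f_bound in auto)

lemma v_continuous: "continuous_on UNIV v"
proof -
  have "(\<lambda>n. v (x n)) \<longlonglongrightarrow> v y" if x: "x \<longlonglongrightarrow> y" for x y
    unfolding v_eq
  proof (rule integral_dominated_convergence[where w="\<lambda>s. C_f * disc s"])
    show "integrable lborel (\<lambda>s. C_f * disc s)" by (intro integrable_mult_right exp_decay_integral lam)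
    show "AE s in lborel. (\<lambda>n. disc s * Pf s (x n)) \<longlonglongrightarrow> disc s * Pf s y"
      using Pf_continuous[OF x] by (intro AE_I2 tendsto_mult tendsto_const)
    show "AE s in lborel. norm (disc s * Pf s (x n)) \<le> C_f * disc s" for n
    proof (rule AE_I2)
      fix s have "\<bar>disc s\<bar> * \<bar>Pf s (x n)\<bar> \<le> \<bar>disc s\<bar> * C_f" using Pf_bound by (intro mult_left_mono) auto
      then show "norm (disc s * Pf s (x n)) \<le> C_f * disc s" by (simp add: abs_mult mult.commute)
    qed
  qed measurable
  then show ?thesis by (auto simp: continuous_on_sequentially comp_def)
qed

lemma v_measurable [measurable]: "v \<in> borel_measurable borel"
  using v_continuous by (rule borel_measurable_continuous_onI)

text \<open>The mild formula at a random \<open>F t\<close>-measurable point, with the independent copy of the noise replaced by the innovation after \<open>t\<close>. The weight \<open>\<theta>\<close> is what allows sums of increments to be stopped later.\<close>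
lemma expectation_v:
  assumes t: "0 \<le> t" and \<eta>: "\<eta> \<in> borel_measurable (F t)" and \<theta>: "\<theta> \<in> borel_measurable (F t)" and b: "\<And>\<omega>. \<bar>\<theta> \<omega>\<bar> \<le> 1"
  shows "(LINT \<omega>|M. \<theta> \<omega> * v (\<eta> \<omega>)) = (LINT s|lborel. disc s * (LINT \<omega>|M. \<theta> \<omega> * f (S (max 0 s) (\<eta> \<omega>) + innovation t (max 0 s) \<omega>)))"
proof -
  have [measurable]: "\<eta> \<in> borel_measurable M" "\<theta> \<in> borel_measurable M" using meas_F_M \<eta> \<theta> t by auto
  have int: "integrable (M \<Otimes>\<^sub>M lborel) (\<lambda>(\<omega>, s). \<theta> \<omega> * (disc s * Pf s (\<eta> \<omega>)))"
  proof (rule integrable_pair_lborel_bound)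
    show "integrable lborel (\<lambda>s. C_f * disc s)" by (intro integrable_mult_right exp_decay_integral lam)
    fix \<omega> s
    have "\<bar>\<theta> \<omega>\<bar> * (\<bar>disc s\<bar> * \<bar>Pf s (\<eta> \<omega>)\<bar>) \<le> 1 * (\<bar>disc s\<bar> * C_f)"
      using Pf_bound b by (intro mult_mono) auto
    then show "norm ((\<lambda>(\<omega>, s). \<theta> \<omega> * (disc s * Pf s (\<eta> \<omega>))) (\<omega>, s)) \<le> C_f * disc s" by (simp add: abs_mult mult_ac)
  qed measurable
  have "(LINT \<omega>|M. \<theta> \<omega> * v (\<eta> \<omega>)) = (LINT \<omega>|M. LINT s|lborel. \<theta> \<omega> * (disc s * Pf s (\<eta> \<omega>)))"
    unfolding v_eq by simp
  also have "\<dots> = (LINT s|lborel. LINT \<omega>|M. \<theta> \<omega> * (disc s * Pf s (\<eta> \<omega>)))"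
    using time.Fubini_integral[OF int] by simp
  also have "\<dots> = (LINT s|lborel. disc s * (LINT \<omega>|M. \<theta> \<omega> * f (S (max 0 s) (\<eta> \<omega>) + innovation t (max 0 s) \<omega>)))"
  proof (intro Bochner_Integration.integral_cong refl)
    fix s :: real
    have S_F: "(\<lambda>\<omega>. S (max 0 s) (\<eta> \<omega>)) \<in> borel_measurable (F t)" by (rule S_meas_const[OF \<eta>])
    have freeze: "(LINT \<omega>|M. \<theta> \<omega> * f (S (max 0 s) (\<eta> \<omega>) + innovation t (max 0 s) \<omega>))
       = (LINT p|(M \<Otimes>\<^sub>M M). \<theta> (fst p) * f (S (max 0 s) (\<eta> (fst p)) + Z (max 0 s) (snd p)))"
      by (rule innovation_freeze[OF t, where \<Phi>="\<lambda>\<omega> z. \<theta> \<omega> * f (S (max 0 s) (\<eta> \<omega>) + z)"]) (use S_F \<theta> in measurable)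
    have int2: "integrable (M \<Otimes>\<^sub>M M) (\<lambda>p. \<theta> (fst p) * f (S (max 0 s) (\<eta> (fst p)) + Z (max 0 s) (snd p)))"
    proof (rule square.P.integrable_bounded[of _ C_f])
      fix p have "\<bar>\<theta> (fst p)\<bar> * \<bar>f (S (max 0 s) (\<eta> (fst p)) + Z (max 0 s) (snd p))\<bar> \<le> 1 * C_f"
        using b f_bound by (intro mult_mono) auto
      then show "norm (\<theta> (fst p) * f (S (max 0 s) (\<eta> (fst p)) + Z (max 0 s) (snd p))) \<le> C_f" by (simp add: abs_mult)
    qed measurable
    have "(LINT \<omega>|M. \<theta> \<omega> * Pf s (\<eta> \<omega>)) = (LINT \<omega>|M. LINT \<omega>'|M. \<theta> \<omega> * f (S (max 0 s) (\<eta> \<omega>) + Z (max 0 s) \<omega>'))"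
      by (simp add: Pf_def)
    also have "\<dots> = (LINT p|(M \<Otimes>\<^sub>M M). \<theta> (fst p) * f (S (max 0 s) (\<eta> (fst p)) + Z (max 0 s) (snd p)))"
      using square.integral_fst'[OF int2] by simp
    finally have "(LINT \<omega>|M. \<theta> \<omega> * Pf s (\<eta> \<omega>)) = (LINT \<omega>|M. \<theta> \<omega> * f (S (max 0 s) (\<eta> \<omega>) + innovation t (max 0 s) \<omega>))"
      using freeze by simp
    moreover have "(LINT \<omega>|M. \<theta> \<omega> * (disc s * Pf s (\<eta> \<omega>))) = disc s * (LINT \<omega>|M. \<theta> \<omega> * Pf s (\<eta> \<omega>))"
      by (subst integral_mult_right_zero[symmetric]) (simp add: mult_ac)
    ultimately show "(LINT \<omega>|M. \<theta> \<omega> * (disc s * Pf s (\<eta> \<omega>))) = disc s * (LINT \<omega>|M. \<theta> \<omega> * f (S (max 0 s) (\<eta> \<omega>) + innovation t (max 0 s) \<omega>))"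
      by simp
  qed
  finally show ?thesis .
qed

text \<open>Both \<open>v\<close> before and \<open>v\<close> after the step are discounted integrals of \<open>f\<close> along the same uncontrolled trajectory, over \<open>[0, \<infinity>)\<close> and over \<open>[h, \<infinity>)\<close>; only the part over \<open>[0, h)\<close> remains.\<close>
lemma uncontrolled_step:
  assumes t: "0 \<le> t" and h: "0 \<le> h"
    and \<xi>: "\<xi> \<in> borel_measurable (F t)" and \<theta>: "\<theta> \<in> borel_measurable (F t)" and b: "\<And>\<omega>. \<bar>\<theta> \<omega>\<bar> \<le> 1"
  shows "(LINT \<omega>|M. \<theta> \<omega> * (exp (- lam * h) * v (S h (\<xi> \<omega>) + innovation t h \<omega>) - v (\<xi> \<omega>)))
    = - (LINT \<omega>|M. \<theta> \<omega> * (LINT s:{0..<h}|lborel. exp (- lam * s) * f (S s (\<xi> \<omega>) + innovation t s \<omega>)))"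
proof -
  have \<xi>M[measurable]: "\<xi> \<in> borel_measurable M" and \<theta>M[measurable]: "\<theta> \<in> borel_measurable M"
    using meas_F_M \<xi> \<theta> t by auto
  have inn[measurable]: "innovation t (max 0 s) \<in> borel_measurable M" for s using innovation_meas t by simp
  have joint: "(\<lambda>(\<omega>, s). innovation t (max 0 s) \<omega>) \<in> borel_measurable (M \<Otimes>\<^sub>M borel)"
    using innovation_meas[OF t] innovation_continuous'[OF _ t] by (rule jointly_measurable_of_continuous_paths)
  then have joint': "(\<lambda>p. innovation t (max 0 (snd p)) (fst p)) \<in> borel_measurable (M \<Otimes>\<^sub>M lborel)"
    by (simp add: split_beta' cong: measurable_cong_sets)
  define Y where "Y s \<omega> = S (max 0 s) (\<xi> \<omega>) + innovation t (max 0 s) \<omega>" for s \<omega>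
  have Yj[measurable]: "(\<lambda>p. Y (snd p) (fst p)) \<in> borel_measurable (M \<Otimes>\<^sub>M lborel)"
    unfolding Y_def using joint' by measurable
  define g where "g s = (LINT \<omega>|M. \<theta> \<omega> * f (Y s \<omega>))" for s
  have fb: "\<bar>\<theta> \<omega> * f (Y s \<omega>)\<bar> \<le> C_f" for s \<omega>
  proof -
    have "\<bar>\<theta> \<omega>\<bar> * \<bar>f (Y s \<omega>)\<bar> \<le> 1 * C_f" using b f_bound by (intro mult_mono) auto
    then show ?thesis by (simp add: abs_mult)
  qed
  have gm[measurable]: "g \<in> borel_measurable lborel"
  proof -
    have "(\<lambda>(s, \<omega>). \<theta> \<omega> * f (Y s \<omega>)) \<in> borel_measurable (lborel \<Otimes>\<^sub>M M)"
      using measurable_compose[OF measurable_pair_swap' Yj] by (simp add: split_beta' comp_def)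
    from borel_measurable_lebesgue_integral[OF this] show ?thesis by (simp add: g_def[abs_def])
  qed
  have gb: "\<bar>g s\<bar> \<le> C_f" for s
  proof -
    have Ym: "Y s \<in> borel_measurable M" unfolding Y_def[abs_def] by measurable
    have i: "integrable M (\<lambda>\<omega>. \<theta> \<omega> * f (Y s \<omega>))"
      by (rule integrable_bounded[of _ C_f]) (use Ym fb in auto)
    have "\<bar>g s\<bar> \<le> (LINT \<omega>|M. \<bar>\<theta> \<omega> * f (Y s \<omega>)\<bar>)" unfolding g_def by (rule integral_abs_bound)
    also have "\<dots> \<le> (LINT \<omega>|M. C_f)" by (rule integral_mono) (use i fb in auto)
    finally show ?thesis by (simp add: prob_space)
  qed
  have dint: "integrable lborel (\<lambda>s. indicator A s * (exp (- lam * s) * g s))" if A: "A \<in> sets borel" "A \<subseteq> {0..}" for A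
  proof (rule Bochner_Integration.integrable_bound)
    show "integrable lborel (\<lambda>s. C_f * disc s)" by (intro integrable_mult_right exp_decay_integral lam)
    show "AE s in lborel. norm (indicator A s * (exp (- lam * s) * g s)) \<le> norm (C_f * disc s)"
    proof (rule AE_I2)
      fix s
      have "exp (- lam * s) * \<bar>g s\<bar> \<le> exp (- lam * s) * C_f" using gb by (intro mult_left_mono) auto
      then show "norm (indicator A s * (exp (- lam * s) * g s)) \<le> norm (C_f * disc s)"
        using A(2) C_f_nonneg by (auto simp: indicator_def abs_mult mult.commute)
    qed
    show "(\<lambda>s. indicator A s * (exp (- lam * s) * g s)) \<in> borel_measurable lborel" using A(1) by measurable
  qed
  have E0: "(LINT \<omega>|M. \<theta> \<omega> * v (\<xi> \<omega>)) = (LINT s|lborel. indicator {0..} s * (exp (- lam * s) * g s))"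
    unfolding expectation_v[OF t \<xi> \<theta> b] g_def Y_def by (simp add: mult.assoc)
  define \<eta> where "\<eta> \<omega> = S h (\<xi> \<omega>) + innovation t h \<omega>" for \<omega>
  have th: "0 \<le> t + h" using t h by simp
  have \<eta>F: "\<eta> \<in> borel_measurable (F (t + h))"
    unfolding \<eta>_def[abs_def]
    by (intro borel_measurable_add innovation_adapted t h S_meas_const meas_F_mono[OF \<xi> t]) (use h in simp)
  have \<theta>F: "\<theta> \<in> borel_measurable (F (t + h))" by (rule meas_F_mono[OF \<theta> t]) (use h in simp)
  have \<eta>M[measurable]: "\<eta> \<in> borel_measurable M" by (rule meas_F_M[OF \<eta>F th])
  have flow: "S s (\<eta> \<omega>) + innovation (t + h) s \<omega> = Y (h + s) \<omega>" if "0 \<le> s" for s \<omega>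
    using innovation_add[of h s t \<omega>] S_add[of s h "\<xi> \<omega>"] that h
    by (simp add: Y_def \<eta>_def blinfun.add_right add.assoc add.commute[of h s])
  have "(LINT \<omega>|M. \<theta> \<omega> * v (\<eta> \<omega>)) = (LINT s|lborel. disc s * (LINT \<omega>|M. \<theta> \<omega> * f (S (max 0 s) (\<eta> \<omega>) + innovation (t + h) (max 0 s) \<omega>)))"
    by (rule expectation_v[OF th \<eta>F \<theta>F b])
  also have "\<dots> = (LINT s|lborel. disc s * g (h + s))"
  proof (intro Bochner_Integration.integral_cong refl)
    fix s :: real
    show "disc s * (LINT \<omega>|M. \<theta> \<omega> * f (S (max 0 s) (\<eta> \<omega>) + innovation (t + h) (max 0 s) \<omega>)) = disc s * g (h + s)"
      by (cases "0 \<le> s") (simp_all add: flow g_def)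
  qed
  finally have "exp (- lam * h) * (LINT \<omega>|M. \<theta> \<omega> * v (\<eta> \<omega>)) = (LINT s|lborel. exp (- lam * h) * (disc s * g (h + s)))" by simp
  also have "\<dots> = (LINT s|lborel. indicator {h..} (h + 1 * s) * (exp (- lam * (h + 1 * s)) * g (h + 1 * s)))"
    by (intro Bochner_Integration.integral_cong refl) (auto simp: indicator_def exp_add[symmetric] algebra_simps)
  also have "\<dots> = (LINT s|lborel. indicator {h..} s * (exp (- lam * s) * g s))"
    by (subst (2) lborel_integral_real_affine[where c=1 and t=h]) simp_all
  finally have E1: "exp (- lam * h) * (LINT \<omega>|M. \<theta> \<omega> * v (\<eta> \<omega>)) = (LINT s|lborel. indicator {h..} s * (exp (- lam * s) * g s))" .
  have iv: "integrable M (\<lambda>\<omega>. \<theta> \<omega> * v (u \<omega>))" if [measurable]: "u \<in> borel_measurable M" for u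
  proof (rule integrable_bounded[of _ "C_f / lam"])
    fix \<omega> have "\<bar>\<theta> \<omega>\<bar> * \<bar>v (u \<omega>)\<bar> \<le> 1 * (C_f / lam)" using b v_bound by (intro mult_mono) auto
    then show "norm (\<theta> \<omega> * v (u \<omega>)) \<le> C_f / lam" by (simp add: abs_mult)
  qed measurable
  have "(LINT \<omega>|M. \<theta> \<omega> * (exp (- lam * h) * v (\<eta> \<omega>) - v (\<xi> \<omega>))) = (LINT \<omega>|M. exp (- lam * h) * (\<theta> \<omega> * v (\<eta> \<omega>)) - \<theta> \<omega> * v (\<xi> \<omega>))"
    by (intro Bochner_Integration.integral_cong refl) (simp add: algebra_simps)
  also have "\<dots> = (LINT s|lborel. indicator {h..} s * (exp (- lam * s) * g s)) - (LINT s|lborel. indicator {0..} s * (exp (- lam * s) * g s))"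
    unfolding Bochner_Integration.integral_diff[OF integrable_mult_right[OF iv[OF \<eta>M]] iv[OF \<xi>M]] integral_mult_right_zero E0 E1 ..
  also have "\<dots> = (LINT s|lborel. indicator {h..} s * (exp (- lam * s) * g s) - indicator {0..} s * (exp (- lam * s) * g s))"
    by (rule Bochner_Integration.integral_diff[OF dint dint, symmetric]) (use h in auto)
  also have "\<dots> = (LINT s|lborel. - (LINT \<omega>|M. \<theta> \<omega> * (indicator {0..<h} s * (exp (- lam * s) * f (Y s \<omega>)))))"
  proof (intro Bochner_Integration.integral_cong refl)
    fix s :: real
    have "(LINT \<omega>|M. \<theta> \<omega> * (indicator {0..<h} s * (exp (- lam * s) * f (Y s \<omega>)))) = indicator {0..<h} s * (exp (- lam * s) * g s)"
      unfolding g_def by (simp only: integral_mult_right_zero[symmetric]) (simp only: mult_ac)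
    then show "indicator {h..} s * (exp (- lam * s) * g s) - indicator {0..} s * (exp (- lam * s) * g s) = - (LINT \<omega>|M. \<theta> \<omega> * (indicator {0..<h} s * (exp (- lam * s) * f (Y s \<omega>))))"
      using h by (auto simp: indicator_def)
  qed
  also have "\<dots> = - (LINT s|lborel. LINT \<omega>|M. \<theta> \<omega> * (indicator {0..<h} s * (exp (- lam * s) * f (Y s \<omega>))))" by simp
  also have "(LINT s|lborel. LINT \<omega>|M. \<theta> \<omega> * (indicator {0..<h} s * (exp (- lam * s) * f (Y s \<omega>))))
      = (LINT \<omega>|M. LINT s|lborel. \<theta> \<omega> * (indicator {0..<h} s * (exp (- lam * s) * f (Y s \<omega>))))"
  proof -
    have "integrable (M \<Otimes>\<^sub>M lborel) (\<lambda>(\<omega>, s). \<theta> \<omega> * (indicator {0..<h} s * (exp (- lam * s) * f (Y s \<omega>))))"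
    proof (rule integrable_pair_lborel_bound)
      show "integrable lborel (\<lambda>s. C_f * disc s)" by (intro integrable_mult_right exp_decay_integral lam)
      fix \<omega> s
      have "exp (- lam * s) * \<bar>\<theta> \<omega> * f (Y s \<omega>)\<bar> \<le> exp (- lam * s) * C_f" by (intro mult_left_mono fb) auto
      then show "norm ((\<lambda>(\<omega>, s). \<theta> \<omega> * (indicator {0..<h} s * (exp (- lam * s) * f (Y s \<omega>)))) (\<omega>, s)) \<le> C_f * disc s"
        using C_f_nonneg by (auto simp: indicator_def abs_mult mult_ac)
    qed (unfold split_beta', measurable)
    from time.Fubini_integral[OF this] show ?thesis by simp
  qed
  also have "\<dots> = (LINT \<omega>|M. \<theta> \<omega> * (LINT s:{0..<h}|lborel. exp (- lam * s) * f (S s (\<xi> \<omega>) + innovation t s \<omega>)))"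
  proof (intro Bochner_Integration.integral_cong refl)
    fix \<omega>
    have "(LINT s:{0..<h}|lborel. exp (- lam * s) * f (S s (\<xi> \<omega>) + innovation t s \<omega>)) = (LINT s|lborel. indicator {0..<h} s * (exp (- lam * s) * f (Y s \<omega>)))"
      unfolding set_lebesgue_integral_def by (intro Bochner_Integration.integral_cong refl) (auto simp: indicator_def Y_def)
    then show "(LINT s|lborel. \<theta> \<omega> * (indicator {0..<h} s * (exp (- lam * s) * f (Y s \<omega>)))) = \<theta> \<omega> * (LINT s:{0..<h}|lborel. exp (- lam * s) * f (S s (\<xi> \<omega>) + innovation t s \<omega>))"
      by simp
  qed
  finally show ?thesis unfolding \<eta>_def .
qed

end

section \<open>Dynkin's formula for a constant control\<close>

text \<open>A telescoping sum with weights that switch from \<open>1\<close> to \<open>0\<close> once telescopes up to the switch.\<close>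
lemma stopped_telescope:
  fixes a :: "nat \<Rightarrow> real" and \<theta> :: "nat \<Rightarrow> real"
  assumes \<theta>: "\<And>i. \<theta> i = 0 \<or> \<theta> i = 1" "\<And>i. \<theta> (Suc i) \<le> \<theta> i" and a: "\<And>i. \<bar>a i\<bar> \<le> C"
  shows "\<bar>\<Sum>i<m. \<theta> i * (a (Suc i) - a i)\<bar> \<le> 2 * C"
proof -
  have "\<exists>j. (\<Sum>i<m. \<theta> i * (a (Suc i) - a i)) = a j - a 0 \<and> (\<theta> m = 1 \<longrightarrow> j = m)" for m
  proof (induction m)
    case 0 show ?case by (rule exI[of _ 0]) simp
  next
    case (Suc m)
    then obtain j where j: "(\<Sum>i<m. \<theta> i * (a (Suc i) - a i)) = a j - a 0" "\<theta> m = 1 \<longrightarrow> j = m" by blast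
    show ?case
    proof (cases "\<theta> m = 1")
      case True then show ?thesis using j by (intro exI[of _ "Suc m"]) simp
    next
      case False
      then have "\<theta> m = 0" using \<theta>(1)[of m] by simp
      moreover have "\<theta> (Suc m) \<noteq> 1" using \<theta>(2)[of m] \<open>\<theta> m = 0\<close> by simp
      ultimately show ?thesis using j by (intro exI[of _ j]) simp
    qed
  qed
  then obtain j where "(\<Sum>i<m. \<theta> i * (a (Suc i) - a i)) = a j - a 0" by blast
  then show ?thesis using a[of j] a[of 0] by linarith
qed

text \<open>The sum is stopped just after the first term that exceeds \<open>c\<close>, so that at most one term has to be estimated by \<open>C\<close>.\<close>
lemma stopped_sum_bound:
  fixes b :: "nat \<Rightarrow> real"
  assumes \<theta>: "\<And>i. \<theta> i = (if \<forall>j<i. \<bar>b j\<bar> \<le> c then 1 else 0 :: real)" and c: "0 \<le> c" and b: "\<And>i. \<bar>b i\<bar> \<le> C"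
  shows "(\<Sum>i<m. \<theta> i * \<bar>b i\<bar>) \<le> real m * c + C"
proof -
  have C: "0 \<le> C" using b[of 0] by linarith
  have "(\<Sum>i<m. \<theta> i * \<bar>b i\<bar>) \<le> real m * c + (if \<theta> m = 1 then 0 else C)"
  proof (induction m)
    case 0 then show ?case using C by simp
  next
    case (Suc m)
    have nn: "0 \<le> real m * c" using c by simp
    show ?case
    proof (cases "\<theta> m = 1")
      case True
      then have S: "\<forall>j<m. \<bar>b j\<bar> \<le> c" by (auto simp: \<theta> split: if_splits)
      show ?thesis
      proof (cases "\<bar>b m\<bar> \<le> c")
        case True
        then have "\<theta> (Suc m) = 1" using S by (auto simp: \<theta> less_Suc_eq)
        with Suc \<open>\<theta> m = 1\<close> True show ?thesis by (simp add: algebra_simps)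
      next
        case False
        then have "\<theta> (Suc m) \<noteq> 1" by (auto simp: \<theta>)
        with Suc \<open>\<theta> m = 1\<close> b[of m] c show ?thesis by (simp add: algebra_simps)
      qed
    next
      case False
      then have 0: "\<theta> m = 0" using \<theta>[of m] by (auto split: if_splits)
      have "\<theta> (Suc m) \<noteq> 1" using False by (auto simp: \<theta> less_Suc_eq split: if_splits)
      with Suc 0 c show ?thesis by (simp add: algebra_simps)
    qed
  qed
  also have "\<dots> \<le> real m * c + C" using C by simp
  finally show ?thesis .
qed

locale smooth_along_input = discounted_OU M F W S \<sigma> Z f v lam C_f + unbounded_input S D G C_G \<beta> a_G
  for M :: "'w measure" and F :: "real \<Rightarrow> 'w measure"
    and W :: "'x::{real_inner, banach, second_countable_topology} \<Rightarrow> real \<Rightarrow> 'w \<Rightarrow> real"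
    and S :: "real \<Rightarrow> 'h::{real_inner, banach, second_countable_topology} \<Rightarrow>\<^sub>L 'h"
    and \<sigma> Z f v lam C_f
    and D :: "'k::{real_inner, banach, second_countable_topology} set" and G C_G \<beta> a_G +
  fixes dv :: "'h \<Rightarrow> 'k" and B :: real
  assumes dv_cont: "continuous_on UNIV dv" and dv_bound: "\<And>x. norm (dv x) \<le> B"
    and v_along_paths: "\<And>k z. continuous_on {0..} z \<Longrightarrow>
        ((\<lambda>t. (1 / t) * (v (z t + \<Gamma> t k) - v (z t))) \<longlongrightarrow> dv (z 0) \<bullet> k) (at_right 0)"
begin

lemma B_nonneg: "0 \<le> B"
  using dv_bound[of 0] norm_ge_zero order_trans by blast

lemma dv_measurable [measurable]: "dv \<in> borel_measurable borel"
  using dv_cont by (rule borel_measurable_continuous_onI)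

lemma dv_inner_bound: "\<bar>dv x \<bullet> k\<bar> \<le> B * norm k"
  by (meson Cauchy_Schwarz_ineq2 dv_bound mult_right_mono norm_ge_zero order_trans)

lemma \<Gamma>_meas [measurable (raw)]:
  assumes "g \<in> borel_measurable N" "a \<in> borel_measurable N"
  shows "(\<lambda>x. \<Gamma> (max 0 (g x)) (a x)) \<in> borel_measurable N"
proof -
  have "continuous_on UNIV (\<lambda>p. \<Gamma> (max 0 (fst p)) (snd p))" by (intro continuous_intros) auto
  then have "(\<lambda>p. \<Gamma> (max 0 (fst p)) (snd p)) \<in> borel_measurable borel" by (rule borel_measurable_continuous_onI)
  then have "(\<lambda>p. \<Gamma> (max 0 (fst p)) (snd p)) \<in> borel_measurable (borel \<Otimes>\<^sub>M borel)" by (simp add: borel_prod)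
  from measurable_compose[OF measurable_Pair[OF assms] this] show ?thesis by simp
qed

lemma \<Gamma>_meas_const:
  assumes "a \<in> borel_measurable N" "0 \<le> r"
  shows "(\<lambda>x. \<Gamma> r (a x)) \<in> borel_measurable N"
  using \<Gamma>_meas[of "\<lambda>_. r" N a] assms by simp

text \<open>Used without the discount factor to bound difference quotients, and with it in \<open>v_directional_limit\<close> to compute the rate.\<close>
lemma v_difference_limit:
  "((\<lambda>(t, y). (1 / t) * (v (y + \<Gamma> t k) - v y)) \<longlongrightarrow> dv x \<bullet> k) (at_right 0 \<times>\<^sub>F nhds x)"
proof (rule joint_limit_of_path_limits[where q="\<lambda>t y. (1 / t) * (v (y + \<Gamma> t k) - v y)"])
  fix z :: "real \<Rightarrow> 'h" assume z: "continuous_on {0..} z" "z 0 = x"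
  show "((\<lambda>t. (1 / t) * (v (z t + \<Gamma> t k) - v (z t))) \<longlongrightarrow> dv x \<bullet> k) (at_right 0)"
    using v_along_paths[OF z(1), of k] z(2) by simp
qed

lemma v_directional_limit:
  "((\<lambda>(t, y). exp (- lam * t) * ((1 / t) * (v (y + \<Gamma> t k) - v y))) \<longlongrightarrow> dv x \<bullet> k) (at_right 0 \<times>\<^sub>F nhds x)"
proof (rule joint_limit_of_path_limits[where q="\<lambda>t y. exp (- lam * t) * ((1 / t) * (v (y + \<Gamma> t k) - v y))"])
  fix z :: "real \<Rightarrow> 'h" assume z: "continuous_on {0..} z" "z 0 = x"
  have "((\<lambda>t. exp (- lam * t)) \<longlongrightarrow> exp (- lam * 0)) (at_right 0)" by (intro tendsto_intros)
  from tendsto_mult[OF this v_along_paths[OF z(1), of k]]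
  show "((\<lambda>t. exp (- lam * t) * ((1 / t) * (v (z t + \<Gamma> t k) - v (z t)))) \<longlongrightarrow> dv x \<bullet> k) (at_right 0)"
    using z(2) by simp
qed

lemma f_joint_limit: "((\<lambda>(t, y). exp (- lam * t) * f y) \<longlongrightarrow> f x) (at_right 0 \<times>\<^sub>F nhds x)"
proof (rule joint_limit_of_path_limits[where q="\<lambda>t y. exp (- lam * t) * f y"])
  fix z :: "real \<Rightarrow> 'h" assume z: "continuous_on {0..} z" "z 0 = x"
  have "(z \<longlongrightarrow> z 0) (at 0 within {0..})" using z(1) by (auto simp: continuous_on_def)
  then have "(z \<longlongrightarrow> x) (at_right 0)" using z(2) by (auto intro: tendsto_within_subset)
  then have "((\<lambda>t. f (z t)) \<longlongrightarrow> f x) (at_right 0)" using continuous_on_tendsto_compose[OF f_cont] by simp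
  moreover have "((\<lambda>t. exp (- lam * t)) \<longlongrightarrow> exp (- lam * 0)) (at_right 0)" by (intro tendsto_intros)
  ultimately have "((\<lambda>t. exp (- lam * t) * f (z t)) \<longlongrightarrow> exp (- lam * 0) * f x) (at_right 0)" by (intro tendsto_mult)
  then show "((\<lambda>t. exp (- lam * t) * f (z t)) \<longlongrightarrow> f x) (at_right 0)" by simp
qed

context
  fixes t :: real and \<xi> :: "'w \<Rightarrow> 'h" and \<kappa> :: "'w \<Rightarrow> 'k"
  assumes t: "0 \<le> t" and \<xi>: "\<xi> \<in> borel_measurable (F t)" and \<kappa>: "\<kappa> \<in> borel_measurable (F t)" and \<kappa>_int: "integrable M \<kappa>"
begin

text \<open>State at time \<open>t + r\<close>, started from \<open>\<xi>\<close> at time \<open>t\<close> with constant control \<open>\<kappa>\<close>. Below, \<open>Y r h\<close> continues \<open>X r\<close> without control for a time \<open>h\<close>.\<close>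
definition X :: "real \<Rightarrow> 'w \<Rightarrow> 'h" where
  "X r \<omega> = S r (\<xi> \<omega>) + innovation t r \<omega> + \<Gamma> r (\<kappa> \<omega>)"

definition Y :: "real \<Rightarrow> real \<Rightarrow> 'w \<Rightarrow> 'h" where
  "Y r h \<omega> = S h (X r \<omega>) + innovation (t + r) h \<omega>"

definition rate :: "real \<Rightarrow> 'w \<Rightarrow> real" where
  "rate r \<omega> = exp (- lam * r) * (dv (X r \<omega>) \<bullet> \<kappa> \<omega> - f (X r \<omega>))"

lemma X_add:
  assumes "0 \<le> r" "0 \<le> h" shows "X (r + h) \<omega> = Y r h \<omega> + \<Gamma> h (\<kappa> \<omega>)"
proof -
  have "S h (X r \<omega>) = S (r + h) (\<xi> \<omega>) + S h (innovation t r \<omega>) + (\<Gamma> (r + h) (\<kappa> \<omega>) - \<Gamma> h (\<kappa> \<omega>))"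
    using S_\<Gamma>[OF assms(2,1), of "\<kappa> \<omega>"] S_add[OF assms(2,1), of "\<xi> \<omega>"]
    by (simp add: X_def blinfun.add_right add.commute)
  then have "Y r h \<omega> + \<Gamma> h (\<kappa> \<omega>) = S (r + h) (\<xi> \<omega>) + (S h (innovation t r \<omega>) + innovation (t + r) h \<omega>) + \<Gamma> (r + h) (\<kappa> \<omega>)"
    unfolding Y_def by simp
  also have "\<dots> = X (r + h) \<omega>" unfolding innovation_add[OF assms] X_def ..
  finally show ?thesis by simp
qed

lemma X_adapted: "0 \<le> r \<Longrightarrow> X r \<in> borel_measurable (F (t + r))"
  unfolding X_def[abs_def]
  by (intro borel_measurable_add innovation_adapted t S_meas_const \<Gamma>_meas_const meas_F_mono[OF \<xi> t] meas_F_mono[OF \<kappa> t]) auto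

lemma Y_adapted:
  assumes "0 \<le> r" "0 \<le> h" shows "Y r h \<in> borel_measurable (F (t + r + h))"
proof -
  have tr: "0 \<le> t + r" using t assms by simp
  have "X r \<in> borel_measurable (F (t + r + h))" by (rule meas_F_mono[OF X_adapted[OF assms(1)] tr]) (use assms in simp)
  moreover have "innovation (t + r) h \<in> borel_measurable (F (t + r + h))" by (rule innovation_adapted[OF tr assms(2)])
  ultimately show ?thesis unfolding Y_def[abs_def] by (intro borel_measurable_add S_meas_const)
qed

lemma X_meas: "0 \<le> r \<Longrightarrow> X r \<in> borel_measurable M"
  using meas_F_M[OF X_adapted] t by simp

lemma Y_meas: "0 \<le> r \<Longrightarrow> 0 \<le> h \<Longrightarrow> Y r h \<in> borel_measurable M"
  using meas_F_M[OF Y_adapted] t by simp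

lemma X_continuous: "\<omega> \<in> space M \<Longrightarrow> continuous_on {0..} (\<lambda>r. X r \<omega>)"
  unfolding X_def by (intro continuous_intros innovation_continuous' t) auto

lemma Y_continuous:
  assumes "\<omega> \<in> space M" shows "continuous_on ({0..} \<times> {0..}) (\<lambda>(r, h). Y r h \<omega>)"
proof -
  have "continuous_on ({0..} \<times> {0..}) (\<lambda>p. S (snd p) (X (fst p) \<omega>) + (\<lambda>(r, h). innovation (t + r) h \<omega>) p)"
    by (intro continuous_intros innovation_continuous[OF assms t] continuous_on_compose2[OF X_continuous[OF assms]]) auto
  then show ?thesis by (simp add: Y_def split_beta')
qed

lemma Y_section:
  assumes "\<omega> \<in> space M" "0 \<le> r" shows "continuous_on {0..} (\<lambda>h. Y r h \<omega>)"
proof -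
  have "continuous_on {0..} (\<lambda>h. S h (X r \<omega>) + innovation (t + r) h \<omega>)"
    using assms t by (intro continuous_intros innovation_continuous') auto
  then show ?thesis by (simp add: Y_def)
qed

lemma Y_0: "0 \<le> r \<Longrightarrow> Y r 0 \<omega> = X r \<omega>"
  by (simp add: Y_def innovation_def)

lemma X_0: "X 0 \<omega> = \<xi> \<omega>"
  by (simp add: X_def innovation_def)

definition jump :: "real \<Rightarrow> real \<Rightarrow> 'w \<Rightarrow> real" where
  "jump r h \<omega> = v (X (r + h) \<omega>) - v (Y r h \<omega>)"

definition cost_part :: "real \<Rightarrow> real \<Rightarrow> 'w \<Rightarrow> real" where
  "cost_part r h \<omega> = (LINT s:{0..<h}|lborel. exp (- lam * s) * f (Y r s \<omega>))"

text \<open>The two parts of the discounted change of \<open>v\<close> over a step, caused by the control and by the passage of time.\<close>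
definition drift :: "real \<Rightarrow> real \<Rightarrow> 'w \<Rightarrow> real" where
  "drift r h \<omega> = exp (- lam * (r + h)) * jump r h \<omega> - exp (- lam * r) * cost_part r h \<omega>"

text \<open>The indicator that the difference quotients of all steps before the \<open>i\<close>-th stayed below \<open>B * norm \<kappa> + 1\<close>, a bound that any fine enough grid satisfies in the end because the limiting quotients are at most \<open>B * norm \<kappa>\<close>. It depends on the past only.\<close>
definition alive :: "real \<Rightarrow> nat \<Rightarrow> 'w \<Rightarrow> real" where
  "alive h i \<omega> = (if \<forall>j<i. \<bar>jump (real j * h) h \<omega>\<bar> \<le> (B * norm (\<kappa> \<omega>) + 1) * h then 1 else 0)"

lemma jump_adapted:
  assumes "0 \<le> r" "0 \<le> h" shows "jump r h \<in> borel_measurable (F (t + r + h))"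
proof -
  have "X (r + h) \<in> borel_measurable (F (t + (r + h)))" using assms by (intro X_adapted) auto
  then have "X (r + h) \<in> borel_measurable (F (t + r + h))" by (simp add: add.assoc)
  with Y_adapted[OF assms] show ?thesis unfolding jump_def[abs_def] by measurable
qed

lemma alive_adapted:
  assumes h: "0 \<le> h" shows "alive h i \<in> borel_measurable (F (t + real i * h))"
proof -
  have j: "jump (real j * h) h \<in> borel_measurable (F (t + real i * h))" if "j < i" for j
  proof (rule meas_F_mono[OF jump_adapted])
    have "real (Suc j) * h \<le> real i * h" using that h by (intro mult_right_mono) auto
    then show "t + real j * h + h \<le> t + real i * h" by (simp add: algebra_simps)
  qed (use h t in auto)
  have \<kappa>i: "\<kappa> \<in> borel_measurable (F (t + real i * h))" by (rule meas_F_mono[OF \<kappa> t]) (use h in simp)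
  have "alive h i = (\<lambda>\<omega>. \<Prod>j<i. if \<bar>jump (real j * h) h \<omega>\<bar> \<le> (B * norm (\<kappa> \<omega>) + 1) * h then 1 else 0)"
    by (auto simp: alive_def fun_eq_iff intro!: prod_zero[symmetric])
  moreover have "(\<lambda>\<omega>. \<Prod>j<i. if \<bar>jump (real j * h) h \<omega>\<bar> \<le> (B * norm (\<kappa> \<omega>) + 1) * h then 1 else (0::real)) \<in> borel_measurable (F (t + real i * h))"
  proof (rule borel_measurable_prod)
    fix j assume "j \<in> {..<i}"
    then have [measurable]: "jump (real j * h) h \<in> borel_measurable (F (t + real i * h))" using j by simp
    note \<kappa>i[measurable]
    show "(\<lambda>\<omega>. if \<bar>jump (real j * h) h \<omega>\<bar> \<le> (B * norm (\<kappa> \<omega>) + 1) * h then 1 else (0::real)) \<in> borel_measurable (F (t + real i * h))"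
      by measurable
  qed
  ultimately show ?thesis by simp
qed

lemma alive_01: "alive h i \<omega> = 0 \<or> alive h i \<omega> = 1"
  by (simp add: alive_def)

lemma alive_decreasing: "alive h (Suc i) \<omega> \<le> alive h i \<omega>"
  by (auto simp: alive_def)

lemma cost_part_bound:
  assumes h: "0 \<le> h" shows "\<bar>cost_part r h \<omega>\<bar> \<le> C_f * h"
proof (cases "set_integrable lborel {0..<h} (\<lambda>s. exp (- lam * s) * f (Y r s \<omega>))")
  case True
  have "\<bar>cost_part r h \<omega>\<bar> \<le> (LINT s:{0..<h}|lborel. \<bar>exp (- lam * s) * f (Y r s \<omega>)\<bar>)"
    unfolding cost_part_def using set_integral_norm_bound[OF True] by simp
  also have "\<dots> \<le> (LINT s:{0..<h}|lborel. C_f)"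
  proof (rule set_integral_mono)
    show "set_integrable lborel {0..<h} (\<lambda>s. \<bar>exp (- lam * s) * f (Y r s \<omega>)\<bar>)" using True by (rule set_integrable_abs)
    show "set_integrable lborel {0..<h} (\<lambda>_. C_f)"
      using h by (auto simp: set_integrable_def intro!: integrable_real_indicator integrable_mult_left)
    fix s assume s: "s \<in> {0..<h}"
    have "exp (- lam * s) * \<bar>f (Y r s \<omega>)\<bar> \<le> 1 * C_f"
      using s lam f_bound by (intro mult_mono) auto
    then show "\<bar>exp (- lam * s) * f (Y r s \<omega>)\<bar> \<le> C_f" by (simp add: abs_mult)
  qed
  also have "\<dots> = C_f * h" using h by (simp add: set_lebesgue_integral_def mult.commute)
  finally show ?thesis .
next
  case False
  then have "cost_part r h \<omega> = 0"
    unfolding cost_part_def set_lebesgue_integral_def set_integrable_def by (rule not_integrable_integral_eq)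
  then show ?thesis using h C_f_nonneg by simp
qed

lemma cost_part_meas:
  assumes r: "0 \<le> r" shows "cost_part r h \<in> borel_measurable M"
proof -
  have "(\<lambda>(\<omega>, s). Y r (max 0 s) \<omega>) \<in> borel_measurable (M \<Otimes>\<^sub>M borel)"
  proof (rule jointly_measurable_of_continuous_paths)
    show "Y r h \<in> borel_measurable M" if "0 \<le> h" for h using Y_meas r that by simp
    show "continuous_on {0..} (\<lambda>h. Y r h \<omega>)" if "\<omega> \<in> space M" for \<omega>
      using Y_section that r by simp
  qed
  then have [measurable]: "(\<lambda>(\<omega>, s). Y r (max 0 s) \<omega>) \<in> borel_measurable (M \<Otimes>\<^sub>M lborel)"
    by (simp cong: measurable_cong_sets)
  have "(\<lambda>(\<omega>, s). indicator {0..<h} s * (exp (- lam * s) * f ((\<lambda>(\<omega>, s). Y r (max 0 s) \<omega>) (\<omega>, s)))) \<in> borel_measurable (M \<Otimes>\<^sub>M lborel)"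
    by measurable
  from lborel.borel_measurable_lebesgue_integral[OF this]
  have "(\<lambda>\<omega>. LINT s|lborel. indicator {0..<h} s * (exp (- lam * s) * f (Y r (max 0 s) \<omega>))) \<in> borel_measurable M" by simp
  also have "(\<lambda>\<omega>. LINT s|lborel. indicator {0..<h} s * (exp (- lam * s) * f (Y r (max 0 s) \<omega>))) = cost_part r h"
    unfolding cost_part_def[abs_def] set_lebesgue_integral_def
    by (intro ext Bochner_Integration.integral_cong refl) (auto simp: indicator_def)
  finally show ?thesis .
qed

lemma jump_meas: "0 \<le> r \<Longrightarrow> 0 \<le> h \<Longrightarrow> jump r h \<in> borel_measurable M"
  using meas_F_M[OF jump_adapted] t by simp

lemma alive_meas: "0 \<le> h \<Longrightarrow> alive h i \<in> borel_measurable M"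
  using meas_F_M[OF alive_adapted] t by simp

lemma drift_meas: "0 \<le> r \<Longrightarrow> 0 \<le> h \<Longrightarrow> drift r h \<in> borel_measurable M"
  unfolding drift_def[abs_def]
  by (intro borel_measurable_diff borel_measurable_times borel_measurable_const jump_meas cost_part_meas)

lemma alive_abs: "\<bar>alive h i \<omega>\<bar> \<le> 1"
  by (simp add: alive_def)

lemma jump_bound: "\<bar>jump r h \<omega>\<bar> \<le> 2 * (C_f / lam)"
  using v_bound[of "X (r + h) \<omega>"] v_bound[of "Y r h \<omega>"] unfolding jump_def by linarith

definition value_at :: "real \<Rightarrow> 'w \<Rightarrow> real" where
  "value_at r \<omega> = exp (- lam * r) * v (X r \<omega>)"

lemma value_at_bound: "0 \<le> r \<Longrightarrow> \<bar>value_at r \<omega>\<bar> \<le> C_f / lam"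
proof -
  assume r: "0 \<le> r"
  have "exp (- lam * r) * \<bar>v (X r \<omega>)\<bar> \<le> 1 * (C_f / lam)"
    using r lam v_bound by (intro mult_mono) auto
  then show ?thesis by (simp add: value_at_def abs_mult)
qed

lemma value_at_meas: "0 \<le> r \<Longrightarrow> value_at r \<in> borel_measurable M"
  unfolding value_at_def[abs_def] using measurable_compose[OF X_meas v_measurable] by simp

text \<open>The weight is measurable at the beginning of the step, so the uncontrolled identity applies to it; the remaining difference is the displacement by the control.\<close>
lemma expected_step:
  assumes h: "0 \<le> h"
  shows "(LINT \<omega>|M. alive h i \<omega> * (value_at (real (Suc i) * h) \<omega> - value_at (real i * h) \<omega>)) = (LINT \<omega>|M. alive h i \<omega> * drift (real i * h) h \<omega>)"
proof -
  define r where "r = real i * h"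
  have r: "0 \<le> r" using h by (simp add: r_def)
  have rS: "real (Suc i) * h = r + h" by (simp add: r_def algebra_simps)
  have tr: "0 \<le> t + r" using t r by simp
  note [measurable] = alive_meas[OF h, of i] jump_meas[OF r h] cost_part_meas[OF r, of h] X_meas[OF r] Y_meas[OF r h]
  have "(LINT \<omega>|M. alive h i \<omega> * (exp (- lam * h) * v (S h (X r \<omega>) + innovation (t + r) h \<omega>) - v (X r \<omega>)))
    = - (LINT \<omega>|M. alive h i \<omega> * (LINT s:{0..<h}|lborel. exp (- lam * s) * f (S s (X r \<omega>) + innovation (t + r) s \<omega>)))"
    by (rule uncontrolled_step[OF tr h X_adapted[OF r]]) (use alive_adapted[OF h, of i] alive_abs in \<open>auto simp: r_def\<close>)
  then have u: "(LINT \<omega>|M. alive h i \<omega> * (exp (- lam * h) * v (Y r h \<omega>) - v (X r \<omega>))) = - (LINT \<omega>|M. alive h i \<omega> * cost_part r h \<omega>)"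
    unfolding cost_part_def Y_def .
  have i1: "integrable M (\<lambda>\<omega>. exp (- lam * (r + h)) * (alive h i \<omega> * jump r h \<omega>))"
  proof (intro integrable_mult_right integrable_bounded[of _ "2 * (C_f / lam)"])
    fix \<omega> have "\<bar>alive h i \<omega>\<bar> * \<bar>jump r h \<omega>\<bar> \<le> 1 * (2 * (C_f / lam))" using alive_abs jump_bound by (intro mult_mono) auto
    then show "norm (alive h i \<omega> * jump r h \<omega>) \<le> 2 * (C_f / lam)" by (simp add: abs_mult)
  qed measurable
  have i2: "integrable M (\<lambda>\<omega>. exp (- lam * r) * (alive h i \<omega> * cost_part r h \<omega>))"
  proof (intro integrable_mult_right integrable_bounded[of _ "C_f * h"])
    fix \<omega> have "\<bar>alive h i \<omega>\<bar> * \<bar>cost_part r h \<omega>\<bar> \<le> 1 * (C_f * h)" using alive_abs cost_part_bound[OF h] by (intro mult_mono) auto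
    then show "norm (alive h i \<omega> * cost_part r h \<omega>) \<le> C_f * h" by (simp add: abs_mult)
  qed measurable
  have i3: "integrable M (\<lambda>\<omega>. exp (- lam * r) * (alive h i \<omega> * (exp (- lam * h) * v (Y r h \<omega>) - v (X r \<omega>))))"
  proof (intro integrable_mult_right integrable_bounded[of _ "2 * (C_f / lam)"])
    fix \<omega>
    have "exp (- lam * h) * \<bar>v (Y r h \<omega>)\<bar> \<le> 1 * (C_f / lam)" using h lam v_bound by (intro mult_mono) auto
    then have "\<bar>exp (- lam * h) * v (Y r h \<omega>)\<bar> \<le> C_f / lam" by (simp add: abs_mult)
    then have "\<bar>exp (- lam * h) * v (Y r h \<omega>) - v (X r \<omega>)\<bar> \<le> 2 * (C_f / lam)" using v_bound[of "X r \<omega>"] by linarith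
    then have "\<bar>alive h i \<omega>\<bar> * \<bar>exp (- lam * h) * v (Y r h \<omega>) - v (X r \<omega>)\<bar> \<le> 1 * (2 * (C_f / lam))" using alive_abs by (intro mult_mono) auto
    then show "norm (alive h i \<omega> * (exp (- lam * h) * v (Y r h \<omega>) - v (X r \<omega>))) \<le> 2 * (C_f / lam)" by (simp add: abs_mult)
  qed measurable
  have e: "exp (- lam * (r + h)) = exp (- lam * r) * exp (- lam * h)" by (simp add: exp_add[symmetric] algebra_simps)
  have "(LINT \<omega>|M. alive h i \<omega> * (value_at (r + h) \<omega> - value_at r \<omega>))
     = (LINT \<omega>|M. exp (- lam * (r + h)) * (alive h i \<omega> * jump r h \<omega>) + exp (- lam * r) * (alive h i \<omega> * (exp (- lam * h) * v (Y r h \<omega>) - v (X r \<omega>))))"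
    unfolding value_at_def jump_def e by (intro Bochner_Integration.integral_cong refl) (simp only: algebra_simps)
  also have "\<dots> = (LINT \<omega>|M. exp (- lam * (r + h)) * (alive h i \<omega> * jump r h \<omega>)) - (LINT \<omega>|M. exp (- lam * r) * (alive h i \<omega> * cost_part r h \<omega>))"
    unfolding Bochner_Integration.integral_add[OF i1 i3] integral_mult_right_zero u by simp
  also have "\<dots> = (LINT \<omega>|M. exp (- lam * (r + h)) * (alive h i \<omega> * jump r h \<omega>) - exp (- lam * r) * (alive h i \<omega> * cost_part r h \<omega>))"
    by (rule Bochner_Integration.integral_diff[OF i1 i2, symmetric])
  also have "\<dots> = (LINT \<omega>|M. alive h i \<omega> * drift r h \<omega>)"
    unfolding drift_def by (intro Bochner_Integration.integral_cong refl) (simp only: algebra_simps)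
  finally show ?thesis unfolding rS r_def .
qed

lemma cost_part_near:
  assumes \<omega>: "\<omega> \<in> space M" and r: "0 \<le> r" and h: "0 < h" and e: "0 \<le> e"
    and near: "\<And>s. 0 < s \<Longrightarrow> s < h \<Longrightarrow> \<bar>exp (- lam * s) * f (Y r s \<omega>) - c\<bar> \<le> e"
  shows "\<bar>cost_part r h \<omega> - h * c\<bar> \<le> h * e"
proof -
  have cont: "continuous_on {0..h} (\<lambda>s. exp (- lam * s) * f (Y r s \<omega>))"
  proof (intro continuous_intros continuous_on_compose2[OF f_cont])
    show "continuous_on {0..h} (\<lambda>s. Y r s \<omega>)" by (rule continuous_on_subset[OF Y_section[OF \<omega> r]]) auto
  qed auto
  have int: "set_integrable lborel {0..<h} (\<lambda>s. exp (- lam * s) * f (Y r s \<omega>))"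
    by (rule set_integrable_subset[OF borel_integrable_atLeastAtMost'[OF cont]]) auto
  have intc: "set_integrable lborel {0..<h} (\<lambda>_. k :: real)" for k
    using h by (auto simp: set_integrable_def intro!: integrable_real_indicator integrable_mult_left)
  have const: "(LINT s:{0..<h}|lborel. k) = h * k" for k :: real using h by (simp add: set_lebesgue_integral_def)
  have "\<bar>cost_part r h \<omega> - h * c\<bar> = \<bar>LINT s:{0..<h}|lborel. exp (- lam * s) * f (Y r s \<omega>) - c\<bar>"
    unfolding cost_part_def by (subst set_integral_diff(2)[OF int intc]) (simp add: const)
  also have "\<dots> \<le> (LINT s:{0..<h}|lborel. \<bar>exp (- lam * s) * f (Y r s \<omega>) - c\<bar>)"
    using set_integral_norm_bound[OF set_integral_diff(1)[OF int intc]] by simp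
  also have "\<dots> \<le> (LINT s:{0..<h}|lborel. e)"
    unfolding set_lebesgue_integral_def
  proof (rule integral_mono_AE)
    show "integrable lborel (\<lambda>s. indicator {0..<h} s *\<^sub>R \<bar>exp (- lam * s) * f (Y r s \<omega>) - c\<bar>)"
      using set_integrable_abs[OF set_integral_diff(1)[OF int intc]] by (simp add: set_integrable_def)
    show "integrable lborel (\<lambda>s. indicator {0..<h} s *\<^sub>R e)" using intc by (simp add: set_integrable_def)
    show "AE s in lborel. indicator {0..<h} s *\<^sub>R \<bar>exp (- lam * s) * f (Y r s \<omega>) - c\<bar> \<le> indicator {0..<h} s *\<^sub>R e"
      using AE_lborel_singleton[of 0]
    proof eventually_elim
      case (elim s)
      show ?case
      proof (cases "s \<in> {0..<h}")
        case True
        with elim near[of s] show ?thesis by simp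
      qed simp
    qed
  qed
  finally show ?thesis by (simp add: const)
qed

lemma rate_continuous: "\<omega> \<in> space M \<Longrightarrow> continuous_on {0..} (\<lambda>r. rate r \<omega>)"
  unfolding rate_def
  by (intro continuous_intros continuous_on_compose2[OF f_cont X_continuous] continuous_on_compose2[OF dv_cont X_continuous]) auto

lemma Y_rectangle: "\<omega> \<in> space M \<Longrightarrow> continuous_on ({0..d} \<times> {0..1}) (\<lambda>(r, h). Y r h \<omega>)"
  by (rule continuous_on_subset[OF Y_continuous]) auto

lemma drift_near_rate:
  assumes \<omega>: "\<omega> \<in> space M" and e: "e > 0"
  shows "\<exists>\<eta>>0. \<forall>h r. 0 < h \<longrightarrow> h < \<eta> \<longrightarrow> r \<in> {0..d} \<longrightarrow> r + h \<le> d \<longrightarrow> \<bar>drift r h \<omega> - h * rate r \<omega>\<bar> \<le> h * e"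
proof -
  have c1: "continuous_on UNIV (\<lambda>x. dv x \<bullet> \<kappa> \<omega>)" by (intro continuous_intros dv_cont)
  obtain \<eta>1 where \<eta>1: "\<eta>1 > 0" "\<And>h r. 0 < h \<Longrightarrow> h < \<eta>1 \<Longrightarrow> h \<le> 1 \<Longrightarrow> r \<in> {0..d} \<Longrightarrow>
      \<bar>exp (- lam * h) * ((1 / h) * (v (Y r h \<omega> + \<Gamma> h (\<kappa> \<omega>)) - v (Y r h \<omega>))) - dv (Y r 0 \<omega>) \<bullet> \<kappa> \<omega>\<bar> < e / 2"
    using uniform_of_joint_limit[where q="\<lambda>t y. exp (- lam * t) * ((1 / t) * (v (y + \<Gamma> t (\<kappa> \<omega>)) - v y))",
        OF v_directional_limit Y_rectangle[OF \<omega>, of d] c1, of "e / 2"] e by auto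
  obtain \<eta>2 where \<eta>2: "\<eta>2 > 0" "\<And>h r. 0 < h \<Longrightarrow> h < \<eta>2 \<Longrightarrow> h \<le> 1 \<Longrightarrow> r \<in> {0..d} \<Longrightarrow>
      \<bar>exp (- lam * h) * f (Y r h \<omega>) - f (Y r 0 \<omega>)\<bar> < e / 2"
    using uniform_of_joint_limit[where q="\<lambda>t y. exp (- lam * t) * f y", OF f_joint_limit Y_rectangle[OF \<omega>, of d] f_cont, of "e / 2"] e by auto
  show ?thesis
  proof (intro exI[of _ "min 1 (min \<eta>1 \<eta>2)"] conjI allI impI)
    show "0 < min 1 (min \<eta>1 \<eta>2)" using \<eta>1 \<eta>2 by simp
    fix h r assume h: "0 < h" "h < min 1 (min \<eta>1 \<eta>2)" and r: "r \<in> {0..d}" "r + h \<le> d"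
    have r0: "0 \<le> r" using r by simp
    define q1 where "q1 = exp (- lam * h) * ((1 / h) * jump r h \<omega>)"
    have "\<bar>q1 - dv (X r \<omega>) \<bullet> \<kappa> \<omega>\<bar> < e / 2"
      using \<eta>1(2)[of h r] h r X_add[OF r0, of h \<omega>] by (simp add: q1_def jump_def Y_0[OF r0])
    then have 1: "h * \<bar>q1 - dv (X r \<omega>) \<bullet> \<kappa> \<omega>\<bar> \<le> h * (e / 2)" using h by (intro mult_left_mono) auto
    have 2: "\<bar>cost_part r h \<omega> - h * f (X r \<omega>)\<bar> \<le> h * (e / 2)"
    proof (rule cost_part_near[OF \<omega> r0 h(1)])
      show "\<bar>exp (- lam * s) * f (Y r s \<omega>) - f (X r \<omega>)\<bar> \<le> e / 2" if "0 < s" "s < h" for s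
        using \<eta>2(2)[of s r] that h r by (simp add: Y_0[OF r0])
    qed (use e in simp)
    have "exp (- lam * (r + h)) * jump r h \<omega> = exp (- lam * r) * (h * q1)"
      using h by (simp add: q1_def exp_add[symmetric] algebra_simps)
    then have d: "drift r h \<omega> - h * rate r \<omega> = exp (- lam * r) * (h * (q1 - dv (X r \<omega>) \<bullet> \<kappa> \<omega>) - (cost_part r h \<omega> - h * f (X r \<omega>)))"
      unfolding drift_def rate_def by (simp only: algebra_simps)
    have "\<bar>h * (q1 - dv (X r \<omega>) \<bullet> \<kappa> \<omega>) - (cost_part r h \<omega> - h * f (X r \<omega>))\<bar> \<le> \<bar>h * (q1 - dv (X r \<omega>) \<bullet> \<kappa> \<omega>)\<bar> + \<bar>cost_part r h \<omega> - h * f (X r \<omega>)\<bar>"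
      by (rule abs_triangle_ineq4)
    also have "\<dots> \<le> h * (e / 2) + h * (e / 2)"
    proof (rule add_mono[OF _ 2])
      show "\<bar>h * (q1 - dv (X r \<omega>) \<bullet> \<kappa> \<omega>)\<bar> \<le> h * (e / 2)" using 1 h(1) unfolding abs_mult by simp
    qed
    also have "\<dots> = h * e" by (simp add: distrib_left[symmetric])
    finally have "exp (- lam * r) * \<bar>h * (q1 - dv (X r \<omega>) \<bullet> \<kappa> \<omega>) - (cost_part r h \<omega> - h * f (X r \<omega>))\<bar> \<le> 1 * (h * e)"
      using r0 lam h e by (intro mult_mono) auto
    then show "\<bar>drift r h \<omega> - h * rate r \<omega>\<bar> \<le> h * e" unfolding d by (simp add: abs_mult)
  qed
qed

lemma eventually_alive:
  assumes \<omega>: "\<omega> \<in> space M" and d: "d > 0"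
  shows "eventually (\<lambda>m. \<forall>i\<le>m. alive (d / real m) i \<omega> = 1) sequentially"
proof -
  have c1: "continuous_on UNIV (\<lambda>x. dv x \<bullet> \<kappa> \<omega>)" by (intro continuous_intros dv_cont)
  obtain \<eta> where \<eta>: "\<eta> > 0" "\<And>h r. 0 < h \<Longrightarrow> h < \<eta> \<Longrightarrow> h \<le> 1 \<Longrightarrow> r \<in> {0..d} \<Longrightarrow>
      \<bar>(1 / h) * (v (Y r h \<omega> + \<Gamma> h (\<kappa> \<omega>)) - v (Y r h \<omega>)) - dv (Y r 0 \<omega>) \<bullet> \<kappa> \<omega>\<bar> < 1"
    using uniform_of_joint_limit[where q="\<lambda>t y. (1 / t) * (v (y + \<Gamma> t (\<kappa> \<omega>)) - v y)",
        OF v_difference_limit Y_rectangle[OF \<omega>, of d] c1, of 1] by auto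
  obtain m0 :: nat where m0: "real m0 > d / min 1 \<eta>" using reals_Archimedean2 by blast
  have "\<forall>i\<le>m. alive (d / real m) i \<omega> = 1" if m: "m \<ge> Suc m0" for m
  proof -
    define h where "h = d / real m"
    have mp: "real m > 0" using m by simp
    have "d / min 1 \<eta> < real m" using m0 m by linarith
    then have "d < real m * min 1 \<eta>" using \<eta>(1) by (simp add: pos_divide_less_eq)
    then have "h < min 1 \<eta>" using mp by (simp add: h_def pos_divide_less_eq mult.commute del: min_less_iff_conj)
    then have h: "0 < h" "h < \<eta>" "h \<le> 1" using d mp by (auto simp: h_def)
    have "\<bar>jump (real j * h) h \<omega>\<bar> \<le> (B * norm (\<kappa> \<omega>) + 1) * h" if j: "j < m" for j
    proof -
      have "real j * h \<le> real m * h" using j h by (intro mult_right_mono) auto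
      moreover have "real m * h = d" using mp by (simp add: h_def)
      moreover have "0 \<le> real j * h" using h(1) by simp
      ultimately have r: "real j * h \<in> {0..d}" by simp
      then have r0: "0 \<le> real j * h" by simp
      have "\<bar>(1 / h) * jump (real j * h) h \<omega> - dv (X (real j * h) \<omega>) \<bullet> \<kappa> \<omega>\<bar> < 1"
        using \<eta>(2)[OF h r] X_add[OF r0, of h \<omega>] h by (simp add: jump_def Y_0[OF r0])
      then have "\<bar>(1 / h) * jump (real j * h) h \<omega>\<bar> \<le> B * norm (\<kappa> \<omega>) + 1"
        using dv_inner_bound[of "X (real j * h) \<omega>" "\<kappa> \<omega>"] by linarith
      then show ?thesis using h by (simp add: abs_mult field_simps)
    qed
    then show ?thesis unfolding alive_def h_def[symmetric] by auto
  qed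
  then show ?thesis unfolding eventually_sequentially by blast
qed

text \<open>Sum the steps over a grid of \<open>m\<close> cells, stopped by \<open>alive\<close>, and let \<open>m\<close> tend to infinity. Both sides are dominated: the stopped increments of \<open>v\<close> telescope, and the stopped drifts are bounded by a multiple of \<open>norm \<kappa> + 1\<close> with only one exceptional step.\<close>
theorem dynkin_constant_control:
  assumes d: "d > 0"
  shows "exp (- lam * d) * (LINT \<omega>|M. v (X d \<omega>)) - (LINT \<omega>|M. v (\<xi> \<omega>)) = (LINT \<omega>|M. (LINT r:{0..d}|lborel. rate r \<omega>))"
proof -
  define h where "h m = d / real m" for m :: nat
  have h0: "0 \<le> h m" for m using d by (simp add: h_def)
  define L where "L m \<omega> = (\<Sum>i<m. alive (h m) i \<omega> * (value_at (real (Suc i) * h m) \<omega> - value_at (real i * h m) \<omega>))" for m \<omega>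
  define R where "R m \<omega> = (\<Sum>i<m. alive (h m) i \<omega> * drift (real i * h m) (h m) \<omega>)" for m \<omega>
  have hm: "real m * h m = d" if "m > 0" for m using that by (simp add: h_def)
  have vm: "value_at (real j * h m) \<in> borel_measurable M" for j m using h0 by (intro value_at_meas) simp
  have dm: "drift (real j * h m) (h m) \<in> borel_measurable M" for j m using h0 by (intro drift_meas) simp_all
  have Lm: "L m \<in> borel_measurable M" for m
    unfolding L_def[abs_def] by (intro borel_measurable_sum borel_measurable_times borel_measurable_diff alive_meas h0 vm)
  have Rm: "R m \<in> borel_measurable M" for m
    unfolding R_def[abs_def] by (intro borel_measurable_sum borel_measurable_times alive_meas h0 dm)
  have Lb: "\<bar>L m \<omega>\<bar> \<le> 2 * (C_f / lam)" for m \<omega>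
    unfolding L_def
    by (rule stopped_telescope[where a="\<lambda>i. value_at (real i * h m) \<omega>"]) (use alive_01 alive_decreasing h0 in \<open>auto intro!: value_at_bound\<close>)
  have Rb: "\<bar>R m \<omega>\<bar> \<le> d * (B * norm (\<kappa> \<omega>) + 1) + 2 * (C_f / lam) + C_f * d" for m \<omega>
  proof -
    let ?c = "(B * norm (\<kappa> \<omega>) + 1) * h m"
    have c0: "0 \<le> ?c" using B_nonneg h0 by simp
    have mh: "real m * h m \<le> d" using d by (simp add: h_def)
    have "\<bar>alive (h m) i \<omega> * drift (real i * h m) (h m) \<omega>\<bar> \<le> alive (h m) i \<omega> * \<bar>jump (real i * h m) (h m) \<omega>\<bar> + C_f * h m" for i
    proof -
      define r where "r = real i * h m"
      have r: "0 \<le> r" using h0 by (simp add: r_def)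
      have "exp (- lam * (r + h m)) * \<bar>jump r (h m) \<omega>\<bar> \<le> 1 * \<bar>jump r (h m) \<omega>\<bar>"
        using r h0[of m] lam by (intro mult_right_mono) auto
      moreover have "exp (- lam * r) * \<bar>cost_part r (h m) \<omega>\<bar> \<le> 1 * (C_f * h m)"
        using r lam cost_part_bound[OF h0, of r m \<omega>] by (intro mult_mono) auto
      moreover have "\<bar>drift r (h m) \<omega>\<bar> \<le> \<bar>exp (- lam * (r + h m)) * jump r (h m) \<omega>\<bar> + \<bar>exp (- lam * r) * cost_part r (h m) \<omega>\<bar>"
        unfolding drift_def by (rule abs_triangle_ineq4)
      ultimately have dr: "\<bar>drift r (h m) \<omega>\<bar> \<le> \<bar>jump r (h m) \<omega>\<bar> + C_f * h m" unfolding abs_mult abs_exp_cancel by linarith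
      show ?thesis
        using alive_01[of "h m" i \<omega>] dr C_f_nonneg h0[of m] unfolding r_def[symmetric] by auto
    qed
    then have "\<bar>R m \<omega>\<bar> \<le> (\<Sum>i<m. alive (h m) i \<omega> * \<bar>jump (real i * h m) (h m) \<omega>\<bar> + C_f * h m)"
      unfolding R_def by (intro order_trans[OF sum_abs] sum_mono)
    also have "\<dots> = (\<Sum>i<m. alive (h m) i \<omega> * \<bar>jump (real i * h m) (h m) \<omega>\<bar>) + real m * (C_f * h m)" by (simp add: sum.distrib)
    also have "(\<Sum>i<m. alive (h m) i \<omega> * \<bar>jump (real i * h m) (h m) \<omega>\<bar>) \<le> real m * ?c + 2 * (C_f / lam)"
      by (rule stopped_sum_bound[OF alive_def c0 jump_bound])
    also have "real m * ?c = (B * norm (\<kappa> \<omega>) + 1) * (real m * h m)" by simp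
    also have "\<dots> \<le> (B * norm (\<kappa> \<omega>) + 1) * d" using mh B_nonneg by (intro mult_left_mono) auto
    also have "real m * (C_f * h m) = C_f * (real m * h m)" by simp
    also have "C_f * (real m * h m) \<le> C_f * d" using mh C_f_nonneg by (intro mult_left_mono)
    finally show ?thesis by (simp add: mult.commute)
  qed
  have LR: "(LINT \<omega>|M. L m \<omega>) = (LINT \<omega>|M. R m \<omega>)" for m
  proof -
    have iL: "integrable M (\<lambda>\<omega>. alive (h m) i \<omega> * (value_at (real (Suc i) * h m) \<omega> - value_at (real i * h m) \<omega>))" for i
    proof (rule integrable_bounded[of _ "2 * (C_f / lam)"])
      show "(\<lambda>\<omega>. alive (h m) i \<omega> * (value_at (real (Suc i) * h m) \<omega> - value_at (real i * h m) \<omega>)) \<in> borel_measurable M"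
        by (intro borel_measurable_times borel_measurable_diff alive_meas h0 vm)
      fix \<omega>
      have "0 \<le> real (Suc i) * h m" "0 \<le> real i * h m" using h0[of m] by auto
      then have "\<bar>value_at (real (Suc i) * h m) \<omega> - value_at (real i * h m) \<omega>\<bar> \<le> 2 * (C_f / lam)"
        using value_at_bound[of "real (Suc i) * h m" \<omega>] value_at_bound[of "real i * h m" \<omega>] by linarith
      then have "\<bar>alive (h m) i \<omega>\<bar> * \<bar>value_at (real (Suc i) * h m) \<omega> - value_at (real i * h m) \<omega>\<bar> \<le> 1 * (2 * (C_f / lam))"
        using alive_abs by (intro mult_mono) auto
      then show "norm (alive (h m) i \<omega> * (value_at (real (Suc i) * h m) \<omega> - value_at (real i * h m) \<omega>)) \<le> 2 * (C_f / lam)" by (simp only: real_norm_def abs_mult mult_1)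
    qed
    have iR: "integrable M (\<lambda>\<omega>. alive (h m) i \<omega> * drift (real i * h m) (h m) \<omega>)" for i
    proof (rule integrable_bounded[of _ "2 * (C_f / lam) + C_f * h m"])
      show "(\<lambda>\<omega>. alive (h m) i \<omega> * drift (real i * h m) (h m) \<omega>) \<in> borel_measurable M"
        by (intro borel_measurable_times alive_meas h0 dm)
      fix \<omega>
      define r where "r = real i * h m"
      have r: "0 \<le> r" using h0 by (simp add: r_def)
      have "exp (- lam * (r + h m)) * \<bar>jump r (h m) \<omega>\<bar> \<le> 1 * (2 * (C_f / lam))"
        using r h0[of m] lam jump_bound by (intro mult_mono) auto
      moreover have "exp (- lam * r) * \<bar>cost_part r (h m) \<omega>\<bar> \<le> 1 * (C_f * h m)"
        using r lam cost_part_bound[OF h0, of r m \<omega>] by (intro mult_mono) auto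
      moreover have "\<bar>drift r (h m) \<omega>\<bar> \<le> \<bar>exp (- lam * (r + h m)) * jump r (h m) \<omega>\<bar> + \<bar>exp (- lam * r) * cost_part r (h m) \<omega>\<bar>"
        unfolding drift_def by (rule abs_triangle_ineq4)
      ultimately have "\<bar>drift r (h m) \<omega>\<bar> \<le> 2 * (C_f / lam) + C_f * h m" unfolding abs_mult abs_exp_cancel by linarith
      then have "\<bar>alive (h m) i \<omega>\<bar> * \<bar>drift r (h m) \<omega>\<bar> \<le> 1 * (2 * (C_f / lam) + C_f * h m)" using alive_abs by (intro mult_mono) auto
      then show "norm (alive (h m) i \<omega> * drift (real i * h m) (h m) \<omega>) \<le> 2 * (C_f / lam) + C_f * h m"
        by (simp only: real_norm_def abs_mult mult_1 r_def)
    qed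
    show ?thesis unfolding L_def R_def
      by (simp only: Bochner_Integration.integral_sum[OF iL] Bochner_Integration.integral_sum[OF iR] expected_step[OF h0])
  qed
  have Llim: "(\<lambda>m. L m \<omega>) \<longlonglongrightarrow> value_at d \<omega> - value_at 0 \<omega>" if \<omega>: "\<omega> \<in> space M" for \<omega>
  proof (rule tendsto_eventually)
    show "eventually (\<lambda>m. L m \<omega> = value_at d \<omega> - value_at 0 \<omega>) sequentially"
      using eventually_alive[OF \<omega> d] eventually_gt_at_top[of 0]
    proof eventually_elim
      case (elim m)
      have "L m \<omega> = (\<Sum>i<m. value_at (real (Suc i) * h m) \<omega> - value_at (real i * h m) \<omega>)"
        unfolding L_def using elim(1) by (intro sum.cong refl) (simp add: h_def)
      also have "\<dots> = value_at (real m * h m) \<omega> - value_at (real 0 * h m) \<omega>"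
        by (rule sum_lessThan_telescope[of "\<lambda>i. value_at (real i * h m) \<omega>"])
      finally show ?case using hm[OF elim(2)] by simp
    qed
  qed
  have Rlim: "(\<lambda>m. R m \<omega>) \<longlonglongrightarrow> (LINT r:{0..d}|lborel. rate r \<omega>)" if \<omega>: "\<omega> \<in> space M" for \<omega>
  proof -
    have "(\<lambda>m. \<Sum>i<m. drift (real i * (d / real m)) (d / real m) \<omega>) \<longlonglongrightarrow> (LINT r:{0..d}|lborel. rate r \<omega>)"
    proof (rule Riemann_sum_uniform[where Q="\<lambda>r h. drift r h \<omega>", OF d])
      show "continuous_on {0..d} (\<lambda>r. rate r \<omega>)" by (rule continuous_on_subset[OF rate_continuous[OF \<omega>]]) auto
    qed (rule drift_near_rate[OF \<omega>])
    moreover have "eventually (\<lambda>m. (\<Sum>i<m. drift (real i * (d / real m)) (d / real m) \<omega>) = R m \<omega>) sequentially"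
      using eventually_alive[OF \<omega> d]
    proof eventually_elim
      case (elim m)
      show ?case unfolding R_def using elim by (intro sum.cong refl) (simp add: h_def)
    qed
    ultimately show ?thesis by (rule Lim_transform_eventually)
  qed
  have v0m: "(\<lambda>\<omega>. value_at d \<omega> - value_at 0 \<omega>) \<in> borel_measurable M"
    using d by (intro borel_measurable_diff value_at_meas) auto
  have ratem: "(\<lambda>\<omega>. (LINT r:{0..d}|lborel. rate r \<omega>)) \<in> borel_measurable M"
    by (rule borel_measurable_LIMSEQ_real[of M R]) (use Rlim Rm in auto)
  have "(\<lambda>m. LINT \<omega>|M. L m \<omega>) \<longlonglongrightarrow> (LINT \<omega>|M. value_at d \<omega> - value_at 0 \<omega>)"
    by (rule integral_dominated_convergence[where w="\<lambda>_. 2 * (C_f / lam)", OF v0m Lm]) (use Lb Llim in auto)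
  moreover have "(\<lambda>m. LINT \<omega>|M. R m \<omega>) \<longlonglongrightarrow> (LINT \<omega>|M. (LINT r:{0..d}|lborel. rate r \<omega>))"
  proof (rule integral_dominated_convergence[where w="\<lambda>\<omega>. d * (B * norm (\<kappa> \<omega>) + 1) + 2 * (C_f / lam) + C_f * d", OF ratem Rm])
    show "integrable M (\<lambda>\<omega>. d * (B * norm (\<kappa> \<omega>) + 1) + 2 * (C_f / lam) + C_f * d)" using \<kappa>_int by simp
  qed (use Rb Rlim in auto)
  ultimately have "(LINT \<omega>|M. value_at d \<omega> - value_at 0 \<omega>) = (LINT \<omega>|M. (LINT r:{0..d}|lborel. rate r \<omega>))"
    unfolding LR by (rule LIMSEQ_unique)
  moreover have "(LINT \<omega>|M. value_at d \<omega> - value_at 0 \<omega>) = exp (- lam * d) * (LINT \<omega>|M. v (X d \<omega>)) - (LINT \<omega>|M. v (\<xi> \<omega>))"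
  proof -
    have i: "integrable M (value_at r)" if "0 \<le> r" for r
      by (rule integrable_bounded[of _ "C_f / lam"]) (use value_at_meas value_at_bound that in auto)
    have "(LINT \<omega>|M. value_at d \<omega> - value_at 0 \<omega>) = (LINT \<omega>|M. value_at d \<omega>) - (LINT \<omega>|M. value_at 0 \<omega>)"
      using d by (intro Bochner_Integration.integral_diff i) auto
    then show ?thesis by (simp add: value_at_def X_0)
  qed
  ultimately show ?thesis by simp
qed

end
end

section \<open>Dynkin's formula for a general control\<close>

context unbounded_input
begin

lemma E0_meas [measurable (raw)]:
  assumes "g \<in> borel_measurable N" "a \<in> borel_measurable N"
  shows "(\<lambda>x. E0 (g x) (a x)) \<in> borel_measurable N"
  using measurable_compose[OF measurable_Pair[OF assms] E0_measurable] by simp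

lemma E_E0_cong: "(LINT s:{a..<t}|lborel. E (t - s) (k s)) = (LINT s:{a..<t}|lborel. E0 (t - s) (k s))"
  by (rule set_lebesgue_integral_cong) (auto simp: E0_def)

text \<open>Young's inequality for the convolution of \<open>\<rho>\<close>, restricted to \<open>(0, T]\<close>, with \<open>g\<close> in \<open>L\<^sup>1\<close>.\<close>
lemma young_bound:
  fixes g :: "real \<Rightarrow> real"
  assumes [measurable]: "g \<in> borel_measurable borel" and g: "\<And>s. 0 \<le> g s"
  shows "(\<integral>\<^sup>+t. ennreal (indicator {0..T} t) * (\<integral>\<^sup>+s. ennreal (indicator {0..<t} s * (\<rho> (t - s) * g s)) \<partial>lborel) \<partial>lborel)
    \<le> (\<integral>\<^sup>+r. ennreal (indicator {0<..T} r * \<rho> r) \<partial>lborel) * (\<integral>\<^sup>+s. ennreal (g s) \<partial>lborel)"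
proof -
  have [measurable]: "\<rho> \<in> borel_measurable borel" by simp
  have "(\<integral>\<^sup>+t. ennreal (indicator {0..T} t) * (\<integral>\<^sup>+s. ennreal (indicator {0..<t} s * (\<rho> (t - s) * g s)) \<partial>lborel) \<partial>lborel)
     \<le> (\<integral>\<^sup>+t. (\<integral>\<^sup>+s. ennreal (indicator {0<..T} (t - s) * \<rho> (t - s)) * ennreal (g s) \<partial>lborel) \<partial>lborel)"
  proof (rule nn_integral_mono)
    fix t
    show "ennreal (indicator {0..T} t) * (\<integral>\<^sup>+s. ennreal (indicator {0..<t} s * (\<rho> (t - s) * g s)) \<partial>lborel)
      \<le> (\<integral>\<^sup>+s. ennreal (indicator {0<..T} (t - s) * \<rho> (t - s)) * ennreal (g s) \<partial>lborel)"
    proof (cases "t \<in> {0..T}")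
      case True
      then have "(\<integral>\<^sup>+s. ennreal (indicator {0..<t} s * (\<rho> (t - s) * g s)) \<partial>lborel) \<le> (\<integral>\<^sup>+s. ennreal (indicator {0<..T} (t - s) * \<rho> (t - s)) * ennreal (g s) \<partial>lborel)"
        using g \<rho>_nonneg by (intro nn_integral_mono) (auto simp: indicator_def ennreal_mult[symmetric])
      with True show ?thesis by simp
    qed simp
  qed
  also have "\<dots> = (\<integral>\<^sup>+s. (\<integral>\<^sup>+t. ennreal (indicator {0<..T} (t - s) * \<rho> (t - s)) * ennreal (g s) \<partial>lborel) \<partial>lborel)"
    by (rule lborel_pair.Fubini') measurable
  also have "\<dots> = (\<integral>\<^sup>+s. (\<integral>\<^sup>+r. ennreal (indicator {0<..T} r * \<rho> r) \<partial>lborel) * ennreal (g s) \<partial>lborel)"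
  proof (rule nn_integral_cong)
    fix s :: real
    have "(\<integral>\<^sup>+t. ennreal (indicator {0<..T} (t - s) * \<rho> (t - s)) * ennreal (g s) \<partial>lborel) = (\<integral>\<^sup>+t. ennreal (indicator {0<..T} (t - s) * \<rho> (t - s)) \<partial>lborel) * ennreal (g s)"
      by (rule nn_integral_multc) measurable
    also have "(\<integral>\<^sup>+t. ennreal (indicator {0<..T} (t - s) * \<rho> (t - s)) \<partial>lborel) = (\<integral>\<^sup>+r. ennreal (indicator {0<..T} r * \<rho> r) \<partial>lborel)"
      by (subst (2) nn_integral_real_affine[where c=1 and t="- s"]) (auto simp: algebra_simps)
    finally show "(\<integral>\<^sup>+t. ennreal (indicator {0<..T} (t - s) * \<rho> (t - s)) * ennreal (g s) \<partial>lborel) = (\<integral>\<^sup>+r. ennreal (indicator {0<..T} r * \<rho> r) \<partial>lborel) * ennreal (g s)" .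
  qed
  also have "\<dots> = (\<integral>\<^sup>+r. ennreal (indicator {0<..T} r * \<rho> r) \<partial>lborel) * (\<integral>\<^sup>+s. ennreal (g s) \<partial>lborel)"
    by (rule nn_integral_cmult) measurable
  finally show ?thesis .
qed

lemma convolution_integrable:
  assumes [measurable]: "k \<in> borel_measurable borel" and C: "\<And>s. s \<in> {0..<t} \<Longrightarrow> norm (k s) \<le> C"
  shows "set_integrable lborel {0..<t} (\<lambda>s. E0 (t - s) (k s))"
proof (rule set_integrable_bound[where f="\<lambda>s. C * (indicator {0<..t} (t - s) * \<rho> (t - s))"])
  have "integrable lborel (\<lambda>s. indicator {0<..t} (t + (- 1) * s) * \<rho> (t + (- 1) * s))"
    using \<rho>_integrable[of t] unfolding set_integrable_def by (intro lborel_integrable_real_affine[where c="- 1"]) auto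
  then show "set_integrable lborel {0..<t} (\<lambda>s. C * (indicator {0<..t} (t - s) * \<rho> (t - s)))"
    unfolding set_integrable_def by (intro integrable_mult_indicator integrable_mult_right) auto
  show "set_borel_measurable lborel {0..<t} (\<lambda>s. E0 (t - s) (k s))" unfolding set_borel_measurable_def by measurable
  show "AE s in lborel. s \<in> {0..<t} \<longrightarrow> norm (E0 (t - s) (k s)) \<le> norm (C * (indicator {0<..t} (t - s) * \<rho> (t - s)))"
  proof (intro AE_I2 impI)
    fix s assume s: "s \<in> {0..<t}"
    have "norm (E0 (t - s) (k s)) \<le> \<rho> (t - s) * C"
      using norm_E0 C[OF s] \<rho>_nonneg by (meson mult_left_mono order_trans)
    also have "\<dots> = C * (indicator {0<..t} (t - s) * \<rho> (t - s))" using s by simp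
    finally show "norm (E0 (t - s) (k s)) \<le> norm (C * (indicator {0<..t} (t - s) * \<rho> (t - s)))" by (simp add: abs_le_iff)
  qed
qed

end

lemma delayed_average_cong_floor: "\<lfloor>s / \<delta>\<rfloor> = \<lfloor>r / \<delta>\<rfloor> \<Longrightarrow> delayed_average \<delta> g s = delayed_average \<delta> g r"
  by (simp add: delayed_average_def)

context smooth_along_input
begin

definition response :: "'h \<Rightarrow> (real \<Rightarrow> 'w \<Rightarrow> 'k) \<Rightarrow> real \<Rightarrow> 'w \<Rightarrow> 'h" where
  "response x k t \<omega> = S t x + Z t \<omega> + (LINT s:{0..<t}|lborel. E (t - s) (k s \<omega>))"

lemma response_joint:
  assumes k: "(\<lambda>(\<omega>, s). k s \<omega>) \<in> borel_measurable (M \<Otimes>\<^sub>M lborel)"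
  shows "(\<lambda>p. response x k (max 0 (snd p)) (fst p)) \<in> borel_measurable (M \<Otimes>\<^sub>M lborel)"
proof -
  have k': "(\<lambda>q. k (snd q) (fst (fst q))) \<in> borel_measurable ((M \<Otimes>\<^sub>M lborel) \<Otimes>\<^sub>M lborel)"
    using measurable_compose[of "\<lambda>q. (fst (fst q), snd q)" "(M \<Otimes>\<^sub>M lborel) \<Otimes>\<^sub>M lborel" "M \<Otimes>\<^sub>M lborel", OF _ k] by simp
  have "(\<lambda>(p, s). (if 0 \<le> s \<and> s < max 0 (snd p) then 1 else 0 :: real) *\<^sub>R E0 (max 0 (snd p) - s) (k s (fst p))) \<in> borel_measurable ((M \<Otimes>\<^sub>M lborel) \<Otimes>\<^sub>M lborel)"
    unfolding split_beta' using k' by measurable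
  from lborel.borel_measurable_lebesgue_integral[OF this]
  have "(\<lambda>p. LINT s|lborel. (if 0 \<le> s \<and> s < max 0 (snd p) then 1 else 0 :: real) *\<^sub>R E0 (max 0 (snd p) - s) (k s (fst p))) \<in> borel_measurable (M \<Otimes>\<^sub>M lborel)" by simp
  also have "(\<lambda>p. LINT s|lborel. (if 0 \<le> s \<and> s < max 0 (snd p) then 1 else 0 :: real) *\<^sub>R E0 (max 0 (snd p) - s) (k s (fst p)))
     = (\<lambda>p. LINT s:{0..<max 0 (snd p)}|lborel. E (max 0 (snd p) - s) (k s (fst p)))"
    unfolding E_E0_cong set_lebesgue_integral_def
    by (intro ext Bochner_Integration.integral_cong refl) (auto simp: indicator_def E0_def max_def split: if_splits)
  finally have [measurable]: "(\<lambda>p. LINT s:{0..<max 0 (snd p)}|lborel. E (max 0 (snd p) - s) (k s (fst p))) \<in> borel_measurable (M \<Otimes>\<^sub>M lborel)" .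
  show ?thesis unfolding response_def by measurable
qed

text \<open>The time derivative of the expected discounted value for the input process \<open>k\<close> and the state process \<open>Q\<close>, whose arguments are kept separate so that they can be approximated one after the other. The clamping of time at \<open>0\<close> makes it measurable on the whole line.\<close>
definition H :: "(real \<Rightarrow> 'w \<Rightarrow> 'k) \<Rightarrow> (real \<Rightarrow> 'w \<Rightarrow> 'h) \<Rightarrow> 'w \<times> real \<Rightarrow> real" where
  "H k Q p = exp (- lam * snd p) * (dv (Q (max 0 (snd p)) (fst p)) \<bullet> k (snd p) (fst p) - f (Q (max 0 (snd p)) (fst p)))"

lemma H_bound: "0 \<le> snd p \<Longrightarrow> \<bar>H k Q p\<bar> \<le> B * norm (k (snd p) (fst p)) + C_f"
proof -
  assume s: "0 \<le> snd p"
  have "\<bar>dv (Q (max 0 (snd p)) (fst p)) \<bullet> k (snd p) (fst p) - f (Q (max 0 (snd p)) (fst p))\<bar> \<le> B * norm (k (snd p) (fst p)) + C_f"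
    using dv_inner_bound[of "Q (max 0 (snd p)) (fst p)" "k (snd p) (fst p)"] f_bound[of "Q (max 0 (snd p)) (fst p)"] by linarith
  then have "exp (- lam * snd p) * \<bar>dv (Q (max 0 (snd p)) (fst p)) \<bullet> k (snd p) (fst p) - f (Q (max 0 (snd p)) (fst p))\<bar> \<le> 1 * (B * norm (k (snd p) (fst p)) + C_f)"
    using s lam B_nonneg C_f_nonneg by (intro mult_mono) auto
  then show ?thesis by (simp add: H_def abs_mult)
qed

lemma H_int:
  assumes k: "integrable (M \<Otimes>\<^sub>M lborel) (\<lambda>p. k (snd p) (fst p))"
    and Q: "(\<lambda>p. Q (max 0 (snd p)) (fst p)) \<in> borel_measurable (M \<Otimes>\<^sub>M lborel)"
    and a: "0 \<le> a" "a \<le> b"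
  shows "integrable (M \<Otimes>\<^sub>M lborel) (\<lambda>p. indicator {a..<b} (snd p) * H k Q p)"
proof (rule Bochner_Integration.integrable_bound)
  have [measurable]: "(\<lambda>p. k (snd p) (fst p)) \<in> borel_measurable (M \<Otimes>\<^sub>M lborel)" using k by auto
  note Q[measurable]
  have "integrable (M \<Otimes>\<^sub>M lborel) (\<lambda>p. indicator {a..<b} (snd p) * C_f)"
    by (rule integrable_pair_lborel_bound[where c="\<lambda>s. C_f * indicator {a..<b} s"])
      (use a C_f_nonneg in \<open>auto intro!: integrable_mult_right integrable_real_indicator simp: abs_mult\<close>)
  then show "integrable (M \<Otimes>\<^sub>M lborel) (\<lambda>p. B * norm (k (snd p) (fst p)) + indicator {a..<b} (snd p) * C_f)"
    using k by (intro Bochner_Integration.integrable_add integrable_mult_right integrable_norm)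
  show "(\<lambda>p. indicator {a..<b} (snd p) * H k Q p) \<in> borel_measurable (M \<Otimes>\<^sub>M lborel)"
    unfolding H_def by measurable
  show "AE p in M \<Otimes>\<^sub>M lborel. norm (indicator {a..<b} (snd p) * H k Q p) \<le> norm (B * norm (k (snd p) (fst p)) + indicator {a..<b} (snd p) * C_f)"
  proof (rule AE_I2)
    fix p :: "'w \<times> real"
    have nn: "0 \<le> B * norm (k (snd p) (fst p))" using B_nonneg by simp
    show "norm (indicator {a..<b} (snd p) * H k Q p) \<le> norm (B * norm (k (snd p) (fst p)) + indicator {a..<b} (snd p) * C_f)"
      using H_bound[of p k Q] a nn C_f_nonneg by (cases "snd p \<in> {a..<b}") auto
  qed
qed

context
  fixes kk :: "'w \<Rightarrow> real \<Rightarrow> 'k" and T :: real and x :: 'h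
  assumes kk_int: "integrable (M \<Otimes>\<^sub>M lborel) (\<lambda>(\<omega>, s). kk \<omega> s)"
    and kk_adapted: "\<And>a b. 0 \<le> b \<Longrightarrow> (\<lambda>\<omega>. LINT s:{a..<b}|lborel. kk \<omega> s) \<in> borel_measurable (F b)"
    and T: "T > 0"
begin

lemma kk_meas: "(\<lambda>p. kk (fst p) (snd p)) \<in> borel_measurable (M \<Otimes>\<^sub>M lborel)"
  using kk_int by (simp add: split_beta' borel_measurable_integrable)

lemma kk_meas_raw [measurable (raw)]:
  assumes "a \<in> measurable N M" "g \<in> borel_measurable N"
  shows "(\<lambda>x. kk (a x) (g x)) \<in> borel_measurable N"
  using measurable_compose[OF measurable_Pair[of a N M g lborel] kk_meas] assms by simp

lemma kk_path_int: "AE \<omega> in M. integrable lborel (kk \<omega>)"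
  using time.AE_integrable_fst'[OF kk_int] by simp

text \<open>An adapted step control approximating \<open>kk\<close>.\<close>
definition kn :: "real \<Rightarrow> real \<Rightarrow> 'w \<Rightarrow> 'k" where
  "kn \<delta> s \<omega> = delayed_average \<delta> (kk \<omega>) s"

lemma kn_joint: "(\<lambda>p. kn \<delta> (snd p) (fst p)) \<in> borel_measurable (M \<Otimes>\<^sub>M lborel)"
proof -
  have "(\<lambda>p. (\<lambda>i p. (1 / \<delta>) *\<^sub>R (LINT r:{r. \<lfloor>r / \<delta>\<rfloor> + 1 = i}|lborel. kk (fst p) r)) \<lfloor>snd p / \<delta>\<rfloor> p) \<in> borel_measurable (M \<Otimes>\<^sub>M lborel)"
  proof (rule measurable_compose_countable)
    fix i :: int
    have "(\<lambda>(\<omega>, r). indicator {r. \<lfloor>r / \<delta>\<rfloor> + 1 = i} r *\<^sub>R kk \<omega> r) \<in> borel_measurable (M \<Otimes>\<^sub>M lborel)"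
      unfolding split_beta' using kk_meas by measurable
    from lborel.borel_measurable_lebesgue_integral[OF this]
    have [measurable]: "(\<lambda>\<omega>. LINT r:{r. \<lfloor>r / \<delta>\<rfloor> + 1 = i}|lborel. kk \<omega> r) \<in> borel_measurable M"
      by (simp add: set_lebesgue_integral_def)
    show "(\<lambda>p. (1 / \<delta>) *\<^sub>R (LINT r:{r. \<lfloor>r / \<delta>\<rfloor> + 1 = i}|lborel. kk (fst p) r)) \<in> borel_measurable (M \<Otimes>\<^sub>M lborel)"
      by measurable
  next
    show "(\<lambda>p. \<lfloor>snd p / \<delta>\<rfloor>) \<in> measurable (M \<Otimes>\<^sub>M lborel) (count_space UNIV)" by measurable
  qed
  then show ?thesis by (simp add: kn_def delayed_average_def)
qed

lemma kn_int:
  assumes "\<delta> > 0" shows "integrable (M \<Otimes>\<^sub>M lborel) (\<lambda>p. kn \<delta> (snd p) (fst p))"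
proof (rule integrableI_bounded)
  have [measurable]: "(\<lambda>p. kn \<delta> (snd p) (fst p)) \<in> borel_measurable (M \<Otimes>\<^sub>M lborel)" by (rule kn_joint)
  note kk_meas[measurable]
  have "(\<integral>\<^sup>+p. ennreal (norm (kn \<delta> (snd p) (fst p))) \<partial>(M \<Otimes>\<^sub>M lborel)) = (\<integral>\<^sup>+\<omega>. (\<integral>\<^sup>+s. ennreal (norm (kn \<delta> s \<omega>)) \<partial>lborel) \<partial>M)"
    by (subst lborel.nn_integral_fst[symmetric]) auto
  also have "\<dots> \<le> (\<integral>\<^sup>+\<omega>. (\<integral>\<^sup>+s. ennreal (norm (kk \<omega> s)) \<partial>lborel) \<partial>M)"
    using kk_path_int unfolding kn_def
    by (intro nn_integral_mono_AE) (auto elim!: eventually_mono intro: nn_integral_delayed_average_le[OF assms])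
  also have "\<dots> = (\<integral>\<^sup>+p. ennreal (norm (kk (fst p) (snd p))) \<partial>(M \<Otimes>\<^sub>M lborel))"
    by (subst lborel.nn_integral_fst[symmetric]) auto
  also have "\<dots> < \<infinity>" using kk_int by (simp add: integrable_iff_bounded split_beta')
  finally show "(\<integral>\<^sup>+p. ennreal (norm (kn \<delta> (snd p) (fst p))) \<partial>(M \<Otimes>\<^sub>M lborel)) < \<infinity>" .
qed (rule kn_joint)

lemma kn_cell:
  assumes \<delta>: "\<delta> > 0" and s: "real i * \<delta> \<le> s" "s < real (Suc i) * \<delta>"
  shows "kn \<delta> s \<omega> = kn \<delta> (real i * \<delta>) \<omega>"
proof -
  have "\<lfloor>s / \<delta>\<rfloor> = int i"
    using s \<delta> by (intro floor_unique) (simp_all add: pos_le_divide_eq pos_divide_less_eq algebra_simps)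
  moreover have "\<lfloor>real i * \<delta> / \<delta>\<rfloor> = int i" using \<delta> by simp
  ultimately show ?thesis unfolding kn_def by (intro delayed_average_cong_floor) simp
qed

lemma kn_grid:
  assumes \<delta>: "\<delta> > 0"
  shows "kn \<delta> (real i * \<delta>) \<omega> = (1 / \<delta>) *\<^sub>R (LINT r:{real_of_int (int i - 1) * \<delta>..<real i * \<delta>}|lborel. kk \<omega> r)"
proof -
  have f: "\<lfloor>real i * \<delta> / \<delta>\<rfloor> = int i" using \<delta> by simp
  show ?thesis unfolding kn_def delayed_average_def unfolding floor_cell[OF \<delta>] unfolding f by simp
qed

lemma kn_grid_adapted:
  assumes \<delta>: "\<delta> > 0" shows "kn \<delta> (real i * \<delta>) \<in> borel_measurable (F (real i * \<delta>))"
proof -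
  have "(\<lambda>\<omega>. LINT r:{real_of_int (int i - 1) * \<delta>..<real i * \<delta>}|lborel. kk \<omega> r) \<in> borel_measurable (F (real i * \<delta>))"
    using \<delta> by (intro kk_adapted) simp
  then have "(\<lambda>\<omega>. (1 / \<delta>) *\<^sub>R (LINT r:{real_of_int (int i - 1) * \<delta>..<real i * \<delta>}|lborel. kk \<omega> r)) \<in> borel_measurable (F (real i * \<delta>))"
    by measurable
  then show ?thesis by (simp only: kn_grid[OF \<delta>, symmetric])
qed

lemma kn_grid_int:
  assumes \<delta>: "\<delta> > 0" shows "integrable M (kn \<delta> (real i * \<delta>))"
proof -
  let ?A = "{real_of_int (int i - 1) * \<delta>..<real i * \<delta>}"
  have "integrable (M \<Otimes>\<^sub>M lborel) (\<lambda>p. indicator (space M \<times> ?A) p *\<^sub>R (\<lambda>(\<omega>, s). kk \<omega> s) p)"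
    by (rule integrable_mult_indicator[OF _ kk_int]) auto
  from time.integrable_fst'[OF this]
  have "integrable M (\<lambda>\<omega>. LINT s|lborel. indicator (space M \<times> ?A) (\<omega>, s) *\<^sub>R kk \<omega> s)" by simp
  moreover have "integrable M (\<lambda>\<omega>. LINT s|lborel. indicator (space M \<times> ?A) (\<omega>, s) *\<^sub>R kk \<omega> s) = integrable M (\<lambda>\<omega>. LINT s:?A|lborel. kk \<omega> s)"
    by (rule Bochner_Integration.integrable_cong) (auto simp: set_lebesgue_integral_def indicator_times)
  ultimately have "integrable M (\<lambda>\<omega>. (1 / \<delta>) *\<^sub>R (LINT s:?A|lborel. kk \<omega> s))" by simp
  then show ?thesis by (simp only: kn_grid[OF \<delta>, symmetric])
qed

lemma kn_path_bound:
  assumes \<delta>: "\<delta> > 0" and s: "s \<in> {0..<real n * \<delta>}"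
  shows "norm (kn \<delta> s \<omega>) \<le> (\<Sum>i<n. norm (kn \<delta> (real i * \<delta>) \<omega>))"
proof -
  define i where "i = nat \<lfloor>s / \<delta>\<rfloor>"
  have fl: "0 \<le> \<lfloor>s / \<delta>\<rfloor>" using s \<delta> by simp
  then have ri: "real i = real_of_int \<lfloor>s / \<delta>\<rfloor>" by (simp add: i_def)
  have "real i \<le> s / \<delta>" "s / \<delta> < real i + 1" unfolding ri by linarith+
  then have i: "real i * \<delta> \<le> s" "s < real (Suc i) * \<delta>"
    unfolding pos_le_divide_eq[OF \<delta>] pos_divide_less_eq[OF \<delta>] by (simp_all add: algebra_simps)
  have "real i * \<delta> < real n * \<delta>" using i s by (metis atLeastLessThan_iff le_less_trans)
  then have "i < n" using \<delta> by simp
  then have "norm (kn \<delta> (real i * \<delta>) \<omega>) \<le> (\<Sum>i<n. norm (kn \<delta> (real i * \<delta>) \<omega>))" by (intro member_le_sum) auto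
  then show ?thesis using kn_cell[OF \<delta> i] by simp
qed

lemma kn_convolution_int:
  assumes \<delta>: "\<delta> > 0" and t: "t \<le> t'"
  shows "set_integrable lborel {0..<t} (\<lambda>s. E0 (t' - s) (kn \<delta> s \<omega>))"
proof -
  obtain n :: nat where n: "t' / \<delta> \<le> real n" using real_arch_simple by blast
  have "set_integrable lborel {0..<t'} (\<lambda>s. E0 (t' - s) (kn \<delta> s \<omega>))"
  proof (rule convolution_integrable)
    show "(\<lambda>s. kn \<delta> s \<omega>) \<in> borel_measurable borel" unfolding kn_def by measurable
    fix s assume "s \<in> {0..<t'}"
    then have "s \<in> {0..<real n * \<delta>}" using n \<delta> by (simp add: pos_divide_le_eq)
    then show "norm (kn \<delta> s \<omega>) \<le> (\<Sum>i<n. norm (kn \<delta> (real i * \<delta>) \<omega>))" by (rule kn_path_bound[OF \<delta>])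
  qed
  then show ?thesis by (rule set_integrable_subset) (use t in auto)
qed

abbreviation Xn where "Xn \<delta> \<equiv> response x (kn \<delta>)"

text \<open>Within a cell the step control is constant, so the state is of the form treated by the formula for constant controls.\<close>
lemma response_flow:
  assumes \<delta>: "\<delta> > 0" and r: "0 \<le> r" "r \<le> \<delta>"
  shows "Xn \<delta> (real i * \<delta> + r) \<omega> = S r (Xn \<delta> (real i * \<delta>) \<omega>) + innovation (real i * \<delta>) r \<omega> + \<Gamma> r (kn \<delta> (real i * \<delta>) \<omega>)"
proof -
  define \<tau> where "\<tau> = real i * \<delta>"
  have \<tau>: "0 \<le> \<tau>" using \<delta> by (simp add: \<tau>_def)
  let ?k = "\<lambda>s. kn \<delta> s \<omega>"
  have int: "set_integrable lborel {0..<\<tau> + r} (\<lambda>s. E0 (\<tau> + r - s) (?k s))"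
    by (rule kn_convolution_int[OF \<delta> order_refl])
  have int0: "set_integrable lborel {0..<\<tau>} (\<lambda>s. E0 (\<tau> - s) (?k s))"
    by (rule kn_convolution_int[OF \<delta> order_refl])
  have un: "{0..<\<tau> + r} = {0..<\<tau>} \<union> {\<tau>..<\<tau> + r}" using \<tau> r by auto
  have "(LINT s:{0..<\<tau> + r}|lborel. E0 (\<tau> + r - s) (?k s)) = (LINT s:{0..<\<tau>}|lborel. E0 (\<tau> + r - s) (?k s)) + (LINT s:{\<tau>..<\<tau> + r}|lborel. E0 (\<tau> + r - s) (?k s))"
    unfolding un by (rule set_integral_Un) (use \<tau> r in \<open>auto intro!: set_integrable_subset[OF int]\<close>)
  also have "(LINT s:{0..<\<tau>}|lborel. E0 (\<tau> + r - s) (?k s)) = (LINT s:{0..<\<tau>}|lborel. S r (E0 (\<tau> - s) (?k s)))"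
  proof (rule set_lebesgue_integral_cong)
    show "\<forall>s. s \<in> {0..<\<tau>} \<longrightarrow> E0 (\<tau> + r - s) (?k s) = S r (E0 (\<tau> - s) (?k s))"
    proof (intro allI impI)
      fix s assume "s \<in> {0..<\<tau>}"
      then show "E0 (\<tau> + r - s) (?k s) = S r (E0 (\<tau> - s) (?k s))"
        using E0_add[of r "\<tau> - s" "?k s"] r by (simp add: algebra_simps)
    qed
  qed simp
  also have "\<dots> = S r (LINT s:{0..<\<tau>}|lborel. E0 (\<tau> - s) (?k s))"
    using int0 unfolding set_lebesgue_integral_def set_integrable_def
    by (subst integral_bounded_linear[of "blinfun_apply (S r)", symmetric]) (auto simp: blinfun.scaleR_right blinfun.bounded_linear_right)
  also have "(LINT s:{\<tau>..<\<tau> + r}|lborel. E0 (\<tau> + r - s) (?k s)) = \<Gamma> r (?k \<tau>)"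
  proof -
    have "(LINT s:{\<tau>..<\<tau> + r}|lborel. E0 (\<tau> + r - s) (?k s)) = (LINT s|lborel. indicator {0<..r} (\<tau> + r + (- 1) * s) *\<^sub>R E (\<tau> + r + (- 1) * s) (?k \<tau>))"
      unfolding set_lebesgue_integral_def
    proof (intro Bochner_Integration.integral_cong refl)
      fix s :: real
      show "indicator {\<tau>..<\<tau> + r} s *\<^sub>R E0 (\<tau> + r - s) (?k s) = indicator {0<..r} (\<tau> + r + (- 1) * s) *\<^sub>R E (\<tau> + r + (- 1) * s) (?k \<tau>)"
      proof (cases "s \<in> {\<tau>..<\<tau> + r}")
        case True
        then have "?k s = ?k \<tau>" unfolding \<tau>_def using r by (intro kn_cell[OF \<delta>]) (auto simp: \<tau>_def algebra_simps)
        with True show ?thesis by (simp add: E0_def)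
      next
        case False
        then have "\<tau> + r + (- 1) * s \<notin> {0<..r}" by auto
        with False show ?thesis by simp
      qed
    qed
    also have "\<dots> = \<Gamma> r (?k \<tau>)"
      unfolding \<Gamma>_def set_lebesgue_integral_def
      by (subst (2) lborel_integral_real_affine[where c="- 1" and t="\<tau> + r"]) simp_all
    finally show ?thesis .
  qed
  finally have conv: "(LINT s:{0..<\<tau> + r}|lborel. E (\<tau> + r - s) (?k s)) = S r (LINT s:{0..<\<tau>}|lborel. E (\<tau> - s) (?k s)) + \<Gamma> r (?k \<tau>)"
    unfolding E_E0_cong .
  have "S (\<tau> + r) x = S r (S \<tau> x)" using S_add[of r \<tau> x] r \<tau> by (simp add: add.commute)
  then show ?thesis
    unfolding \<tau>_def[symmetric] response_def conv innovation_def by (simp add: blinfun.add_right)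
qed

lemma response_grid_adapted:
  assumes \<delta>: "\<delta> > 0" shows "Xn \<delta> (real i * \<delta>) \<in> borel_measurable (F (real i * \<delta>))"
proof (induction i)
  case 0
  have "Xn \<delta> 0 = (\<lambda>\<omega>. x + Z 0 \<omega>)" by (simp add: response_def fun_eq_iff set_lebesgue_integral_def)
  then show ?case using Z_adapted[of 0] by simp
next
  case (Suc i)
  let ?\<tau> = "real i * \<delta>"
  have \<tau>: "0 \<le> ?\<tau>" using \<delta> by simp
  have e: "real (Suc i) * \<delta> = ?\<tau> + \<delta>" by (simp add: algebra_simps)
  have "(\<lambda>\<omega>. S \<delta> (Xn \<delta> ?\<tau> \<omega>) + innovation ?\<tau> \<delta> \<omega> + \<Gamma> \<delta> (kn \<delta> ?\<tau> \<omega>)) \<in> borel_measurable (F (?\<tau> + \<delta>))"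
    using \<delta> \<tau>
    by (intro borel_measurable_add S_meas_const \<Gamma>_meas_const innovation_adapted meas_F_mono[OF Suc.IH \<tau>] meas_F_mono[OF kn_grid_adapted[OF \<delta>] \<tau>]) auto
  moreover have "Xn \<delta> (?\<tau> + \<delta>) = (\<lambda>\<omega>. S \<delta> (Xn \<delta> ?\<tau> \<omega>) + innovation ?\<tau> \<delta> \<omega> + \<Gamma> \<delta> (kn \<delta> ?\<tau> \<omega>))"
    using \<delta> by (intro ext response_flow) auto
  ultimately show ?case unfolding e by simp
qed

lemma Xn_joint: "(\<lambda>p. Xn \<delta> (max 0 (snd p)) (fst p)) \<in> borel_measurable (M \<Otimes>\<^sub>M lborel)"
  by (rule response_joint) (use kn_joint in \<open>simp add: split_beta'\<close>)

text \<open>The formula for a constant control, started from the random state at the beginning of the cell and discounted to time \<open>0\<close>.\<close>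
lemma dynkin_cell:
  assumes \<delta>: "\<delta> > 0"
  shows "exp (- lam * (real (Suc i) * \<delta>)) * (LINT \<omega>|M. v (Xn \<delta> (real (Suc i) * \<delta>) \<omega>)) - exp (- lam * (real i * \<delta>)) * (LINT \<omega>|M. v (Xn \<delta> (real i * \<delta>) \<omega>))
    = (LINT p|(M \<Otimes>\<^sub>M lborel). indicator {real i * \<delta>..<real (Suc i) * \<delta>} (snd p) * H (kn \<delta>) (Xn \<delta>) p)"
proof -
  define \<tau> where "\<tau> = real i * \<delta>"
  have \<tau>: "0 \<le> \<tau>" using \<delta> by (simp add: \<tau>_def)
  have \<tau>S: "real (Suc i) * \<delta> = \<tau> + \<delta>" by (simp add: \<tau>_def algebra_simps)
  have asm: "Xn \<delta> \<tau> \<in> borel_measurable (F \<tau>)" "kn \<delta> \<tau> \<in> borel_measurable (F \<tau>)" "integrable M (kn \<delta> \<tau>)"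
    unfolding \<tau>_def by (rule response_grid_adapted[OF \<delta>] kn_grid_adapted[OF \<delta>] kn_grid_int[OF \<delta>])+
  note ctx = \<tau> asm
  have X: "X \<tau> (Xn \<delta> \<tau>) (kn \<delta> \<tau>) r \<omega> = Xn \<delta> (\<tau> + r) \<omega>" if "0 \<le> r" "r \<le> \<delta>" for r \<omega>
    unfolding X_def[OF ctx] unfolding \<tau>_def by (rule response_flow[OF \<delta> that, symmetric])
  have "exp (- lam * \<delta>) * (LINT \<omega>|M. v (Xn \<delta> (\<tau> + \<delta>) \<omega>)) - (LINT \<omega>|M. v (Xn \<delta> \<tau> \<omega>)) = (LINT \<omega>|M. (LINT r:{0..\<delta>}|lborel. rate \<tau> (Xn \<delta> \<tau>) (kn \<delta> \<tau>) r \<omega>))"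
    using dynkin_constant_control[OF ctx \<delta>] \<delta> by (simp add: X)
  then have "exp (- lam * \<tau>) * (exp (- lam * \<delta>) * (LINT \<omega>|M. v (Xn \<delta> (\<tau> + \<delta>) \<omega>)) - (LINT \<omega>|M. v (Xn \<delta> \<tau> \<omega>)))
     = (LINT \<omega>|M. exp (- lam * \<tau>) * (LINT r:{0..\<delta>}|lborel. rate \<tau> (Xn \<delta> \<tau>) (kn \<delta> \<tau>) r \<omega>))" by simp
  also have "\<dots> = (LINT \<omega>|M. LINT s|lborel. indicator {\<tau>..<\<tau> + \<delta>} s * H (kn \<delta>) (Xn \<delta>) (\<omega>, s))"
  proof (intro Bochner_Integration.integral_cong refl)
    fix \<omega> assume \<omega>: "\<omega> \<in> space M"
    have "exp (- lam * \<tau>) * (LINT r:{0..\<delta>}|lborel. rate \<tau> (Xn \<delta> \<tau>) (kn \<delta> \<tau>) r \<omega>) = (LINT r|lborel. exp (- lam * \<tau>) * (indicator {0..\<delta>} r * rate \<tau> (Xn \<delta> \<tau>) (kn \<delta> \<tau>) r \<omega>))"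
      by (simp add: set_lebesgue_integral_def)
    also have "\<dots> = (LINT r|lborel. indicator {\<tau>..<\<tau> + \<delta>} (\<tau> + 1 * r) * H (kn \<delta>) (Xn \<delta>) (\<omega>, \<tau> + 1 * r))"
    proof -
      let ?rate = "\<lambda>r. rate \<tau> (Xn \<delta> \<tau>) (kn \<delta> \<tau>) r \<omega>"
      have eq: "exp (- lam * \<tau>) * rate \<tau> (Xn \<delta> \<tau>) (kn \<delta> \<tau>) r \<omega> = H (kn \<delta>) (Xn \<delta>) (\<omega>, \<tau> + 1 * r)" if r: "0 \<le> r" "r < \<delta>" for r
      proof -
        have k: "kn \<delta> (\<tau> + r) \<omega> = kn \<delta> \<tau> \<omega>" unfolding \<tau>_def using r by (intro kn_cell[OF \<delta>]) (auto simp: algebra_simps)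
        have ex: "exp (- lam * (\<tau> + r)) = exp (- lam * \<tau>) * exp (- lam * r)" by (simp add: exp_add[symmetric] algebra_simps)
        have mx: "max 0 (\<tau> + r) = \<tau> + r" using \<tau> r by simp
        show ?thesis unfolding rate_def[OF ctx] H_def using X[of r \<omega>] r by (simp only: fst_conv snd_conv mult_1 mx k ex mult.assoc)
      qed
      have pt: "indicator {\<tau>..<\<tau> + \<delta>} (\<tau> + 1 * r) * H (kn \<delta>) (Xn \<delta>) (\<omega>, \<tau> + 1 * r) = exp (- lam * \<tau>) * (indicator {0..<\<delta>} r * ?rate r)" for r
      proof (cases "r \<in> {0..<\<delta>}")
        case True
        then have i: "\<tau> + 1 * r \<in> {\<tau>..<\<tau> + \<delta>}" by auto
        have "exp (- lam * \<tau>) * ?rate r = H (kn \<delta>) (Xn \<delta>) (\<omega>, \<tau> + 1 * r)" using eq True by simp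
        then show ?thesis unfolding indicator_simps(1)[OF True] indicator_simps(1)[OF i] by simp
      next
        case False
        then have i: "\<tau> + 1 * r \<notin> {\<tau>..<\<tau> + \<delta>}" by auto
        then show ?thesis unfolding indicator_simps(2)[OF False] indicator_simps(2)[OF i] by simp
      qed
      have meas: "(\<lambda>r. exp (- lam * \<tau>) * (indicator A r * ?rate r)) \<in> borel_measurable lborel" if "A \<in> sets borel" "A \<subseteq> {0..}" for A
      proof -
        have "continuous_on A ?rate" by (rule continuous_on_subset[OF rate_continuous[OF ctx \<omega>] that(2)])
        from borel_measurable_continuous_on_indicator[OF that(1) this] show ?thesis by simp
      qed
      show ?thesis
        unfolding pt
      proof (rule integral_cong_AE)
        show "AE r in lborel. exp (- lam * \<tau>) * (indicator {0..\<delta>} r * ?rate r) = exp (- lam * \<tau>) * (indicator {0..<\<delta>} r * ?rate r)"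
          using AE_lborel_singleton[of \<delta>] by eventually_elim (auto simp: indicator_def)
        show "(\<lambda>r. exp (- lam * \<tau>) * (indicator {0..\<delta>} r * ?rate r)) \<in> borel_measurable lborel" by (rule meas) auto
        show "(\<lambda>r. exp (- lam * \<tau>) * (indicator {0..<\<delta>} r * ?rate r)) \<in> borel_measurable lborel" by (rule meas) auto
      qed
    qed
    also have "\<dots> = (LINT s|lborel. indicator {\<tau>..<\<tau> + \<delta>} s * H (kn \<delta>) (Xn \<delta>) (\<omega>, s))"
      by (subst (2) lborel_integral_real_affine[where c=1 and t=\<tau>]) simp_all
    finally show "exp (- lam * \<tau>) * (LINT r:{0..\<delta>}|lborel. rate \<tau> (Xn \<delta> \<tau>) (kn \<delta> \<tau>) r \<omega>) = (LINT s|lborel. indicator {\<tau>..<\<tau> + \<delta>} s * H (kn \<delta>) (Xn \<delta>) (\<omega>, s))" .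
  qed
  also have "\<dots> = (LINT p|(M \<Otimes>\<^sub>M lborel). indicator {\<tau>..<\<tau> + \<delta>} (snd p) * H (kn \<delta>) (Xn \<delta>) p)"
    using time.integral_fst'[OF H_int[OF kn_int[OF \<delta>] Xn_joint \<tau>, of "\<tau> + \<delta>"]] \<delta> by simp
  finally have cell: "exp (- lam * \<tau>) * (exp (- lam * \<delta>) * (LINT \<omega>|M. v (Xn \<delta> (\<tau> + \<delta>) \<omega>)) - (LINT \<omega>|M. v (Xn \<delta> \<tau> \<omega>)))
      = (LINT p|(M \<Otimes>\<^sub>M lborel). indicator {\<tau>..<\<tau> + \<delta>} (snd p) * H (kn \<delta>) (Xn \<delta>) p)" .
  have exp_split: "exp (- lam * (\<tau> + \<delta>)) = exp (- lam * \<tau>) * exp (- lam * \<delta>)"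
    by (simp add: exp_add[symmetric] algebra_simps)
  from cell show ?thesis
    unfolding \<tau>S \<tau>_def[symmetric] exp_split by (simp only: right_diff_distrib mult.assoc)
qed

lemma dynkin_step_control:
  assumes \<delta>: "\<delta> > 0"
  shows "exp (- lam * (real n * \<delta>)) * (LINT \<omega>|M. v (Xn \<delta> (real n * \<delta>) \<omega>)) - v x = (LINT p|(M \<Otimes>\<^sub>M lborel). indicator {0..<real n * \<delta>} (snd p) * H (kn \<delta>) (Xn \<delta>) p)"
proof (induction n)
  case 0
  have "(LINT \<omega>|M. v (Xn \<delta> 0 \<omega>)) = (LINT \<omega>|M. v x)"
  proof (rule integral_cong_AE)
    show "AE \<omega> in M. v (Xn \<delta> 0 \<omega>) = v x"
      using Z_0 by eventually_elim (simp add: response_def set_lebesgue_integral_def)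
    have "Xn \<delta> 0 = (\<lambda>\<omega>. x + Z 0 \<omega>)" by (simp add: response_def fun_eq_iff set_lebesgue_integral_def)
    moreover have [measurable]: "Z 0 \<in> borel_measurable M" by (rule Z_meas) simp
    ultimately show "(\<lambda>\<omega>. v (Xn \<delta> 0 \<omega>)) \<in> borel_measurable M" by simp
  qed simp
  then show ?case by (simp add: prob_space)
next
  case (Suc n)
  have s: "0 \<le> real n * \<delta>" "real n * \<delta> \<le> real (Suc n) * \<delta>" using \<delta> by (auto intro: mult_right_mono)
  have ind: "indicator {0..<real (Suc n) * \<delta>} (snd p) * H (kn \<delta>) (Xn \<delta>) p
     = indicator {0..<real n * \<delta>} (snd p) * H (kn \<delta>) (Xn \<delta>) p + indicator {real n * \<delta>..<real (Suc n) * \<delta>} (snd p) * H (kn \<delta>) (Xn \<delta>) p" for p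
  proof -
    have "indicator {0..<real (Suc n) * \<delta>} (snd p) = (indicator {0..<real n * \<delta>} (snd p) + indicator {real n * \<delta>..<real (Suc n) * \<delta>} (snd p) :: real)"
      using s unfolding indicator_def by (simp del: of_nat_Suc)
    then show ?thesis by (simp only: distrib_right)
  qed
  have "(LINT p|(M \<Otimes>\<^sub>M lborel). indicator {0..<real (Suc n) * \<delta>} (snd p) * H (kn \<delta>) (Xn \<delta>) p)
    = (LINT p|(M \<Otimes>\<^sub>M lborel). indicator {0..<real n * \<delta>} (snd p) * H (kn \<delta>) (Xn \<delta>) p) + (LINT p|(M \<Otimes>\<^sub>M lborel). indicator {real n * \<delta>..<real (Suc n) * \<delta>} (snd p) * H (kn \<delta>) (Xn \<delta>) p)"
    unfolding ind by (rule Bochner_Integration.integral_add) (use s in \<open>auto intro!: H_int kn_int[OF \<delta>] Xn_joint simp del: of_nat_Suc\<close>)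
  then show ?case unfolding dynkin_cell[OF \<delta>, symmetric] Suc.IH[symmetric] by simp
qed

abbreviation K where "K \<equiv> (\<lambda>s \<omega>. kk \<omega> s)"
abbreviation XX where "XX \<equiv> response x K"

lemma K_int: "integrable (M \<Otimes>\<^sub>M lborel) (\<lambda>p. K (snd p) (fst p))"
  using kk_int by (simp add: split_beta')

lemma XX_joint: "(\<lambda>p. XX (max 0 (snd p)) (fst p)) \<in> borel_measurable (M \<Otimes>\<^sub>M lborel)"
  by (rule response_joint) (use kk_meas in \<open>simp add: split_beta'\<close>)

lemma diff_int:
  assumes "\<delta> > 0" shows "integrable (M \<Otimes>\<^sub>M lborel) (\<lambda>p. norm (kn \<delta> (snd p) (fst p) - kk (fst p) (snd p)))"
  by (intro integrable_norm Bochner_Integration.integrable_diff kn_int[OF assms] K_int)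

definition \<delta>n :: "nat \<Rightarrow> real" where "\<delta>n n = T / real (Suc n)"

lemma \<delta>n_pos: "\<delta>n n > 0"
  using T by (simp add: \<delta>n_def)

lemma \<delta>n_lim: "\<delta>n \<longlonglongrightarrow> 0"
proof -
  have "(\<lambda>n. T * (1 / real (Suc n))) \<longlonglongrightarrow> 0"
    by (rule tendsto_mult_right_zero[OF LIMSEQ_Suc[OF lim_1_over_n]])
  then show ?thesis by (simp add: \<delta>n_def[abs_def])
qed

text \<open>Convergence holds for almost every trajectory and is dominated by twice its \<open>L\<^sup>1\<close> norm.\<close>
lemma control_L1_convergence:
  "(\<lambda>n. LINT p|(M \<Otimes>\<^sub>M lborel). norm (kn (\<delta>n n) (snd p) (fst p) - kk (fst p) (snd p))) \<longlonglongrightarrow> 0"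
proof -
  define d where "d n \<omega> = (LINT s|lborel. norm (kn (\<delta>n n) s \<omega> - kk \<omega> s))" for n \<omega>
  have eq: "(LINT p|(M \<Otimes>\<^sub>M lborel). norm (kn (\<delta>n n) (snd p) (fst p) - kk (fst p) (snd p))) = (LINT \<omega>|M. d n \<omega>)" for n
    using time.integral_fst'[OF diff_int[OF \<delta>n_pos]] by (simp add: d_def)
  have "integrable M (\<lambda>\<omega>. LINT s|lborel. norm (kk \<omega> s))"
    using time.integrable_fst'[OF integrable_norm[OF K_int]] by simp
  then have w: "integrable M (\<lambda>\<omega>. 2 * (LINT s|lborel. norm (kk \<omega> s)))" by simp
  have dm: "d n \<in> borel_measurable M" for n
    using time.integrable_fst'[OF diff_int[OF \<delta>n_pos]] by (simp add: d_def[abs_def] borel_measurable_integrable)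
  have lim: "AE \<omega> in M. (\<lambda>n. d n \<omega>) \<longlonglongrightarrow> 0"
    using kk_path_int
  proof eventually_elim
    case (elim \<omega>)
    show ?case using delayed_average_tendsto[OF \<delta>n_pos \<delta>n_lim elim] by (simp add: d_def kn_def)
  qed
  have bd: "AE \<omega> in M. norm (d n \<omega>) \<le> 2 * (LINT s|lborel. norm (kk \<omega> s))" for n
    using kk_path_int
  proof eventually_elim
    case (elim \<omega>)
    have i: "integrable lborel (delayed_average (\<delta>n n) (kk \<omega>))" by (rule delayed_average_integrable[OF \<delta>n_pos elim])
    have "d n \<omega> \<le> (LINT s|lborel. norm (delayed_average (\<delta>n n) (kk \<omega>) s) + norm (kk \<omega> s))"
      unfolding d_def kn_def
    proof (rule integral_mono)
      show "integrable lborel (\<lambda>s. norm (delayed_average (\<delta>n n) (kk \<omega>) s - kk \<omega> s))" using i elim by auto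
      show "integrable lborel (\<lambda>s. norm (delayed_average (\<delta>n n) (kk \<omega>) s) + norm (kk \<omega> s))" using i elim by auto
    qed (rule norm_triangle_ineq4)
    also have "\<dots> = (LINT s|lborel. norm (delayed_average (\<delta>n n) (kk \<omega>) s)) + (LINT s|lborel. norm (kk \<omega> s))"
      using i elim by (intro Bochner_Integration.integral_add integrable_norm)
    also have "\<dots> \<le> 2 * (LINT s|lborel. norm (kk \<omega> s))"
      using integral_norm_delayed_average_le[OF \<delta>n_pos elim, of n] by simp
    finally have "d n \<omega> \<le> 2 * (LINT s|lborel. norm (kk \<omega> s))" .
    moreover have "0 \<le> d n \<omega>" by (simp add: d_def)
    ultimately show ?case by simp
  qed
  have "(\<lambda>n. LINT \<omega>|M. d n \<omega>) \<longlonglongrightarrow> (LINT \<omega>|M. 0)"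
    by (rule integral_dominated_convergence[OF _ dm w lim bd]) simp
  then show ?thesis unfolding eq by simp
qed

definition state_error :: "nat \<Rightarrow> 'w \<times> real \<Rightarrow> 'h" where
  "state_error n p = indicator {0..<T} (snd p) *\<^sub>R (Xn (\<delta>n n) (max 0 (snd p)) (fst p) - XX (max 0 (snd p)) (fst p))"

lemma state_error_meas: "state_error n \<in> borel_measurable (M \<Otimes>\<^sub>M lborel)"
proof -
  note Xn_joint[measurable] XX_joint[measurable]
  show ?thesis unfolding state_error_def[abs_def] by measurable
qed

abbreviation \<rho>T where "\<rho>T \<equiv> (\<integral>\<^sup>+r. ennreal (indicator {0<..T} r * \<rho> r) \<partial>lborel)"

lemma \<rho>T_finite: "\<rho>T < \<infinity>"
proof -
  have "integrable lborel (\<lambda>r. indicator {0<..T} r * \<rho> r)" using \<rho>_integrable[of T] by (simp add: set_integrable_def)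
  then have "(\<integral>\<^sup>+r. ennreal (norm (indicator {0<..T} r * \<rho> r)) \<partial>lborel) < \<infinity>" by (simp only: integrable_iff_bounded)
  then show ?thesis using \<rho>_nonneg by (simp add: abs_mult)
qed

lemma state_error_path:
  assumes \<omega>: "\<omega> \<in> space M" and int: "integrable lborel (kk \<omega>)"
  shows "(\<integral>\<^sup>+t. ennreal (norm (state_error n (\<omega>, t))) \<partial>lborel) \<le> \<rho>T * (\<integral>\<^sup>+s. ennreal (norm (kn (\<delta>n n) s \<omega> - kk \<omega> s)) \<partial>lborel)"
proof -
  have km[measurable]: "kk \<omega> \<in> borel_measurable borel" using int by auto
  have knm[measurable]: "(\<lambda>s. kn (\<delta>n n) s \<omega>) \<in> borel_measurable borel" unfolding kn_def by measurable
  define g where "g s = norm (kn (\<delta>n n) s \<omega> - kk \<omega> s)" for s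
  have gm: "g \<in> borel_measurable borel" unfolding g_def[abs_def] by measurable
  have g0: "0 \<le> g s" for s by (simp add: g_def)
  let ?I = "\<lambda>t. \<integral>\<^sup>+s. ennreal (indicator {0..<t} s * (\<rho> (t - s) * norm (kk \<omega> s))) \<partial>lborel"
  have Im: "?I \<in> borel_measurable lborel"
  proof -
    have "(\<lambda>(t, s). ennreal ((if 0 \<le> s \<and> s < t then 1 else 0) * (\<rho> (t - s) * norm (kk \<omega> s)))) \<in> borel_measurable (lborel \<Otimes>\<^sub>M lborel)"
      unfolding split_beta' by measurable
    from lborel.borel_measurable_nn_integral[OF this]
    have "(\<lambda>t. \<integral>\<^sup>+s. ennreal ((if 0 \<le> s \<and> s < t then 1 else 0) * (\<rho> (t - s) * norm (kk \<omega> s))) \<partial>lborel) \<in> borel_measurable lborel" by simp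
    moreover have "(if 0 \<le> s \<and> s < t then 1 else 0 :: real) = indicator {0..<t} s" for s t :: real by (simp add: indicator_def)
    ultimately show ?thesis by simp
  qed
  have "(\<integral>\<^sup>+t. ennreal (indicator {0..T} t) * ?I t \<partial>lborel) \<le> \<rho>T * (\<integral>\<^sup>+s. ennreal (norm (kk \<omega> s)) \<partial>lborel)"
    by (rule young_bound) auto
  also have "\<dots> < \<infinity>"
    using \<rho>T_finite int by (simp add: integrable_iff_bounded ennreal_mult_less_top)
  finally have "(\<integral>\<^sup>+t. ennreal (indicator {0..T} t) * ?I t \<partial>lborel) \<noteq> \<infinity>" by simp
  then have fin: "AE t in lborel. ennreal (indicator {0..T} t) * ?I t \<noteq> \<infinity>"
    by (rule nn_integral_PInf_AE[rotated]) (use Im in measurable)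
  have "(\<integral>\<^sup>+t. ennreal (norm (state_error n (\<omega>, t))) \<partial>lborel)
      \<le> (\<integral>\<^sup>+t. ennreal (indicator {0..T} t) * (\<integral>\<^sup>+s. ennreal (indicator {0..<t} s * (\<rho> (t - s) * g s)) \<partial>lborel) \<partial>lborel)"
  proof (rule nn_integral_mono_AE)
    show "AE t in lborel. ennreal (norm (state_error n (\<omega>, t))) \<le> ennreal (indicator {0..T} t) * (\<integral>\<^sup>+s. ennreal (indicator {0..<t} s * (\<rho> (t - s) * g s)) \<partial>lborel)"
      using fin
    proof eventually_elim
      case (elim t)
      show ?case
      proof (cases "t \<in> {0..<T}")
        case True
        then have tT: "t \<in> {0..T}" "0 \<le> t" by auto
        have If: "?I t < \<infinity>" using elim tT by (simp add: less_top)
        have iK: "set_integrable lborel {0..<t} (\<lambda>s. E0 (t - s) (kk \<omega> s))"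
          unfolding set_integrable_def
        proof (rule integrableI_bounded)
          show "(\<lambda>s. indicator {0..<t} s *\<^sub>R E0 (t - s) (kk \<omega> s)) \<in> borel_measurable lborel" by measurable
          have "(\<integral>\<^sup>+s. ennreal (norm (indicator {0..<t} s *\<^sub>R E0 (t - s) (kk \<omega> s))) \<partial>lborel) \<le> ?I t"
            using norm_E0 by (intro nn_integral_mono ennreal_leI) (auto simp: indicator_def)
          with If show "(\<integral>\<^sup>+s. ennreal (norm (indicator {0..<t} s *\<^sub>R E0 (t - s) (kk \<omega> s))) \<partial>lborel) < \<infinity>" by (rule le_less_trans[rotated])
        qed
        have iN: "set_integrable lborel {0..<t} (\<lambda>s. E0 (t - s) (kn (\<delta>n n) s \<omega>))"
          by (rule kn_convolution_int[OF \<delta>n_pos order_refl])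
        have "state_error n (\<omega>, t) = (LINT s:{0..<t}|lborel. E0 (t - s) (kn (\<delta>n n) s \<omega>)) - (LINT s:{0..<t}|lborel. E0 (t - s) (kk \<omega> s))"
          using True tT unfolding state_error_def response_def E_E0_cong by simp
        also have "\<dots> = (LINT s:{0..<t}|lborel. E0 (t - s) (kn (\<delta>n n) s \<omega>) - E0 (t - s) (kk \<omega> s))"
          by (rule set_integral_diff(2)[OF iN iK, symmetric])
        finally have e: "state_error n (\<omega>, t) = \<dots>" .
        have "ennreal (norm (state_error n (\<omega>, t))) \<le> (\<integral>\<^sup>+s. ennreal (norm (indicator {0..<t} s *\<^sub>R (E0 (t - s) (kn (\<delta>n n) s \<omega>) - E0 (t - s) (kk \<omega> s)))) \<partial>lborel)"
          unfolding e set_lebesgue_integral_def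
          using set_integral_diff(1)[OF iN iK] unfolding set_integrable_def by (rule integral_norm_bound_ennreal)
        also have "\<dots> \<le> (\<integral>\<^sup>+s. ennreal (indicator {0..<t} s * (\<rho> (t - s) * g s)) \<partial>lborel)"
        proof (intro nn_integral_mono ennreal_leI)
          fix s
          have "E0 (t - s) (kn (\<delta>n n) s \<omega>) - E0 (t - s) (kk \<omega> s) = E0 (t - s) (kn (\<delta>n n) s \<omega> - kk \<omega> s)"
            by (simp add: E0_def blinfun.diff_right)
          then show "norm (indicator {0..<t} s *\<^sub>R (E0 (t - s) (kn (\<delta>n n) s \<omega>) - E0 (t - s) (kk \<omega> s))) \<le> indicator {0..<t} s * (\<rho> (t - s) * g s)"
            using norm_E0[of "t - s" "kn (\<delta>n n) s \<omega> - kk \<omega> s"] by (simp add: g_def indicator_def)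
        qed
        finally show ?thesis using tT by simp
      next
        case False
        then show ?thesis by (simp add: state_error_def)
      qed
    qed
  qed
  also have "\<dots> \<le> \<rho>T * (\<integral>\<^sup>+s. ennreal (g s) \<partial>lborel)" by (rule young_bound[OF gm g0])
  finally show ?thesis by (simp add: g_def)
qed

lemma state_error_L1:
  "(\<integral>\<^sup>+p. ennreal (norm (state_error n p)) \<partial>(M \<Otimes>\<^sub>M lborel)) \<le> \<rho>T * ennreal (LINT p|(M \<Otimes>\<^sub>M lborel). norm (kn (\<delta>n n) (snd p) (fst p) - kk (fst p) (snd p)))"
proof -
  note state_error_meas[measurable] kn_joint[measurable] kk_meas[measurable]
  have "(\<integral>\<^sup>+p. ennreal (norm (state_error n p)) \<partial>(M \<Otimes>\<^sub>M lborel)) = (\<integral>\<^sup>+\<omega>. (\<integral>\<^sup>+t. ennreal (norm (state_error n (\<omega>, t))) \<partial>lborel) \<partial>M)"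
    by (rule lborel.nn_integral_fst[symmetric]) measurable
  also have "\<dots> \<le> (\<integral>\<^sup>+\<omega>. \<rho>T * (\<integral>\<^sup>+s. ennreal (norm (kn (\<delta>n n) s \<omega> - kk \<omega> s)) \<partial>lborel) \<partial>M)"
  proof (rule nn_integral_mono_AE)
    show "AE \<omega> in M. (\<integral>\<^sup>+t. ennreal (norm (state_error n (\<omega>, t))) \<partial>lborel) \<le> \<rho>T * (\<integral>\<^sup>+s. ennreal (norm (kn (\<delta>n n) s \<omega> - kk \<omega> s)) \<partial>lborel)"
      using kk_path_int AE_space by eventually_elim (rule state_error_path)
  qed
  also have "\<dots> = \<rho>T * (\<integral>\<^sup>+\<omega>. (\<integral>\<^sup>+s. ennreal (norm (kn (\<delta>n n) s \<omega> - kk \<omega> s)) \<partial>lborel) \<partial>M)"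
  proof (rule nn_integral_cmult)
    have "(\<lambda>p. ennreal (norm (kn (\<delta>n n) (snd p) (fst p) - kk (fst p) (snd p)))) \<in> borel_measurable (M \<Otimes>\<^sub>M lborel)" by measurable
    from lborel.borel_measurable_nn_integral_fst[OF this]
    show "(\<lambda>\<omega>. \<integral>\<^sup>+s. ennreal (norm (kn (\<delta>n n) s \<omega> - kk \<omega> s)) \<partial>lborel) \<in> borel_measurable M" by simp
  qed
  also have "(\<integral>\<^sup>+\<omega>. (\<integral>\<^sup>+s. ennreal (norm (kn (\<delta>n n) s \<omega> - kk \<omega> s)) \<partial>lborel) \<partial>M) = (\<integral>\<^sup>+p. ennreal (norm (kn (\<delta>n n) (snd p) (fst p) - kk (fst p) (snd p))) \<partial>(M \<Otimes>\<^sub>M lborel))"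
    by (subst lborel.nn_integral_fst[symmetric]) auto
  also have "\<dots> = ennreal (LINT p|(M \<Otimes>\<^sub>M lborel). norm (kn (\<delta>n n) (snd p) (fst p) - kk (fst p) (snd p)))"
    by (rule nn_integral_eq_integral[OF diff_int[OF \<delta>n_pos]]) simp
  finally show ?thesis .
qed

text \<open>Pass to the limit in \<open>dynkin_step_control\<close>: first the input inside \<open>H\<close>, in \<open>L\<^sup>1\<close> with the state left unchanged, then the state, which converges almost everywhere along a subsequence. The terminal value enters only through its bound, for the states are not claimed to converge at the fixed time \<open>T\<close>.\<close>
theorem dynkin_estimate:
  "\<bar>v x + (LINT p|(M \<Otimes>\<^sub>M lborel). indicator {0..<T} (snd p) * H K XX p)\<bar> \<le> exp (- lam * T) * (C_f / lam)"
proof -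
  let ?N = "M \<Otimes>\<^sub>M (lborel :: real measure)"
  define c where "c n = (LINT p|?N. norm (kn (\<delta>n n) (snd p) (fst p) - kk (fst p) (snd p)))" for n
  have c: "c \<longlonglongrightarrow> 0" unfolding c_def by (rule control_L1_convergence)
  note XX_joint[measurable] Xn_joint[measurable] kk_meas[measurable] kn_joint[measurable]
  have err_le: "(\<integral>\<^sup>+p. ennreal (norm (state_error n p)) \<partial>?N) \<le> \<rho>T * ennreal (c n)" for n
    unfolding c_def by (rule state_error_L1)
  have c0: "0 \<le> c n" for n by (simp add: c_def)
  have err_int: "integrable ?N (state_error n)" for n
  proof (rule integrableI_bounded[OF state_error_meas])
    show "(\<integral>\<^sup>+p. ennreal (norm (state_error n p)) \<partial>?N) < \<infinity>"
      using err_le[of n] \<rho>T_finite by (auto intro: le_less_trans simp: ennreal_mult_less_top)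
  qed
  have "(\<lambda>n. LINT p|?N. norm (state_error n p)) \<longlonglongrightarrow> 0"
  proof (rule tendsto_0_squeeze)
    have r: "\<rho>T = ennreal (enn2real \<rho>T)" using \<rho>T_finite by simp
    show "(LINT p|?N. norm (state_error n p)) \<le> enn2real \<rho>T * c n" for n
    proof -
      have "ennreal (LINT p|?N. norm (state_error n p)) = (\<integral>\<^sup>+p. ennreal (norm (state_error n p)) \<partial>?N)"
        by (rule nn_integral_eq_integral[symmetric]) (use err_int in auto)
      also have "\<dots> \<le> ennreal (enn2real \<rho>T) * ennreal (c n)" using err_le[of n] r by simp
      also have "\<dots> = ennreal (enn2real \<rho>T * c n)" using c0 by (simp add: ennreal_mult)
      finally show ?thesis using c0[of n] by (subst (asm) ennreal_le_iff) auto
    qed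
    show "(\<lambda>n. enn2real \<rho>T * c n) \<longlonglongrightarrow> 0" by (rule tendsto_mult_right_zero[OF c])
  qed simp
  from tendsto_L1_AE_subseq[OF err_int this] obtain r where r: "strict_mono r" "AE p in ?N. (\<lambda>n. state_error (r n) p) \<longlonglongrightarrow> 0"
    by blast
  let ?ind = "\<lambda>p. indicator {0..<T} (snd p :: real) :: real"
  have kn_H: "(\<lambda>n. (LINT p|?N. ?ind p * H (kn (\<delta>n n)) (Xn (\<delta>n n)) p) - (LINT p|?N. ?ind p * H K (Xn (\<delta>n n)) p)) \<longlonglongrightarrow> 0"
  proof (rule Lim_null_comparison)
    show "(\<lambda>n. B * c n) \<longlonglongrightarrow> 0" by (rule tendsto_mult_right_zero[OF c])
    show "eventually (\<lambda>n. norm ((LINT p|?N. ?ind p * H (kn (\<delta>n n)) (Xn (\<delta>n n)) p) - (LINT p|?N. ?ind p * H K (Xn (\<delta>n n)) p)) \<le> B * c n) sequentially"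
    proof (intro always_eventually allI)
      fix n
      have i1: "integrable ?N (\<lambda>p. ?ind p * H (kn (\<delta>n n)) (Xn (\<delta>n n)) p)" by (rule H_int[OF kn_int[OF \<delta>n_pos] Xn_joint]) (use T in auto)
      have i2: "integrable ?N (\<lambda>p. ?ind p * H K (Xn (\<delta>n n)) p)" by (rule H_int[OF K_int Xn_joint]) (use T in auto)
      have "norm ((LINT p|?N. ?ind p * H (kn (\<delta>n n)) (Xn (\<delta>n n)) p) - (LINT p|?N. ?ind p * H K (Xn (\<delta>n n)) p))
        = norm (LINT p|?N. ?ind p * H (kn (\<delta>n n)) (Xn (\<delta>n n)) p - ?ind p * H K (Xn (\<delta>n n)) p)"
        by (subst Bochner_Integration.integral_diff[OF i1 i2]) simp
      also have "\<dots> \<le> (LINT p|?N. norm (?ind p * H (kn (\<delta>n n)) (Xn (\<delta>n n)) p - ?ind p * H K (Xn (\<delta>n n)) p))"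
        by (rule integral_norm_bound)
      also have "\<dots> \<le> (LINT p|?N. B * norm (kn (\<delta>n n) (snd p) (fst p) - kk (fst p) (snd p)))"
      proof (rule integral_mono)
        show "integrable ?N (\<lambda>p. norm (?ind p * H (kn (\<delta>n n)) (Xn (\<delta>n n)) p - ?ind p * H K (Xn (\<delta>n n)) p))"
          by (intro integrable_norm Bochner_Integration.integrable_diff i1 i2)
        show "integrable ?N (\<lambda>p. B * norm (kn (\<delta>n n) (snd p) (fst p) - kk (fst p) (snd p)))"
          by (intro integrable_mult_right diff_int \<delta>n_pos)
        fix p :: "'w \<times> real"
        let ?y = "dv (Xn (\<delta>n n) (max 0 (snd p)) (fst p))"
        have nn: "0 \<le> B * norm (kn (\<delta>n n) (snd p) (fst p) - kk (fst p) (snd p))" using B_nonneg by simp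
        show "norm (?ind p * H (kn (\<delta>n n)) (Xn (\<delta>n n)) p - ?ind p * H K (Xn (\<delta>n n)) p) \<le> B * norm (kn (\<delta>n n) (snd p) (fst p) - kk (fst p) (snd p))"
        proof (cases "snd p \<in> {0..<T}")
          case True
          have "H (kn (\<delta>n n)) (Xn (\<delta>n n)) p - H K (Xn (\<delta>n n)) p = exp (- lam * snd p) * (?y \<bullet> (kn (\<delta>n n) (snd p) (fst p) - kk (fst p) (snd p)))"
            by (simp add: H_def inner_diff_right algebra_simps)
          moreover have "exp (- lam * snd p) * \<bar>?y \<bullet> (kn (\<delta>n n) (snd p) (fst p) - kk (fst p) (snd p))\<bar> \<le> 1 * (B * norm (kn (\<delta>n n) (snd p) (fst p) - kk (fst p) (snd p)))"
            using True lam dv_inner_bound by (intro mult_mono) auto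
          ultimately show ?thesis using True by (simp add: abs_mult)
        next
          case False then show ?thesis using nn by simp
        qed
      qed
      also have "\<dots> = B * c n" by (simp add: c_def)
      finally show "norm ((LINT p|?N. ?ind p * H (kn (\<delta>n n)) (Xn (\<delta>n n)) p) - (LINT p|?N. ?ind p * H K (Xn (\<delta>n n)) p)) \<le> B * c n" .
    qed
  qed
  have K_H: "(\<lambda>n. LINT p|?N. ?ind p * H K (Xn (\<delta>n (r n))) p) \<longlonglongrightarrow> (LINT p|?N. ?ind p * H K XX p)"
  proof (rule integral_dominated_convergence[where w="\<lambda>p. B * norm (kk (fst p) (snd p)) + ?ind p * C_f"])
    have "integrable ?N (\<lambda>p. ?ind p * C_f)"
      by (rule integrable_pair_lborel_bound[where c="\<lambda>s. C_f * indicator {0..<T} s"])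
        (use T C_f_nonneg in \<open>auto intro!: integrable_mult_right integrable_real_indicator simp: abs_mult\<close>)
    then show "integrable ?N (\<lambda>p. B * norm (kk (fst p) (snd p)) + ?ind p * C_f)"
      using K_int by (intro Bochner_Integration.integrable_add integrable_mult_right integrable_norm)
    show "(\<lambda>p. ?ind p * H K XX p) \<in> borel_measurable ?N" using H_int[OF K_int XX_joint, of 0 T] T by auto
    show "(\<lambda>p. ?ind p * H K (Xn (\<delta>n (r n))) p) \<in> borel_measurable ?N" for n using H_int[OF K_int Xn_joint, of 0 T] T by auto
    show "AE p in ?N. norm (?ind p * H K (Xn (\<delta>n (r n))) p) \<le> B * norm (kk (fst p) (snd p)) + ?ind p * C_f" for n
    proof (rule AE_I2)
      fix p :: "'w \<times> real"
      have nn: "0 \<le> B * norm (kk (fst p) (snd p))" using B_nonneg by simp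
      show "norm (?ind p * H K (Xn (\<delta>n (r n))) p) \<le> B * norm (kk (fst p) (snd p)) + ?ind p * C_f"
        using H_bound[of p K "Xn (\<delta>n (r n))"] nn C_f_nonneg by (cases "snd p \<in> {0..<T}") auto
    qed
    show "AE p in ?N. (\<lambda>n. ?ind p * H K (Xn (\<delta>n (r n))) p) \<longlonglongrightarrow> ?ind p * H K XX p"
      using r(2)
    proof eventually_elim
      case (elim p)
      show ?case
      proof (cases "snd p \<in> {0..<T}")
        case True
        then have "(\<lambda>n. Xn (\<delta>n (r n)) (max 0 (snd p)) (fst p)) \<longlonglongrightarrow> XX (max 0 (snd p)) (fst p)"
          using elim by (simp add: state_error_def LIM_zero_iff)
        then have "(\<lambda>n. dv (Xn (\<delta>n (r n)) (max 0 (snd p)) (fst p))) \<longlonglongrightarrow> dv (XX (max 0 (snd p)) (fst p))"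
            "(\<lambda>n. f (Xn (\<delta>n (r n)) (max 0 (snd p)) (fst p))) \<longlonglongrightarrow> f (XX (max 0 (snd p)) (fst p))"
          using continuous_on_tendsto_compose[OF dv_cont] continuous_on_tendsto_compose[OF f_cont] by simp_all
        then show ?thesis unfolding H_def by (intro tendsto_intros)
      qed simp
    qed
  qed
  have "(\<lambda>n. (LINT p|?N. ?ind p * H (kn (\<delta>n (r n))) (Xn (\<delta>n (r n))) p) - (LINT p|?N. ?ind p * H K (Xn (\<delta>n (r n))) p)) \<longlonglongrightarrow> 0"
    using LIMSEQ_subseq_LIMSEQ[OF kn_H r(1)] by (simp add: comp_def)
  from tendsto_add[OF this K_H]
  have lim: "(\<lambda>n. LINT p|?N. ?ind p * H (kn (\<delta>n (r n))) (Xn (\<delta>n (r n))) p) \<longlonglongrightarrow> (LINT p|?N. ?ind p * H K XX p)" by simp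
  have bound: "\<bar>v x + (LINT p|?N. ?ind p * H (kn (\<delta>n n)) (Xn (\<delta>n n)) p)\<bar> \<le> exp (- lam * T) * (C_f / lam)" for n
  proof -
    have g: "real (Suc n) * \<delta>n n = T" by (simp add: \<delta>n_def)
    have "\<bar>LINT \<omega>|M. v (Xn (\<delta>n n) T \<omega>)\<bar> \<le> C_f / lam"
    proof -
      have "Xn (\<delta>n n) T \<in> borel_measurable (F T)" using response_grid_adapted[OF \<delta>n_pos, of n "Suc n"] unfolding g .
      then have [measurable]: "Xn (\<delta>n n) T \<in> borel_measurable M" using T by (intro meas_F_M[of _ T]) auto
      have i: "integrable M (\<lambda>\<omega>. v (Xn (\<delta>n n) T \<omega>))" by (rule integrable_bounded[of _ "C_f / lam"]) (use v_bound in auto)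
      have "\<bar>LINT \<omega>|M. v (Xn (\<delta>n n) T \<omega>)\<bar> \<le> (LINT \<omega>|M. \<bar>v (Xn (\<delta>n n) T \<omega>)\<bar>)" by (rule integral_abs_bound)
      also have "\<dots> \<le> (LINT \<omega>|M. C_f / lam)" by (rule integral_mono) (use i v_bound in auto)
      finally show ?thesis by (simp add: prob_space)
    qed
    then have "exp (- lam * T) * \<bar>LINT \<omega>|M. v (Xn (\<delta>n n) T \<omega>)\<bar> \<le> exp (- lam * T) * (C_f / lam)" by (intro mult_left_mono) auto
    moreover have "v x + (LINT p|?N. ?ind p * H (kn (\<delta>n n)) (Xn (\<delta>n n)) p) = exp (- lam * T) * (LINT \<omega>|M. v (Xn (\<delta>n n) T \<omega>))"
      using dynkin_step_control[OF \<delta>n_pos[of n], of "Suc n"] unfolding g by linarith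
    ultimately show ?thesis by (simp only: abs_mult abs_exp_cancel)
  qed
  have "(\<lambda>n. \<bar>v x + (LINT p|?N. ?ind p * H (kn (\<delta>n (r n))) (Xn (\<delta>n (r n))) p)\<bar>) \<longlonglongrightarrow> \<bar>v x + (LINT p|?N. ?ind p * H K XX p)\<bar>"
    by (intro tendsto_rabs tendsto_add tendsto_const lim)
  from LIMSEQ_le_const2[OF this] bound show ?thesis by blast
qed

end
end

section \<open>Value and cost\<close>

lemma ereal_integral_real:
  assumes g: "integrable M g" and eq: "AE x in M. h x = ereal (g x)"
  shows "ereal_integral M h = ereal (LINT x|M. g x)"
proof -
  have p: "(\<integral>\<^sup>+x. e2ennreal (h x) \<partial>M) = (\<integral>\<^sup>+x. ennreal (g x) \<partial>M)"
    by (rule nn_integral_cong_AE) (use eq in \<open>eventually_elim, simp add: e2ennreal_ereal\<close>)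
  have n: "(\<integral>\<^sup>+x. e2ennreal (- h x) \<partial>M) = (\<integral>\<^sup>+x. ennreal (- g x) \<partial>M)"
    by (rule nn_integral_cong_AE) (use eq in \<open>eventually_elim, simp add: e2ennreal_ereal\<close>)
  have fp: "(\<integral>\<^sup>+x. ennreal (g x) \<partial>M) < \<infinity>"
  proof -
    have "(\<integral>\<^sup>+x. ennreal (g x) \<partial>M) \<le> (\<integral>\<^sup>+x. ennreal (norm (g x)) \<partial>M)" by (intro nn_integral_mono ennreal_leI) simp
    also have "\<dots> < \<infinity>" using g by (simp add: integrable_iff_bounded)
    finally show ?thesis .
  qed
  have fn: "(\<integral>\<^sup>+x. ennreal (- g x) \<partial>M) < \<infinity>"
  proof -
    have "(\<integral>\<^sup>+x. ennreal (- g x) \<partial>M) \<le> (\<integral>\<^sup>+x. ennreal (norm (g x)) \<partial>M)" by (intro nn_integral_mono ennreal_leI) simp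
    also have "\<dots> < \<infinity>" using g by (simp add: integrable_iff_bounded)
    finally show ?thesis .
  qed
  obtain a where a: "(\<integral>\<^sup>+x. ennreal (g x) \<partial>M) = ennreal a" "0 \<le> a" using fp by (cases "\<integral>\<^sup>+x. ennreal (g x) \<partial>M") auto
  obtain b where b: "(\<integral>\<^sup>+x. ennreal (- g x) \<partial>M) = ennreal b" "0 \<le> b" using fn by (cases "\<integral>\<^sup>+x. ennreal (- g x) \<partial>M") auto
  have "(LINT x|M. g x) = a - b" using real_lebesgue_integral_def[OF g] a b by simp
  then show ?thesis unfolding ereal_integral_def p n a(1) b(1) using a(2) b(2) by simp
qed

text \<open>The inner integral over time may be infinite on a set of positive probability; a bounded negative part prevents any cancellation.\<close>
lemma ereal_integral_infinite:
  assumes M: "prob_space M" and P: "P \<in> borel_measurable M" "(\<integral>\<^sup>+x. P x \<partial>M) = \<infinity>" and Q: "\<And>x. x \<in> space M \<Longrightarrow> Q x \<le> ennreal q" and Qm: "Q \<in> borel_measurable M"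
  shows "ereal_integral M (\<lambda>x. enn2ereal (P x) - enn2ereal (Q x)) = \<infinity>"
proof -
  interpret prob_space M by fact
  have Qfin: "Q x \<noteq> \<infinity>" if "x \<in> space M" for x using Q[OF that] by (auto simp: top_unique)
  have m: "(\<lambda>x. e2ennreal (enn2ereal (P x) - enn2ereal (Q x))) \<in> borel_measurable M" using P(1) Qm by measurable
  have "\<infinity> = (\<integral>\<^sup>+x. P x \<partial>M)" using P by simp
  also have "\<dots> \<le> (\<integral>\<^sup>+x. e2ennreal (enn2ereal (P x) - enn2ereal (Q x)) + ennreal q \<partial>M)"
  proof (rule nn_integral_mono)
    fix x assume x: "x \<in> space M"
    obtain b where b: "Q x = ennreal b" "0 \<le> b" using Qfin[OF x] by (cases "Q x") auto
    have "P x \<le> e2ennreal (enn2ereal (P x) - enn2ereal (Q x)) + Q x"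
    proof (cases "P x")
      case (real a)
      have "ennreal a \<le> ennreal (a - b) + ennreal b"
      proof (cases "b \<le> a")
        case True then show ?thesis using b by (subst ennreal_plus[symmetric]) auto
      next
        case False then show ?thesis by (intro order_trans[OF ennreal_leI[of a b]]) auto
      qed
      then show ?thesis using real b by (simp add: e2ennreal_ereal)
    next
      case top
      then show ?thesis using b by simp
    qed
    also have "\<dots> \<le> e2ennreal (enn2ereal (P x) - enn2ereal (Q x)) + ennreal q" using Q[OF x] by (rule add_left_mono)
    finally show "P x \<le> e2ennreal (enn2ereal (P x) - enn2ereal (Q x)) + ennreal q" .
  qed
  also have "\<dots> = (\<integral>\<^sup>+x. e2ennreal (enn2ereal (P x) - enn2ereal (Q x)) \<partial>M) + ennreal q"
    by (subst nn_integral_add) (use m in \<open>auto simp: emeasure_space_1\<close>)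
  finally have inf: "(\<integral>\<^sup>+x. e2ennreal (enn2ereal (P x) - enn2ereal (Q x)) \<partial>M) = \<infinity>" by (simp add: top_unique)
  have "(\<integral>\<^sup>+x. e2ennreal (- (enn2ereal (P x) - enn2ereal (Q x))) \<partial>M) \<le> (\<integral>\<^sup>+x. ennreal q \<partial>M)"
  proof (rule nn_integral_mono)
    fix x assume x: "x \<in> space M"
    obtain b where b: "Q x = ennreal b" "0 \<le> b" using Qfin[OF x] by (cases "Q x") auto
    have "e2ennreal (- (enn2ereal (P x) - enn2ereal (Q x))) \<le> Q x"
    proof (cases "P x")
      case (real a)
      then show ?thesis using b by (simp add: e2ennreal_ereal ennreal_leI)
    next
      case top
      then show ?thesis using b by (simp add: e2ennreal_neg)
    qed
    also have "\<dots> \<le> ennreal q" by (rule Q[OF x])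
    finally show "e2ennreal (- (enn2ereal (P x) - enn2ereal (Q x))) \<le> ennreal q" .
  qed
  also have "\<dots> = ennreal q" by (simp add: emeasure_space_1)
  finally have "(\<integral>\<^sup>+x. e2ennreal (- (enn2ereal (P x) - enn2ereal (Q x))) \<partial>M) < \<infinity>" by (rule le_less_trans) simp
  then obtain b where "(\<integral>\<^sup>+x. e2ennreal (- (enn2ereal (P x) - enn2ereal (Q x))) \<partial>M) = ennreal b" "0 \<le> b"
    by (cases "\<integral>\<^sup>+x. e2ennreal (- (enn2ereal (P x) - enn2ereal (Q x))) \<partial>M") auto
  then show ?thesis unfolding ereal_integral_def inf by simp
qed

locale controlled_HJB = smooth_along_input M F W S \<sigma> Z f v lam C_f D G C_G \<beta> a_G dv B
  for M :: "'w measure" and F :: "real \<Rightarrow> 'w measure"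
    and W :: "'x::{real_inner, banach, second_countable_topology} \<Rightarrow> real \<Rightarrow> 'w \<Rightarrow> real"
    and S :: "real \<Rightarrow> 'h::{real_inner, banach, second_countable_topology} \<Rightarrow>\<^sub>L 'h"
    and \<sigma> Z f v lam C_f
    and D :: "'k::{real_inner, banach, second_countable_topology} set" and G C_G \<beta> a_G dv B +
  fixes \<Lambda> :: "'u::banach set" and L :: "'u \<Rightarrow> 'k" and l :: "'h \<Rightarrow> 'u \<Rightarrow> real" and C_L p c :: real
  assumes L: "L \<in> borel_measurable (restrict_space borel \<Lambda>)"
    and C_L: "C_L > 0" "\<And>u. u \<in> \<Lambda> \<Longrightarrow> norm (L u) \<le> C_L * (1 + norm u)"
    and p: "p \<ge> 1"
    and l: "(\<lambda>(x, u). l x u) \<in> borel_measurable (borel \<Otimes>\<^sub>M restrict_space borel \<Lambda>)"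
    and c: "c \<ge> 0" "\<And>x u. u \<in> \<Lambda> \<Longrightarrow> - c \<le> l x u"
    and f_le: "\<And>x u. u \<in> \<Lambda> \<Longrightarrow> f x \<le> L u \<bullet> dv x + l x u"
begin

context
  fixes u :: "real \<Rightarrow> 'w \<Rightarrow> 'u" and x :: 'h
  assumes u: "u \<in> controls M F \<Lambda> p"
begin

lemma u_in: "0 \<le> s \<Longrightarrow> \<omega> \<in> space M \<Longrightarrow> u s \<omega> \<in> \<Lambda>"
  using u by (simp add: controls_def)

lemma u_clamped_F:
  assumes \<tau>: "0 \<le> \<tau>"
  shows "(\<lambda>(\<omega>, s). u (max 0 (min \<tau> s)) \<omega>) \<in> measurable (F \<tau> \<Otimes>\<^sub>M borel) (restrict_space borel \<Lambda>)"
proof (rule measurable_restrict_space2)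
  show "(\<lambda>(\<omega>, s). u (max 0 (min \<tau> s)) \<omega>) \<in> space (F \<tau> \<Otimes>\<^sub>M (borel :: real measure)) \<rightarrow> \<Lambda>"
    using u_in space_F[OF \<tau>] by (auto simp: space_pair_measure)
  have pm: "(\<lambda>(\<omega>, s). u s \<omega>) \<in> borel_measurable (F \<tau> \<Otimes>\<^sub>M restrict_space borel {0..\<tau>})"
    using u \<tau> by (simp add: controls_def progressively_measurable_def)
  have cl: "(\<lambda>s. max 0 (min \<tau> s)) \<in> measurable borel (restrict_space borel {0..\<tau>})"
    using \<tau> by (intro measurable_restrict_space2) auto
  have "(\<lambda>p. (fst p, max 0 (min \<tau> (snd p)))) \<in> measurable (F \<tau> \<Otimes>\<^sub>M borel) (F \<tau> \<Otimes>\<^sub>M restrict_space borel {0..\<tau>})"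
    by (intro measurable_Pair measurable_fst measurable_compose[OF measurable_snd cl])
  from measurable_compose[OF this pm] show "(\<lambda>(\<omega>, s). u (max 0 (min \<tau> s)) \<omega>) \<in> borel_measurable (F \<tau> \<Otimes>\<^sub>M borel)"
    by (simp add: split_beta')
qed

lemma u_clamped_M:
  assumes \<tau>: "0 \<le> \<tau>"
  shows "(\<lambda>q. u (max 0 (min \<tau> (snd q))) (fst q)) \<in> measurable (M \<Otimes>\<^sub>M lborel) (restrict_space borel \<Lambda>)"
proof -
  have id: "(\<lambda>\<omega>. \<omega>) \<in> measurable M (F \<tau>)"
    using F_sub[OF \<tau>] by (intro measurableI) (auto simp: subalgebra_def)
  have "(\<lambda>q. (fst q, snd q)) \<in> measurable (M \<Otimes>\<^sub>M lborel) (F \<tau> \<Otimes>\<^sub>M (borel :: real measure))"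
    by (intro measurable_Pair measurable_compose[OF measurable_fst id]) measurable
  from measurable_compose[OF this u_clamped_F[OF \<tau>]] show ?thesis by simp
qed

lemma u_joint: "(\<lambda>q. u (max 0 (snd q)) (fst q)) \<in> measurable (M \<Otimes>\<^sub>M lborel) (restrict_space borel \<Lambda>)"
proof -
  have "(\<lambda>q. (\<lambda>n q. u (max 0 (min (real n) (snd q))) (fst q)) (nat \<lceil>snd q\<rceil>) q) \<in> measurable (M \<Otimes>\<^sub>M lborel) (restrict_space borel \<Lambda>)"
    by (rule measurable_compose_countable) (use u_clamped_M in \<open>auto\<close>)
  moreover have "max 0 (min (real (nat \<lceil>s\<rceil>)) s) = max 0 s" for s :: real
  proof (cases "0 \<le> s")
    case True
    then have "s \<le> real (nat \<lceil>s\<rceil>)" by linarith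
    then show ?thesis by (simp add: min_absorb2)
  qed simp
  ultimately show ?thesis by simp
qed

text \<open>Time is clamped at \<open>0\<close>, since controls are constrained on \<open>[0, \<infinity>)\<close> only; \<open>kT\<close> below is cut off at \<open>T\<close> to be integrable.\<close>
definition k :: "real \<Rightarrow> 'w \<Rightarrow> 'k" where "k s \<omega> = L (u (max 0 s) \<omega>)"

lemma k_joint: "(\<lambda>q. k (snd q) (fst q)) \<in> borel_measurable (M \<Otimes>\<^sub>M lborel)"
  using measurable_compose[OF u_joint L] by (simp add: k_def)

definition kT :: "real \<Rightarrow> 'w \<Rightarrow> real \<Rightarrow> 'k" where "kT T \<omega> s = indicator {0..T} s *\<^sub>R k s \<omega>"

lemma kT_meas: "(\<lambda>q. kT T (fst q) (snd q)) \<in> borel_measurable (M \<Otimes>\<^sub>M lborel)"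
  unfolding kT_def using k_joint by measurable

text \<open>As \<open>p \<ge> 1\<close> and \<open>L\<close> has linear growth, \<open>norm (L u)\<close> is at most \<open>C_L * (2 + norm u powr p)\<close>.\<close>
lemma kT_int:
  assumes T: "T > 0" shows "integrable (M \<Otimes>\<^sub>M lborel) (\<lambda>(\<omega>, s). kT T \<omega> s)"
proof (rule integrableI_bounded)
  show "(\<lambda>(\<omega>, s). kT T \<omega> s) \<in> borel_measurable (M \<Otimes>\<^sub>M lborel)" using kT_meas by (simp add: split_beta')
  have um: "(\<lambda>q. u (max 0 (snd q)) (fst q)) \<in> borel_measurable (M \<Otimes>\<^sub>M lborel)"
    using u_joint by (simp add: measurable_restrict_space2_iff)
  have nm[measurable]: "(\<lambda>q. norm (u (max 0 (snd q)) (fst q))) \<in> borel_measurable (M \<Otimes>\<^sub>M lborel)"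
    by (rule measurable_compose[OF um]) (intro borel_measurable_continuous_onI continuous_intros)
  have "(\<integral>\<^sup>+q. ennreal (norm (case q of (\<omega>, s) \<Rightarrow> kT T \<omega> s)) \<partial>(M \<Otimes>\<^sub>M lborel))
     \<le> (\<integral>\<^sup>+q. ennreal (2 * C_L) * ennreal (indicator {0..T} (snd q)) + ennreal C_L * (ennreal (norm (u (max 0 (snd q)) (fst q)) powr p) * ennreal (indicator {0..T} (snd q))) \<partial>(M \<Otimes>\<^sub>M lborel))"
  proof (rule nn_integral_mono)
    fix q :: "'w \<times> real" assume "q \<in> space (M \<Otimes>\<^sub>M lborel)"
    then obtain \<omega> s where q: "q = (\<omega>, s)" "\<omega> \<in> space M" by (auto simp: space_pair_measure)
    show "ennreal (norm (case q of (\<omega>, s) \<Rightarrow> kT T \<omega> s)) \<le> ennreal (2 * C_L) * ennreal (indicator {0..T} (snd q)) + ennreal C_L * (ennreal (norm (u (max 0 (snd q)) (fst q)) powr p) * ennreal (indicator {0..T} (snd q)))"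
    proof (cases "s \<in> {0..T}")
      case True
      let ?a = "norm (u (max 0 s) \<omega>)"
      have "?a \<le> 1 + ?a powr p"
      proof (cases "?a \<le> 1")
        case False
        then have "?a powr 1 \<le> ?a powr p" using p by (intro powr_mono) auto
        then show ?thesis using False by simp
      qed (simp add: add_increasing2)
      then have "C_L * (1 + ?a) \<le> C_L * (2 + ?a powr p)" using C_L(1) by (intro mult_left_mono) auto
      then have "norm (kT T \<omega> s) \<le> 2 * C_L + C_L * ?a powr p"
        using C_L(2)[OF u_in[of "max 0 s" \<omega>]] True q by (simp add: kT_def k_def algebra_simps)
      then have "ennreal (norm (kT T \<omega> s)) \<le> ennreal (2 * C_L + C_L * ?a powr p)" by (rule ennreal_leI)
      also have "\<dots> = ennreal (2 * C_L) + ennreal C_L * ennreal (?a powr p)"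
        using C_L(1) by (simp add: ennreal_plus ennreal_mult)
      finally show ?thesis using True q by simp
    next
      case False then show ?thesis using q by (simp add: kT_def)
    qed
  qed
  also have "\<dots> = ennreal (2 * C_L) * (\<integral>\<^sup>+q. ennreal (indicator {0..T} (snd q)) \<partial>(M \<Otimes>\<^sub>M lborel))
      + ennreal C_L * (\<integral>\<^sup>+q. ennreal (norm (u (max 0 (snd q)) (fst q)) powr p) * ennreal (indicator {0..T} (snd q)) \<partial>(M \<Otimes>\<^sub>M lborel))"
    by (subst nn_integral_add) (auto simp: nn_integral_cmult)
  also have "\<dots> < \<infinity>"
  proof -
    have "(\<integral>\<^sup>+q. ennreal (indicator {0..T} (snd q)) \<partial>(M \<Otimes>\<^sub>M lborel)) = (\<integral>\<^sup>+\<omega>. (\<integral>\<^sup>+s. ennreal (indicator {0..T} s) \<partial>lborel) \<partial>M)"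
      by (subst lborel.nn_integral_fst[symmetric]) auto
    also have "\<dots> = ennreal T" using T by (simp add: ennreal_indicator emeasure_space_1)
    finally have 1: "(\<integral>\<^sup>+q. ennreal (indicator {0..T} (snd q)) \<partial>(M \<Otimes>\<^sub>M lborel)) < \<infinity>" by simp
    have "(\<integral>\<^sup>+q. ennreal (norm (u (max 0 (snd q)) (fst q)) powr p) * ennreal (indicator {0..T} (snd q)) \<partial>(M \<Otimes>\<^sub>M lborel))
       = (\<integral>\<^sup>+s. (\<integral>\<^sup>+\<omega>. ennreal (norm (u (max 0 s) \<omega>) powr p) * ennreal (indicator {0..T} s) \<partial>M) \<partial>lborel)"
      by (subst time.nn_integral_snd[symmetric]) auto
    also have "\<dots> = (\<integral>\<^sup>+s\<in>{0..T}. (\<integral>\<^sup>+\<omega>. ennreal (norm (u s \<omega>) powr p) \<partial>M) \<partial>lborel)"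
    proof (rule nn_integral_cong)
      fix s :: real
      show "(\<integral>\<^sup>+\<omega>. ennreal (norm (u (max 0 s) \<omega>) powr p) * ennreal (indicator {0..T} s) \<partial>M) = (\<integral>\<^sup>+\<omega>. ennreal (norm (u s \<omega>) powr p) \<partial>M) * indicator {0..T} s"
        by (cases "s \<in> {0..T}") simp_all
    qed
    also have "\<dots> < \<infinity>" using u T by (simp add: controls_def)
    finally have 2: "(\<integral>\<^sup>+q. ennreal (norm (u (max 0 (snd q)) (fst q)) powr p) * ennreal (indicator {0..T} (snd q)) \<partial>(M \<Otimes>\<^sub>M lborel)) < \<infinity>" .
    show ?thesis using 1 2 by (simp add: ennreal_mult_less_top)
  qed
  finally show "(\<integral>\<^sup>+q. ennreal (norm (case q of (\<omega>, s) \<Rightarrow> kT T \<omega> s)) \<partial>(M \<Otimes>\<^sub>M lborel)) < \<infinity>" .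
qed

lemma kT_adapted:
  assumes b: "0 \<le> b" shows "(\<lambda>\<omega>. LINT s:{a..<b}|lborel. kT T \<omega> s) \<in> borel_measurable (F b)"
proof -
  have "(\<lambda>(\<omega>, s). L (u (max 0 (min b s)) \<omega>)) \<in> borel_measurable (F b \<Otimes>\<^sub>M borel)"
    using measurable_compose[OF u_clamped_F[OF b] L] by (simp add: split_beta')
  then have [measurable]: "(\<lambda>q. L (u (max 0 (min b (snd q))) (fst q))) \<in> borel_measurable (F b \<Otimes>\<^sub>M lborel)"
    by (simp add: split_beta' cong: measurable_cong_sets)
  have "(\<lambda>(\<omega>, s). (if a \<le> s \<and> s < b then 1 else 0 :: real) *\<^sub>R indicator {0..T} s *\<^sub>R L (u (max 0 (min b s)) \<omega>)) \<in> borel_measurable (F b \<Otimes>\<^sub>M lborel)"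
    unfolding split_beta' by measurable
  from lborel.borel_measurable_lebesgue_integral[OF this]
  have "(\<lambda>\<omega>. LINT s|lborel. (if a \<le> s \<and> s < b then 1 else 0 :: real) *\<^sub>R indicator {0..T} s *\<^sub>R L (u (max 0 (min b s)) \<omega>)) \<in> borel_measurable (F b)" by simp
  also have "(\<lambda>\<omega>. LINT s|lborel. (if a \<le> s \<and> s < b then 1 else 0 :: real) *\<^sub>R indicator {0..T} s *\<^sub>R L (u (max 0 (min b s)) \<omega>)) = (\<lambda>\<omega>. LINT s:{a..<b}|lborel. kT T \<omega> s)"
    unfolding set_lebesgue_integral_def kT_def k_def
    by (intro ext Bochner_Integration.integral_cong refl) (auto simp: indicator_def)
  finally show ?thesis .
qed

abbreviation Xu where "Xu \<equiv> state S D G L Z x u"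

lemma Xu_response: "Xu t \<omega> = response x k t \<omega>"
  unfolding state_def response_def k_def
  by (intro arg_cong2[where f="(+)"] refl set_lebesgue_integral_cong) auto

lemma Xu_joint: "(\<lambda>q. Xu (max 0 (snd q)) (fst q)) \<in> borel_measurable (M \<Otimes>\<^sub>M lborel)"
  unfolding Xu_response by (rule response_joint) (use k_joint in \<open>simp add: split_beta'\<close>)

text \<open>The integrand that reproduces \<open>v x\<close>; \<open>running\<close> below is the one that defines the cost.\<close>
definition gain :: "'w \<times> real \<Rightarrow> real" where
  "gain q = exp (- lam * snd q) * (f (Xu (max 0 (snd q)) (fst q)) - k (snd q) (fst q) \<bullet> dv (Xu (max 0 (snd q)) (fst q)))"

definition running :: "'w \<times> real \<Rightarrow> real" where
  "running q = exp (- lam * snd q) * l (Xu (max 0 (snd q)) (fst q)) (u (max 0 (snd q)) (fst q))"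

lemma running_meas: "running \<in> borel_measurable (M \<Otimes>\<^sub>M lborel)"
proof -
  have [measurable]: "(\<lambda>q. l (Xu (max 0 (snd q)) (fst q)) (u (max 0 (snd q)) (fst q))) \<in> borel_measurable (M \<Otimes>\<^sub>M lborel)"
    using measurable_compose[OF measurable_Pair[OF Xu_joint u_joint] l] by simp
  show ?thesis unfolding running_def[abs_def] by measurable
qed

lemma gain_le_running: "fst q \<in> space M \<Longrightarrow> gain q \<le> running q"
  using f_le[OF u_in[of "max 0 (snd q)" "fst q"], of "Xu (max 0 (snd q)) (fst q)"]
  unfolding gain_def running_def k_def by (intro mult_left_mono) auto

lemma running_lower: "fst q \<in> space M \<Longrightarrow> - (c * exp (- lam * snd q)) \<le> running q"
proof -
  assume "fst q \<in> space M"
  then have "- c \<le> l (Xu (max 0 (snd q)) (fst q)) (u (max 0 (snd q)) (fst q))" by (intro c u_in) auto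
  then have "exp (- lam * snd q) * (- c) \<le> running q" unfolding running_def by (intro mult_left_mono) auto
  then show ?thesis by (simp add: mult.commute)
qed

lemma H_gain:
  assumes "s \<in> {0..<T}"
  shows "H (\<lambda>s \<omega>. kT T \<omega> s) (response x (\<lambda>s \<omega>. kT T \<omega> s)) (\<omega>, s) = - gain (\<omega>, s)"
proof -
  have "response x (\<lambda>s \<omega>. kT T \<omega> s) s \<omega> = Xu s \<omega>"
    unfolding Xu_response response_def
    by (intro arg_cong2[where f="(+)"] refl set_lebesgue_integral_cong) (use assms in \<open>auto simp: kT_def\<close>)
  moreover have "kT T \<omega> s = k s \<omega>" using assms by (simp add: kT_def)
  ultimately show ?thesis using assms by (simp add: H_def gain_def inner_commute algebra_simps)
qed

lemma gain_int:
  assumes T: "T > 0" shows "integrable (M \<Otimes>\<^sub>M lborel) (\<lambda>q. indicator {0..<T} (snd q) * gain q)"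
proof -
  have "integrable (M \<Otimes>\<^sub>M lborel) (\<lambda>q. indicator {0..<T} (snd q) * H (\<lambda>s \<omega>. kT T \<omega> s) (response x (\<lambda>s \<omega>. kT T \<omega> s)) q)"
  proof (rule H_int)
    show "integrable (M \<Otimes>\<^sub>M lborel) (\<lambda>p. kT T (fst p) (snd p))" using kT_int[OF T] by (simp add: split_beta')
    show "(\<lambda>p. response x (\<lambda>s \<omega>. kT T \<omega> s) (max 0 (snd p)) (fst p)) \<in> borel_measurable (M \<Otimes>\<^sub>M lborel)"
      by (rule response_joint[OF borel_measurable_integrable[OF kT_int[OF T]]])
  qed (use T in auto)
  then have "integrable (M \<Otimes>\<^sub>M lborel) (\<lambda>q. - (indicator {0..<T} (snd q) * H (\<lambda>s \<omega>. kT T \<omega> s) (response x (\<lambda>s \<omega>. kT T \<omega> s)) q))" by simp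
  also have "(\<lambda>q. - (indicator {0..<T} (snd q) * H (\<lambda>s \<omega>. kT T \<omega> s) (response x (\<lambda>s \<omega>. kT T \<omega> s)) q)) = (\<lambda>q. indicator {0..<T} (snd q) * gain q)"
  proof
    fix q :: "'w \<times> real"
    show "- (indicator {0..<T} (snd q) * H (\<lambda>s \<omega>. kT T \<omega> s) (response x (\<lambda>s \<omega>. kT T \<omega> s)) q) = indicator {0..<T} (snd q) * gain q"
      using H_gain[of "snd q" T "fst q"] by (cases "snd q \<in> {0..<T}") auto
  qed
  finally show ?thesis .
qed

lemma value_gain_estimate:
  assumes T: "T > 0"
  shows "\<bar>v x - (LINT q|(M \<Otimes>\<^sub>M lborel). indicator {0..<T} (snd q) * gain q)\<bar> \<le> exp (- lam * T) * (C_f / lam)"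
proof -
  have e: "indicator {0..<T} (snd q) * H (\<lambda>s \<omega>. kT T \<omega> s) (response x (\<lambda>s \<omega>. kT T \<omega> s)) q = - (indicator {0..<T} (snd q) * gain q)" for q :: "'w \<times> real"
    using H_gain[of "snd q" T "fst q"] by (cases "snd q \<in> {0..<T}") auto
  show ?thesis using dynkin_estimate[OF kT_int[OF T] kT_adapted T, of x] unfolding e by simp
qed

abbreviation Ju where "Ju \<equiv> J M S D G L Z lam l x u"

text \<open>The iterated integral defining the cost agrees with the integral over the product space, because the negative part is bounded by \<open>c\<close> times the discount.\<close>
lemma J_cases:
  defines "R \<equiv> \<lambda>q. indicator {0..} (snd q) * running q"
  shows "(\<integral>\<^sup>+q. ennreal (R q) \<partial>(M \<Otimes>\<^sub>M lborel)) = \<infinity> \<Longrightarrow> Ju = \<infinity>"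
    and "(\<integral>\<^sup>+q. ennreal (R q) \<partial>(M \<Otimes>\<^sub>M lborel)) < \<infinity> \<Longrightarrow> integrable (M \<Otimes>\<^sub>M lborel) R \<and> Ju = ereal (LINT q|(M \<Otimes>\<^sub>M lborel). R q)"
proof -
  let ?N = "M \<Otimes>\<^sub>M (lborel :: real measure)"
  have Rm[measurable]: "R \<in> borel_measurable ?N" unfolding R_def using running_meas by measurable
  define P where "P \<omega> = (\<integral>\<^sup>+s. ennreal (R (\<omega>, s)) \<partial>lborel)" for \<omega>
  define Q where "Q \<omega> = (\<integral>\<^sup>+s. ennreal (- R (\<omega>, s)) \<partial>lborel)" for \<omega>
  have Pm: "P \<in> borel_measurable M" and Qm: "Q \<in> borel_measurable M"
    unfolding P_def[abs_def] Q_def[abs_def] by (rule lborel.borel_measurable_nn_integral_fst; measurable)+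
  have inner: "ereal_integral (restrict_space lborel {0..}) (\<lambda>s. ereal (exp (- lam * s) * l (Xu s \<omega>) (u s \<omega>))) = enn2ereal (P \<omega>) - enn2ereal (Q \<omega>)" for \<omega>
  proof -
    have 1: "(\<integral>\<^sup>+s. e2ennreal (ereal (exp (- lam * s) * l (Xu s \<omega>) (u s \<omega>))) \<partial>restrict_space lborel {0..}) = P \<omega>"
      unfolding P_def by (subst nn_integral_restrict_space) (auto intro!: nn_integral_cong simp: R_def running_def e2ennreal_ereal indicator_def)
    have 2: "(\<integral>\<^sup>+s. e2ennreal (- ereal (exp (- lam * s) * l (Xu s \<omega>) (u s \<omega>))) \<partial>restrict_space lborel {0..}) = Q \<omega>"
      unfolding Q_def by (subst nn_integral_restrict_space) (auto intro!: nn_integral_cong simp: R_def running_def e2ennreal_ereal indicator_def)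
    show ?thesis unfolding ereal_integral_def 1 2 ..
  qed
  then have J: "Ju = ereal_integral M (\<lambda>\<omega>. enn2ereal (P \<omega>) - enn2ereal (Q \<omega>))"
    unfolding J_def cost_def by simp
  have Rlow: "- R (\<omega>, s) \<le> c * disc s" if "\<omega> \<in> space M" for \<omega> s
    using running_lower[of "(\<omega>, s)"] that by (auto simp: R_def indicator_def)
  have Qb: "Q \<omega> \<le> ennreal (c / lam)" if \<omega>: "\<omega> \<in> space M" for \<omega>
  proof -
    have "Q \<omega> \<le> (\<integral>\<^sup>+s. ennreal (c * disc s) \<partial>lborel)"
      unfolding Q_def by (intro nn_integral_mono ennreal_leI Rlow \<omega>)
    also have "\<dots> = ennreal (LINT s|lborel. c * disc s)"
      using c(1) by (intro nn_integral_eq_integral integrable_mult_right exp_decay_integral lam) auto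
    also have "\<dots> = ennreal (c / lam)" using exp_decay_integral(2)[OF lam] by simp
    finally show ?thesis .
  qed
  have PN: "(\<integral>\<^sup>+q. ennreal (R q) \<partial>?N) = (\<integral>\<^sup>+\<omega>. P \<omega> \<partial>M)"
    unfolding P_def by (rule lborel.nn_integral_fst[symmetric]) measurable
  have QN: "(\<integral>\<^sup>+q. ennreal (- R q) \<partial>?N) = (\<integral>\<^sup>+\<omega>. Q \<omega> \<partial>M)"
    unfolding Q_def by (rule lborel.nn_integral_fst[symmetric]) measurable
  show "Ju = \<infinity>" if "(\<integral>\<^sup>+q. ennreal (R q) \<partial>?N) = \<infinity>"
    unfolding J by (rule ereal_integral_infinite[OF prob_space_axioms Pm _ Qb Qm]) (use that PN in auto)
  show "integrable ?N R \<and> Ju = ereal (LINT q|?N. R q)" if fin: "(\<integral>\<^sup>+q. ennreal (R q) \<partial>?N) < \<infinity>"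
  proof
    have "(\<integral>\<^sup>+\<omega>. Q \<omega> \<partial>M) \<le> (\<integral>\<^sup>+\<omega>. ennreal (c / lam) \<partial>M)" by (intro nn_integral_mono Qb)
    also have "\<dots> < \<infinity>" by (simp add: emeasure_space_1)
    finally have finQ: "(\<integral>\<^sup>+q. ennreal (- R q) \<partial>?N) < \<infinity>" unfolding QN .
    show int: "integrable ?N R"
      using fin finQ by (simp add: real_integrable_def less_top)
    define g where "g \<omega> = (LINT s|lborel. R (\<omega>, s))" for \<omega>
    have gi: "integrable M g" unfolding g_def[abs_def] by (rule time.integrable_fst'[OF int])
    have ae: "AE \<omega> in M. enn2ereal (P \<omega>) - enn2ereal (Q \<omega>) = ereal (g \<omega>)"
      using time.AE_integrable_fst'[OF int]
    proof eventually_elim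
      case (elim \<omega>)
      have "P \<omega> \<noteq> \<infinity>" "Q \<omega> \<noteq> \<infinity>" using elim unfolding real_integrable_def P_def Q_def by auto
      then obtain a b where ab: "P \<omega> = ennreal a" "0 \<le> a" "Q \<omega> = ennreal b" "0 \<le> b" by (cases "P \<omega>"; cases "Q \<omega>") auto
      have "g \<omega> = a - b" unfolding g_def using real_lebesgue_integral_def[OF elim] ab unfolding P_def Q_def by simp
      then show ?case using ab by simp
    qed
    have "Ju = ereal (LINT \<omega>|M. g \<omega>)" unfolding J by (rule ereal_integral_real[OF gi ae])
    also have "(LINT \<omega>|M. g \<omega>) = (LINT q|?N. R q)" unfolding g_def by (rule time.integral_fst'[OF int])
    finally show "Ju = ereal (LINT q|?N. R q)" .
  qed
qed

lemma truncated_limit: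
  assumes "integrable (M \<Otimes>\<^sub>M lborel) (\<lambda>q. indicator {0..} (snd q) * running q)"
  shows "(\<lambda>n. LINT q|(M \<Otimes>\<^sub>M lborel). indicator {0..<real (Suc n)} (snd q) * running q) \<longlonglongrightarrow> (LINT q|(M \<Otimes>\<^sub>M lborel). indicator {0..} (snd q) * running q)"
proof (rule integral_dominated_convergence[where w="\<lambda>q. norm (indicator {0..} (snd q) * running q)"])
  note running_meas[measurable]
  show "(\<lambda>q. indicator {0..} (snd q) * running q) \<in> borel_measurable (M \<Otimes>\<^sub>M lborel)" by measurable
  show "(\<lambda>q. indicator {0..<real (Suc n)} (snd q) * running q) \<in> borel_measurable (M \<Otimes>\<^sub>M lborel)" for n by measurable
  show "integrable (M \<Otimes>\<^sub>M lborel) (\<lambda>q. norm (indicator {0..} (snd q) * running q))" using assms by (rule integrable_norm)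
  show "AE q in M \<Otimes>\<^sub>M lborel. norm (indicator {0..<real (Suc n)} (snd q) * running q) \<le> norm (indicator {0..} (snd q) * running q)" for n
    by (intro AE_I2) (auto simp: indicator_def)
  show "AE q in M \<Otimes>\<^sub>M lborel. (\<lambda>n. indicator {0..<real (Suc n)} (snd q) * running q) \<longlonglongrightarrow> indicator {0..} (snd q) * running q"
  proof (intro AE_I2 tendsto_eventually)
    fix q :: "'w \<times> real"
    obtain N :: nat where N: "snd q < real N" using reals_Archimedean2 by blast
    have "indicator {0..<real (Suc n)} (snd q) * running q = indicator {0..} (snd q) * running q" if "n \<ge> N" for n
      using N that by (auto simp: indicator_def)
    then show "eventually (\<lambda>n. indicator {0..<real (Suc n)} (snd q) * running q = indicator {0..} (snd q) * running q) sequentially"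
      unfolding eventually_sequentially by blast
  qed
qed

lemma error_tendsto_0: "(\<lambda>n. exp (- lam * real (Suc n)) * (C_f / lam)) \<longlonglongrightarrow> 0"
proof (rule tendsto_mult_left_zero)
  have "(\<lambda>n. (exp (- lam)) ^ Suc n) \<longlonglongrightarrow> 0"
    by (intro LIMSEQ_Suc LIMSEQ_power_zero) (use lam in simp)
  then show "(\<lambda>n. exp (- lam * real (Suc n))) \<longlonglongrightarrow> 0"
    by (simp only: exp_of_nat_mult[symmetric] mult.commute)
qed

theorem value_le_cost: "ereal (v x) \<le> Ju"
proof (cases "(\<integral>\<^sup>+q. ennreal (indicator {0..} (snd q) * running q) \<partial>(M \<Otimes>\<^sub>M lborel)) = \<infinity>")
  case True
  then show ?thesis using J_cases(1) by simp
next
  case False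
  let ?N = "M \<Otimes>\<^sub>M (lborel :: real measure)"
  from False have fin: "(\<integral>\<^sup>+q. ennreal (indicator {0..} (snd q) * running q) \<partial>?N) < \<infinity>" by (simp add: less_top)
  have int: "integrable ?N (\<lambda>q. indicator {0..} (snd q) * running q)" and J: "Ju = ereal (LINT q|?N. indicator {0..} (snd q) * running q)"
    using J_cases(2)[OF fin] by auto
  have le: "v x \<le> (LINT q|?N. indicator {0..<real (Suc n)} (snd q) * running q) + exp (- lam * real (Suc n)) * (C_f / lam)" for n
  proof -
    have T: "real (Suc n) > 0" by simp
    have "(LINT q|?N. indicator {0..<real (Suc n)} (snd q) * gain q) \<le> (LINT q|?N. indicator {0..<real (Suc n)} (snd q) * running q)"
    proof (rule integral_mono[OF gain_int[OF T]])
      have "integrable ?N (\<lambda>q. indicator (space M \<times> {0..<real (Suc n)}) q *\<^sub>R (indicator {0..} (snd q) * running q))"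
        by (rule integrable_mult_indicator[OF _ int]) auto
      also have "integrable ?N (\<lambda>q. indicator (space M \<times> {0..<real (Suc n)}) q *\<^sub>R (indicator {0..} (snd q) * running q)) = integrable ?N (\<lambda>q. indicator {0..<real (Suc n)} (snd q) * running q)"
        by (rule Bochner_Integration.integrable_cong) (auto simp: indicator_def space_pair_measure)
      finally show "integrable ?N (\<lambda>q. indicator {0..<real (Suc n)} (snd q) * running q)" .
      fix q assume "q \<in> space ?N"
      then have "fst q \<in> space M" by (auto simp: space_pair_measure)
      then show "indicator {0..<real (Suc n)} (snd q) * gain q \<le> indicator {0..<real (Suc n)} (snd q) * running q"
        by (intro mult_left_mono gain_le_running) auto
    qed
    then show ?thesis using value_gain_estimate[OF T] by (simp only: abs_le_iff) linarith
  qed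
  have "(\<lambda>n. (LINT q|?N. indicator {0..<real (Suc n)} (snd q) * running q) + exp (- lam * real (Suc n)) * (C_f / lam)) \<longlonglongrightarrow> (LINT q|?N. indicator {0..} (snd q) * running q) + 0"
    by (intro tendsto_add truncated_limit[OF int] error_tendsto_0)
  from LIMSEQ_le_const[OF this] le have "v x \<le> (LINT q|?N. indicator {0..} (snd q) * running q)" by simp
  then show ?thesis unfolding J by simp
qed

text \<open>The integrals of \<open>running\<close> over \<open>[0, n)\<close> stay bounded because those of \<open>gain\<close> do; with the lower bound this makes \<open>running\<close> integrable, so that the cost is the limit of these integrals.\<close>
theorem value_eq_cost:
  assumes opt: "AE q in M \<Otimes>\<^sub>M lborel. 0 \<le> snd q \<longrightarrow> gain q = running q"
  shows "Ju = ereal (v x)"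
proof -
  let ?N = "M \<Otimes>\<^sub>M (lborel :: real measure)"
  note running_meas[measurable]
  define R where "R n q = indicator {0..<real (Suc n)} (snd q) * running q" for n and q :: "'w \<times> real"
  have Rm[measurable]: "R n \<in> borel_measurable ?N" for n unfolding R_def[abs_def] by measurable
  have eq: "AE q in ?N. R n q = indicator {0..<real (Suc n)} (snd q) * gain q" for n
    using opt by eventually_elim (auto simp: R_def indicator_def)
  have gi: "integrable ?N (\<lambda>q. indicator {0..<real (Suc n)} (snd q) * gain q)" for n by (rule gain_int) simp
  have Ri: "integrable ?N (R n)" for n
  proof (rule integrable_cong_AE_imp[OF gi Rm])
    show "AE q in ?N. indicator {0..<real (Suc n)} (snd q) * gain q = R n q" using eq[of n] by eventually_elim (rule sym)
  qed
  have Rv: "(LINT q|?N. R n q) = (LINT q|?N. indicator {0..<real (Suc n)} (snd q) * gain q)" for n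
    by (rule integral_cong_AE[OF _ _ eq]) (use gi in auto)
  have est: "\<bar>v x - (LINT q|?N. R n q)\<bar> \<le> exp (- lam * real (Suc n)) * (C_f / lam)" for n
    unfolding Rv by (rule value_gain_estimate) simp
  have Cf0: "0 \<le> C_f / lam" using C_f_nonneg lam by simp
  have Rb: "(LINT q|?N. R n q) \<le> v x + C_f / lam" for n
  proof -
    have "exp (- lam * real (Suc n)) * (C_f / lam) \<le> 1 * (C_f / lam)" using lam Cf0 by (intro mult_right_mono) auto
    with est[of n] show ?thesis by linarith
  qed
  have di: "integrable ?N (\<lambda>q. c * disc (snd q))"
  proof (rule integrable_pair_lborel_bound[where c="\<lambda>s. c * disc s"])
    show "integrable lborel (\<lambda>s. c * disc s)" by (rule integrable_mult_right[OF exp_decay_integral(1)[OF lam]])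
  qed (use c(1) in \<open>auto simp: abs_mult\<close>)
  have dv: "(LINT q|?N. c * disc (snd q)) = c / lam"
  proof -
    have "(LINT q|?N. c * disc (snd q)) = (LINT \<omega>|M. LINT s|lborel. c * disc s)"
      unfolding time.integral_fst'[OF di, symmetric] by (simp only: snd_conv)
    then show ?thesis unfolding integral_mult_right_zero exp_decay_integral(2)[OF lam] by (simp add: prob_space)
  qed
  have nonneg: "0 \<le> R n q + c * disc (snd q)" if "fst q \<in> space M" for n q
    using running_lower[OF that] c(1) by (auto simp: R_def indicator_def)
  have part: "(\<integral>\<^sup>+q. ennreal (R n q) \<partial>?N) \<le> ennreal (v x + C_f / lam + c / lam)" for n
  proof -
    have "(\<integral>\<^sup>+q. ennreal (R n q) \<partial>?N) \<le> (\<integral>\<^sup>+q. ennreal (R n q + c * disc (snd q)) \<partial>?N)"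
      using c(1) by (intro nn_integral_mono ennreal_leI) simp
    also have "\<dots> = ennreal (LINT q|?N. R n q + c * disc (snd q))"
    proof (rule nn_integral_eq_integral)
      show "integrable ?N (\<lambda>q. R n q + c * disc (snd q))" by (intro Bochner_Integration.integrable_add Ri di)
      show "AE q in ?N. 0 \<le> R n q + c * disc (snd q)" by (intro AE_I2 nonneg) (auto simp: space_pair_measure)
    qed
    also have "(LINT q|?N. R n q + c * disc (snd q)) = (LINT q|?N. R n q) + c / lam"
      unfolding Bochner_Integration.integral_add[OF Ri di] dv ..
    also have "ennreal \<dots> \<le> ennreal (v x + C_f / lam + c / lam)" using Rb[of n] by (intro ennreal_leI) simp
    finally show ?thesis .
  qed
  have "(\<integral>\<^sup>+q. ennreal (indicator {0..} (snd q) * running q) \<partial>?N) = (\<integral>\<^sup>+q. (SUP n. ennreal (R n q)) \<partial>?N)"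
  proof (rule nn_integral_cong)
    fix q :: "'w \<times> real"
    obtain N :: nat where N: "snd q < real N" using reals_Archimedean2 by blast
    have le: "ennreal (R n q) \<le> ennreal (indicator {0..} (snd q) * running q)" for n
      by (cases "running q \<ge> 0") (auto simp: R_def indicator_def ennreal_neg)
    have "R N q = indicator {0..} (snd q) * running q" using N by (auto simp: R_def indicator_def)
    then show "ennreal (indicator {0..} (snd q) * running q) = (SUP n. ennreal (R n q))"
      using le by (intro antisym SUP_least) (auto intro: SUP_upper2[of N])
  qed
  also have "\<dots> = (SUP n. \<integral>\<^sup>+q. ennreal (R n q) \<partial>?N)"
  proof (rule nn_integral_monotone_convergence_SUP)
    show "incseq (\<lambda>n q. ennreal (R n q))"
    proof (intro incseq_SucI le_funI)
      fix n and q :: "'w \<times> real"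
      show "ennreal (R n q) \<le> ennreal (R (Suc n) q)"
        by (cases "running q \<ge> 0") (auto simp: R_def indicator_def ennreal_neg)
    qed
  qed measurable
  also have "\<dots> \<le> ennreal (v x + C_f / lam + c / lam)" by (intro SUP_least part)
  finally have fin: "(\<integral>\<^sup>+q. ennreal (indicator {0..} (snd q) * running q) \<partial>?N) < \<infinity>" by (rule le_less_trans) simp
  have int: "integrable ?N (\<lambda>q. indicator {0..} (snd q) * running q)" and J: "Ju = ereal (LINT q|?N. indicator {0..} (snd q) * running q)"
    using J_cases(2)[OF fin] by auto
  have "(\<lambda>n. v x - (LINT q|?N. R n q)) \<longlonglongrightarrow> 0"
    by (rule Lim_null_comparison[OF _ error_tendsto_0]) (use est in \<open>auto intro!: always_eventually\<close>)
  moreover have "(\<lambda>n. v x - (LINT q|?N. R n q)) \<longlonglongrightarrow> v x - (LINT q|?N. indicator {0..} (snd q) * running q)"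
    unfolding R_def by (intro tendsto_diff tendsto_const truncated_limit[OF int])
  ultimately have "v x - (LINT q|?N. indicator {0..} (snd q) * running q) = 0" by (intro LIMSEQ_unique)
  then show ?thesis unfolding J by simp
qed

end
end

theorem theorem5p6:
  fixes M :: "'w measure" and F :: "real \<Rightarrow> 'w measure"
    and W :: "'x::{real_inner, banach, second_countable_topology} \<Rightarrow> real \<Rightarrow> 'w \<Rightarrow> real"
    and DA :: "'h::{real_inner, banach, second_countable_topology} set" and A :: "'h \<Rightarrow> 'h"
    and S :: "real \<Rightarrow> 'h \<Rightarrow>\<^sub>L 'h"
    and \<sigma> :: "'x \<Rightarrow>\<^sub>L 'h"
    and DG :: "'k::{real_inner, banach, second_countable_topology} set" and G :: "'k \<Rightarrow> 'h"
    and \<Lambda> :: "'u::banach set" and L :: "'u \<Rightarrow> 'k"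
    and Z :: "real \<Rightarrow> 'w \<Rightarrow> 'h"
    and l :: "'h \<Rightarrow> 'u \<Rightarrow> real" and v :: "'h \<Rightarrow> real"
    and \<gamma> C_G a_G \<beta> C_L p lam :: real
  assumes "filtered_prob_space_usual M F"
    and "cylindrical_brownian_motion M F W"
    and "\<Lambda> \<in> sets borel"
    and "closed_densely_defined DA A" and "generates DA A S"
    and "\<forall>s>0. trace_class (cov S \<sigma> s)"
    and "0 < \<gamma>" and "\<gamma> < 1 / 2"
    and "\<forall>t\<ge>0. (\<integral>\<^sup>+s\<in>{0<..t}. ennreal (s powr (- 2 * \<gamma>) * op_trace (cov S \<sigma> s)) \<partial>lborel) < \<infinity>"
    and "closed_densely_defined DG G"
    and "\<forall>s>0. \<exists>T. SG_extends S DG G s T"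
    and "C_G > 0" and "0 \<le> \<beta>" and "\<beta> < 1"
    and "\<forall>s>0. norm (SG_ext S DG G s) \<le> C_G * max (s powr (- \<beta>)) 1 * exp (a_G * s)"
    and "L \<in> borel_measurable (restrict_space borel \<Lambda>)"
    and "C_L > 0" and "\<forall>u\<in>\<Lambda>. norm (L u) \<le> C_L * (1 + norm u)"
    and "p > 1 / (1 - \<beta>)"
    and "stochastic_convolution M W S \<sigma> Z"
    and "(\<lambda>(x, u). l x u) \<in> borel_measurable (borel \<Otimes>\<^sub>M restrict_space borel \<Lambda>)"
    and "\<exists>c. \<forall>x. \<forall>u\<in>\<Lambda>. c \<le> l x u"
    and "lam > 0"
    and "mild_solution M \<Lambda> S DG G L Z lam l v"
    and "v \<in> S_AG S DG G"
  shows "(\<forall>x. ereal (v x) \<le> V M F \<Lambda> p S DG G L Z lam l x) \<and>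
    (\<forall>x. \<forall>u'\<in>controls M F \<Lambda> p.
       (AE (\<omega>, t) in M \<Otimes>\<^sub>M lborel. 0 \<le> t \<longrightarrow>
          F0 \<Lambda> L l (state S DG G L Z x u' t \<omega>) (G_deriv DG G v (state S DG G L Z x u' t \<omega>)) =
          ereal (F0_CV L l (state S DG G L Z x u' t \<omega>)
                   (G_deriv DG G v (state S DG G L Z x u' t \<omega>)) (u' t \<omega>))) \<longrightarrow>
       ereal (v x) = V M F \<Lambda> p S DG G L Z lam l x \<and>
       V M F \<Lambda> p S DG G L Z lam l x = J M S DG G L Z lam l x u')"
proof -
  have v_mild: "mild_solution M \<Lambda> S DG G L Z lam l v" and v_S: "v \<in> S_AG S DG G" by fact+
  from v_mild obtain f where f: "f \<in> bcontfun" "\<And>x. F0 \<Lambda> L l x (G_deriv DG G v x) = ereal (f x)"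
    and fv: "\<And>x. v x = (LINT s:{0..}|lborel. exp (- lam * s) * P0 M S Z s f x)"
    unfolding mild_solution_def by blast
  have f_cont: "continuous_on UNIV f" using f(1) by (simp add: bcontfun_def)
  from f(1) have "bounded (range f)" by (simp add: bcontfun_def)
  then obtain C_f where C_f: "\<And>x. \<bar>f x\<bar> \<le> C_f" unfolding bounded_iff by auto
  from v_S have dv: "bounded (range (G_deriv DG G v))" "continuous_on UNIV (G_deriv DG G v)"
    by (auto simp: S_AG_def C1_G_b_def)
  from dv(1) obtain B where B: "\<And>x. norm (G_deriv DG G v x) \<le> B" unfolding bounded_iff by auto
  have "\<exists>c. \<forall>x. \<forall>u\<in>\<Lambda>. c \<le> l x u" by fact
  then obtain c0 where c0: "\<And>x u. u \<in> \<Lambda> \<Longrightarrow> c0 \<le> l x u" by blast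
  have p1: "p \<ge> 1"
  proof -
    have "0 \<le> \<beta>" "\<beta> < 1" "p > 1 / (1 - \<beta>)" by fact+
    moreover from this have "1 \<le> 1 / (1 - \<beta>)" by simp
    ultimately show ?thesis by linarith
  qed
  have f_le: "f x \<le> L u \<bullet> G_deriv DG G v x + l x u" if u: "u \<in> \<Lambda>" for x u
  proof -
    have "ereal (f x) \<le> ereal (F0_CV L l x (G_deriv DG G v x) u)"
      unfolding f(2)[symmetric] F0_def by (rule INF_lower[OF u])
    then show ?thesis by (simp add: F0_CV_def)
  qed
  interpret cylindrical_BM M F W
    by standard fact+
  interpret strongly_continuous_semigroup S
    by standard (use assms in \<open>simp add: generates_def\<close>)
  interpret unbounded_input S DG G C_G \<beta> a_G
    by standard (use assms in auto)
  have paths: "((\<lambda>t. (1 / t) * (v (z t + \<Gamma> t k) - v (z t))) \<longlongrightarrow> G_deriv DG G v (z 0) \<bullet> k) (at_right 0)"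
    if "continuous_on {0..} z" for k z
    using v_S that by (simp add: S_AG_def \<Gamma>_def)
  \<comment> \<open>\<open>l\<close> is bounded below by \<open>c0\<close>, hence by minus a nonnegative constant\<close>
  interpret controlled_HJB M F W S \<sigma> Z f v lam C_f DG G C_G \<beta> a_G "G_deriv DG G v" B \<Lambda> L l C_L p "max 0 (- c0)"
  proof
    show "stochastic_convolution M W S \<sigma> Z" "lam > 0" "L \<in> borel_measurable (restrict_space borel \<Lambda>)" "C_L > 0"
      "(\<lambda>(x, u). l x u) \<in> borel_measurable (borel \<Otimes>\<^sub>M restrict_space borel \<Lambda>)" by fact+
    show "norm (L u) \<le> C_L * (1 + norm u)" if "u \<in> \<Lambda>" for u using assms that by blast
    show "- max 0 (- c0) \<le> l x u" if "u \<in> \<Lambda>" for x u using c0[OF that, of x] by linarith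
  qed (use f_cont C_f fv dv(2) B paths p1 f_le in auto)
  have le: "ereal (v x) \<le> V M F \<Lambda> p S DG G L Z lam l x" for x
    unfolding V_def by (intro INF_greatest value_le_cost)
  have eq: "J M S DG G L Z lam l x u = ereal (v x)"
    if u: "u \<in> controls M F \<Lambda> p"
      and opt: "AE (\<omega>, t) in M \<Otimes>\<^sub>M lborel. 0 \<le> t \<longrightarrow>
          F0 \<Lambda> L l (state S DG G L Z x u t \<omega>) (G_deriv DG G v (state S DG G L Z x u t \<omega>)) =
          ereal (F0_CV L l (state S DG G L Z x u t \<omega>)
                   (G_deriv DG G v (state S DG G L Z x u t \<omega>)) (u t \<omega>))" for x u
  proof (rule value_eq_cost[OF u])
    show "AE q in M \<Otimes>\<^sub>M lborel. 0 \<le> snd q \<longrightarrow> gain u x q = running u x q"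
      using opt
    proof eventually_elim
      case (elim q)
      then show ?case
        by (auto simp: f(2) F0_CV_def gain_def[OF u] running_def[OF u] k_def[OF u] split_beta')
    qed
  qed
  have "V M F \<Lambda> p S DG G L Z lam l x \<le> J M S DG G L Z lam l x u" if "u \<in> controls M F \<Lambda> p" for x u
    unfolding V_def by (rule INF_lower[OF that])
  then have V_eq: "ereal (v x) = V M F \<Lambda> p S DG G L Z lam l x" if "u \<in> controls M F \<Lambda> p" "J M S DG G L Z lam l x u = ereal (v x)" for x u
    using le[of x] that by (metis antisym)
  show ?thesis
  proof (intro conjI allI ballI impI)
    fix x u
    assume u: "u \<in> controls M F \<Lambda> p"
      and "AE (\<omega>, t) in M \<Otimes>\<^sub>M lborel. 0 \<le> t \<longrightarrow>
          F0 \<Lambda> L l (state S DG G L Z x u t \<omega>) (G_deriv DG G v (state S DG G L Z x u t \<omega>)) =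
          ereal (F0_CV L l (state S DG G L Z x u t \<omega>)
                   (G_deriv DG G v (state S DG G L Z x u t \<omega>)) (u t \<omega>))"
    note Jv = eq[OF this]
    show "ereal (v x) = V M F \<Lambda> p S DG G L Z lam l x" by (rule V_eq[OF u Jv])
    then show "V M F \<Lambda> p S DG G L Z lam l x = J M S DG G L Z lam l x u" using Jv by simp
  qed (rule le)
qed

end
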